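(* Let $\mathfrak g$ be a complex simple Lie algebra with fixed Cartan subalgebra and positive roots. Let $\beta_1=\alpha_0$ be the highest root, $\beta_2$ a highest long root orthogonal to $\beta_1$, $\beta_3$ a highest long root orthogonal to $\beta_1$ and $\beta_2$, and so on. If $\sigma_i=\beta_1+\beta_2+\cdots+\beta_i$ is dominant for all $i\le k$, then $\sigma_k$ is the highest weight of an irreducible component of the symmetric power $S^k\mathfrak g$.
   Context: "A highest long root orthogonal to $\beta_1,\dots,\beta_{i-1}$" means a long root of $\mathfrak g$ which is the highest root of an irreducible component of the root subsystem formed by the roots of $\mathfrak g$ orthogonal to $\beta_1,\dots,\beta_{i-1}$ (if this subsystem is reducible there may be several choices). *)

theory Defs
  imports Complex_Main "HOL-Library.Multiset" "HOL-Library.Poly_Mapping"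
begin

class complex_vector = ab_group_add +
  fixes scaleC :: "complex \<Rightarrow> 'a \<Rightarrow> 'a"  (infixr "*\<^sub>C" 75)
  assumes scaleC_add_right: "a *\<^sub>C (x + y) = a *\<^sub>C x + a *\<^sub>C y"
    and scaleC_add_left: "(a + b) *\<^sub>C x = a *\<^sub>C x + b *\<^sub>C x"
    and scaleC_scaleC: "a *\<^sub>C (b *\<^sub>C x) = (a * b) *\<^sub>C x"
    and scaleC_one: "1 *\<^sub>C x = x"

global_interpretation cvec: vector_space "scaleC :: complex \<Rightarrow> 'a \<Rightarrow> 'a::complex_vector"
  defines csubspace = cvec.subspace
    and cspan = cvec.span
    and cdependent = cvec.dependent
    and crepresentation = cvec.representation
  by unfold_locales (simp_all add: scaleC_add_right scaleC_add_left scaleC_scaleC scaleC_one)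

class complex_lie_algebra = complex_vector +
  fixes lie_bracket :: "'a \<Rightarrow> 'a \<Rightarrow> 'a"  ("\<lbrakk>_, _\<rbrakk>")
  assumes bracket_add_left: "\<lbrakk>x + y, z\<rbrakk> = \<lbrakk>x, z\<rbrakk> + \<lbrakk>y, z\<rbrakk>"
    and bracket_add_right: "\<lbrakk>x, y + z\<rbrakk> = \<lbrakk>x, y\<rbrakk> + \<lbrakk>x, z\<rbrakk>"
    and bracket_scale_left: "\<lbrakk>a *\<^sub>C x, y\<rbrakk> = a *\<^sub>C \<lbrakk>x, y\<rbrakk>"
    and bracket_scale_right: "\<lbrakk>x, a *\<^sub>C y\<rbrakk> = a *\<^sub>C \<lbrakk>x, y\<rbrakk>"
    and bracket_self: "\<lbrakk>x, x\<rbrakk> = 0"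
    and jacobi: "\<lbrakk>x, \<lbrakk>y, z\<rbrakk>\<rbrakk> + \<lbrakk>y, \<lbrakk>z, x\<rbrakk>\<rbrakk> + \<lbrakk>z, \<lbrakk>x, y\<rbrakk>\<rbrakk> = 0"

definition lie_ideal :: "'g::complex_lie_algebra set \<Rightarrow> bool" where
  "lie_ideal I \<longleftrightarrow> csubspace I \<and> (\<forall>x. \<forall>y\<in>I. \<lbrakk>x, y\<rbrakk> \<in> I)"

definition lie_subalgebra :: "'g::complex_lie_algebra set \<Rightarrow> bool" where
  "lie_subalgebra H \<longleftrightarrow> csubspace H \<and> (\<forall>x\<in>H. \<forall>y\<in>H. \<lbrakk>x, y\<rbrakk> \<in> H)"

text \<open>The Lie algebra is the whole type; the argument only serves to name that type.\<close>

definition simple_lie_algebra :: "'g::complex_lie_algebra itself \<Rightarrow> bool" where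
  "simple_lie_algebra _ \<longleftrightarrow>
     (\<exists>B :: 'g set. finite B \<and> cspan B = UNIV) \<and>
     (\<exists>x y :: 'g. \<lbrakk>x, y\<rbrakk> \<noteq> 0) \<and>
     (\<forall>I :: 'g set. lie_ideal I \<longrightarrow> I = {0} \<or> I = UNIV)"

fun lower_central :: "'g::complex_lie_algebra set \<Rightarrow> nat \<Rightarrow> 'g set" where
  "lower_central H 0 = H"
| "lower_central H (Suc n) = cspan {\<lbrakk>x, y\<rbrakk> | x y. x \<in> H \<and> y \<in> lower_central H n}"

definition cartan_subalgebra :: "'g::complex_lie_algebra set \<Rightarrow> bool" where
  "cartan_subalgebra H \<longleftrightarrow>
     lie_subalgebra H \<and>
     (\<exists>n. lower_central H n = {0}) \<and>
     {x. \<forall>h\<in>H. \<lbrakk>x, h\<rbrakk> \<in> H} = H"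

text \<open>Sum of the diagonal coefficients in some basis; meaningful in finite dimension, where
  it does not depend on the basis.\<close>

definition ctrace :: "('v::complex_vector \<Rightarrow> 'v) \<Rightarrow> complex" where
  "ctrace f = (let B = (SOME B. \<not> cdependent B \<and> cspan B = UNIV)
               in \<Sum>b\<in>B. crepresentation B (f b) b)"

definition killing :: "'g::complex_lie_algebra \<Rightarrow> 'g \<Rightarrow> complex" where
  "killing x y = ctrace (\<lambda>z. \<lbrakk>x, \<lbrakk>y, z\<rbrakk>\<rbrakk>)"

text \<open>Linear functionals on \<open>H\<close> are represented by functions on the whole Lie algebra that
  vanish outside \<open>H\<close>, so that equality of functionals is equality of functions.\<close>

definition dual_space :: "'g::complex_vector set \<Rightarrow> ('g \<Rightarrow> complex) set" where
  "dual_space H = {f. (\<forall>x. x \<notin> H \<longrightarrow> f x = 0) \<and>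
     (\<forall>x\<in>H. \<forall>y\<in>H. f (x + y) = f x + f y) \<and> (\<forall>c. \<forall>x\<in>H. f (c *\<^sub>C x) = c * f x)}"

definition root_space :: "'g::complex_lie_algebra set \<Rightarrow> ('g \<Rightarrow> complex) \<Rightarrow> 'g set" where
  "root_space H \<alpha> = {x. \<forall>h\<in>H. \<lbrakk>h, x\<rbrakk> = \<alpha> h *\<^sub>C x}"

definition roots :: "'g::complex_lie_algebra set \<Rightarrow> ('g \<Rightarrow> complex) set" where
  "roots H = {\<alpha> \<in> dual_space H. \<alpha> \<noteq> (\<lambda>h. 0) \<and> root_space H \<alpha> \<noteq> {0}}"

text \<open>The bilinear form on the dual of \<open>H\<close> transported from the Killing form on \<open>H\<close>.\<close>

definition killing_dual :: "'g::complex_lie_algebra set \<Rightarrow> ('g \<Rightarrow> complex) \<Rightarrow> 'g" where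
  "killing_dual H \<mu> = (THE t. t \<in> H \<and> (\<forall>h\<in>H. killing t h = \<mu> h))"

definition root_form ::
  "'g::complex_lie_algebra set \<Rightarrow> ('g \<Rightarrow> complex) \<Rightarrow> ('g \<Rightarrow> complex) \<Rightarrow> complex" where
  "root_form H \<mu> \<nu> = killing (killing_dual H \<mu>) (killing_dual H \<nu>)"

text \<open>A choice of positive roots: one from each pair \<open>\<plusminus>\<alpha>\<close>, closed under addition within
  the roots.\<close>

definition positive_system ::
  "'g::complex_lie_algebra set \<Rightarrow> ('g \<Rightarrow> complex) set \<Rightarrow> bool" where
  "positive_system H P \<longleftrightarrow>
     P \<subseteq> roots H \<and>
     (\<forall>\<alpha>\<in>roots H. (\<alpha> \<in> P) \<noteq> ((\<lambda>h. - \<alpha> h) \<in> P)) \<and>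
     (\<forall>\<alpha>\<in>P. \<forall>\<beta>\<in>P. (\<lambda>h. \<alpha> h + \<beta> h) \<in> roots H \<longrightarrow> (\<lambda>h. \<alpha> h + \<beta> h) \<in> P)"

text \<open>\<open>\<theta>\<close> is the highest root of the root system \<open>\<Psi>\<close> with positive roots \<open>\<Psi> \<inter> P\<close>: the
  greatest element for the order in which \<open>\<alpha> \<le> \<theta>\<close> means that \<open>\<theta> - \<alpha>\<close> is a combination of
  positive roots of \<open>\<Psi>\<close> with natural number coefficients.\<close>

definition highest_root ::
  "('g \<Rightarrow> complex) set \<Rightarrow> ('g \<Rightarrow> complex) set \<Rightarrow> ('g \<Rightarrow> complex) \<Rightarrow> bool" where
  "highest_root P \<Psi> \<theta> \<longleftrightarrow>
     \<theta> \<in> \<Psi> \<and>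
     (\<forall>\<alpha>\<in>\<Psi>. \<exists>c :: ('g \<Rightarrow> complex) \<Rightarrow> nat.
        \<forall>h. \<theta> h - \<alpha> h = (\<Sum>\<gamma>\<in>\<Psi> \<inter> P. of_nat (c \<gamma>) * \<gamma> h))"

text \<open>The form is real on roots, so \<open>Re\<close> only changes the type.\<close>

definition long_root :: "'g::complex_lie_algebra set \<Rightarrow> ('g \<Rightarrow> complex) \<Rightarrow> bool" where
  "long_root H \<alpha> \<longleftrightarrow>
     \<alpha> \<in> roots H \<and> (\<forall>\<beta>\<in>roots H. Re (root_form H \<beta> \<beta>) \<le> Re (root_form H \<alpha> \<alpha>))"

definition orthogonal_sets ::
  "'g::complex_lie_algebra set \<Rightarrow> ('g \<Rightarrow> complex) set \<Rightarrow> ('g \<Rightarrow> complex) set \<Rightarrow> bool" where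
  "orthogonal_sets H A B \<longleftrightarrow> (\<forall>\<alpha>\<in>A. \<forall>\<beta>\<in>B. root_form H \<alpha> \<beta> = 0)"

definition irreducible_roots ::
  "'g::complex_lie_algebra set \<Rightarrow> ('g \<Rightarrow> complex) set \<Rightarrow> bool" where
  "irreducible_roots H \<Psi> \<longleftrightarrow>
     \<Psi> \<noteq> {} \<and>
     (\<forall>A B. A \<union> B = \<Psi> \<and> A \<inter> B = {} \<and> orthogonal_sets H A B \<longrightarrow> A = {} \<or> B = {})"

definition root_component ::
  "'g::complex_lie_algebra set \<Rightarrow> ('g \<Rightarrow> complex) set \<Rightarrow> ('g \<Rightarrow> complex) set \<Rightarrow> bool" where
  "root_component H \<Psi> C \<longleftrightarrow>
     C \<subseteq> \<Psi> \<and> irreducible_roots H C \<and> orthogonal_sets H C (\<Psi> - C)"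

definition orthogonal_roots ::
  "'g::complex_lie_algebra set \<Rightarrow> ('g \<Rightarrow> complex) set \<Rightarrow> ('g \<Rightarrow> complex) set" where
  "orthogonal_roots H B = {\<alpha> \<in> roots H. \<forall>\<beta>\<in>B. root_form H \<alpha> \<beta> = 0}"

definition highest_long_root_orthogonal ::
  "'g::complex_lie_algebra set \<Rightarrow> ('g \<Rightarrow> complex) set \<Rightarrow> ('g \<Rightarrow> complex) set \<Rightarrow>
    ('g \<Rightarrow> complex) \<Rightarrow> bool" where
  "highest_long_root_orthogonal H P B \<beta> \<longleftrightarrow>
     long_root H \<beta> \<and>
     (\<exists>C. root_component H (orthogonal_roots H B) C \<and> highest_root P C \<beta>)"

text \<open>Dominant integral weights: all the numbers \<open>\<langle>\<mu>, \<alpha>\<^sup>\<or>\<rangle>\<close> with \<open>\<alpha>\<close> positive are natural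
  numbers.\<close>

definition dominant ::
  "'g::complex_lie_algebra set \<Rightarrow> ('g \<Rightarrow> complex) set \<Rightarrow> ('g \<Rightarrow> complex) \<Rightarrow> bool" where
  "dominant H P \<mu> \<longleftrightarrow>
     \<mu> \<in> dual_space H \<and> (\<forall>\<alpha>\<in>P. 2 * root_form H \<mu> \<alpha> / root_form H \<alpha> \<alpha> \<in> \<nat>)"

text \<open>The polynomial ring in the indeterminates \<open>X\<^sub>x\<close>, one for every vector \<open>x\<close>, is the monoid
  algebra of the finite multisets of vectors. The symmetric algebra is its quotient by the
  ideal generated by \<open>X\<^sub>x\<^sub>+\<^sub>y - X\<^sub>x - X\<^sub>y\<close> and \<open>X\<^sub>c\<^sub>x - c X\<^sub>x\<close>.\<close>

type_synonym 'a vpoly = "'a multiset \<Rightarrow>\<^sub>0 complex"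

abbreviation indet :: "'a \<Rightarrow> 'a vpoly" where
  "indet x \<equiv> Poly_Mapping.single {#x#} 1"

abbreviation vconst :: "complex \<Rightarrow> 'a vpoly" where
  "vconst c \<equiv> Poly_Mapping.single {#} c"

inductive_set sym_ideal :: "'a::complex_vector vpoly set" where
  zero: "0 \<in> sym_ideal"
| add: "p \<in> sym_ideal \<Longrightarrow> q \<in> sym_ideal \<Longrightarrow> p + q \<in> sym_ideal"
| mult: "p \<in> sym_ideal \<Longrightarrow> q * p \<in> sym_ideal"
| gen_add: "indet (x + y) - indet x - indet y \<in> sym_ideal"
| gen_scale: "indet (c *\<^sub>C x) - vconst c * indet x \<in> sym_ideal"

definition sym_rel :: "'a::complex_vector vpoly \<Rightarrow> 'a vpoly \<Rightarrow> bool" where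
  "sym_rel p q \<longleftrightarrow> p - q \<in> sym_ideal"

lemma sym_ideal_uminus: "p \<in> sym_ideal \<Longrightarrow> - p \<in> sym_ideal"
  using sym_ideal.mult[of p "-1"] by simp

lemma sym_ideal_diff: "p \<in> sym_ideal \<Longrightarrow> q \<in> sym_ideal \<Longrightarrow> p - q \<in> sym_ideal"
  using sym_ideal.add[of p "- q"] sym_ideal_uminus[of q] by simp

lemma sym_rel_trans: "sym_rel p q \<Longrightarrow> sym_rel q r \<Longrightarrow> sym_rel p r"
  unfolding sym_rel_def by (drule (1) sym_ideal.add) simp

lemma equivp_sym_rel: "equivp sym_rel"
proof (rule equivpI)
  show "reflp sym_rel" by (simp add: reflp_def sym_rel_def sym_ideal.zero)
  show "symp sym_rel"
    unfolding symp_def sym_rel_def using sym_ideal_uminus by (metis minus_diff_eq)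
  show "transp sym_rel" by (blast intro: transpI sym_rel_trans)
qed

quotient_type (overloaded) 'a sym_alg = "'a::complex_vector vpoly" / sym_rel
  by (rule equivp_sym_rel)

instantiation sym_alg :: (complex_vector) "{comm_ring, comm_monoid_mult, complex_vector}"
begin

lift_definition zero_sym_alg :: "'a sym_alg" is 0 .
lift_definition one_sym_alg :: "'a sym_alg" is 1 .

lift_definition plus_sym_alg :: "'a sym_alg \<Rightarrow> 'a sym_alg \<Rightarrow> 'a sym_alg" is "(+)"
  unfolding sym_rel_def by (drule (1) sym_ideal.add) (simp add: algebra_simps)

lift_definition uminus_sym_alg :: "'a sym_alg \<Rightarrow> 'a sym_alg" is uminus
  unfolding sym_rel_def by (drule sym_ideal_uminus) (simp add: algebra_simps)

lift_definition minus_sym_alg :: "'a sym_alg \<Rightarrow> 'a sym_alg \<Rightarrow> 'a sym_alg" is "(-)"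
  unfolding sym_rel_def by (drule (1) sym_ideal_diff) (simp add: algebra_simps)

lift_definition times_sym_alg :: "'a sym_alg \<Rightarrow> 'a sym_alg \<Rightarrow> 'a sym_alg" is "(*)"
proof -
  fix p q r s :: "'a vpoly"
  assume "sym_rel p q" "sym_rel r s"
  then have "r * (p - q) + q * (r - s) \<in> sym_ideal"
    unfolding sym_rel_def by (intro sym_ideal.add sym_ideal.mult)
  then show "sym_rel (p * r) (q * s)"
    unfolding sym_rel_def by (simp add: algebra_simps)
qed

lift_definition scaleC_sym_alg :: "complex \<Rightarrow> 'a sym_alg \<Rightarrow> 'a sym_alg"
  is "\<lambda>c p. vconst c * p"
  unfolding sym_rel_def by (metis right_diff_distrib sym_ideal.mult)

instance
proof
  fix a b c :: "'a sym_alg" and r s :: complex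
  show "a + b + c = a + (b + c)" by transfer (simp add: add.assoc sym_rel_def sym_ideal.zero)
  show "a + b = b + a" by transfer (simp add: add.commute sym_rel_def sym_ideal.zero)
  show "0 + a = a" by transfer (simp add: sym_rel_def sym_ideal.zero)
  show "- a + a = 0" by transfer (simp add: sym_rel_def sym_ideal.zero)
  show "a - b = a + - b" by transfer (simp add: sym_rel_def sym_ideal.zero)
  show "a * b * c = a * (b * c)" by transfer (simp add: mult.assoc sym_rel_def sym_ideal.zero)
  show "a * b = b * a" by transfer (simp add: mult.commute sym_rel_def sym_ideal.zero)
  show "1 * a = a" by transfer (simp add: sym_rel_def sym_ideal.zero)
  show "(a + b) * c = a * c + b * c"
    by transfer (simp add: distrib_right sym_rel_def sym_ideal.zero)
  show "r *\<^sub>C (a + b) = r *\<^sub>C a + r *\<^sub>C b"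
    by transfer (simp add: distrib_left sym_rel_def sym_ideal.zero)
  show "(r + s) *\<^sub>C a = r *\<^sub>C a + s *\<^sub>C a"
    by transfer (simp add: single_add distrib_right sym_rel_def sym_ideal.zero)
  show "r *\<^sub>C (s *\<^sub>C a) = (r * s) *\<^sub>C a"
    by transfer (simp add: mult_single mult.assoc[symmetric] sym_rel_def sym_ideal.zero)
  show "1 *\<^sub>C a = a"
    by transfer (simp add: sym_rel_def sym_ideal.zero)
qed

end

lift_definition sym_inj :: "'a::complex_vector \<Rightarrow> 'a sym_alg" is indet .

lemma sym_inj_add: "sym_inj (x + y) = sym_inj x + sym_inj y"
  by transfer (use sym_ideal.gen_add in \<open>simp add: sym_rel_def diff_diff_add\<close>)

lemma sym_inj_scale: "sym_inj (c *\<^sub>C x) = c *\<^sub>C sym_inj x"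
  by transfer (use sym_ideal.gen_scale in \<open>simp add: sym_rel_def\<close>)

definition sym_power :: "nat \<Rightarrow> 'a::complex_vector sym_alg set" where
  "sym_power k = cspan {prod_list (map sym_inj xs) | xs. length xs = k}"

text \<open>The adjoint action extended to polynomials as a derivation with \<open>x \<cdot> X\<^sub>y = X\<^bsub>[x,y]\<^esub>\<close>.\<close>

definition mono_act :: "'g::complex_lie_algebra \<Rightarrow> 'g multiset \<Rightarrow> 'g vpoly" where
  "mono_act x m = (\<Sum>y\<in>#m. Poly_Mapping.single (m - {#y#} + {#\<lbrakk>x, y\<rbrakk>#}) 1)"

definition vpoly_act :: "'g::complex_lie_algebra \<Rightarrow> 'g vpoly \<Rightarrow> 'g vpoly" where
  "vpoly_act x p = (\<Sum>m\<in>Poly_Mapping.keys p. vconst (Poly_Mapping.lookup p m) * mono_act x m)"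

lemma vpoly_act_superset:
  assumes "finite A" "Poly_Mapping.keys p \<subseteq> A"
  shows "vpoly_act x p = (\<Sum>m\<in>A. vconst (Poly_Mapping.lookup p m) * mono_act x m)"
  unfolding vpoly_act_def
  by (rule sum.mono_neutral_left) (use assms in \<open>auto simp: in_keys_iff\<close>)

lemma vpoly_act_add: "vpoly_act x (p + q) = vpoly_act x p + vpoly_act x q"
proof -
  let ?A = "Poly_Mapping.keys p \<union> Poly_Mapping.keys q"
  have "Poly_Mapping.keys (p + q) \<subseteq> ?A" by (rule keys_add)
  then show ?thesis
    by (simp add: vpoly_act_superset[of ?A] lookup_add single_add distrib_right sum.distrib)
qed

lemma vpoly_act_zero [simp]: "vpoly_act x 0 = 0"
  by (simp add: vpoly_act_def)

lemma vpoly_act_uminus: "vpoly_act x (- p) = - vpoly_act x p"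
  using vpoly_act_add[of x p "- p"] by (simp add: eq_neg_iff_add_eq_0 add.commute)

lemma vpoly_act_diff: "vpoly_act x (p - q) = vpoly_act x p - vpoly_act x q"
  using vpoly_act_add[of x p "- q"] by (simp add: vpoly_act_uminus)

lemma vpoly_act_single: "vpoly_act x (Poly_Mapping.single m c) = vconst c * mono_act x m"
  by (simp add: vpoly_act_superset[of "{m}"])

lemma mono_act_union:
  "mono_act x (m + n) =
     mono_act x m * Poly_Mapping.single n 1 + Poly_Mapping.single m 1 * mono_act x n"
proof -
  have 1: "(\<Sum>y\<in>#m. Poly_Mapping.single (m + n - {#y#} + {#\<lbrakk>x, y\<rbrakk>#}) (1::complex)) =
      (\<Sum>y\<in>#m. Poly_Mapping.single (m - {#y#} + {#\<lbrakk>x, y\<rbrakk>#}) 1 * Poly_Mapping.single n 1)"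
    by (intro arg_cong[where f = sum_mset] image_mset_cong)
      (auto simp: mult_single dest!: multi_member_split)
  have 2: "(\<Sum>y\<in>#n. Poly_Mapping.single (m + n - {#y#} + {#\<lbrakk>x, y\<rbrakk>#}) (1::complex)) =
      (\<Sum>y\<in>#n. Poly_Mapping.single m 1 * Poly_Mapping.single (n - {#y#} + {#\<lbrakk>x, y\<rbrakk>#}) 1)"
    by (intro arg_cong[where f = sum_mset] image_mset_cong)
      (auto simp: mult_single dest!: multi_member_split)
  show ?thesis
    unfolding mono_act_def by (simp only: image_mset_union sum_mset.union 1 2 sum_mset_distrib_left
        sum_mset_distrib_right)
qed

lemma vpoly_induct [case_names single add]:
  fixes p :: "'a vpoly"
  assumes "\<And>m c. Q (Poly_Mapping.single m c)" "\<And>p q. Q p \<Longrightarrow> Q q \<Longrightarrow> Q (p + q)"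
  shows "Q p"
proof (induction p rule: update_induct)
  case const
  show ?case using assms(1)[of _ 0] by simp
next
  case (update f a b)
  have "Poly_Mapping.update a b f = f + Poly_Mapping.single a b"
    using update by (intro poly_mapping_eqI)
      (auto simp: lookup_update lookup_add lookup_single when_def in_keys_iff)
  then show ?case using assms update by simp
qed

lemma vpoly_act_mult: "vpoly_act x (p * q) = vpoly_act x p * q + p * vpoly_act x q"
proof (induction p rule: vpoly_induct)
  case (single m c)
  show ?case
  proof (induction q rule: vpoly_induct)
    case (single n d)
    have m: "Poly_Mapping.single m c = vconst c * Poly_Mapping.single m 1"
      and n: "Poly_Mapping.single n d = vconst d * Poly_Mapping.single n 1"
      and cd: "vconst (c * d) = vconst c * (vconst d :: 'g vpoly)"
      by (simp_all add: mult_single)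
    have "vpoly_act x (Poly_Mapping.single m c * Poly_Mapping.single n d) =
        vconst c * vconst d *
          (mono_act x m * Poly_Mapping.single n 1 + Poly_Mapping.single m 1 * mono_act x n)"
      by (simp only: mult_single vpoly_act_single mono_act_union cd)
    also have "\<dots> = vpoly_act x (Poly_Mapping.single m c) * Poly_Mapping.single n d +
        Poly_Mapping.single m c * vpoly_act x (Poly_Mapping.single n d)"
      by (simp only: vpoly_act_single) (simp only: m n algebra_simps)
    finally show ?case .
  qed (simp add: vpoly_act_add algebra_simps)
qed (simp add: vpoly_act_add algebra_simps)

lemma vpoly_act_indet: "vpoly_act x (indet y) = indet \<lbrakk>x, y\<rbrakk>"
  by (simp add: vpoly_act_single mono_act_def)

lemma vpoly_act_vconst: "vpoly_act x (vconst c) = 0"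
  by (simp add: vpoly_act_single mono_act_def)

lemma vpoly_act_sym_ideal: "p \<in> sym_ideal \<Longrightarrow> vpoly_act x p \<in> sym_ideal"
proof (induction rule: sym_ideal.induct)
  case (mult p q)
  then show ?case
    by (metis vpoly_act_mult sym_ideal.add sym_ideal.mult)
next
  case (gen_add y z)
  then show ?case
    by (simp add: vpoly_act_diff vpoly_act_indet bracket_add_right sym_ideal.gen_add)
next
  case (gen_scale c y)
  then show ?case
    by (simp only: vpoly_act_diff vpoly_act_mult vpoly_act_indet vpoly_act_vconst
        bracket_scale_right) (use sym_ideal.gen_scale in simp)
qed (simp_all add: vpoly_act_add sym_ideal.zero sym_ideal.add)

lift_definition sym_act :: "'g::complex_lie_algebra \<Rightarrow> 'g sym_alg \<Rightarrow> 'g sym_alg" is vpoly_act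
  unfolding sym_rel_def by (metis vpoly_act_diff vpoly_act_sym_ideal)

lemma sym_act_sym_inj: "sym_act x (sym_inj y) = sym_inj \<lbrakk>x, y\<rbrakk>"
  by transfer (simp add: vpoly_act_indet sym_rel_def sym_ideal.zero)

lemma sym_act_add: "sym_act x (a + b) = sym_act x a + sym_act x b"
  by transfer (simp add: vpoly_act_add sym_rel_def sym_ideal.zero)

lemma sym_act_mult: "sym_act x (a * b) = sym_act x a * b + a * sym_act x b"
  by transfer (simp add: vpoly_act_mult sym_rel_def sym_ideal.zero)

lemma sym_act_scale: "sym_act x (c *\<^sub>C a) = c *\<^sub>C sym_act x a"
  by transfer (simp add: vpoly_act_mult vpoly_act_vconst sym_rel_def sym_ideal.zero)

definition subrepresentation ::
  "('g::complex_lie_algebra \<Rightarrow> 'v::complex_vector \<Rightarrow> 'v) \<Rightarrow> 'v set \<Rightarrow> bool" where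
  "subrepresentation \<rho> W \<longleftrightarrow> csubspace W \<and> (\<forall>x. \<forall>w\<in>W. \<rho> x w \<in> W)"

definition irreducible_representation ::
  "('g::complex_lie_algebra \<Rightarrow> 'v::complex_vector \<Rightarrow> 'v) \<Rightarrow> 'v set \<Rightarrow> bool" where
  "irreducible_representation \<rho> W \<longleftrightarrow>
     subrepresentation \<rho> W \<and> W \<noteq> {0} \<and>
     (\<forall>U. subrepresentation \<rho> U \<and> U \<subseteq> W \<longrightarrow> U = {0} \<or> U = W)"

text \<open>A component of \<open>V\<close> is a direct summand.\<close>

definition irreducible_component ::
  "('g::complex_lie_algebra \<Rightarrow> 'v::complex_vector \<Rightarrow> 'v) \<Rightarrow> 'v set \<Rightarrow> 'v set \<Rightarrow> bool" where
  "irreducible_component \<rho> V W \<longleftrightarrow>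
     irreducible_representation \<rho> W \<and>
     (\<exists>U. subrepresentation \<rho> U \<and> W \<inter> U = {0} \<and> V = {w + u | w u. w \<in> W \<and> u \<in> U})"

definition has_highest_weight ::
  "'g::complex_lie_algebra set \<Rightarrow> ('g \<Rightarrow> complex) set \<Rightarrow> ('g \<Rightarrow> 'v::complex_vector \<Rightarrow> 'v) \<Rightarrow>
    'v set \<Rightarrow> ('g \<Rightarrow> complex) \<Rightarrow> bool" where
  "has_highest_weight H P \<rho> W \<mu> \<longleftrightarrow>
     (\<exists>v\<in>W. v \<noteq> 0 \<and>
        (\<forall>h\<in>H. \<rho> h v = \<mu> h *\<^sub>C v) \<and>
        (\<forall>\<alpha>\<in>P. \<forall>x\<in>root_space H \<alpha>. \<rho> x v = 0))"

end

theory Submission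
  imports Defs "HOL-Computational_Algebra.Fundamental_Theorem_Algebra" "HOL-Library.Complex_Order"
    "HOL-Library.Product_Plus"
begin

text \<open>Induction on \<open>k\<close>: from a highest weight vector \<open>v\<close> of weight \<open>\<sigma>\<^sub>m\<close> in \<open>S\<^sup>m g\<close>, \<open>m = k - 1\<close>, one of weight
  \<open>\<sigma>\<^sub>k\<close> in \<open>S\<^sup>k g\<close> is built. Let \<open>T\<close> represent \<open>\<sigma>\<^sub>k\<close> on the Cartan subalgebra and let \<open>l\<close> be its centralizer.
  Since \<open>\<sigma>\<^sub>k\<close> is dominant, the root vectors of \<open>\<beta>\<^sub>1, \<dots>, \<beta>\<^sub>k\<close> lie in the top eigenspace \<open>g\<^sub>2\<close> of \<open>ad T\<close>, which
  commutes with all positive eigenspaces. Dominance of \<open>\<sigma>\<^sub>m\<close> makes the root vector of \<open>-\<beta>\<^sub>k\<close> a highest weight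
  vector for \<open>l\<close>; after a twist by \<open>\<sigma>\<^sub>k\<close> it has the weight of \<open>v\<close>, so the two vectors generate isomorphic
  irreducible \<open>l\<close>-modules, and the isomorphism \<open>\<Phi>\<close> from a submodule of \<open>g\<^sub>-\<^sub>2\<close> into \<open>S\<^sup>m g\<close> gives the invariant
  \<open>\<Sum>\<delta>. X\<^sub>\<delta> \<Phi>(X\<^sub>-\<^sub>\<delta>)\<close>. (For \<open>sl\<^sub>n\<close> these vectors are the corner minors and \<open>\<Phi>\<close> is the cofactor map.) It is not
  zero: contracting it with the root vectors of \<open>-\<beta>\<^sub>1, \<dots>, -\<beta>\<^sub>k\<close> gives \<open>k\<close> equal terms, because for
  each \<open>j < k\<close> two commuting elements of \<open>l\<close> exchange \<open>\<beta>\<^sub>k\<close> and \<open>\<beta>\<^sub>j\<close>.\<close>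

section \<open>Linear algebra\<close>

text \<open>The obstacle is cancellation: a sum of products in a commutative algebra can vanish
  although its summands do not. Hence the induction carries more than \<open>v \<noteq> 0\<close>:
  contracting \<open>v\<close> with the root vectors of all \<open>-\<beta>\<^sub>j\<close> leaves a
  nonzero scalar (\<open>good\<close>). \<open>\<Phi>\<close> is not built as a map. The pair of the
  two highest weight vectors generates a submodule of the direct sum, and irreducibility makes it a
  graph. Irreducibility and complements come from the Casimir operator of the centralizer of an
  arbitrary \<open>t\<close> in \<open>H\<close>; the case \<open>t = 0\<close> turns the final
  vector into a direct summand. Why the \<beta>_i reach the top eigenvalue of ad \<open>T\<close>:
  reflections in these orthogonal roots make the coefficients of any root along them nonnegative
  without changing absolute values, and comparison with the highest root bounds their absolute sum
  by 2. The same bound decides which sums of roots are roots in the exchange, whose starting root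
  exists because g is simple. Complex numbers are compared in the partial order where
  \<open>0 \<le> z\<close> says that \<open>z\<close> is real and nonnegative.\<close>

abbreviation clinear :: "('a::complex_vector \<Rightarrow> 'b::complex_vector) \<Rightarrow> bool" where
  "clinear \<equiv> Vector_Spaces.linear scaleC scaleC"

lemma clinear_iff:
  "clinear f \<longleftrightarrow> (\<forall>x y. f (x + y) = f x + f y) \<and> (\<forall>c x. f (c *\<^sub>C x) = c *\<^sub>C f x)"
  unfolding Vector_Spaces.linear_iff
  using cvec.vector_space_axioms[where 'a='a] cvec.vector_space_axioms[where 'a='b] by blast

lemma clinearI:
  "(\<And>x y. f (x + y) = f x + f y) \<Longrightarrow> (\<And>c x. f (c *\<^sub>C x) = c *\<^sub>C f x) \<Longrightarrow> clinear f"
  by (simp add: clinear_iff)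

context
  fixes f :: "'a::complex_vector \<Rightarrow> 'b::complex_vector"
  assumes f: "clinear f"
begin

interpretation Vector_Spaces.linear scaleC scaleC f by (rule f)

lemma clinear_add: "f (x + y) = f x + f y" by (rule add)
lemma clinear_scale: "f (c *\<^sub>C x) = c *\<^sub>C f x" by (rule scale)
lemma clinear_0: "f 0 = 0" by (rule zero)
lemma clinear_neg: "f (- x) = - f x" by (rule neg)
lemma clinear_diff: "f (x - y) = f x - f y" by (rule diff)
lemma clinear_sum: "f (sum g A) = (\<Sum>i\<in>A. f (g i))" by (rule sum)
lemma csubspace_vimage: "csubspace S \<Longrightarrow> csubspace {x. f x \<in> S}"
  by (simp add: cvec.subspace_def clinear_0 clinear_add clinear_scale)
lemma csubspace_image: "csubspace S \<Longrightarrow> csubspace (f ` S)"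
proof (rule cvec.subspaceI)
  assume S: "csubspace S"
  show "0 \<in> f ` S" using clinear_0 cvec.subspace_0[OF S] by force
  show "x + y \<in> f ` S" if "x \<in> f ` S" "y \<in> f ` S" for x y
    using that cvec.subspace_add[OF S] by (auto simp flip: clinear_add)
  show "c *\<^sub>C x \<in> f ` S" if "x \<in> f ` S" for c x
    using that cvec.subspace_scale[OF S] by (auto simp flip: clinear_scale)
qed

lemma clinear_span_into:
  assumes "x \<in> cspan B" "csubspace S" "\<And>b. b \<in> B \<Longrightarrow> f b \<in> S"
  shows "f x \<in> S"
proof -
  have "cspan B \<subseteq> {x. f x \<in> S}"
    by (rule cvec.span_minimal) (use assms csubspace_vimage in auto)
  then show ?thesis using assms by auto
qed

lemma clinear_eq_0_on_span:
  assumes "x \<in> cspan B" "\<And>b. b \<in> B \<Longrightarrow> f b = 0"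
  shows "f x = 0"
  using clinear_span_into[of x B "{0}"] assms by auto

end

lemma clinear_compose: "clinear f \<Longrightarrow> clinear g \<Longrightarrow> clinear (\<lambda>x. f (g x))"
  by (simp add: clinear_iff)
lemma clinear_plus: "clinear f \<Longrightarrow> clinear g \<Longrightarrow> clinear (\<lambda>x. f x + g x)"
  by (simp add: clinear_iff algebra_simps scaleC_add_right)
lemma clinear_minus: "clinear f \<Longrightarrow> clinear g \<Longrightarrow> clinear (\<lambda>x. f x - g x)"
  by (simp add: clinear_iff algebra_simps cvec.scale_right_diff_distrib)
lemma clinear_scaleC: "clinear f \<Longrightarrow> clinear (\<lambda>x. c *\<^sub>C f x)"
  by (simp add: clinear_iff scaleC_add_right scaleC_scaleC mult.commute)
lemma clinear_id: "clinear (\<lambda>x. x)"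
  by (simp add: clinear_iff)
lemma clinear_zero: "clinear (\<lambda>x. 0)"
  by (simp add: clinear_iff)
lemma clinear_funpow: "clinear (f :: 'a::complex_vector \<Rightarrow> 'a) \<Longrightarrow> clinear (f ^^ n)"
  by (induction n) (auto simp: clinear_iff)
lemma clinear_sum_fun: "(\<And>i. i \<in> I \<Longrightarrow> clinear (f i)) \<Longrightarrow> clinear (\<lambda>x. \<Sum>i\<in>I. f i x)"
  by (induction I rule: infinite_finite_induct) (auto simp: clinear_zero clinear_plus)

lemma funpow_commute: fixes f :: "'a \<Rightarrow> 'a" shows "(\<And>x. f (g x) = g (f x)) \<Longrightarrow> (f ^^ n) (g x) = g ((f ^^ n) x)"
  by (induction n) auto

lemma cspan_image_finite:
  assumes "finite I" "x \<in> cspan (f ` I)"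
  shows "\<exists>c. x = (\<Sum>i\<in>I. c i *\<^sub>C f i)"
  using assms
proof (induction I arbitrary: x rule: finite_induct)
  case (insert i I)
  then obtain k where "x - k *\<^sub>C f i \<in> cspan (f ` I)"
    using cvec.span_breakdown_eq[of x "f i" "f ` I"] by auto
  then obtain c where c: "x - k *\<^sub>C f i = (\<Sum>i\<in>I. c i *\<^sub>C f i)" using insert.IH by blast
  have "x = (\<Sum>j\<in>insert i I. (c(i := k)) j *\<^sub>C f j)"
    using insert.hyps c by (simp add: algebra_simps) (auto intro!: sum.cong)
  then show ?case by blast
qed simp

lemma cspan_finite_sum:
  assumes "finite B" "x \<in> cspan B"
  shows "\<exists>c. x = (\<Sum>b\<in>B. c b *\<^sub>C b)"
  using cspan_image_finite[of B x id] assms by simp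

lemma cspan_imp_finite_sum:
  assumes "x \<in> cspan B"
  obtains C c where "finite C" "C \<subseteq> B" "x = (\<Sum>b\<in>C. c b *\<^sub>C b)"
  using assms by (auto simp: cvec.span_explicit)

section \<open>Generalized eigenspaces of one operator\<close>

definition shift :: "('v::complex_vector \<Rightarrow> 'v) \<Rightarrow> complex \<Rightarrow> 'v \<Rightarrow> 'v" where
  "shift T a x = T x - a *\<^sub>C x"

definition gen_eig :: "('v::complex_vector \<Rightarrow> 'v) \<Rightarrow> complex \<Rightarrow> 'v set" where
  "gen_eig T a = {x. \<exists>n. (shift T a ^^ n) x = 0}"

lemma clinear_shift: "clinear T \<Longrightarrow> clinear (shift T a)"
  unfolding shift_def by (intro clinear_minus clinear_scaleC clinear_id)

lemma funpow_eq_0_mono: fixes f :: "'a::complex_vector \<Rightarrow> 'a" shows "clinear f \<Longrightarrow> (f ^^ n) x = 0 \<Longrightarrow> n \<le> m \<Longrightarrow> (f ^^ m) x = 0"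
  using clinear_0[OF clinear_funpow, of f "m - n"] funpow_add[of "m - n" n f] by (simp add: fun_eq_iff)

lemma gen_eig_subspace:
  assumes T: "clinear T"
  shows "csubspace (gen_eig T a)"
proof (rule cvec.subspaceI)
  let ?f = "shift T a"
  have f: "clinear ?f" using clinear_shift[OF T] .
  show "0 \<in> gen_eig T a" by (auto simp: gen_eig_def intro!: exI[of _ 0])
  fix x y assume "x \<in> gen_eig T a" "y \<in> gen_eig T a"
  then obtain n m where nm: "(?f ^^ n) x = 0" "(?f ^^ m) y = 0" by (auto simp: gen_eig_def)
  have "(?f ^^ (max n m)) (x + y) = 0"
    using funpow_eq_0_mono[OF f nm(1), of "max n m"] funpow_eq_0_mono[OF f nm(2), of "max n m"]
    by (simp add: clinear_add[OF clinear_funpow[OF f]])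
  then show "x + y \<in> gen_eig T a" by (auto simp: gen_eig_def)
next
  fix c x assume "x \<in> gen_eig T a"
  then show "c *\<^sub>C x \<in> gen_eig T a"
    by (auto simp: gen_eig_def clinear_scale[OF clinear_funpow[OF clinear_shift[OF T]]])
qed

lemma gen_eig_commute:
  assumes "clinear T" "clinear U" "\<And>x. T (U x) = U (T x)" "x \<in> gen_eig T a"
  shows "U x \<in> gen_eig T a"
proof -
  obtain n where n: "(shift T a ^^ n) x = 0" using assms by (auto simp: gen_eig_def)
  have "shift T a (U y) = U (shift T a y)" for y
    by (simp add: shift_def assms(3) clinear_diff[OF assms(2)] clinear_scale[OF assms(2)])
  then have "(shift T a ^^ n) (U x) = U ((shift T a ^^ n) x)" by (rule funpow_commute)
  then show ?thesis using n clinear_0[OF assms(2)] by (auto simp: gen_eig_def)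
qed

lemma gen_eig_shiftI:
  assumes "shift T a x \<in> gen_eig T a" shows "x \<in> gen_eig T a"
proof -
  obtain n where "(shift T a ^^ n) (shift T a x) = 0" using assms by (auto simp: gen_eig_def)
  then have "(shift T a ^^ Suc n) x = 0" by (simp add: funpow_swap1)
  then show ?thesis unfolding gen_eig_def by blast
qed

text \<open>On the generalized eigenspace for \<open>l\<close>, the operator \<open>T - a\<close> is
  the nonzero scalar \<open>l - a\<close> plus a locally nilpotent operator, hence invertible. The
  induction runs over the exponent that kills \<open>y\<close>.\<close>

lemma gen_eig_invert:
  assumes T: "clinear T" and S: "csubspace S" "\<And>x. x \<in> S \<Longrightarrow> T x \<in> S" and "l \<noteq> a"
    and y: "y \<in> S" "y \<in> gen_eig T l"
  shows "\<exists>x \<in> S \<inter> gen_eig T l. shift T a x = y"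
proof -
  let ?G = "S \<inter> gen_eig T l"
  have G: "csubspace ?G" using S gen_eig_subspace[OF T] by (simp add: cvec.subspace_inter)
  have "y \<in> ?G \<Longrightarrow> (shift T l ^^ n) y = 0 \<Longrightarrow> \<exists>x \<in> ?G. shift T a x = y" for n
  proof (induction n arbitrary: y)
    case 0
    then show ?case using clinear_0[OF clinear_shift[OF T]] G cvec.subspace_0
      by (intro bexI[of _ 0]) auto
  next
    case (Suc n)
    \<comment> \<open>\<open>T - a\<close> sends \<open>y / (l - a)\<close> to
      \<open>y + ?y'\<close>, and the error \<open>?y'\<close> is killed by one power fewer.\<close>
    let ?y' = "(1 / (l - a)) *\<^sub>C shift T l y"
    have sub: "shift T l y \<in> ?G"
      using Suc.prems(1) S gen_eig_commute[OF T clinear_shift[OF T, of l], of y l]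
      by (auto simp: shift_def cvec.subspace_diff cvec.subspace_scale clinear_diff[OF T] clinear_scale[OF T])
    then have "?y' \<in> ?G" using G cvec.subspace_scale by blast
    moreover have "(shift T l ^^ n) ?y' = 0"
      using Suc.prems(2) clinear_scale[OF clinear_funpow[OF clinear_shift[OF T]]]
      by (simp add: funpow_swap1)
    ultimately obtain x' where x': "x' \<in> ?G" "shift T a x' = ?y'" using Suc.IH by blast
    let ?x = "(1 / (l - a)) *\<^sub>C y - x'"
    have "shift T a y = shift T l y + (l - a) *\<^sub>C y"
      by (simp add: shift_def cvec.scale_left_diff_distrib)
    then have "shift T a ?x = y"
      using \<open>l \<noteq> a\<close> x'
      by (simp add: clinear_diff[OF clinear_shift[OF T]] clinear_scale[OF clinear_shift[OF T]]
          scaleC_add_right scaleC_scaleC scaleC_one)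
    moreover have "?x \<in> ?G" using G x' Suc.prems cvec.subspace_scale cvec.subspace_diff by blast
    ultimately show ?case by blast
  qed
  then show ?thesis using y by (auto simp: gen_eig_def)
qed

section \<open>Polynomials in an operator; generalized eigenvectors span in finite dimension\<close>

definition papply :: "('v::complex_vector \<Rightarrow> 'v) \<Rightarrow> complex poly \<Rightarrow> 'v \<Rightarrow> 'v" where
  "papply T p x = fold_coeffs (\<lambda>c y. c *\<^sub>C x + T y) p 0"

context
  fixes T :: "'v::complex_vector \<Rightarrow> 'v"
  assumes T: "clinear T"
begin

lemma papply_0: "papply T 0 x = 0" by (simp add: papply_def)

lemma papply_pCons: "papply T (pCons c p) x = c *\<^sub>C x + T (papply T p x)"
  by (cases "c = 0 \<and> p = 0") (auto simp: papply_def clinear_0[OF T])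

lemma papply_add: "papply T (p + q) x = papply T p x + papply T q x"
  by (induction p q rule: poly_induct2)
    (auto simp: papply_0 papply_pCons clinear_add[OF T] scaleC_add_left)

lemma papply_smult: "papply T (smult c p) x = c *\<^sub>C papply T p x"
  by (induction p)
    (auto simp: papply_0 papply_pCons clinear_scale[OF T] scaleC_add_right scaleC_scaleC)

lemma papply_sum: "papply T (sum f A) x = (\<Sum>i\<in>A. papply T (f i) x)"
  by (induction A rule: infinite_finite_induct) (auto simp: papply_0 papply_add)

lemma papply_monom: "papply T (monom c n) x = c *\<^sub>C (T ^^ n) x"
  by (induction n) (auto simp: papply_0 papply_pCons monom_0 monom_Suc clinear_0[OF T] clinear_scale[OF T])

lemma papply_shift_commute: "papply T p (shift T a x) = shift T a (papply T p x)"
  by (induction p)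
    (auto simp: papply_0 papply_pCons shift_def clinear_0[OF T] clinear_add[OF T] clinear_diff[OF T]
      clinear_scale[OF T] scaleC_add_right cvec.scale_right_diff_distrib scaleC_scaleC mult.commute)

lemma papply_factor: "papply T ([:- a, 1:] * q) x = papply T q (shift T a x)"
proof -
  have "[:- a, 1:] * q = pCons 0 q + smult (- a) q" by simp
  moreover have "papply T q (shift T a x) = T (papply T q x) - a *\<^sub>C papply T q x"
    by (simp only: papply_shift_commute) (simp only: shift_def)
  ultimately show ?thesis
    by (simp only: papply_add papply_pCons papply_smult
        cvec.scale_zero_left add_0 cvec.scale_minus_left add_uminus_conv_diff)
qed

text \<open>The iterates of \<open>x\<close> stay in a finite-dimensional space, so some iterate
  depends linearly on the earlier ones. This relation is monic, which keeps the polynomial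
  nonzero.\<close>

lemma papply_annihilator:
  assumes "finite B" "S \<subseteq> cspan B" "x \<in> S" "\<And>x. x \<in> S \<Longrightarrow> T x \<in> S"
  shows "\<exists>p. p \<noteq> 0 \<and> papply T p x = 0"
proof -
  let ?v = "\<lambda>i. (T ^^ i) x"
  have inS: "?v i \<in> S" for i using assms by (induction i) auto
  have "\<exists>n. ?v n \<in> cspan (?v ` {..<n})"
  proof (rule ccontr)
    assume *: "\<nexists>n. ?v n \<in> cspan (?v ` {..<n})"
    have ind: "\<not> cdependent (?v ` {..<m}) \<and> card (?v ` {..<m}) = m" for m
    proof (induction m)
      case (Suc m)
      have "?v m \<notin> ?v ` {..<m}" using * cvec.span_base[of "?v m" "?v ` {..<m}"] by metis
      moreover have "\<not> cdependent (insert (?v m) (?v ` {..<m}))"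
        using * Suc.IH cvec.independent_insertI by blast
      moreover have "?v ` {..<Suc m} = insert (?v m) (?v ` {..<m})" by (simp add: lessThan_Suc)
      ultimately show ?case using Suc.IH by simp
    qed (auto simp: cvec.independent_empty)
    have "?v ` {..<Suc (card B)} \<subseteq> cspan B" using inS assms by blast
    then have "card (?v ` {..<Suc (card B)}) \<le> card B"
      using cvec.independent_span_bound[OF assms(1)] ind by blast
    then show False using ind[of "Suc (card B)"] by simp
  qed
  then obtain n c where n: "?v n = (\<Sum>i<n. c i *\<^sub>C ?v i)"
    using cspan_image_finite[of "{..<_}" _ ?v] by blast
  let ?p = "monom 1 n - (\<Sum>i<n. monom (c i) i)"
  have "coeff ?p n = 1" by (simp add: coeff_sum)
  then have "?p \<noteq> 0" by (metis coeff_0 zero_neq_one)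
  moreover have "papply T ?p x + papply T (\<Sum>i<n. monom (c i) i) x = papply T (monom 1 n) x"
    by (simp flip: papply_add)
  then have "papply T ?p x = 0"
    using n by (simp add: papply_sum papply_monom scaleC_one)
  ultimately show ?thesis by blast
qed

text \<open>Induction on the degree. With a root \<open>a\<close> of \<open>p\<close> split off, the
  induction hypothesis puts \<open>(T - a) x\<close> into the span; pulling it back through
  \<open>T - a\<close> recovers \<open>x\<close> up to a generalized eigenvector for
  \<open>a\<close>.\<close>

lemma gen_eig_span_if_papply:
  assumes S: "csubspace S" "\<And>x. x \<in> S \<Longrightarrow> T x \<in> S" and "p \<noteq> 0" "x \<in> S" "papply T p x = 0"
  shows "x \<in> cspan (\<Union>a. S \<inter> gen_eig T a)"
  using assms(3-)
proof (induction "degree p" arbitrary: p x)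
  case 0
  then obtain c where "p = [:c:]" by (metis degree_eq_zeroE)
  then show ?case using 0 by (auto simp: papply_pCons papply_0 clinear_0[OF T] cvec.span_zero)
next
  case (Suc n)
  then have "\<not> constant (poly p)" by (simp add: constant_degree)
  then obtain a where "poly p a = 0" using fundamental_theorem_of_algebra by blast
  then obtain q where q: "p = [:- a, 1:] * q" using poly_eq_0_iff_dvd by blast
  have q0: "q \<noteq> 0" using q Suc.prems by auto
  have "degree p = degree [:- a, 1:] + degree q" unfolding q by (rule degree_mult_eq) (use q0 in auto)
  then have dq: "n = degree q" using Suc.hyps by simp
  let ?G = "cspan (\<Union>a. S \<inter> gen_eig T a)"
  let ?f = "shift T a"
  have fl: "clinear ?f" using clinear_shift[OF T] .
  have fS: "?f y \<in> S" if "y \<in> S" for y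
    using that S by (simp add: shift_def cvec.subspace_diff cvec.subspace_scale)
  have GS: "?G \<subseteq> S" using S by (intro cvec.span_minimal) auto
  have "papply T q (?f x) = 0" using Suc.prems q papply_factor by simp
  then have y: "?f x \<in> ?G" using Suc.hyps(1)[OF dq q0] fS Suc.prems by blast
  \<comment> \<open>Components for eigenvalues other than \<open>a\<close> are images under
    \<open>?f\<close> by \<open>gen_eig_invert\<close>, so only the component at \<open>a\<close> is
    left over.\<close>
  have "\<exists>x'\<in>?G. y - ?f x' \<in> S \<inter> gen_eig T a" if "y \<in> ?G" for y
    using that
  proof (induction rule: cvec.span_induct_alt)
    case base
    then show ?case using cvec.span_zero[of "\<Union>a. S \<inter> gen_eig T a"] S gen_eig_subspace[OF T] clinear_0[OF fl]
      by (intro bexI[of _ 0]) (auto simp: cvec.subspace_0)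
  next
    case (step c y z)
    then obtain x' where x': "x' \<in> ?G" "z - ?f x' \<in> S \<inter> gen_eig T a" by blast
    obtain l where l: "y \<in> S" "y \<in> gen_eig T l" using step by blast
    have "\<exists>x''\<in>?G. y - ?f x'' \<in> S \<inter> gen_eig T a"
    proof (cases "l = a")
      case True
      then show ?thesis using l cvec.span_zero[of "\<Union>a. S \<inter> gen_eig T a"] clinear_0[OF fl]
        by (intro bexI[of _ 0]) auto
    next
      case False
      then obtain u where "u \<in> S \<inter> gen_eig T l" "?f u = y"
        using gen_eig_invert[OF T S False l] by blast
      then show ?thesis using cvec.span_base[of u "\<Union>a. S \<inter> gen_eig T a"]
          S gen_eig_subspace[OF T] by (intro bexI[of _ u]) (auto simp: cvec.subspace_0)
    qed
    then obtain x'' where x'': "x'' \<in> ?G" "y - ?f x'' \<in> S \<inter> gen_eig T a" by blast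
    have "c *\<^sub>C y + z - ?f (c *\<^sub>C x'' + x') = c *\<^sub>C (y - ?f x'') + (z - ?f x')"
      by (simp add: clinear_add[OF fl] clinear_scale[OF fl] cvec.scale_right_diff_distrib)
    also have "\<dots> \<in> S \<inter> gen_eig T a"
      using x' x'' S(1) gen_eig_subspace[OF T, of a] by (simp add: cvec.subspace_add cvec.subspace_scale)
    finally show ?case using x' x'' by (intro bexI[of _ "c *\<^sub>C x'' + x'"])
        (auto intro: cvec.span_add cvec.span_scale)
  qed
  then obtain x' where x': "x' \<in> ?G" "?f x - ?f x' \<in> S \<inter> gen_eig T a" using y by blast
  then have "?f (x - x') \<in> gen_eig T a" by (simp add: clinear_diff[OF fl])
  then have "x - x' \<in> gen_eig T a" by (rule gen_eig_shiftI)
  moreover have "x - x' \<in> S" using x' GS Suc.prems S cvec.subspace_diff by blast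
  ultimately have "x - x' \<in> ?G" by (intro cvec.span_base) auto
  then have "(x - x') + x' \<in> ?G" using x' by (intro cvec.span_add)
  then show ?case by simp
qed

lemma gen_eig_span:
  assumes "csubspace S" "\<And>x. x \<in> S \<Longrightarrow> T x \<in> S" "finite B" "S \<subseteq> cspan B" "x \<in> S"
  shows "x \<in> cspan (\<Union>a. S \<inter> gen_eig T a)"
  using papply_annihilator[of B S x] gen_eig_span_if_papply[of S _ x] assms by blast

end

subsection \<open>Traces\<close>

text \<open>In contrast to \<open>ctrace\<close> the basis is explicit and may span a proper
  subspace. If \<open>f\<close> preserves \<open>cspan B\<close>, this is the trace of the
  restriction; the main arguments on roots take it on sums of weight spaces.\<close>

definition trc :: "'v::complex_vector set \<Rightarrow> ('v \<Rightarrow> 'v) \<Rightarrow> complex" where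
  "trc B f = (\<Sum>b\<in>B. crepresentation B (f b) b)"

context
  fixes B :: "'v::complex_vector set"
  assumes B: "\<not> cdependent B" "finite B"
begin

lemma crep_sum: "v \<in> cspan B \<Longrightarrow> (\<Sum>b\<in>B. crepresentation B v b *\<^sub>C b) = v"
  using cvec.sum_representation_eq[OF B(1) _ B(2) order_refl] by blast

lemma trc_commute:
  assumes f: "clinear f" and g: "clinear g" and "\<And>b. b \<in> B \<Longrightarrow> f b \<in> cspan B" "\<And>b. b \<in> B \<Longrightarrow> g b \<in> cspan B"
  shows "trc B (\<lambda>x. f (g x)) = trc B (\<lambda>x. g (f x))"
proof -
  have *: "trc B (\<lambda>x. f (g x)) = (\<Sum>b\<in>B. \<Sum>c\<in>B. crepresentation B (g b) c * crepresentation B (f c) b)"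
    if f: "clinear f" and f': "\<And>b. b \<in> B \<Longrightarrow> f b \<in> cspan B" and g': "\<And>b. b \<in> B \<Longrightarrow> g b \<in> cspan B"
    for f g :: "'v \<Rightarrow> 'v"
  proof -
    have "crepresentation B (f (g b)) b = (\<Sum>c\<in>B. crepresentation B (g b) c * crepresentation B (f c) b)"
      if b: "b \<in> B" for b
    proof -
      have "f (g b) = (\<Sum>c\<in>B. crepresentation B (g b) c *\<^sub>C f c)"
        by (subst crep_sum[symmetric, OF g'[OF b]]) (simp add: clinear_sum[OF f] clinear_scale[OF f])
      then show ?thesis
        using f' by (simp add: cvec.representation_sum[OF B(1)] cvec.span_scale
            cvec.representation_scale[OF B(1)])
    qed
    then show ?thesis by (simp add: trc_def)
  qed
  have "trc B (\<lambda>x. f (g x)) = (\<Sum>b\<in>B. \<Sum>c\<in>B. crepresentation B (g b) c * crepresentation B (f c) b)"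
    by (rule *) (use assms in auto)
  also have "\<dots> = (\<Sum>b\<in>B. \<Sum>c\<in>B. crepresentation B (f b) c * crepresentation B (g c) b)"
    by (subst sum.swap) (simp add: mult.commute)
  also have "\<dots> = trc B (\<lambda>x. g (f x))"
    by (rule *[symmetric]) (use assms in auto)
  finally show ?thesis .
qed

lemma trc_basis_indep:
  assumes B': "\<not> cdependent B'" "finite B'" "cspan B' = cspan B"
    and f: "clinear f" "\<And>b. b \<in> B \<Longrightarrow> f b \<in> cspan B"
  shows "trc B f = trc B' f"
proof -
  have fs: "f v \<in> cspan B" if "v \<in> cspan B" for v
    using clinear_span_into[OF f(1) that] f(2) by auto
  have "trc B f = (\<Sum>b\<in>B. \<Sum>b'\<in>B'. crepresentation B' b b' * crepresentation B (f b') b)"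
    unfolding trc_def
  proof (rule sum.cong[OF refl])
    fix b assume b: "b \<in> B"
    have "b = (\<Sum>b'\<in>B'. crepresentation B' b b' *\<^sub>C b')"
      using cvec.sum_representation_eq[OF B'(1) _ B'(2) order_refl, of b] B'(3) b cvec.span_base[of b B] by simp
    then have "f b = (\<Sum>b'\<in>B'. crepresentation B' b b' *\<^sub>C f b')"
      by (metis (no_types, lifting) clinear_sum[OF f(1)] clinear_scale[OF f(1)] sum.cong)
    moreover have "f b' \<in> cspan B" if "b' \<in> B'" for b' using fs B' that cvec.span_base by metis
    ultimately show "crepresentation B (f b) b = (\<Sum>b'\<in>B'. crepresentation B' b b' * crepresentation B (f b') b)"
      by (simp add: cvec.representation_sum[OF B(1)] cvec.span_scale cvec.representation_scale[OF B(1)])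
  qed
  also have "\<dots> = (\<Sum>b'\<in>B'. \<Sum>b\<in>B. crepresentation B (f b') b * crepresentation B' b b')"
    by (subst sum.swap) (simp add: mult.commute)
  also have "\<dots> = trc B' f"
    unfolding trc_def
  proof (rule sum.cong[OF refl])
    fix b' assume b': "b' \<in> B'"
    have "f b' \<in> cspan B" using fs B' b' cvec.span_base by metis
    then have fb': "(\<Sum>b\<in>B. crepresentation B (f b') b *\<^sub>C b) = f b'" using crep_sum by simp
    have "b \<in> cspan B'" if "b \<in> B" for b using that B' cvec.span_base by metis
    then have "crepresentation B' (\<Sum>b\<in>B. crepresentation B (f b') b *\<^sub>C b) =
        (\<lambda>x. \<Sum>b\<in>B. crepresentation B (f b') b * crepresentation B' b x)"
      by (simp add: cvec.representation_sum[OF B'(1)] cvec.span_scale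
          cvec.representation_scale[OF B'(1)])
    then have "crepresentation B' (f b') = (\<lambda>x. \<Sum>b\<in>B. crepresentation B (f b') b * crepresentation B' b x)"
      unfolding fb' .
    then show "(\<Sum>b\<in>B. crepresentation B (f b') b * crepresentation B' b b') = crepresentation B' (f b') b'"
      by simp
  qed
  finally show ?thesis .
qed

lemma trc_add:
  assumes "\<And>b. b \<in> B \<Longrightarrow> f b \<in> cspan B" "\<And>b. b \<in> B \<Longrightarrow> g b \<in> cspan B"
  shows "trc B (\<lambda>x. f x + g x) = trc B f + trc B g"
  using assms by (simp add: trc_def cvec.representation_add[OF B(1)] sum.distrib)

lemma trc_diff:
  assumes "\<And>b. b \<in> B \<Longrightarrow> f b \<in> cspan B" "\<And>b. b \<in> B \<Longrightarrow> g b \<in> cspan B"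
  shows "trc B (\<lambda>x. f x - g x) = trc B f - trc B g"
  using assms by (simp add: trc_def cvec.representation_diff[OF B(1)] sum_subtractf)

lemma trc_scale:
  assumes "\<And>b. b \<in> B \<Longrightarrow> f b \<in> cspan B"
  shows "trc B (\<lambda>x. c *\<^sub>C f x) = c * trc B f"
  using assms by (simp add: trc_def cvec.representation_scale[OF B(1)] sum_distrib_left)

lemma trc_scalar: "trc B (\<lambda>x. c *\<^sub>C x) = of_nat (card B) * c"
proof -
  have "trc B (\<lambda>x. c *\<^sub>C x) = c * trc B (\<lambda>x. x)" by (rule trc_scale) (rule cvec.span_base)
  also have "trc B (\<lambda>x. x) = of_nat (card B)"
    by (simp add: trc_def cvec.representation_basis[OF B(1)])
  finally show ?thesis by simp
qed

end

lemma trc_mono_span: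
  assumes "\<not> cdependent B" "C \<subseteq> B" "\<And>b. b \<in> C \<Longrightarrow> f b \<in> cspan C"
  shows "(\<Sum>b\<in>C. crepresentation B (f b) b) = trc C f"
  unfolding trc_def using cvec.representation_extend[OF assms(1) assms(3) assms(2)] by simp

text \<open>Induction on the dimension. A basis of the image of \<open>f\<close> is extended to the
  whole space: the added vectors are mapped into the image and have zero diagonal entries, the
  others give the trace on a smaller space.\<close>

lemma trc_nilpotent:
  fixes f :: "'v::complex_vector \<Rightarrow> 'v"
  assumes "\<not> cdependent B" "finite B" "clinear f" "\<And>b. b \<in> B \<Longrightarrow> f b \<in> cspan B"
    and "\<And>x. x \<in> cspan B \<Longrightarrow> \<exists>n. (f ^^ n) x = 0"
  shows "trc B f = 0"
  using assms(1,2,4,5)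
proof (induction "card B" arbitrary: B rule: less_induct)
  case less
  note B = less.prems(1,2)
  show ?case
  proof (cases "B = {}")
    case False
    let ?V = "cspan B" and ?U = "f ` cspan B"
    have fV: "f x \<in> ?V" if "x \<in> ?V" for x
      using clinear_span_into[OF assms(3) that] less.prems(3) by auto
    have U: "csubspace ?U" using csubspace_image[OF assms(3)] by simp
    have UV: "?U \<subseteq> ?V" using fV by auto
    \<comment> \<open>If \<open>f\<close> were onto, all its powers would be, but a common exponent
      for the finitely many basis vectors makes one power zero.\<close>
    have "?U \<noteq> ?V"
    proof
      assume eq: "?U = ?V"
      have "\<exists>n. \<forall>b\<in>B. (f ^^ n) b = 0"
      proof -
        have "\<forall>b\<in>B. \<exists>n. (f ^^ n) b = 0" using less.prems(4) cvec.span_base by blast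
        then obtain n where n: "\<forall>b\<in>B. (f ^^ n b) b = 0" by metis
        have "n b \<le> Max (n ` B)" if "b \<in> B" for b using that B by simp
        then show ?thesis using n funpow_eq_0_mono[OF assms(3)] by blast
      qed
      then obtain n where n: "\<forall>b\<in>B. (f ^^ n) b = 0" by blast
      have "(f ^^ m) ` ?V = ?V" for m
      proof (induction m)
        case (Suc m)
        have "(f ^^ Suc m) ` ?V = f ` ((f ^^ m) ` ?V)" by (simp add: image_comp)
        then show ?case using Suc eq by simp
      qed simp
      moreover have "(f ^^ n) x = 0" if "x \<in> ?V" for x
        using clinear_eq_0_on_span[OF clinear_funpow[OF assms(3)] that] n by blast
      ultimately have "?V \<subseteq> {0}" by (metis image_subsetI insertI1)
      moreover obtain b where "b \<in> B" using False by blast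
      ultimately have "b = 0" using cvec.span_base by blast
      then show False using \<open>b \<in> B\<close> B cvec.dependent_zero by blast
    qed
    obtain C where C: "C \<subseteq> ?U" "\<not> cdependent C" "?U \<subseteq> cspan C"
      using cvec.maximal_independent_subset by blast
    have spanC: "cspan C = ?U" using C U cvec.span_minimal by blast
    obtain B' where B': "C \<subseteq> B'" "B' \<subseteq> ?V" "\<not> cdependent B'" "?V \<subseteq> cspan B'"
      by (rule cvec.maximal_independent_subset_extend[of C ?V]) (use C UV in auto)
    have finB': "finite B'" "card B' \<le> card B"
      using cvec.independent_span_bound[OF B(2) B'(3,2)] by auto
    have spanB': "cspan B' = ?V" using B' cvec.span_minimal[of B' ?V] by auto
    have "C \<noteq> B'" using spanC spanB' \<open>?U \<noteq> ?V\<close> by blast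
    then have "card C < card B" using B' finB' psubset_card_mono[of B' C] by fastforce
    have finC: "finite C" using B' finB' finite_subset by blast
    have fU: "f x \<in> cspan C" if "x \<in> ?V" for x using that spanC by blast
    have "trc B f = trc B' f"
      using trc_basis_indep[OF B B'(3) finB'(1) spanB' assms(3) less.prems(3)] .
    also have "\<dots> = (\<Sum>b\<in>C. crepresentation B' (f b) b) + (\<Sum>b\<in>B'-C. crepresentation B' (f b) b)"
      unfolding trc_def using B'(1) finB'(1)
      by (metis (no_types, lifting) add.commute sum.subset_diff)
    also have "(\<Sum>b\<in>B'-C. crepresentation B' (f b) b) = 0"
    proof (rule sum.neutral, rule ballI)
      fix b assume b: "b \<in> B' - C"
      then have "crepresentation B' (f b) = crepresentation C (f b)"
        using cvec.representation_extend[OF B'(3) fU B'(1)] B' by blast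
      then show "crepresentation B' (f b) b = 0"
        using cvec.representation_ne_zero[of C "f b" b] b by auto
    qed
    also have "(\<Sum>b\<in>C. crepresentation B' (f b) b) = trc C f"
      by (rule trc_mono_span[OF B'(3,1)]) (use fU C UV in blast)
    also have "trc C f = 0"
    proof (rule less.hyps[OF \<open>card C < card B\<close> C(2) finC])
      show "f b \<in> cspan C" if "b \<in> C" for b using fU that C UV by blast
      show "\<exists>n. (f ^^ n) x = 0" if "x \<in> cspan C" for x using less.prems(4) that spanC UV by blast
    qed
    finally show ?thesis by simp
  qed (simp add: trc_def)
qed

lemma trc_gen_eig:
  assumes "\<not> cdependent B" "finite B" "clinear f" "\<And>b. b \<in> B \<Longrightarrow> f b \<in> cspan B"
    and "cspan B \<subseteq> gen_eig f a"
  shows "trc B f = of_nat (card B) * a"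
proof -
  have "trc B f = trc B (\<lambda>x. (f x - a *\<^sub>C x) + a *\<^sub>C x)" by simp
  also have "\<dots> = trc B (\<lambda>x. f x - a *\<^sub>C x) + trc B (\<lambda>x. a *\<^sub>C x)"
    by (rule trc_add[OF assms(1,2)]) (use assms in \<open>auto intro: cvec.span_diff cvec.span_scale cvec.span_base\<close>)
  also have "trc B (\<lambda>x. f x - a *\<^sub>C x) = 0"
    by (rule trc_nilpotent[OF assms(1,2)])
      (use assms clinear_shift[OF assms(3), of a] in
        \<open>auto simp: shift_def[abs_def] gen_eig_def subset_eq intro: cvec.span_base cvec.span_scale cvec.span_diff\<close>)
  finally show ?thesis using trc_scalar[OF assms(1,2)] by simp
qed

text \<open>\<open>T^2 - a^2\<close> factors into the commuting operators \<open>T - a\<close> and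
  \<open>T + a\<close>.\<close>

lemma gen_eig_square:
  assumes "clinear f" "x \<in> gen_eig f a"
  shows "x \<in> gen_eig (\<lambda>x. f (f x)) (a * a)"
proof -
  let ?g = "\<lambda>x. f x + a *\<^sub>C x"
  let ?N = "shift (\<lambda>x. f (f x)) (a * a)"
  have g: "clinear ?g" using assms(1) by (intro clinear_plus clinear_scaleC clinear_id)
  have eq: "?N y = shift f a (?g y)" for y
    by (simp add: shift_def clinear_add[OF assms(1)] clinear_scale[OF assms(1)] scaleC_add_right scaleC_scaleC)
  have comm: "shift f a (?g y) = ?g (shift f a y)" for y
    by (simp add: shift_def clinear_add[OF assms(1)] clinear_scale[OF assms(1)] clinear_diff[OF assms(1)]
        scaleC_add_right cvec.scale_right_diff_distrib)
  have "(?N ^^ n) y = (?g ^^ n) ((shift f a ^^ n) y)" for n y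
  proof (induction n)
    case (Suc n)
    have "(?N ^^ Suc n) y = shift f a (?g ((?N ^^ n) y))" by (simp add: eq)
    also have "\<dots> = shift f a ((?g ^^ Suc n) ((shift f a ^^ n) y))" using Suc by simp
    also have "\<dots> = (?g ^^ Suc n) (shift f a ((shift f a ^^ n) y))"
      by (rule funpow_commute[symmetric]) (rule comm[symmetric])
    finally show ?case by simp
  qed simp
  moreover obtain n where "(shift f a ^^ n) x = 0" using assms(2) by (auto simp: gen_eig_def)
  ultimately have "(?N ^^ n) x = 0" using clinear_0[OF clinear_funpow[OF g]] by simp
  then show ?thesis unfolding gen_eig_def by blast
qed

section \<open>Cartan subalgebras of simple Lie algebras\<close>

lemma clinear_bracket_right: "clinear (lie_bracket (x::'g::complex_lie_algebra))"
  by (rule clinearI) (simp_all add: bracket_add_right bracket_scale_right)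

lemma clinear_bracket_left: "clinear (\<lambda>x. \<lbrakk>x, y::'g::complex_lie_algebra\<rbrakk>)"
  by (rule clinearI) (simp_all add: bracket_add_left bracket_scale_left)

lemmas bracket_0 = clinear_0[OF clinear_bracket_right] clinear_0[OF clinear_bracket_left]
lemmas bracket_neg = clinear_neg[OF clinear_bracket_right] clinear_neg[OF clinear_bracket_left]
lemmas bracket_diff = clinear_diff[OF clinear_bracket_right] clinear_diff[OF clinear_bracket_left]
lemma bracket_anticomm: "\<lbrakk>x, y\<rbrakk> = - \<lbrakk>y, x::'g::complex_lie_algebra\<rbrakk>"
proof -
  have "\<lbrakk>x + y, x + y\<rbrakk> = 0" by (rule bracket_self)
  then have "\<lbrakk>x, y\<rbrakk> + \<lbrakk>y, x\<rbrakk> = 0"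
    by (simp add: bracket_add_left bracket_add_right bracket_self[of x] bracket_self[of y] add.commute)
  then show ?thesis by (simp only: eq_neg_iff_add_eq_0)
qed

lemma bracket_derivation: "\<lbrakk>x, \<lbrakk>y, z\<rbrakk>\<rbrakk> = \<lbrakk>\<lbrakk>x, y\<rbrakk>, z\<rbrakk> + \<lbrakk>y, \<lbrakk>x, z::'g::complex_lie_algebra\<rbrakk>\<rbrakk>"
proof -
  have "\<lbrakk>x, \<lbrakk>y, z\<rbrakk>\<rbrakk> + \<lbrakk>y, \<lbrakk>z, x\<rbrakk>\<rbrakk> + \<lbrakk>z, \<lbrakk>x, y\<rbrakk>\<rbrakk> = 0" by (rule jacobi)
  moreover have "\<lbrakk>y, \<lbrakk>z, x\<rbrakk>\<rbrakk> = - \<lbrakk>y, \<lbrakk>x, z\<rbrakk>\<rbrakk>" "\<lbrakk>z, \<lbrakk>x, y\<rbrakk>\<rbrakk> = - \<lbrakk>\<lbrakk>x, y\<rbrakk>, z\<rbrakk>"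
    using bracket_anticomm[of z x] bracket_anticomm[of z "\<lbrakk>x, y\<rbrakk>"] by (simp_all add: bracket_neg)
  ultimately show ?thesis by (simp add: algebra_simps)
qed

lemma bracket_bracket: "\<lbrakk>\<lbrakk>x, y\<rbrakk>, z\<rbrakk> = \<lbrakk>x, \<lbrakk>y, z\<rbrakk>\<rbrakk> - \<lbrakk>y, \<lbrakk>x, z::'g::complex_lie_algebra\<rbrakk>\<rbrakk>"
  using bracket_derivation[of x y z] by simp

text \<open>\<open>ad h - (a + b)\<close> acts on a bracket by the Leibniz rule, with
  \<open>ad h - a\<close> on the left entry and \<open>ad h - b\<close> on the right one. After
  \<open>m + n\<close> applications one entry has been killed.\<close>

lemma gen_eig_bracket:
  fixes x y h :: "'g::complex_lie_algebra"
  assumes "x \<in> gen_eig (lie_bracket h) a" "y \<in> gen_eig (lie_bracket h) b"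
  shows "\<lbrakk>x, y\<rbrakk> \<in> gen_eig (lie_bracket h) (a + b)"
proof -
  let ?T = "shift (lie_bracket h)"
  have lin: "clinear (?T c)" for c by (rule clinear_shift[OF clinear_bracket_right])
  have "(?T a ^^ m) x = 0 \<Longrightarrow> (?T b ^^ n) y = 0 \<Longrightarrow> (?T (a + b) ^^ (m + n)) \<lbrakk>x, y\<rbrakk> = 0" for m n
  proof (induction "m + n" arbitrary: m n x y)
    case 0
    then show ?case by (simp add: bracket_0)
  next
    case (Suc k)
    have step: "?T (a + b) \<lbrakk>x, y\<rbrakk> = \<lbrakk>?T a x, y\<rbrakk> + \<lbrakk>x, ?T b y\<rbrakk>"
      by (simp add: shift_def bracket_derivation[of h x y] bracket_diff bracket_scale_left
          bracket_scale_right scaleC_add_left)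
    have 1: "(?T (a + b) ^^ k) \<lbrakk>?T a x, y\<rbrakk> = 0"
    proof (cases m)
      case 0
      then show ?thesis using Suc.prems(1)
        by (simp add: bracket_0 clinear_0[OF lin] clinear_0[OF clinear_funpow[OF lin]])
    next
      case (Suc m')
      then show ?thesis using Suc.hyps(1)[of m' n "?T a x" y] Suc.hyps(2) Suc.prems
        by (simp add: funpow_swap1)
    qed
    have 2: "(?T (a + b) ^^ k) \<lbrakk>x, ?T b y\<rbrakk> = 0"
    proof (cases n)
      case 0
      then show ?thesis using Suc.prems(2)
        by (simp add: bracket_0 clinear_0[OF lin] clinear_0[OF clinear_funpow[OF lin]])
    next
      case (Suc n')
      then show ?thesis using Suc.hyps(1)[of m n' x "?T b y"] Suc.hyps(2) Suc.prems
        by (simp add: funpow_swap1)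
    qed
    have "(?T (a + b) ^^ Suc k) \<lbrakk>x, y\<rbrakk> = (?T (a + b) ^^ k) (\<lbrakk>?T a x, y\<rbrakk> + \<lbrakk>x, ?T b y\<rbrakk>)"
      by (simp add: funpow_swap1 flip: step)
    also have "\<dots> = 0" using 1 2 by (simp add: clinear_add[OF clinear_funpow[OF lin]])
    finally show ?case using Suc.hyps(2) by simp
  qed
  then show ?thesis using assms unfolding gen_eig_def by blast
qed

text \<open>A genuine eigenvector for \<open>a\<close> is scaled by \<open>(a - b)^n\<close> under
  \<open>(T - b)^n\<close>, so it cannot be killed unless it is 0. The exponent at \<open>a\<close>
  is then lowered step by step.\<close>

lemma gen_eig_disjoint:
  assumes T: "clinear T" and "a \<noteq> b" "x \<in> gen_eig T a" "x \<in> gen_eig T b"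
  shows "x = 0"
proof -
  have 1: "x = 0" if "shift T a x = 0" "x \<in> gen_eig T b" for x
  proof -
    obtain n where n: "(shift T b ^^ n) x = 0" using \<open>x \<in> gen_eig T b\<close> by (auto simp: gen_eig_def)
    have "shift T b x = (a - b) *\<^sub>C x" using that by (simp add: shift_def cvec.scale_left_diff_distrib)
    then have "(shift T b ^^ n) x = ((a - b) ^ n) *\<^sub>C x" for n
      by (induction n) (auto simp: scaleC_one clinear_scale[OF clinear_shift[OF T]] scaleC_scaleC mult.commute)
    then show ?thesis using n \<open>a \<noteq> b\<close> by simp
  qed
  have "(shift T a ^^ n) x = 0 \<Longrightarrow> x \<in> gen_eig T b \<Longrightarrow> x = 0" for n
  proof (induction n arbitrary: x)
    case (Suc n)
    have "shift T a x \<in> gen_eig T b"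
      by (rule gen_eig_commute[OF T clinear_shift[OF T] _ Suc.prems(2)])
        (simp add: shift_def clinear_diff[OF T] clinear_scale[OF T])
    moreover have "(shift T a ^^ n) (shift T a x) = 0" using Suc.prems(1) by (simp add: funpow_swap1)
    ultimately have "shift T a x = 0" by (rule Suc.IH[rotated])
    then show ?case using 1 Suc.prems(2) by blast
  qed simp
  then show ?thesis using assms by (auto simp: gen_eig_def)
qed

locale simple_cartan =
  fixes H :: "'g::complex_lie_algebra set"
  assumes simple: "simple_lie_algebra TYPE('g)"
    and cartan: "cartan_subalgebra H"
begin

lemma finite_span: "\<exists>B :: 'g set. finite B \<and> cspan B = UNIV"
  using simple by (simp add: simple_lie_algebra_def)

lemma finite_basis:
  obtains B :: "'g set" where "finite B" "\<not> cdependent B" "cspan B = UNIV"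
proof -
  obtain B0 :: "'g set" where B0: "finite B0" "cspan B0 = UNIV" using finite_span by blast
  obtain B where B: "B \<subseteq> B0" "\<not> cdependent B" "B0 \<subseteq> cspan B"
    using cvec.maximal_independent_subset by blast
  then have "finite B" "cspan B = UNIV"
    using B0 finite_subset cvec.span_minimal[of B0 "cspan B"] by auto
  then show ?thesis using that B by blast
qed

lemma independent_finite: "\<not> cdependent B \<Longrightarrow> finite (B :: 'g set)"
  using finite_span cvec.independent_span_bound by blast

lemma dim_psubset:
  assumes "csubspace S" "csubspace T" "S \<subset> (T :: 'g set)"
  shows "cvec.dim S < cvec.dim T"
proof -
  obtain B :: "'g set" where B: "finite B" "\<not> cdependent B" "cspan B = UNIV" by (rule finite_basis)
  interpret fd: finite_dimensional_vector_space "scaleC :: complex \<Rightarrow> 'g \<Rightarrow> 'g" B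
    using B by unfold_locales (simp_all add: cspan_def cdependent_def)
  have "cspan S \<subset> cspan T" using assms by (simp add: cvec.span_eq_iff[THEN iffD2])
  then show ?thesis using fd.dim_psubset[of S T] by (simp add: cspan_def)
qed

lemma simple_ideal: "lie_ideal (I :: 'g set) \<Longrightarrow> I = {0} \<or> I = UNIV"
  using simple by (simp add: simple_lie_algebra_def)

lemma not_abelian: "\<exists>x y :: 'g. \<lbrakk>x, y\<rbrakk> \<noteq> 0"
  using simple by (simp add: simple_lie_algebra_def)

lemma subspace_H: "csubspace H"
  using cartan by (simp add: cartan_subalgebra_def lie_subalgebra_def)

lemma bracket_H: "x \<in> H \<Longrightarrow> y \<in> H \<Longrightarrow> \<lbrakk>x, y\<rbrakk> \<in> H"
  using cartan by (simp add: cartan_subalgebra_def lie_subalgebra_def)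

lemma normalizer_H: "(\<And>h. h \<in> H \<Longrightarrow> \<lbrakk>x, h\<rbrakk> \<in> H) \<Longrightarrow> x \<in> H"
  using cartan by (auto simp: cartan_subalgebra_def)

lemma nilpotent_H: "\<exists>n. lower_central H n = {0}"
  using cartan by (simp add: cartan_subalgebra_def)

lemma ad_funpow_lower_central: "h \<in> H \<Longrightarrow> h' \<in> H \<Longrightarrow> (lie_bracket h ^^ n) h' \<in> lower_central H n"
proof (induction n)
  case (Suc n)
  then have "\<lbrakk>h, (lie_bracket h ^^ n) h'\<rbrakk> \<in> {\<lbrakk>x, y\<rbrakk> |x y. x \<in> H \<and> y \<in> lower_central H n}" by blast
  then show ?case by (auto intro: cvec.span_base)
qed simp

lemma subspace_lower_central: "csubspace (lower_central H n)"
  using subspace_H by (cases n) auto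

lemma lower_central_Suc_subset: "lower_central H (Suc n) \<subseteq> lower_central H n"
proof (induction n)
  case 0
  have "cspan {\<lbrakk>x, y\<rbrakk> |x y. x \<in> H \<and> y \<in> H} \<subseteq> H"
    by (rule cvec.span_minimal[OF _ subspace_H]) (use bracket_H in auto)
  then show ?case by simp
next
  case (Suc n)
  then show ?case by (subst (1 2) lower_central.simps) (intro cvec.span_mono, blast)
qed

lemma lower_central_subset: "lower_central H n \<subseteq> H"
  by (induction n) (use lower_central_Suc_subset in \<open>auto simp del: lower_central.simps(2)\<close>)

subsection \<open>Generalized weight spaces\<close>

definition gws :: "('g \<Rightarrow> complex) \<Rightarrow> 'g set" where
  "gws \<alpha> = {x. \<forall>h\<in>H. x \<in> gen_eig (lie_bracket h) (\<alpha> h)}"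

text \<open>Weights are functions on all of g of which only the values on \<open>H\<close> matter.
  Vanishing outside \<open>H\<close> turns equality on \<open>H\<close> into equality of functions,
  as it does in \<open>dual_space\<close>.\<close>

definition supported :: "('g \<Rightarrow> complex) \<Rightarrow> bool" where
  "supported \<alpha> \<longleftrightarrow> (\<forall>x. x \<notin> H \<longrightarrow> \<alpha> x = 0)"

lemma subspace_gws: "csubspace (gws \<alpha>)"
proof -
  have "csubspace (\<Inter>h\<in>H. gen_eig (lie_bracket h) (\<alpha> h))"
    by (rule cvec.subspace_Int) (rule gen_eig_subspace[OF clinear_bracket_right])
  moreover have "gws \<alpha> = (\<Inter>h\<in>H. gen_eig (lie_bracket h) (\<alpha> h))" by (auto simp: gws_def)
  ultimately show ?thesis by simp
qed

lemma bracket_gws: "x \<in> gws \<alpha> \<Longrightarrow> y \<in> gws \<beta> \<Longrightarrow> \<lbrakk>x, y\<rbrakk> \<in> gws (\<lambda>h. \<alpha> h + \<beta> h)"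
  by (simp add: gws_def gen_eig_bracket)

lemma H_subset_gws_0: "H \<subseteq> gws (\<lambda>h. 0)"
proof -
  obtain n where n: "lower_central H n = {0}" using nilpotent_H by blast
  have "shift (lie_bracket h) 0 = lie_bracket h" for h :: 'g by (simp add: shift_def fun_eq_iff)
  then have "(shift (lie_bracket h) 0 ^^ n) h' = 0" if "h \<in> H" "h' \<in> H" for h h'
    using ad_funpow_lower_central[OF that, of n] n by simp
  then show ?thesis by (auto simp: gws_def gen_eig_def)
qed

lemma bracket_H_gws: "h \<in> H \<Longrightarrow> x \<in> gws \<alpha> \<Longrightarrow> \<lbrakk>h, x\<rbrakk> \<in> gws \<alpha>"
  using bracket_gws[of h "\<lambda>h. 0" x \<alpha>] H_subset_gws_0 by auto

lemma gws_cong: "(\<And>h. h \<in> H \<Longrightarrow> \<alpha> h = \<beta> h) \<Longrightarrow> gws \<alpha> = gws \<beta>"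
  by (auto simp: gws_def)

text \<open>Induction on the dimension of \<open>S\<close>. If each ad h with h in \<open>H\<close>
  has a single eigenvalue on \<open>S\<close>, then \<open>S\<close> is one weight space; otherwise
  the generalized eigenspaces of some ad h inside \<open>S\<close> are proper.\<close>

lemma gws_decomposition:
  assumes "csubspace S" "\<And>h x. h \<in> H \<Longrightarrow> x \<in> S \<Longrightarrow> \<lbrakk>h, x\<rbrakk> \<in> S"
  shows "S \<subseteq> cspan (\<Union>\<alpha>. S \<inter> gws \<alpha>)"
  using assms
proof (induction "cvec.dim S" arbitrary: S rule: less_induct)
  case less
  obtain B :: "'g set" where B: "finite B" "\<not> cdependent B" "cspan B = UNIV" by (rule finite_basis)
  show ?case
  proof (cases "\<forall>h\<in>H. \<exists>a. S \<subseteq> gen_eig (lie_bracket h) a")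
    case True
    then obtain \<alpha> where "\<forall>h\<in>H. S \<subseteq> gen_eig (lie_bracket h) (\<alpha> h)" by metis
    then have "S \<subseteq> gws \<alpha>" by (auto simp: gws_def)
    then have "S \<subseteq> (\<Union>\<alpha>. S \<inter> gws \<alpha>)" by blast
    then show ?thesis using cvec.span_superset by blast
  next
    case False
    then obtain h where h: "h \<in> H" "\<And>a. \<not> S \<subseteq> gen_eig (lie_bracket h) a" by blast
    let ?S = "\<lambda>a. S \<inter> gen_eig (lie_bracket h) a"
    have sub: "?S a \<subseteq> cspan (\<Union>\<alpha>. S \<inter> gws \<alpha>)" for a
    proof -
      have sS: "csubspace (?S a)"
        using less.prems(1) gen_eig_subspace[OF clinear_bracket_right] by (rule cvec.subspace_inter)
      have "?S a \<subset> S" using h(2)[of a] by blast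
      then have "cvec.dim (?S a) < cvec.dim S"
        using dim_psubset sS less.prems(1) by blast
      \<comment> \<open>Nilpotency of \<open>H\<close> enters here: \<open>k\<close> lies in the
        generalized 0-eigenspace of ad h, so bracketing with it keeps the eigenvalue
        \<open>a\<close>.\<close>
      moreover have "\<lbrakk>k, x\<rbrakk> \<in> ?S a" if "k \<in> H" "x \<in> ?S a" for k x
        using that less.prems(2) gen_eig_bracket[of k h 0 x a] H_subset_gws_0 h(1)
        by (auto simp: gws_def)
      ultimately have "?S a \<subseteq> cspan (\<Union>\<alpha>. ?S a \<inter> gws \<alpha>)" using less.hyps sS by blast
      also have "\<dots> \<subseteq> cspan (\<Union>\<alpha>. S \<inter> gws \<alpha>)" by (rule cvec.span_mono) blast
      finally show ?thesis .
    qed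
    have "x \<in> cspan (\<Union>a. ?S a)" if "x \<in> S" for x
      using gen_eig_span[OF clinear_bracket_right less.prems(1) less.prems(2)[OF h(1)] B(1)] B(3) that
      by auto
    moreover have "cspan (\<Union>a. ?S a) \<subseteq> cspan (\<Union>\<alpha>. S \<inter> gws \<alpha>)"
      by (rule cvec.span_minimal) (use sub in auto)
    ultimately show ?thesis by blast
  qed
qed

text \<open>A power of \<open>ad h - \<alpha>0 h\<close> removes the summand at
  \<open>\<alpha>0\<close>. By induction it then kills every other summand too, so each of these
  lies in two different generalized eigenspaces.\<close>

lemma gws_independent:
  assumes "finite F" "\<And>\<alpha>. \<alpha> \<in> F \<Longrightarrow> supported \<alpha>" "\<And>\<alpha>. \<alpha> \<in> F \<Longrightarrow> x \<alpha> \<in> gws \<alpha>"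
    "(\<Sum>\<alpha>\<in>F. x \<alpha>) = 0" "\<alpha> \<in> F"
  shows "x \<alpha> = 0"
  using assms
proof (induction F arbitrary: x \<alpha> rule: finite_induct)
  case (insert \<alpha>0 F)
  have *: "x \<alpha> = 0" if \<alpha>: "\<alpha> \<in> F" for \<alpha>
  proof -
    have "\<alpha> \<noteq> \<alpha>0" using \<alpha> insert.hyps by blast
    then obtain h where "\<alpha> h \<noteq> \<alpha>0 h" by blast
    moreover have "supported \<alpha>" "supported \<alpha>0" using insert.prems(1) \<alpha> by auto
    ultimately have h: "h \<in> H" "\<alpha> h \<noteq> \<alpha>0 h" by (auto simp: supported_def) metis
    have "x \<alpha>0 \<in> gws \<alpha>0" using insert.prems by simp
    then obtain n where n: "(shift (lie_bracket h) (\<alpha>0 h) ^^ n) (x \<alpha>0) = 0"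
      using h by (auto simp: gws_def gen_eig_def)
    let ?f = "shift (lie_bracket h) (\<alpha>0 h) ^^ n"
    have lin: "clinear ?f" by (intro clinear_funpow clinear_shift clinear_bracket_right)
    have f: "?f y \<in> gws \<beta>" if "y \<in> gws \<beta>" for y \<beta>
    proof (induction n)
      case (Suc m)
      then show ?case using bracket_H_gws[OF h(1)] subspace_gws
        by (simp add: shift_def cvec.subspace_diff cvec.subspace_scale)
    qed (use that in simp)
    have "?f (\<Sum>\<alpha>\<in>insert \<alpha>0 F. x \<alpha>) = 0" using insert.prems clinear_0[OF lin] by simp
    then have "(\<Sum>\<alpha>\<in>F. ?f (x \<alpha>)) = 0" using insert.hyps n
      by (simp add: clinear_add[OF lin] clinear_sum[OF lin])
    then have "?f (x \<alpha>) = 0" using insert.IH[of "\<lambda>\<alpha>. ?f (x \<alpha>)" \<alpha>] insert.prems f \<alpha> by simp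
    then have "x \<alpha> \<in> gen_eig (lie_bracket h) (\<alpha>0 h)" by (auto simp: gen_eig_def)
    moreover have "x \<alpha> \<in> gen_eig (lie_bracket h) (\<alpha> h)" using insert.prems(2)[of \<alpha>] \<alpha> h by (auto simp: gws_def)
    ultimately show ?thesis using gen_eig_disjoint[OF clinear_bracket_right] h by blast
  qed
  then have "x \<alpha>0 = 0" using insert.prems(3) insert.hyps by simp
  then show ?case using * insert.prems by blast
qed simp

text \<open>Engel's argument along the lower central series: on vectors killed modulo \<open>H\<close> by its
  \<open>(i+1)\<close>-st term, the elements of the \<open>i\<close>-th term commute.\<close>

lemma gws_0: "gws (\<lambda>h. 0) = H"
proof (rule ccontr)
  let ?L = "lower_central H"
  let ?P = "\<lambda>x Y. x \<in> gws (\<lambda>h. 0) \<and> x \<notin> H \<and> (\<forall>y\<in>Y. \<lbrakk>y, x\<rbrakk> \<in> H)"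
  assume "gws (\<lambda>h. 0) \<noteq> H"
  then obtain x0 where x0: "x0 \<in> gws (\<lambda>h. 0)" "x0 \<notin> H" using H_subset_gws_0 by blast
  obtain n where n: "?L n = {0}" using nilpotent_H by blast
  have LH: "y \<in> H" if "y \<in> ?L i" for y i using that lower_central_subset by blast
  have step: "\<exists>x. ?P x (?L i)" if "\<exists>x. ?P x (?L (Suc i))" for i
  proof -
    obtain Y where Y: "Y \<subseteq> ?L i" "\<not> cdependent Y" "?L i \<subseteq> cspan Y"
      using cvec.maximal_independent_subset by blast
    have "finite Y" by (rule independent_finite[OF Y(2)])
    then have "\<exists>x. ?P x (?L (Suc i)) \<and> ?P x Y" using Y(1)
    proof (induction Y rule: finite_induct)
      case empty
      then show ?case using that by auto
    next
      case (insert y Y)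
      then obtain x where x: "?P x (?L (Suc i))" "?P x Y" by auto
      have yL: "y \<in> ?L i" and yH: "y \<in> H" using insert.prems LH by auto
      \<comment> \<open>The conditions already achieved. They survive ad y because
        \<open>\<lbrakk>u, y\<rbrakk>\<close> falls into the next term of the series, where they are
        known to hold.\<close>
      define Q where "Q z \<longleftrightarrow> z \<in> gws (\<lambda>h. 0) \<and> (\<forall>u\<in>?L (Suc i) \<union> Y. \<lbrakk>u, z\<rbrakk> \<in> H)" for z
      have Q: "Q \<lbrakk>y, z\<rbrakk>" if "Q z" for z
      proof -
        have "\<lbrakk>u, \<lbrakk>y, z\<rbrakk>\<rbrakk> \<in> H" if u: "u \<in> ?L (Suc i) \<union> Y" for u
        proof -
          have "u \<in> H" using u LH insert.prems by blast
          have "\<lbrakk>u, y\<rbrakk> \<in> ?L (Suc i)"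
          proof (cases "u \<in> Y")
            case True
            then show ?thesis using \<open>u \<in> H\<close> yL by (auto intro: cvec.span_base)
          next
            case False
            then have "u \<in> ?L (Suc i)" using u by blast
            then have "\<lbrakk>y, u\<rbrakk> \<in> {\<lbrakk>a, b\<rbrakk> |a b. a \<in> H \<and> b \<in> ?L (Suc i)}" using yH by blast
            then have "\<lbrakk>y, u\<rbrakk> \<in> ?L (Suc (Suc i))"
              by (subst lower_central.simps) (rule cvec.span_base)
            then have "\<lbrakk>y, u\<rbrakk> \<in> ?L (Suc i)" using lower_central_Suc_subset by blast
            then show ?thesis
              using bracket_anticomm[of u y] cvec.subspace_neg[OF subspace_lower_central[of "Suc i"]] by (simp del: lower_central.simps)
          qed
          then have "\<lbrakk>\<lbrakk>u, y\<rbrakk>, z\<rbrakk> \<in> H" using \<open>Q z\<close> Q_def by blast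
          moreover have "\<lbrakk>y, \<lbrakk>u, z\<rbrakk>\<rbrakk> \<in> H" using \<open>Q z\<close> u yH bracket_H by (auto simp: Q_def)
          ultimately show ?thesis
            using bracket_derivation[of u y z] cvec.subspace_add[OF subspace_H] by simp
        qed
        then show ?thesis using \<open>Q z\<close> bracket_H_gws[OF yH] by (auto simp: Q_def)
      qed
      have Qn: "Q ((lie_bracket y ^^ k) x)" for k
        by (induction k) (use x Q in \<open>auto simp: Q_def\<close>)
      have "x \<in> gen_eig (lie_bracket y) 0" using x yH by (auto simp: gws_def)
      moreover have "shift (lie_bracket y) 0 = lie_bracket y" by (simp add: shift_def fun_eq_iff)
      ultimately obtain m where "(lie_bracket y ^^ m) x = 0" by (auto simp: gen_eig_def)
      then have ex: "(lie_bracket y ^^ m) x \<in> H" using subspace_H cvec.subspace_0 by simp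
      \<comment> \<open>Repeated bracketing with \<open>y\<close> ends in \<open>H\<close>; the last
        iterate outside \<open>H\<close> is the vector that satisfies the new condition.\<close>
      define k where "k = (LEAST k. (lie_bracket y ^^ k) x \<in> H)"
      have k: "(lie_bracket y ^^ k) x \<in> H" unfolding k_def using ex by (rule LeastI)
      then obtain k' where k': "k = Suc k'" using x by (cases k) auto
      then have "(lie_bracket y ^^ k') x \<notin> H" using not_less_Least[of k' "\<lambda>k. (lie_bracket y ^^ k) x \<in> H"]
        by (simp add: k_def)
      moreover have "\<lbrakk>y, (lie_bracket y ^^ k') x\<rbrakk> \<in> H" using k k' by simp
      ultimately show ?case using Qn[of k'] unfolding Q_def
        by (intro exI[of _ "(lie_bracket y ^^ k') x"]) auto
    qed
    then obtain x where x: "?P x Y" by blast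
    have "\<lbrakk>y, x\<rbrakk> \<in> H" if "y \<in> ?L i" for y
      using clinear_span_into[OF clinear_bracket_left _ subspace_H, of y Y x] that Y x by blast
    then show ?thesis using x by blast
  qed
  have "?P x0 (?L n)" using x0 n subspace_H cvec.subspace_0 by (simp add: bracket_0)
  then have "\<exists>x. ?P x (?L n)" by blast
  then have "\<exists>x. ?P x (?L (n - k))" for k
  proof (induction k)
    case (Suc k)
    note IH = Suc.IH[OF Suc.prems]
    show ?case
    proof (cases "n - k")
      case 0
      then show ?thesis using IH by (simp only: diff_Suc nat.case)
    next
      case (Suc j)
      then have "n - Suc k = j" by simp
      then show ?thesis using step[of j] IH unfolding Suc by (simp only:)
    qed
  qed simp
  from this[of n] obtain x where x: "?P x H" by auto
  \<comment> \<open>Now \<open>x\<close> normalizes \<open>H\<close>, and a Cartan subalgebra is its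
    own normalizer.\<close>
  have "x \<in> H"
    by (rule normalizer_H) (use x bracket_anticomm[of x] cvec.subspace_neg[OF subspace_H] in auto)
  then show False using x by blast
qed

text \<open>The span of all brackets is an ideal, and it is nonzero because g is not
  abelian.\<close>

lemma perfect: "cspan {\<lbrakk>x, y\<rbrakk> | x y. True} = (UNIV :: 'g set)"
proof -
  let ?I = "cspan {\<lbrakk>x, y\<rbrakk> | x y :: 'g. True}"
  have "\<lbrakk>x, y\<rbrakk> \<in> ?I" for x y :: 'g by (rule cvec.span_base) blast
  then have "lie_ideal ?I" unfolding lie_ideal_def by simp
  moreover have "?I \<noteq> {0}"
  proof -
    obtain x y :: 'g where xy: "\<lbrakk>x, y\<rbrakk> \<noteq> 0" using not_abelian by blast
    have "\<lbrakk>x, y\<rbrakk> \<in> ?I" by (rule cvec.span_base) blast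
    then show ?thesis using xy by blast
  qed
  ultimately show ?thesis using simple_ideal by blast
qed

end

section \<open>Bases of generalized weight vectors and the Killing form\<close>

locale weight_basis = simple_cartan H for H :: "'g::complex_lie_algebra set" +
  fixes B :: "'g::complex_lie_algebra set" and w :: "'g \<Rightarrow> 'g \<Rightarrow> complex"
  assumes indep: "\<not> cdependent B"
    and span_B: "cspan B = UNIV"
    and w_gws: "b \<in> B \<Longrightarrow> b \<in> gws (w b)"
    and w_supported: "b \<in> B \<Longrightarrow> supported (w b)"
begin

lemma finite_B: "finite B" using independent_finite[OF indep] .

end

context simple_cartan
begin

lemma ex_weight_basis: "\<exists>B w. weight_basis H B w"
proof -
  let ?X = "\<Union>\<alpha>. gws \<alpha>"
  have "UNIV \<subseteq> cspan (\<Union>\<alpha>. UNIV \<inter> gws \<alpha>)" by (rule gws_decomposition) auto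
  then have X: "cspan ?X = UNIV" by auto
  obtain B where B: "B \<subseteq> ?X" "\<not> cdependent B" "?X \<subseteq> cspan B"
    using cvec.maximal_independent_subset by blast
  have span: "cspan B = UNIV" using B(3) X cvec.span_minimal[OF B(3)] by auto
  have "\<exists>\<alpha>. b \<in> gws \<alpha> \<and> supported \<alpha>" if b: "b \<in> B" for b
  proof -
    obtain \<alpha> where "b \<in> gws \<alpha>" using subsetD[OF B(1) b] by (auto simp only: UN_iff)
    moreover have "gws \<alpha> = gws (\<lambda>h. if h \<in> H then \<alpha> h else 0)" by (rule gws_cong) simp
    ultimately show ?thesis by (intro exI[of _ "\<lambda>h. if h \<in> H then \<alpha> h else 0"]) (simp add: supported_def)
  qed
  then obtain w where w: "b \<in> B \<Longrightarrow> b \<in> gws (w b) \<and> supported (w b)" for b by metis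
  have "weight_basis H B w"
    by unfold_locales (use B span w in auto)
  then show ?thesis by blast
qed

end

context weight_basis
begin

text \<open>The expansion of \<open>x\<close> is grouped by weights; subtracting \<open>x\<close> at
  the weight \<open>\<alpha>\<close> gives a vanishing sum of weight vectors, so the group at
  \<open>\<alpha>\<close> alone equals \<open>x\<close>.\<close>

lemma gws_span:
  assumes "supported \<alpha>" "x \<in> gws \<alpha>"
  shows "x \<in> cspan {b\<in>B. w b = \<alpha>}"
proof -
  have "x \<in> cspan B" using span_B by simp
  then obtain c where c: "x = (\<Sum>b\<in>B. c b *\<^sub>C b)" using cspan_finite_sum[OF finite_B] by blast
  define y where "y \<beta> = (\<Sum>b\<in>{b\<in>B. w b = \<beta>}. c b *\<^sub>C b)" for \<beta>
  have y: "y \<beta> \<in> gws \<beta>" for \<beta>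
    unfolding y_def by (intro cvec.subspace_sum[OF subspace_gws] cvec.subspace_scale[OF subspace_gws])
      (use w_gws in auto)
  let ?F = "insert \<alpha> (w ` B)"
  have F: "finite ?F" using finite_B by simp
  have "(\<Sum>\<beta>\<in>?F. y \<beta>) = x"
    unfolding y_def c by (rule sum.group[OF finite_B F]) auto
  moreover have "(\<Sum>\<beta>\<in>?F. if \<beta> = \<alpha> then x else 0) = x" using F by simp
  ultimately have "(\<Sum>\<beta>\<in>?F. y \<beta> - (if \<beta> = \<alpha> then x else 0)) = 0" by (simp add: sum_subtractf)
  then have "y \<alpha> - (if \<alpha> = \<alpha> then x else 0) = 0"
    by (rule gws_independent[OF F, rotated 2])
      (use y assms w_supported cvec.subspace_diff[OF subspace_gws] cvec.subspace_0[OF subspace_gws] in auto)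
  then have "x = y \<alpha>" by simp
  moreover have "y \<alpha> \<in> cspan {b\<in>B. w b = \<alpha>}"
    unfolding y_def by (intro cvec.span_sum cvec.span_scale cvec.span_base)
  ultimately show ?thesis by simp
qed

lemma gws_nontrivial: "supported \<alpha> \<Longrightarrow> x \<in> gws \<alpha> \<Longrightarrow> x \<noteq> 0 \<Longrightarrow> \<exists>b\<in>B. w b = \<alpha>"
  using gws_span[of \<alpha> x] by (cases "{b\<in>B. w b = \<alpha>} = {}") auto

text \<open>On the span of the basis vectors of one weight, \<open>f\<close> has a single
  generalized eigenvalue and its trace is a multiplicity times that value. \<open>S\<close> selects
  the weights that count.\<close>

lemma trc_weights:
  assumes f: "clinear f" "\<And>b. b \<in> B \<Longrightarrow> f b \<in> gws (w b)"
    and e: "\<And>b. b \<in> B \<Longrightarrow> gws (w b) \<subseteq> gen_eig f (e (w b))"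
  shows "trc {b\<in>B. w b \<in> S} f = (\<Sum>b\<in>{b\<in>B. w b \<in> S}. e (w b))"
proof -
  let ?C = "{b\<in>B. w b \<in> S}"
  have C: "\<not> cdependent ?C" "finite ?C"
    using indep cvec.independent_mono[of B ?C] finite_B by auto
  have "trc ?C f = (\<Sum>\<alpha>\<in>w ` ?C. \<Sum>b\<in>{b\<in>?C. w b = \<alpha>}. crepresentation ?C (f b) b)"
    unfolding trc_def by (rule sum.group[symmetric]) (use C in auto)
  also have "\<dots> = (\<Sum>\<alpha>\<in>w ` ?C. \<Sum>b\<in>{b\<in>?C. w b = \<alpha>}. e (w b))"
  proof (rule sum.cong[OF refl])
    fix \<alpha> assume \<alpha>: "\<alpha> \<in> w ` ?C"
    let ?D = "{b\<in>?C. w b = \<alpha>}"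
    have D: "?D = {b\<in>B. w b = \<alpha>}" using \<alpha> by auto
    have Di: "\<not> cdependent ?D" "finite ?D" using C cvec.independent_mono[of ?C ?D] finite_B by auto
    obtain b0 where b0: "b0 \<in> B" "\<alpha> = w b0" using \<alpha> by auto
    have fD: "f b \<in> cspan ?D" if "b \<in> ?D" for b
      unfolding D using gws_span[of \<alpha> "f b"] f(2)[of b] that w_supported by auto
    have "cspan ?D \<subseteq> gws \<alpha>"
      by (rule cvec.span_minimal[OF _ subspace_gws]) (use w_gws in auto)
    then have Dg: "cspan ?D \<subseteq> gen_eig f (e \<alpha>)" using e b0 by blast
    have "(\<Sum>b\<in>?D. crepresentation ?C (f b) b) = trc ?D f"
      by (rule trc_mono_span[OF C(1)]) (use fD in auto)
    also have "\<dots> = of_nat (card ?D) * e \<alpha>" by (rule trc_gen_eig[OF Di f(1) fD Dg])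
    finally show "(\<Sum>b\<in>?D. crepresentation ?C (f b) b) = (\<Sum>b\<in>?D. e (w b))" by simp
  qed
  also have "\<dots> = (\<Sum>b\<in>?C. e (w b))" by (rule sum.group) (use C in auto)
  finally show ?thesis .
qed

lemma gws_gen_eig: "h \<in> H \<Longrightarrow> gws \<alpha> \<subseteq> gen_eig (lie_bracket h) (\<alpha> h)"
  by (auto simp: gws_def)

lemma trc_ad: "h \<in> H \<Longrightarrow> trc {b\<in>B. w b \<in> S} (lie_bracket h) = (\<Sum>b\<in>{b\<in>B. w b \<in> S}. w b h)"
  by (rule trc_weights[OF clinear_bracket_right]) (use w_gws bracket_H_gws gws_gen_eig in auto)

lemma trc_ad_square:
  "h \<in> H \<Longrightarrow> trc B (\<lambda>x. \<lbrakk>h, \<lbrakk>h, x\<rbrakk>\<rbrakk>) = (\<Sum>b\<in>B. w b h * w b h)"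
proof -
  assume h: "h \<in> H"
  have "trc {b\<in>B. w b \<in> UNIV} (\<lambda>x. \<lbrakk>h, \<lbrakk>h, x\<rbrakk>\<rbrakk>) = (\<Sum>b\<in>{b\<in>B. w b \<in> UNIV}. w b h * w b h)"
  proof (rule trc_weights)
    show "clinear (\<lambda>x. \<lbrakk>h, \<lbrakk>h, x\<rbrakk>\<rbrakk>)" by (intro clinear_compose[OF clinear_bracket_right] clinear_bracket_right)
    show "\<lbrakk>h, \<lbrakk>h, b\<rbrakk>\<rbrakk> \<in> gws (w b)" if "b \<in> B" for b using that h w_gws bracket_H_gws by blast
    show "gws (w b) \<subseteq> gen_eig (\<lambda>x. \<lbrakk>h, \<lbrakk>h, x\<rbrakk>\<rbrakk>) (w b h * w b h)" for b
      using gws_gen_eig[OF h] gen_eig_square[OF clinear_bracket_right] by blast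
  qed
  then show ?thesis by simp
qed

lemma indep_subset: "C \<subseteq> B \<Longrightarrow> \<not> cdependent C \<and> finite C"
  using indep cvec.independent_mono finite_B finite_subset by blast

lemma ad_H_span: "h \<in> H \<Longrightarrow> b \<in> {b\<in>B. w b \<in> S} \<Longrightarrow> \<lbrakk>h, b\<rbrakk> \<in> cspan {b\<in>B. w b \<in> S}"
proof -
  assume h: "h \<in> H" and b: "b \<in> {b\<in>B. w b \<in> S}"
  then have "\<lbrakk>h, b\<rbrakk> \<in> cspan {c\<in>B. w c = w b}"
    by (intro gws_span) (use w_supported bracket_H_gws w_gws in auto)
  moreover have "cspan {c\<in>B. w c = w b} \<subseteq> cspan {b\<in>B. w b \<in> S}"
    by (rule cvec.span_mono) (use b in auto)
  ultimately show ?thesis by blast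
qed

lemma card_w_pos: "b \<in> B \<Longrightarrow> card {c\<in>B. w c \<in> {w b}} \<noteq> 0"
  using finite_B by auto

text \<open>A generalized eigenvalue is not visibly additive in h. The trace of ad h on the weight
  space is, and it equals the weight times a nonzero multiplicity.\<close>

lemma w_dual: "b \<in> B \<Longrightarrow> w b \<in> dual_space H"
proof -
  assume b: "b \<in> B"
  let ?C = "{c\<in>B. w c \<in> {w b}}"
  have C: "\<not> cdependent ?C" "finite ?C" using indep_subset[of ?C] by auto
  have t: "trc ?C (lie_bracket h) = of_nat (card ?C) * w b h" if "h \<in> H" for h
    using trc_ad[OF that, of "{w b}"] by simp
  have lb: "lie_bracket (h + k) = (\<lambda>x. \<lbrakk>h, x\<rbrakk> + \<lbrakk>k, x\<rbrakk>)" "lie_bracket (c *\<^sub>C h) = (\<lambda>x. c *\<^sub>C \<lbrakk>h, x\<rbrakk>)" for h k :: 'g and c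
    by (auto simp: bracket_add_left bracket_scale_left)
  have "w b (h + k) = w b h + w b k" if "h \<in> H" "k \<in> H" for h k
    using t[OF cvec.subspace_add[OF subspace_H that]] t[OF that(1)] t[OF that(2)]
      trc_add[OF C, of "lie_bracket h" "lie_bracket k"] ad_H_span[OF that(1), of _ "{w b}"] ad_H_span[OF that(2), of _ "{w b}"] card_w_pos[OF b]
    by (simp add: lb flip: distrib_left)
  moreover have "w b (c *\<^sub>C h) = c * w b h" if "h \<in> H" for h c
    using t[OF cvec.subspace_scale[OF subspace_H that]] t[OF that]
      trc_scale[OF C, of "lie_bracket h" c] ad_H_span[OF that, of _ "{w b}"] card_w_pos[OF b]
    by (simp add: lb)
  ultimately show ?thesis using w_supported[OF b] by (auto simp: dual_space_def supported_def)
qed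

text \<open>The trace of \<open>[e, f]\<close> on the \<open>\<alpha>\<close>-string through a weight vanishes, which makes every
  weight a rational multiple of \<open>\<alpha>\<close> on \<open>[e, f]\<close>.\<close>

lemma w_rational:
  assumes "e \<in> gws \<alpha>" "f \<in> gws (\<lambda>h. - \<alpha> h)" "b \<in> B" "supported \<alpha>"
  shows "\<exists>r::real. w b \<lbrakk>e, f\<rbrakk> = of_real r * \<alpha> \<lbrakk>e, f\<rbrakk>"
proof -
  let ?h = "\<lbrakk>e, f\<rbrakk>"
  have hH: "?h \<in> H" using bracket_gws[OF assms(1,2)] gws_0 by simp
  \<comment> \<open>The full \<open>\<alpha>\<close>-string through the weight. It may be an
    infinite set, but only the finitely many basis vectors with weights in it are summed
    over.\<close>
  let ?S = "range (\<lambda>i::int. (\<lambda>h. w b h + of_int i * \<alpha> h))"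
  let ?C = "{c\<in>B. w c \<in> ?S}"
  have C: "\<not> cdependent ?C" "finite ?C" using indep_subset[of ?C] by auto
  have into: "\<lbrakk>g, c\<rbrakk> \<in> cspan ?C" if c: "c \<in> ?C" and g: "g \<in> gws (\<lambda>h. of_int s * \<alpha> h)" for c g s
  proof -
    obtain i :: int where i: "w c = (\<lambda>h. w b h + of_int i * \<alpha> h)" using c by blast
    let ?\<beta> = "\<lambda>h. w b h + of_int (s + i) * \<alpha> h"
    have "\<lbrakk>g, c\<rbrakk> \<in> gws (\<lambda>h. of_int s * \<alpha> h + w c h)" using c g w_gws bracket_gws by auto
    then have "\<lbrakk>g, c\<rbrakk> \<in> gws ?\<beta>" by (simp add: i algebra_simps)
    moreover have "supported ?\<beta>" using w_supported[OF assms(3)] assms(4) by (simp add: supported_def)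
    ultimately have "\<lbrakk>g, c\<rbrakk> \<in> cspan {c\<in>B. w c = ?\<beta>}" by (intro gws_span)
    moreover have "?\<beta> \<in> ?S" by (rule range_eqI[of _ _ "s + i"]) simp
    then have "cspan {c\<in>B. w c = ?\<beta>} \<subseteq> cspan ?C" by (intro cvec.span_mono) blast
    ultimately show ?thesis by blast
  qed
  have ie: "\<lbrakk>e, c\<rbrakk> \<in> cspan ?C" if "c \<in> ?C" for c using into[OF that, of e 1] assms(1) by simp
  have jf: "\<lbrakk>f, c\<rbrakk> \<in> cspan ?C" if "c \<in> ?C" for c using into[OF that, of f "-1"] assms(2) by simp
  have ef: "\<lbrakk>e, x\<rbrakk> \<in> cspan ?C" "\<lbrakk>f, x\<rbrakk> \<in> cspan ?C" if "x \<in> cspan ?C" for x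
    using clinear_span_into[OF clinear_bracket_right that cvec.subspace_span] ie jf by blast+
  have "lie_bracket ?h = (\<lambda>x. \<lbrakk>e, \<lbrakk>f, x\<rbrakk>\<rbrakk> - \<lbrakk>f, \<lbrakk>e, x\<rbrakk>\<rbrakk>)" by (auto simp: bracket_bracket)
  then have "trc ?C (lie_bracket ?h) = trc ?C (\<lambda>x. \<lbrakk>e, \<lbrakk>f, x\<rbrakk>\<rbrakk>) - trc ?C (\<lambda>x. \<lbrakk>f, \<lbrakk>e, x\<rbrakk>\<rbrakk>)"
    using trc_diff[OF C, of "\<lambda>x. \<lbrakk>e, \<lbrakk>f, x\<rbrakk>\<rbrakk>" "\<lambda>x. \<lbrakk>f, \<lbrakk>e, x\<rbrakk>\<rbrakk>"] ef ie jf by simp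
  also have "trc ?C (\<lambda>x. \<lbrakk>e, \<lbrakk>f, x\<rbrakk>\<rbrakk>) = trc ?C (\<lambda>x. \<lbrakk>f, \<lbrakk>e, x\<rbrakk>\<rbrakk>)"
    by (rule trc_commute[OF C clinear_bracket_right clinear_bracket_right]) (use ie jf in auto)
  finally have 0: "(\<Sum>c\<in>?C. w c ?h) = 0" using trc_ad[OF hH, of ?S] by simp
  have "\<forall>c\<in>?C. \<exists>i::int. w c = (\<lambda>h. w b h + of_int i * \<alpha> h)" by blast
  from bchoice[OF this] obtain i :: "'g \<Rightarrow> int"
    where i: "w c = (\<lambda>h. w b h + of_int (i c) * \<alpha> h)" if "c \<in> ?C" for c by blast
  have "(\<Sum>c\<in>?C. w c ?h) = of_nat (card ?C) * w b ?h + (\<Sum>c\<in>?C. of_int (i c)) * \<alpha> ?h"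
  proof -
    have "(\<Sum>c\<in>?C. w c ?h) = (\<Sum>c\<in>?C. w b ?h + of_int (i c) * \<alpha> ?h)"
      by (rule sum.cong[OF refl]) (rule fun_cong[OF i])
    then show ?thesis by (simp add: sum.distrib sum_distrib_right)
  qed
  then have eq: "of_nat (card ?C) * w b ?h = - (\<Sum>c\<in>?C. of_int (i c)) * \<alpha> ?h"
    using 0 by (simp add: eq_neg_iff_add_eq_0)
  have "w b = (\<lambda>h. w b h + of_int 0 * \<alpha> h)" by simp
  then have "b \<in> ?C" using assms(3) by blast
  then have "card ?C \<noteq> 0" using C by auto
  then have "w b ?h = of_real (- (\<Sum>c\<in>?C. of_int (i c)) / of_nat (card ?C)) * \<alpha> ?h"
    using eq by (simp add: field_simps)
  then show ?thesis by blast
qed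

subsection \<open>The Killing form\<close>

lemma killing_trc: "killing (x::'g) y = trc B (\<lambda>z. \<lbrakk>x, \<lbrakk>y, z\<rbrakk>\<rbrakk>)"
proof -
  let ?f = "\<lambda>z. \<lbrakk>x, \<lbrakk>y, z\<rbrakk>\<rbrakk>"
  let ?B = "SOME B. \<not> cdependent B \<and> cspan B = (UNIV :: 'g set)"
  have B': "\<not> cdependent ?B \<and> cspan ?B = (UNIV :: 'g set)"
    by (rule someI[of _ B]) (use indep span_B in blast)
  have "trc B ?f = trc ?B ?f"
    by (rule trc_basis_indep) (use B' indep finite_B span_B independent_finite
        clinear_compose[OF clinear_bracket_right clinear_bracket_right] in auto)
  then show ?thesis by (simp add: killing_def ctrace_def trc_def Let_def)
qed

lemma in_span_B: "x \<in> cspan B" by (simp add: span_B)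

lemma killing_add_left: "killing (x + y) (z::'g) = killing x z + killing y z"
  unfolding killing_trc
  by (subst trc_add[OF indep finite_B, symmetric]) (auto simp: in_span_B bracket_add_left)

lemma killing_scale_left: "killing (c *\<^sub>C x) (z::'g) = c * killing x z"
  unfolding killing_trc
  by (subst trc_scale[OF indep finite_B, symmetric]) (auto simp: in_span_B bracket_scale_left)

lemma killing_commute: "killing x (y::'g) = killing y x"
  unfolding killing_trc
  by (rule trc_commute[OF indep finite_B]) (auto simp: in_span_B clinear_bracket_right)

lemma killing_add_right: "killing (z::'g) (x + y) = killing z x + killing z y"
  using killing_add_left[of x y z] by (simp add: killing_commute)

lemma killing_scale_right: "killing (z::'g) (c *\<^sub>C x) = c * killing z x"
  using killing_scale_left[of c x z] by (simp add: killing_commute)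

lemma killing_invariant: "killing \<lbrakk>x, y\<rbrakk> (z::'g) = killing x \<lbrakk>y, z\<rbrakk>"
proof -
  note lin = clinear_bracket_right clinear_compose[OF clinear_bracket_right clinear_bracket_right]
    clinear_compose[OF clinear_bracket_right clinear_compose[OF clinear_bracket_right clinear_bracket_right]]
  have "killing \<lbrakk>x, y\<rbrakk> z = trc B (\<lambda>v. \<lbrakk>x, \<lbrakk>y, \<lbrakk>z, v\<rbrakk>\<rbrakk>\<rbrakk> - \<lbrakk>y, \<lbrakk>x, \<lbrakk>z, v\<rbrakk>\<rbrakk>\<rbrakk>)"
    unfolding killing_trc by (simp add: bracket_bracket)
  also have "\<dots> = trc B (\<lambda>v. \<lbrakk>x, \<lbrakk>y, \<lbrakk>z, v\<rbrakk>\<rbrakk>\<rbrakk>) - trc B (\<lambda>v. \<lbrakk>y, \<lbrakk>x, \<lbrakk>z, v\<rbrakk>\<rbrakk>\<rbrakk>)"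
    by (rule trc_diff[OF indep finite_B]) (auto simp: in_span_B)
  also have "trc B (\<lambda>v. \<lbrakk>y, \<lbrakk>x, \<lbrakk>z, v\<rbrakk>\<rbrakk>\<rbrakk>) = trc B (\<lambda>v. \<lbrakk>x, \<lbrakk>z, \<lbrakk>y, v\<rbrakk>\<rbrakk>\<rbrakk>)"
    by (rule trc_commute[OF indep finite_B lin(1,2)]) (auto simp: in_span_B)
  also have "trc B (\<lambda>v. \<lbrakk>x, \<lbrakk>y, \<lbrakk>z, v\<rbrakk>\<rbrakk>\<rbrakk>) - trc B (\<lambda>v. \<lbrakk>x, \<lbrakk>z, \<lbrakk>y, v\<rbrakk>\<rbrakk>\<rbrakk>)
      = trc B (\<lambda>v. \<lbrakk>x, \<lbrakk>y, \<lbrakk>z, v\<rbrakk>\<rbrakk>\<rbrakk> - \<lbrakk>x, \<lbrakk>z, \<lbrakk>y, v\<rbrakk>\<rbrakk>\<rbrakk>)"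
    by (rule trc_diff[OF indep finite_B, symmetric]) (auto simp: in_span_B)
  also have "\<dots> = killing x \<lbrakk>y, z\<rbrakk>"
    unfolding killing_trc by (simp add: bracket_bracket bracket_diff)
  finally show ?thesis .
qed

lemma killing_0: "killing (x::'g) 0 = 0" "killing 0 (x::'g) = 0"
  using killing_scale_right[of x 0 0] killing_scale_left[of 0 0 x] by simp_all

lemma killing_neg: "killing (x::'g) (- y) = - killing x y" "killing (- x) (y::'g) = - killing x y"
  using killing_scale_right[of x "-1" y] killing_scale_left[of "-1" x y] by (simp_all add: cvec.scale_minus_left scaleC_one)

lemma killing_diff: "killing (x::'g) (y - z) = killing x y - killing x z" "killing (x - y) (z::'g) = killing x z - killing y z"
  using killing_add_right[of x y "- z"] killing_add_left[of x "- y" z] by (simp_all add: killing_neg)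

lemma killing_sum: "killing (x::'g) (\<Sum>i\<in>I. f i) = (\<Sum>i\<in>I. killing x (f i))"
  "killing (\<Sum>i\<in>I. f i) (x::'g) = (\<Sum>i\<in>I. killing (f i) x)"
  by (induction I rule: infinite_finite_induct) (auto simp: killing_0 killing_add_right killing_add_left)

lemma killing_invariant_left: "killing \<lbrakk>x, y\<rbrakk> (z::'g) = - killing y \<lbrakk>x, z\<rbrakk>"
  using killing_invariant[of y x z] bracket_anticomm[of x y] by (simp add: killing_neg)

text \<open>Polarization: weights determine the trace of the square of one ad h directly, whereas
  the commutativity of \<open>H\<close> is still unproved at this point.\<close>

lemma killing_H: "h \<in> H \<Longrightarrow> k \<in> H \<Longrightarrow> killing h k = (\<Sum>b\<in>B. w b h * w b k)"
proof -
  assume h: "h \<in> H" and k: "k \<in> H"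
  have sq: "killing h h = (\<Sum>b\<in>B. w b h * w b h)" if "h \<in> H" for h
    using trc_ad_square[OF that] by (simp add: killing_trc)
  have "killing (h + k) (h + k) = killing h h + 2 * killing h k + killing k k"
    by (simp add: killing_add_left killing_add_right killing_commute[of k h])
  moreover have "killing (h + k) (h + k) = (\<Sum>b\<in>B. (w b h + w b k) * (w b h + w b k))"
    using sq[OF cvec.subspace_add[OF subspace_H h k]] w_dual h k by (auto simp: dual_space_def)
  moreover have "\<dots> = (\<Sum>b\<in>B. w b h * w b h) + 2 * (\<Sum>b\<in>B. w b h * w b k) + (\<Sum>b\<in>B. w b k * w b k)"
    by (simp add: algebra_simps sum.distrib sum_distrib_left)
  ultimately show ?thesis using sq[OF h] sq[OF k] by simp
qed

text \<open>Applying ad y and ad x shifts every weight by the nonzero function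
  \<open>\<alpha> + \<beta>\<close>, so all diagonal entries vanish.\<close>

lemma killing_gws:
  assumes "x \<in> gws \<alpha>" "y \<in> gws \<beta>" "supported \<alpha>" "supported \<beta>" "(\<lambda>h. \<alpha> h + \<beta> h) \<noteq> (\<lambda>h. 0)"
  shows "killing x y = 0"
proof -
  obtain h where h: "\<alpha> h + \<beta> h \<noteq> 0" using assms(5) by blast
  have "crepresentation B \<lbrakk>x, \<lbrakk>y, b\<rbrakk>\<rbrakk> b = 0" if b: "b \<in> B" for b
  proof -
    let ?\<mu> = "\<lambda>h. \<alpha> h + (\<beta> h + w b h)"
    let ?C = "{c\<in>B. w c = ?\<mu>}"
    have "\<lbrakk>x, \<lbrakk>y, b\<rbrakk>\<rbrakk> \<in> gws ?\<mu>" using bracket_gws[OF assms(1) bracket_gws[OF assms(2) w_gws[OF b]]] .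
    moreover have "supported ?\<mu>" using assms(3,4) w_supported[OF b] by (simp add: supported_def)
    ultimately have "\<lbrakk>x, \<lbrakk>y, b\<rbrakk>\<rbrakk> \<in> cspan ?C" by (intro gws_span)
    then have "crepresentation B \<lbrakk>x, \<lbrakk>y, b\<rbrakk>\<rbrakk> = crepresentation ?C \<lbrakk>x, \<lbrakk>y, b\<rbrakk>\<rbrakk>"
      by (intro cvec.representation_extend[OF indep]) auto
    moreover have "b \<notin> ?C"
    proof
      assume "b \<in> ?C"
      then have "w b h = \<alpha> h + (\<beta> h + w b h)" by (auto dest: fun_cong)
      then show False using h by (simp add: algebra_simps)
    qed
    ultimately show ?thesis using cvec.representation_ne_zero[of ?C _ b] by auto
  qed
  then show ?thesis by (simp add: killing_trc trc_def)
qed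

text \<open>On the bracket every weight is a real multiple of \<open>\<alpha>\<close>. Its Killing
  square is therefore a sum of real squares times a square of a value of \<open>\<alpha>\<close>,
  and one of these two factors must be 0.\<close>

lemma w_bracket_eq_0:
  assumes K: "\<And>h. h \<in> H \<Longrightarrow> killing h h = 0" and "e \<in> gws \<alpha>" "f \<in> gws (\<lambda>h. - \<alpha> h)" "supported \<alpha>" "b \<in> B"
  shows "w b \<lbrakk>e, f\<rbrakk> = 0"
proof -
  let ?h = "\<lbrakk>e, f\<rbrakk>"
  have hH: "?h \<in> H" using bracket_gws[OF assms(2,3)] gws_0 by simp
  obtain r :: "'g \<Rightarrow> real" where r: "w b ?h = of_real (r b) * \<alpha> ?h" if "b \<in> B" for b
    using w_rational[OF assms(2,3) _ assms(4)] by metis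
  have "0 = (\<Sum>b\<in>B. (of_real (r b) * \<alpha> ?h) * (of_real (r b) * \<alpha> ?h))"
    using K[OF hH] killing_H[OF hH hH] r by simp
  also have "\<dots> = of_real (\<Sum>b\<in>B. r b * r b) * (\<alpha> ?h * \<alpha> ?h)"
    by (simp add: sum_distrib_left sum_distrib_right mult_ac)
  finally have "(\<Sum>b\<in>B. r b * r b) = 0 \<or> \<alpha> ?h = 0" by (simp del: of_real_sum)
  then show ?thesis
  proof
    assume "(\<Sum>b\<in>B. r b * r b) = 0"
    then have "r b = 0" using assms(5) finite_B by (subst (asm) sum_nonneg_eq_0_iff) auto
    then show ?thesis using r assms(5) by simp
  qed (use r assms(5) in simp)
qed

text \<open>Cartan's criterion in the case at hand. If the form vanished, so would all weights on
  \<open>H\<close>; then \<open>H\<close> would be everything, and g would be both nilpotent and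
  perfect.\<close>

lemma killing_nonzero: "\<exists>x y :: 'g. killing x y \<noteq> 0"
proof (rule ccontr)
  assume "\<not> ?thesis"
  then have K: "killing h h = 0" for h :: 'g by blast
  have lin0: "w b h = 0" if b: "b \<in> B" and h: "h \<in> H" for b h
  proof -
    let ?Z = "{\<lbrakk>c, d\<rbrakk> | c d. c \<in> B \<and> d \<in> B}"
    let ?U = "\<Union>\<alpha>\<in>{\<alpha>. supported \<alpha> \<and> \<alpha> \<noteq> (\<lambda>h. 0)}. gws \<alpha>"
    have sub: "csubspace {z\<in>H. w b z = 0}"
      using w_dual[OF b] subspace_H unfolding dual_space_def cvec.subspace_def
      by (auto, metis cvec.scale_zero_left mult_zero_left)
    have br: "\<lbrakk>c, d\<rbrakk> \<in> cspan ({z\<in>H. w b z = 0} \<union> ?U)" if cd: "c \<in> B" "d \<in> B" for c d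
    proof (cases "(\<lambda>h. w c h + w d h) = (\<lambda>h. 0)")
      case True
      then have wd: "w d = (\<lambda>h. - w c h)" by (auto simp: fun_eq_iff add_eq_0_iff)
      then have d: "d \<in> gws (\<lambda>h. - w c h)" using w_gws[OF cd(2)] by simp
      have "w b \<lbrakk>c, d\<rbrakk> = 0"
        by (rule w_bracket_eq_0[OF K w_gws[OF cd(1)] d w_supported[OF cd(1)] b])
      moreover have "\<lbrakk>c, d\<rbrakk> \<in> H" using bracket_gws[OF w_gws[OF cd(1)] d] gws_0 by simp
      ultimately show ?thesis by (intro cvec.span_base) auto
    next
      case False
      have "\<lbrakk>c, d\<rbrakk> \<in> gws (\<lambda>h. w c h + w d h)" using bracket_gws w_gws cd by blast
      moreover have "supported (\<lambda>h. w c h + w d h)" using w_supported cd by (simp add: supported_def)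
      ultimately have "\<lbrakk>c, d\<rbrakk> \<in> ?U" using False by blast
      then show ?thesis by (intro cvec.span_base) auto
    qed
    have "\<lbrakk>x, y\<rbrakk> \<in> cspan ({z\<in>H. w b z = 0} \<union> ?U)" for x y
    proof -
      have "\<lbrakk>c, y\<rbrakk> \<in> cspan ({z\<in>H. w b z = 0} \<union> ?U)" if "c \<in> B" for c
        by (rule clinear_span_into[OF clinear_bracket_right in_span_B cvec.subspace_span br[OF that]])
      then show ?thesis
        by (rule clinear_span_into[OF clinear_bracket_left in_span_B cvec.subspace_span])
    qed
    then have "cspan {\<lbrakk>x, y\<rbrakk> | x y. True} \<subseteq> cspan ({z\<in>H. w b z = 0} \<union> ?U)"
      by (intro cvec.span_minimal) auto
    \<comment> \<open>As g is perfect, \<open>h\<close> is a combination of brackets. Comparing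
      components of weight zero leaves an element of \<open>H\<close> on which \<open>w b\<close>
      vanishes.\<close>
    then have "h \<in> cspan ({z\<in>H. w b z = 0} \<union> ?U)" using perfect by auto
    then obtain z u where z: "z \<in> {z\<in>H. w b z = 0}" and u: "u \<in> cspan ?U" and hzu: "h = z + u"
      using cvec.span_eq_iff[THEN iffD2, OF sub] by (auto simp: cvec.span_Un)
    obtain C c where C: "finite C" "C \<subseteq> ?U" "u = (\<Sum>v\<in>C. c v *\<^sub>C v)" using u by (rule cspan_imp_finite_sum)
    have "\<forall>v\<in>C. \<exists>\<alpha>. supported \<alpha> \<and> \<alpha> \<noteq> (\<lambda>h. 0) \<and> v \<in> gws \<alpha>" using C by blast
    then obtain a where a: "\<forall>v\<in>C. supported (a v) \<and> a v \<noteq> (\<lambda>h. 0) \<and> v \<in> gws (a v)" by metis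
    define y where "y \<beta> = (\<Sum>v\<in>{v\<in>C. a v = \<beta>}. c v *\<^sub>C v)" for \<beta>
    have y: "y \<beta> \<in> gws \<beta>" for \<beta>
      unfolding y_def by (intro cvec.subspace_sum[OF subspace_gws] cvec.subspace_scale[OF subspace_gws])
        (use a in auto)
    let ?F = "insert (\<lambda>h. 0) (a ` C)"
    have F: "finite ?F" using C by simp
    have "(\<Sum>\<beta>\<in>?F. y \<beta>) = u" unfolding y_def C(3) by (rule sum.group[OF C(1) F]) auto
    moreover have "(\<Sum>\<beta>\<in>?F. if \<beta> = (\<lambda>h. 0) then h - z else 0) = h - z" using F by simp
    ultimately have "(\<Sum>\<beta>\<in>?F. y \<beta> - (if \<beta> = (\<lambda>h. 0) then h - z else 0)) = 0"
      using hzu by (simp add: sum_subtractf)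
    moreover have "h - z \<in> gws (\<lambda>h. 0)" using h z gws_0 cvec.subspace_diff[OF subspace_H] by blast
    ultimately have "y (\<lambda>h. 0) - (if (\<lambda>h::'g. 0::complex) = (\<lambda>h. 0) then h - z else 0) = 0"
      by (intro gws_independent[OF F])
        (use y a cvec.subspace_diff[OF subspace_gws] cvec.subspace_0[OF subspace_gws] in \<open>auto simp: supported_def\<close>)
    moreover have "{v\<in>C. a v = (\<lambda>h. 0)} = {}" using a by auto
    then have "y (\<lambda>h. 0) = 0" unfolding y_def by (simp only: sum.empty)
    ultimately have "h = z" by simp
    then show ?thesis using z by simp
  qed
  \<comment> \<open>With all weights zero on \<open>H\<close>, the whole basis lies in the zero
    weight space, which is \<open>H\<close>.\<close>
  have "gws (w b) = gws (\<lambda>h. 0)" if "b \<in> B" for b by (rule gws_cong) (use lin0 that in auto)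
  then have "B \<subseteq> H" using w_gws gws_0 by blast
  then have "H = UNIV" using cvec.span_minimal[OF _ subspace_H] span_B by auto
  then have "lower_central H n = UNIV" for n
    using perfect by (induction n) auto
  then have "(UNIV :: 'g set) = {0}" using nilpotent_H by auto
  then show False using not_abelian by (metis UNIV_I singletonD bracket_0(1))
qed

text \<open>By invariance the radical of the form is an ideal, and it is not everything.\<close>

lemma killing_nondegenerate: "(\<And>y::'g. killing x y = 0) \<Longrightarrow> x = 0"
proof -
  assume x: "\<And>y. killing x y = 0"
  let ?R = "{x :: 'g. \<forall>y. killing x y = 0}"
  have "lie_ideal ?R"
    unfolding lie_ideal_def cvec.subspace_def
    by (auto simp: killing_0 killing_add_left killing_scale_left killing_invariant_left)
  moreover have "?R \<noteq> UNIV" using killing_nonzero by auto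
  ultimately have "?R = {0}" using simple_ideal by blast
  then show ?thesis using x by blast
qed

lemma killing_nondegenerate_gws:
  assumes "supported \<alpha>" "x \<in> gws \<alpha>" "x \<noteq> 0"
  shows "\<exists>b\<in>B. w b = (\<lambda>h. - \<alpha> h) \<and> killing x b \<noteq> 0"
proof -
  have "\<exists>b\<in>B. killing x b \<noteq> 0"
  proof (rule ccontr)
    assume *: "\<not> ?thesis"
    have "killing x y = 0" for y
      using cspan_finite_sum[OF finite_B in_span_B[of y]] * by (auto simp: killing_sum killing_scale_right)
    then show False using killing_nondegenerate assms(3) by blast
  qed
  then obtain b where b: "b \<in> B" "killing x b \<noteq> 0" by blast
  then have "(\<lambda>h. \<alpha> h + w b h) = (\<lambda>h. 0)"
    using killing_gws[OF assms(2) w_gws[OF b(1)] assms(1) w_supported[OF b(1)]] by blast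
  then have "w b = (\<lambda>h. - \<alpha> h)" by (auto simp: fun_eq_iff add_eq_0_iff)
  then show ?thesis using b by blast
qed

lemma killing_nondegenerate_H: "h \<in> H \<Longrightarrow> (\<And>k. k \<in> H \<Longrightarrow> killing h k = 0) \<Longrightarrow> h = 0"
proof (rule ccontr)
  assume h: "h \<in> H" and k: "\<And>k. k \<in> H \<Longrightarrow> killing h k = 0" and "h \<noteq> 0"
  then obtain b where "b \<in> B" "w b = (\<lambda>h. - 0)" "killing h b \<noteq> 0"
    using killing_nondegenerate_gws[of "\<lambda>h. 0" h] gws_0 by (auto simp: supported_def)
  then show False using k w_gws[of b] gws_0 by simp
qed

lemma weights_separate: "h \<in> H \<Longrightarrow> (\<And>b. b \<in> B \<Longrightarrow> w b h = 0) \<Longrightarrow> h = 0"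
  by (rule killing_nondegenerate_H) (auto simp: killing_H)

text \<open>The rationality of weights for the weight 0 says that all weights vanish on
  \<open>\<lbrakk>h, k\<rbrakk>\<close>, and weights separate the points of
  \<open>H\<close>.\<close>

lemma H_abelian: "h \<in> H \<Longrightarrow> k \<in> H \<Longrightarrow> \<lbrakk>h, k\<rbrakk> = 0"
proof -
  assume h: "h \<in> H" and k: "k \<in> H"
  have "w b \<lbrakk>h, k\<rbrakk> = 0" if "b \<in> B" for b
    using w_rational[of h "\<lambda>h. 0" k b] h k that gws_0 by (auto simp: supported_def)
  then show ?thesis using weights_separate bracket_H[OF h k] by blast
qed

end

section \<open>Roots\<close>

context simple_cartan
begin

text \<open>Makes a prescribed weight vector a member of the basis, so that it contributes a
  diagonal entry of its own to a trace.\<close>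

lemma ex_weight_basis_extend:
  assumes "supported \<beta>" "e \<in> gws \<beta>" "e \<noteq> 0"
  shows "\<exists>B w. weight_basis H B w \<and> e \<in> B \<and> w e = \<beta>"
proof -
  obtain B0 w0 where "weight_basis H B0 w0" using ex_weight_basis by blast
  then interpret b0: weight_basis H B0 w0 .
  let ?X = "\<Union>\<alpha>\<in>{\<alpha>. supported \<alpha>}. gws \<alpha>"
  have "{e} \<subseteq> ?X" "\<not> cdependent {e}" using assms by auto
  then obtain B where B: "{e} \<subseteq> B" "B \<subseteq> ?X" "\<not> cdependent B" "?X \<subseteq> cspan B"
    by (rule cvec.maximal_independent_subset_extend)
  have "B0 \<subseteq> ?X" using b0.w_gws b0.w_supported by blast
  then have "cspan B0 \<subseteq> cspan B" using B(4) by (intro cvec.span_minimal) auto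
  then have span: "cspan B = UNIV" using b0.span_B by auto
  have "\<forall>b\<in>B. \<exists>\<alpha>. supported \<alpha> \<and> b \<in> gws \<alpha>" using B(2) by blast
  from bchoice[OF this] obtain w0 where w0: "\<forall>b\<in>B. supported (w0 b) \<and> b \<in> gws (w0 b)" by blast
  define w where "w = w0(e := \<beta>)"
  have "\<forall>b\<in>B. supported (w b) \<and> b \<in> gws (w b)" using w0 assms by (simp add: w_def)
  then have "weight_basis H B w" by unfold_locales (use B span in auto)
  moreover have "e \<in> B" "w e = \<beta>" using B by (auto simp: w_def)
  ultimately show ?thesis by blast
qed

lemma gws_nonzero_dual:
  assumes "supported \<beta>" "gws \<beta> \<noteq> {0}"
  shows "\<beta> \<in> dual_space H"
proof -
  obtain e where e: "e \<in> gws \<beta>" "e \<noteq> 0"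
    using assms(2) cvec.subspace_0[OF subspace_gws[of \<beta>]] by blast
  then obtain B w where B: "weight_basis H B w" "e \<in> B" "w e = \<beta>"
    using ex_weight_basis_extend[OF assms(1)] by blast
  interpret weight_basis H B w by fact
  show ?thesis using w_dual[OF B(2)] B(3) by simp
qed

lemma dual_space_supported: "\<beta> \<in> dual_space H \<Longrightarrow> supported \<beta>"
  by (simp add: dual_space_def supported_def)

lemma root_space_subset_gws: "root_space H \<beta> \<subseteq> gws \<beta>"
proof
  fix x assume x: "x \<in> root_space H \<beta>"
  have "(shift (lie_bracket h) (\<beta> h) ^^ 1) x = 0" if "h \<in> H" for h
    using that x by (simp add: root_space_def shift_def)
  then show "x \<in> gws \<beta>" unfolding gws_def gen_eig_def by blast
qed

lemma subspace_root_space: "csubspace (root_space H \<beta>)"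
  unfolding root_space_def cvec.subspace_def
  by (auto simp: bracket_0 bracket_add_right bracket_scale_right scaleC_add_right scaleC_scaleC mult.commute)

text \<open>\<open>H\<close> is commutative, so the elements of a basis of \<open>H\<close> can be
  treated one after the other: the last nonzero iterate of \<open>ad y - \<beta> y\<close> is an
  eigenvector for \<open>y\<close> and stays one for its predecessors.\<close>

lemma common_eigenvector:
  assumes "supported \<beta>" "gws \<beta> \<noteq> {0}"
  shows "\<exists>x\<in>root_space H \<beta>. x \<noteq> 0"
proof -
  obtain x0 where x0: "x0 \<in> gws \<beta>" "x0 \<noteq> 0"
    using assms(2) cvec.subspace_0[OF subspace_gws[of \<beta>]] by blast
  obtain Y where Y: "Y \<subseteq> H" "\<not> cdependent Y" "H \<subseteq> cspan Y"
    using cvec.maximal_independent_subset by blast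
  obtain B w where "weight_basis H B w" using ex_weight_basis by blast
  then interpret weight_basis H B w .
  have "finite Y" by (rule independent_finite[OF Y(2)])
  then have "\<exists>x\<in>gws \<beta>. x \<noteq> 0 \<and> (\<forall>y\<in>Y. \<lbrakk>y, x\<rbrakk> = \<beta> y *\<^sub>C x)" using Y(1)
  proof (induction Y rule: finite_induct)
    case empty
    then show ?case using x0 by auto
  next
    case (insert y Y)
    then obtain x where x: "x \<in> gws \<beta>" "x \<noteq> 0" "\<forall>y\<in>Y. \<lbrakk>y, x\<rbrakk> = \<beta> y *\<^sub>C x" by auto
    have y: "y \<in> H" using insert.prems by simp
    let ?f = "shift (lie_bracket y) (\<beta> y)"
    obtain m where m: "(?f ^^ m) x = 0" using x(1) y by (auto simp: gws_def gen_eig_def)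
    define k where "k = (LEAST k. (?f ^^ k) x = 0)"
    have k: "(?f ^^ k) x = 0" unfolding k_def using m by (rule LeastI)
    then obtain k' where k': "k = Suc k'" using x by (cases k) auto
    then have ne: "(?f ^^ k') x \<noteq> 0" using not_less_Least[of k' "\<lambda>k. (?f ^^ k) x = 0"]
      by (simp add: k_def)
    have fx: "?f z \<in> gws \<beta> \<and> (\<forall>y'\<in>Y. \<lbrakk>y', ?f z\<rbrakk> = \<beta> y' *\<^sub>C ?f z)"
      if z: "z \<in> gws \<beta> \<and> (\<forall>y'\<in>Y. \<lbrakk>y', z\<rbrakk> = \<beta> y' *\<^sub>C z)" for z
    proof -
      have "?f z \<in> gws \<beta>" using z bracket_H_gws[OF y] subspace_gws
        by (simp add: shift_def cvec.subspace_diff cvec.subspace_scale)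
      moreover have "\<lbrakk>y', ?f z\<rbrakk> = \<beta> y' *\<^sub>C ?f z" if y': "y' \<in> Y" for y'
      proof -
        have "\<lbrakk>y', y\<rbrakk> = 0" using H_abelian insert.prems y' by blast
        then have "\<lbrakk>y', \<lbrakk>y, z\<rbrakk>\<rbrakk> = \<beta> y' *\<^sub>C \<lbrakk>y, z\<rbrakk>"
          using z y' by (simp add: bracket_derivation[of y' y z] bracket_0 bracket_scale_right)
        then show ?thesis using z y'
          by (simp add: shift_def bracket_diff bracket_scale_right cvec.scale_right_diff_distrib
              scaleC_scaleC mult.commute)
      qed
      ultimately show ?thesis by blast
    qed
    have "(?f ^^ i) x \<in> gws \<beta> \<and> (\<forall>y'\<in>Y. \<lbrakk>y', (?f ^^ i) x\<rbrakk> = \<beta> y' *\<^sub>C (?f ^^ i) x)" for i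
      by (induction i) (use x fx in auto)
    from this[of k'] show ?case using ne k k'
      by (intro bexI[of _ "(?f ^^ k') x"]) (auto simp: shift_def)
  qed
  then obtain x where x: "x \<in> gws \<beta>" "x \<noteq> 0" "\<forall>y\<in>Y. \<lbrakk>y, x\<rbrakk> = \<beta> y *\<^sub>C x" by blast
  have "\<beta> \<in> dual_space H" by (rule gws_nonzero_dual[OF assms])
  then have "csubspace {h \<in> H. \<lbrakk>h, x\<rbrakk> = \<beta> h *\<^sub>C x}"
    using subspace_H unfolding cvec.subspace_def dual_space_def
    by (auto simp: bracket_0 bracket_add_left bracket_scale_left scaleC_add_left scaleC_scaleC)
      (metis cvec.scale_zero_left mult_zero_left)
  then have "cspan Y \<subseteq> {h \<in> H. \<lbrakk>h, x\<rbrakk> = \<beta> h *\<^sub>C x}"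
    by (rule cvec.span_minimal[rotated]) (use x Y in auto)
  then have "x \<in> root_space H \<beta>" using Y(3) by (auto simp: root_space_def)
  then show ?thesis using x by blast
qed

text \<open>Roots are defined by genuine eigenvectors while the decomposition yields generalized
  ones; \<open>common_eigenvector\<close> bridges the two.\<close>

lemma roots_iff: "\<alpha> \<in> roots H \<longleftrightarrow> supported \<alpha> \<and> \<alpha> \<noteq> (\<lambda>h. 0) \<and> gws \<alpha> \<noteq> {0}"
proof
  assume a: "\<alpha> \<in> roots H"
  then have "root_space H \<alpha> \<noteq> {0}" by (simp add: roots_def)
  then obtain x where "x \<in> root_space H \<alpha>" "x \<noteq> 0"
    using cvec.subspace_0[OF subspace_root_space[of \<alpha>]] by blast
  then have "gws \<alpha> \<noteq> {0}" using root_space_subset_gws by blast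
  then show "supported \<alpha> \<and> \<alpha> \<noteq> (\<lambda>h. 0) \<and> gws \<alpha> \<noteq> {0}"
    using a by (simp add: roots_def dual_space_supported)
next
  assume a: "supported \<alpha> \<and> \<alpha> \<noteq> (\<lambda>h. 0) \<and> gws \<alpha> \<noteq> {0}"
  then have "\<alpha> \<in> dual_space H" using gws_nonzero_dual by blast
  moreover have "root_space H \<alpha> \<noteq> {0}" using common_eigenvector[of \<alpha>] a by auto
  ultimately show "\<alpha> \<in> roots H" using a by (simp add: roots_def)
qed

lemma root_dual: "\<alpha> \<in> roots H \<Longrightarrow> \<alpha> \<in> dual_space H"
  by (simp add: roots_def)

lemma root_supported: "\<alpha> \<in> roots H \<Longrightarrow> supported \<alpha>"
  by (simp add: roots_iff)

lemma root_nonzero: "\<alpha> \<in> roots H \<Longrightarrow> \<alpha> \<noteq> (\<lambda>h. 0)"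
  by (simp add: roots_iff)

text \<open>The nondegenerate Killing form can pair a weight vector nontrivially only with one of
  the opposite weight.\<close>

lemma uminus_root: "\<alpha> \<in> roots H \<Longrightarrow> (\<lambda>h. - \<alpha> h) \<in> roots H"
proof -
  assume a: "\<alpha> \<in> roots H"
  obtain B w where "weight_basis H B w" using ex_weight_basis by blast
  then interpret weight_basis H B w .
  obtain x where x: "x \<in> gws \<alpha>" "x \<noteq> 0"
    using a cvec.subspace_0[OF subspace_gws[of \<alpha>]] unfolding roots_iff by blast
  then obtain b where b: "b \<in> B" "w b = (\<lambda>h. - \<alpha> h)" "killing x b \<noteq> 0"
    using killing_nondegenerate_gws root_supported[OF a] by blast
  then have "b \<in> gws (\<lambda>h. - \<alpha> h)" "b \<noteq> 0" using w_gws[of b] by (auto simp: killing_0)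
  then show ?thesis using a by (auto simp: roots_iff supported_def fun_eq_iff)
qed

text \<open>Jacobson's trace argument on \<open>\<complex> e + H + (\<Sum>k\<ge>1. gws (k \<alpha>))\<close> with \<open>e\<close> of weight \<open>-\<alpha>\<close>.\<close>

lemma root_multiplicity:
  assumes a: "\<alpha> \<in> roots H"
  obtains e x t where "e \<in> root_space H (\<lambda>h. - \<alpha> h)" "x \<in> gws \<alpha>" "killing x e = 1"
    "t \<in> H" "t = \<lbrakk>x, e\<rbrakk>" "\<And>h. h \<in> H \<Longrightarrow> killing t h = \<alpha> h" "\<alpha> t \<noteq> 0" "gws \<alpha> = cspan {x}" "x \<noteq> 0"
    "\<And>k::nat. 2 \<le> k \<Longrightarrow> (\<lambda>h. of_nat k * \<alpha> h) \<notin> roots H"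
proof -
  have ma: "(\<lambda>h. - \<alpha> h) \<in> roots H" by (rule uminus_root[OF a])
  note dual = root_dual[OF a]
  obtain e where e: "e \<in> root_space H (\<lambda>h. - \<alpha> h)" "e \<noteq> 0"
    using common_eigenvector[of "\<lambda>h. - \<alpha> h"] ma by (auto simp: roots_iff)
  have eg: "e \<in> gws (\<lambda>h. - \<alpha> h)" using e root_space_subset_gws by blast
  obtain B w where B: "weight_basis H B w" "e \<in> B" "w e = (\<lambda>h. - \<alpha> h)"
    using ex_weight_basis_extend[OF root_supported[OF ma] eg e(2)] by blast
  interpret weight_basis H B w by fact
  have he: "\<lbrakk>h, e\<rbrakk> = - \<alpha> h *\<^sub>C e" if "h \<in> H" for h using e that by (simp add: root_space_def)
  obtain x0 where x0: "x0 \<in> B" "w x0 = (\<lambda>h. - (- \<alpha> h))" "killing e x0 \<noteq> 0"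
    using killing_nondegenerate_gws[OF root_supported[OF ma] eg e(2)] by blast
  define x where "x = (1 / killing x0 e) *\<^sub>C x0"
  have x0g: "x0 \<in> gws \<alpha>" using w_gws[OF x0(1)] x0(2) by simp
  then have x: "x \<in> gws \<alpha>" by (simp add: x_def cvec.subspace_scale[OF subspace_gws])
  have xe: "killing x e = 1" using x0(3) killing_commute[of e x0] by (simp add: x_def killing_scale_left)
  define t where "t = \<lbrakk>x, e\<rbrakk>"
  have tH: "t \<in> H" using bracket_gws[OF x eg] gws_0 by (simp add: t_def)
  have kt: "killing t h = \<alpha> h" if "h \<in> H" for h
  proof -
    have "\<lbrakk>e, h\<rbrakk> = \<alpha> h *\<^sub>C e" using he[OF that] bracket_anticomm[of e h] by simp
    then have "killing t h = \<alpha> h * killing x e" unfolding t_def killing_invariant by (simp add: killing_scale_right)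
    then show ?thesis using xe by simp
  qed
  have at: "\<alpha> t \<noteq> 0"
  proof
    assume "\<alpha> t = 0"
    then have "w b t = 0" if "b \<in> B" for b
      using w_rational[OF x eg that root_supported[OF a]] by (auto simp: t_def)
    then have "t = 0" using weights_separate tH by blast
    then have "\<alpha> h = 0" if "h \<in> H" for h using kt[OF that] by (simp add: killing_0)
    then have "\<alpha> = (\<lambda>h. 0)" using root_supported[OF a] by (auto simp: supported_def)
    then show False using root_nonzero[OF a] by blast
  qed
  let ?m = "\<lambda>k::nat. (\<lambda>h. of_nat k * \<alpha> h)"
  let ?S = "range ?m"
  let ?D = "{c\<in>B. w c \<in> ?S}"
  let ?C = "insert e ?D"
  have eD: "e \<notin> ?D"
  proof
    assume "e \<in> ?D"
    then obtain k :: nat where "(\<lambda>h. - \<alpha> h) = (\<lambda>h. of_nat k * \<alpha> h)" using B(3) by auto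
    from fun_cong[OF this, of t] have 1: "of_nat k * \<alpha> t = - \<alpha> t" by (rule sym)
    have "of_nat (Suc k) * \<alpha> t = 0" by (simp add: distrib_right 1)
    then show False using at by (simp del: of_nat_Suc)
  qed
  have C: "\<not> cdependent ?C" "finite ?C" "?C \<subseteq> B" using indep_subset[of ?C] B(2) by auto
  have sup: "supported (?m k)" for k using root_supported[OF a] by (simp add: supported_def)
  have gC: "gws (?m k) \<subseteq> cspan ?C" for k
  proof
    fix y assume "y \<in> gws (?m k)"
    then have "y \<in> cspan {b\<in>B. w b = ?m k}" by (rule gws_span[OF sup])
    moreover have "cspan {b\<in>B. w b = ?m k} \<subseteq> cspan ?C" by (rule cvec.span_mono) blast
    ultimately show "y \<in> cspan ?C" by blast
  qed
  have xC: "\<lbrakk>x, c\<rbrakk> \<in> cspan ?C" if c: "c \<in> ?C" for c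
  proof (cases "c = e")
    case True
    then show ?thesis using gC[of 0] tH gws_0 by (auto simp: t_def)
  next
    case False
    then obtain k where k: "w c = ?m k" "c \<in> B" using c by auto
    have "\<lbrakk>x, c\<rbrakk> \<in> gws (\<lambda>h. \<alpha> h + ?m k h)" using bracket_gws[OF x w_gws[OF k(2)]] k by simp
    also have "(\<lambda>h. \<alpha> h + ?m k h) = ?m (Suc k)" by (simp add: algebra_simps)
    finally show ?thesis using gC by blast
  qed
  have eC: "\<lbrakk>e, c\<rbrakk> \<in> cspan ?C" if c: "c \<in> ?C" for c
  proof (cases "c = e")
    case True
    then show ?thesis by (simp add: bracket_self cvec.span_zero)
  next
    case False
    then obtain k where k: "w c = ?m k" "c \<in> B" using c by auto
    show ?thesis
    proof (cases k)
      case 0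
      then have "c \<in> H" using w_gws[OF k(2)] k gws_0 by simp
      then have "\<lbrakk>e, c\<rbrakk> = \<alpha> c *\<^sub>C e" using he bracket_anticomm[of e c] by simp
      then show ?thesis by (simp add: cvec.span_scale cvec.span_base)
    next
      case (Suc j)
      have "\<lbrakk>e, c\<rbrakk> \<in> gws (\<lambda>h. - \<alpha> h + ?m k h)" using bracket_gws[OF eg w_gws[OF k(2)]] k by simp
      also have "(\<lambda>h. - \<alpha> h + ?m k h) = ?m j" using Suc by (simp add: algebra_simps)
      finally show ?thesis using gC by blast
    qed
  qed
  have span: "\<lbrakk>g, y\<rbrakk> \<in> cspan ?C" if "y \<in> cspan ?C" "\<And>c. c \<in> ?C \<Longrightarrow> \<lbrakk>g, c\<rbrakk> \<in> cspan ?C" for g y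
    by (rule clinear_span_into[OF clinear_bracket_right that(1) cvec.subspace_span that(2)])
  have "lie_bracket t = (\<lambda>y. \<lbrakk>x, \<lbrakk>e, y\<rbrakk>\<rbrakk> - \<lbrakk>e, \<lbrakk>x, y\<rbrakk>\<rbrakk>)" by (auto simp: bracket_bracket t_def)
  then have "trc ?C (lie_bracket t) = trc ?C (\<lambda>y. \<lbrakk>x, \<lbrakk>e, y\<rbrakk>\<rbrakk>) - trc ?C (\<lambda>y. \<lbrakk>e, \<lbrakk>x, y\<rbrakk>\<rbrakk>)"
    using trc_diff[OF C(1,2), of "\<lambda>y. \<lbrakk>x, \<lbrakk>e, y\<rbrakk>\<rbrakk>" "\<lambda>y. \<lbrakk>e, \<lbrakk>x, y\<rbrakk>\<rbrakk>"] span[OF eC xC] span[OF xC eC] by simp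
  also have "trc ?C (\<lambda>y. \<lbrakk>x, \<lbrakk>e, y\<rbrakk>\<rbrakk>) = trc ?C (\<lambda>y. \<lbrakk>e, \<lbrakk>x, y\<rbrakk>\<rbrakk>)"
    by (rule trc_commute[OF C(1,2) clinear_bracket_right clinear_bracket_right]) (use xC eC in auto)
  finally have 0: "trc ?C (lie_bracket t) = 0" by simp
  have "trc ?C (lie_bracket t) = crepresentation ?C \<lbrakk>t, e\<rbrakk> e + (\<Sum>c\<in>?D. crepresentation ?C \<lbrakk>t, c\<rbrakk> c)"
    unfolding trc_def using eD C(2) by simp
  also have "crepresentation ?C \<lbrakk>t, e\<rbrakk> e = - \<alpha> t"
    unfolding he[OF tH]
    by (subst cvec.representation_scale[OF C(1)])
      (simp_all add: cvec.span_base cvec.representation_basis[OF C(1)])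
  also have "(\<Sum>c\<in>?D. crepresentation ?C \<lbrakk>t, c\<rbrakk> c) = trc ?D (lie_bracket t)"
    by (rule trc_mono_span[OF C(1)]) (use ad_H_span[OF tH] in auto)
  also have "\<dots> = (\<Sum>c\<in>?D. w c t)" by (rule trc_ad[OF tH])
  finally have 1: "(\<Sum>c\<in>?D. w c t) = \<alpha> t" using 0 by simp
  have "\<forall>c\<in>?D. \<exists>k. w c = ?m k" by blast
  from bchoice[OF this] obtain k where k: "w c = ?m (k c)" if "c \<in> ?D" for c by blast
  have "(\<Sum>c\<in>?D. w c t) = (\<Sum>c\<in>?D. of_nat (k c) * \<alpha> t)"
    by (rule sum.cong[OF refl]) (rule fun_cong[OF k])
  \<comment> \<open>The vanishing trace reads
    \<open>- \<alpha> t + (\<Sum>c. k c) * \<alpha> t = 0\<close>. So the \<open>k c\<close> add up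
    to 1: exactly one basis vector has weight \<open>\<alpha>\<close> and none has a higher
    multiple.\<close>
  then have "of_nat (\<Sum>c\<in>?D. k c) * \<alpha> t = 1 * \<alpha> t" using 1 by (simp add: sum_distrib_right)
  then have "of_nat (\<Sum>c\<in>?D. k c) = (1::complex)" using at by (simp only: mult_cancel_right) simp
  then have k1: "(\<Sum>c\<in>?D. k c) = 1" by (simp only: of_nat_eq_1_iff)
  have x0k: "k x0 = 1 \<and> x0 \<in> ?D"
  proof -
    have "w x0 = ?m 1" using x0 by simp
    then have D: "x0 \<in> ?D" using x0(1) by blast
    have "of_nat (k x0) * \<alpha> t = \<alpha> t" using fun_cong[OF k[OF D], of t] x0(2) by simp
    then have "of_nat (k x0) = (1::complex)" using at by simp
    then show ?thesis using D by (simp only: of_nat_eq_1_iff)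
  qed
  have other: "k c = 0" if c: "c \<in> ?D" "c \<noteq> x0" for c
  proof -
    have "(\<Sum>c\<in>{x0, c}. k c) \<le> (\<Sum>c\<in>?D. k c)"
      by (rule sum_mono2) (use C x0k c in auto)
    then show ?thesis using c x0k k1 by simp
  qed
  have only: "c = x0" if "c \<in> B" "w c = ?m j" "j \<ge> 1" for c j
  proof (rule ccontr)
    assume "c \<noteq> x0"
    have D: "c \<in> ?D" using that by blast
    then have "of_nat j * \<alpha> t = 0"
      using other[OF D \<open>c \<noteq> x0\<close>] fun_cong[OF k[OF D], of t] that(2) by simp
    then show False using at that(3) by simp
  qed
  have gx0: "gws \<alpha> = cspan {x0}"
  proof
    show "gws \<alpha> \<subseteq> cspan {x0}"
    proof
      fix y assume "y \<in> gws \<alpha>"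
      then have "y \<in> cspan {b\<in>B. w b = \<alpha>}" by (rule gws_span[OF root_supported[OF a]])
      moreover have "{b\<in>B. w b = \<alpha>} \<subseteq> {x0}" using only[of _ 1] by auto
      ultimately show "y \<in> cspan {x0}" using cvec.span_mono by blast
    qed
    show "cspan {x0} \<subseteq> gws \<alpha>" by (rule cvec.span_minimal) (use x0g subspace_gws in auto)
  qed
  have "cspan {x} = cspan {x0}"
    unfolding x_def by (rule cvec.span_image_scale[of "{x0}" "\<lambda>_. 1 / killing x0 e", simplified])
      (use x0 killing_commute in auto)
  then have gx: "gws \<alpha> = cspan {x}" using gx0 by simp
  have mult: "?m j \<notin> roots H" if "2 \<le> j" for j
  proof
    assume r: "?m j \<in> roots H"
    then obtain y where "y \<in> gws (?m j)" "y \<noteq> 0"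
      using cvec.subspace_0[OF subspace_gws[of "?m j"]] unfolding roots_iff by blast
    then obtain b where b: "b \<in> B" "w b = ?m j" using gws_nontrivial[OF sup] by blast
    have "b = x0" by (rule only[OF b]) (use that in simp)
    then have "w x0 t = of_nat j * \<alpha> t" using fun_cong[OF b(2), of t] by simp
    moreover have "w x0 t = \<alpha> t" using fun_cong[OF x0(2), of t] by simp
    ultimately have "\<alpha> t = of_nat j * \<alpha> t" by simp
    then have "of_nat j = (1::complex)" using at by simp
    then show False using that by (simp only: of_nat_eq_1_iff)
  qed
  have "x \<noteq> 0" using xe by (auto simp: killing_0)
  show ?thesis
    by (rule that[of e x t]) (fact e(1) x xe tH t_def kt at gx \<open>x \<noteq> 0\<close> mult)+
qed

text \<open>A one-dimensional generalized weight space that contains a genuine eigenvector consists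
  of eigenvectors.\<close>

lemma root_space_gws: "\<alpha> \<in> roots H \<Longrightarrow> root_space H \<alpha> = gws \<alpha>"
proof -
  assume a: "\<alpha> \<in> roots H"
  obtain x where x: "gws \<alpha> = cspan {x}" "x \<noteq> 0" by (rule root_multiplicity[OF a]) (rule that; assumption)
  obtain y where y: "y \<in> root_space H \<alpha>" "y \<noteq> 0"
    using common_eigenvector[of \<alpha>] a unfolding roots_iff by blast
  then have "y \<in> cspan {x}" using root_space_subset_gws x by blast
  then obtain c where c: "y = c *\<^sub>C x" by (auto simp: cvec.span_singleton)
  then have "x = (1 / c) *\<^sub>C y" using y by (auto simp: scaleC_scaleC scaleC_one)
  then have "x \<in> root_space H \<alpha>" using y cvec.subspace_scale[OF subspace_root_space] by simp
  then have "gws \<alpha> \<subseteq> root_space H \<alpha>"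
    unfolding x by (intro cvec.span_minimal subspace_root_space) simp
  then show ?thesis using root_space_subset_gws by blast
qed

lemma root_space_span: "\<alpha> \<in> roots H \<Longrightarrow> x \<in> root_space H \<alpha> \<Longrightarrow> x \<noteq> 0 \<Longrightarrow> root_space H \<alpha> = cspan {x}"
proof -
  assume a: "\<alpha> \<in> roots H" and x: "x \<in> root_space H \<alpha>" "x \<noteq> 0"
  obtain y where y: "gws \<alpha> = cspan {y}" "y \<noteq> 0" by (rule root_multiplicity[OF a]) (rule that; assumption)
  obtain c where c: "x = c *\<^sub>C y" using x y root_space_gws[OF a] by (auto simp: cvec.span_singleton)
  then have "y = (1 / c) *\<^sub>C x" using x by (auto simp: scaleC_scaleC scaleC_one)
  then have "y \<in> cspan {x}" by (simp add: cvec.span_scale cvec.span_base)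
  then have "cspan {y} \<subseteq> cspan {x}" by (intro cvec.span_minimal) auto
  moreover have "cspan {x} \<subseteq> root_space H \<alpha>" using x by (intro cvec.span_minimal subspace_root_space) auto
  ultimately show ?thesis using y root_space_gws[OF a] by blast
qed

lemma root_space_scale: "\<alpha> \<in> roots H \<Longrightarrow> x \<in> root_space H \<alpha> \<Longrightarrow> x \<noteq> 0 \<Longrightarrow> y \<in> root_space H \<alpha> \<Longrightarrow> \<exists>c. y = c *\<^sub>C x"
  using root_space_span[of \<alpha> x] by (auto simp: cvec.span_singleton)

lemma root_space_nonzero: "\<alpha> \<in> roots H \<Longrightarrow> \<exists>x\<in>root_space H \<alpha>. x \<noteq> 0"
  using common_eigenvector[of \<alpha>] unfolding roots_iff by blast

lemma gws_trivial: "supported \<alpha> \<Longrightarrow> \<alpha> \<noteq> (\<lambda>h. 0) \<Longrightarrow> \<alpha> \<notin> roots H \<Longrightarrow> gws \<alpha> = {0}"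
  by (simp add: roots_iff)

lemma multiple_root: "\<alpha> \<in> roots H \<Longrightarrow> (2::nat) \<le> k \<Longrightarrow> (\<lambda>h. of_nat k * \<alpha> h) \<notin> roots H"
  by (rule root_multiplicity) auto

subsection \<open>Identification of the dual space by the Killing form\<close>

text \<open>These facts were proved with the help of a weight basis but do not mention one; here the
  basis is discharged.\<close>

lemma killing_form:
  shows kadd_left: "killing (x + y) z = killing x z + killing y (z::'g)"
    and kscale_left: "killing (c *\<^sub>C x) z = c * killing x z"
    and kcommute: "killing x z = killing z x"
    and kinvariant: "killing \<lbrakk>x, y\<rbrakk> z = killing x \<lbrakk>y, z\<rbrakk>"
    and kinvariant_left: "killing \<lbrakk>x, y\<rbrakk> z = - killing y \<lbrakk>x, z\<rbrakk>"
    and kadd_right: "killing z (x + y) = killing z x + killing z y"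
    and kscale_right: "killing z (c *\<^sub>C x) = c * killing z x"
    and k0: "killing x 0 = 0" "killing 0 x = 0"
    and kneg: "killing x (- y) = - killing x y" "killing (- x) y = - killing x y"
    and kdiff: "killing x (y - z) = killing x y - killing x z" "killing (x - y) z = killing x z - killing y z"
proof -
  obtain B w where "weight_basis H B w" using ex_weight_basis by blast
  then interpret weight_basis H B w .
  show "killing (x + y) z = killing x z + killing y (z::'g)" "killing (c *\<^sub>C x) z = c * killing x z"
    "killing \<lbrakk>x, y\<rbrakk> z = killing x \<lbrakk>y, z\<rbrakk>" "killing \<lbrakk>x, y\<rbrakk> z = - killing y \<lbrakk>x, z\<rbrakk>"
    "killing z (x + y) = killing z x + killing z y" "killing z (c *\<^sub>C x) = c * killing z x"
    "killing x 0 = 0" "killing 0 x = 0"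
    "killing x (- y) = - killing x y" "killing (- x) y = - killing x y"
    "killing x (y - z) = killing x y - killing x z" "killing (x - y) z = killing x z - killing y z"
    by (fact killing_add_left killing_scale_left killing_invariant killing_invariant_left
        killing_add_right killing_scale_right killing_0 killing_neg killing_diff)+
  show "killing x z = killing z x" by (rule killing_commute)
qed

lemma ksum: "killing x (\<Sum>i\<in>I. f i) = (\<Sum>i\<in>I. killing (x::'g) (f i))"
  "killing (\<Sum>i\<in>I. f i) x = (\<Sum>i\<in>I. killing (f i) (x::'g))"
  by (induction I rule: infinite_finite_induct) (auto simp: k0 kadd_right kadd_left)

lemma knondeg_H: "h \<in> H \<Longrightarrow> (\<And>k. k \<in> H \<Longrightarrow> killing h k = 0) \<Longrightarrow> h = 0"
proof -
  obtain B w where "weight_basis H B w" using ex_weight_basis by blast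
  then interpret weight_basis H B w .
  show "h \<in> H \<Longrightarrow> (\<And>k. k \<in> H \<Longrightarrow> killing h k = 0) \<Longrightarrow> h = 0" by (rule killing_nondegenerate_H)
qed

lemma abelian_H: "h \<in> H \<Longrightarrow> k \<in> H \<Longrightarrow> \<lbrakk>h, k\<rbrakk> = 0"
proof -
  obtain B w where "weight_basis H B w" using ex_weight_basis by blast
  then interpret weight_basis H B w .
  show "h \<in> H \<Longrightarrow> k \<in> H \<Longrightarrow> \<lbrakk>h, k\<rbrakk> = 0" by (rule H_abelian)
qed

abbreviation tt :: "('g \<Rightarrow> complex) \<Rightarrow> 'g" where "tt \<equiv> killing_dual H"

lemma killing_dual_eq:
  assumes "t \<in> H" "\<And>h. h \<in> H \<Longrightarrow> killing t h = \<mu> h"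
  shows "tt \<mu> = t"
  unfolding killing_dual_def
proof (rule the_equality)
  show "t \<in> H \<and> (\<forall>h\<in>H. killing t h = \<mu> h)" using assms by blast
  fix s assume s: "s \<in> H \<and> (\<forall>h\<in>H. killing s h = \<mu> h)"
  have "s - t = 0"
    by (rule knondeg_H) (use s assms subspace_H in \<open>auto simp: cvec.subspace_diff kdiff\<close>)
  then show "s = t" by simp
qed

lemma root_dual_vector:
  assumes "\<alpha> \<in> roots H"
  shows tt_H: "tt \<alpha> \<in> H" and killing_tt: "h \<in> H \<Longrightarrow> killing (tt \<alpha>) h = \<alpha> h"
    and root_self_nonzero: "\<alpha> (tt \<alpha>) \<noteq> 0"
proof -
  obtain t where t: "t \<in> H" "\<And>h. h \<in> H \<Longrightarrow> killing t h = \<alpha> h" "\<alpha> t \<noteq> 0"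
    by (rule root_multiplicity[OF assms]) (rule that; assumption)
  then have "tt \<alpha> = t" by (intro killing_dual_eq)
  then show "tt \<alpha> \<in> H" "h \<in> H \<Longrightarrow> killing (tt \<alpha>) h = \<alpha> h" "\<alpha> (tt \<alpha>) \<noteq> 0" using t by auto
qed

lemma root_form_eq: "\<alpha> \<in> roots H \<Longrightarrow> \<beta> \<in> roots H \<Longrightarrow> root_form H \<alpha> \<beta> = \<alpha> (tt \<beta>)"
  by (simp add: root_form_def killing_tt tt_H)

lemma root_tt_commute: "\<alpha> \<in> roots H \<Longrightarrow> \<beta> \<in> roots H \<Longrightarrow> \<alpha> (tt \<beta>) = \<beta> (tt \<alpha>)"
  using killing_tt[of \<alpha> "tt \<beta>"] killing_tt[of \<beta> "tt \<alpha>"] tt_H kcommute by simp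

lemma root_bracket:
  assumes a: "\<alpha> \<in> roots H" and e: "e \<in> root_space H \<alpha>" and f: "f \<in> root_space H (\<lambda>h. - \<alpha> h)"
  shows "\<lbrakk>e, f\<rbrakk> = killing e f *\<^sub>C tt \<alpha>"
proof -
  have "\<lbrakk>e, f\<rbrakk> \<in> gws (\<lambda>h. \<alpha> h + - \<alpha> h)"
    using bracket_gws e f root_space_subset_gws by blast
  then have H: "\<lbrakk>e, f\<rbrakk> \<in> H" using gws_0 by simp
  have "\<lbrakk>e, f\<rbrakk> - killing e f *\<^sub>C tt \<alpha> = 0"
  proof (rule knondeg_H)
    show "\<lbrakk>e, f\<rbrakk> - killing e f *\<^sub>C tt \<alpha> \<in> H"
      using H tt_H[OF a] subspace_H by (simp add: cvec.subspace_diff cvec.subspace_scale)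
    fix h assume h: "h \<in> H"
    have "\<lbrakk>f, h\<rbrakk> = \<alpha> h *\<^sub>C f" using f h bracket_anticomm[of f h] by (simp add: root_space_def)
    then have "killing \<lbrakk>e, f\<rbrakk> h = \<alpha> h * killing e f" by (simp add: kinvariant kscale_right)
    then show "killing (\<lbrakk>e, f\<rbrakk> - killing e f *\<^sub>C tt \<alpha>) h = 0"
      by (simp add: kdiff kscale_left killing_tt[OF a h])
  qed
  then show ?thesis by simp
qed

lemma root_pairing:
  assumes a: "\<alpha> \<in> roots H" and e: "e \<in> root_space H \<alpha>" "e \<noteq> 0" and f: "f \<in> root_space H (\<lambda>h. - \<alpha> h)" "f \<noteq> 0"
  shows "killing e f \<noteq> 0"
proof -
  obtain f' x where fx: "f' \<in> root_space H (\<lambda>h. - \<alpha> h)" "x \<in> gws \<alpha>" "killing x f' = 1"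
    by (rule root_multiplicity[OF a]) (rule that; assumption)
  obtain c where "x = c *\<^sub>C e" using root_space_scale[OF a e] fx root_space_gws[OF a] by blast
  moreover obtain d where "f' = d *\<^sub>C f" using root_space_scale[OF uminus_root[OF a] f] fx by blast
  ultimately show ?thesis using fx(3) by (auto simp: kscale_left kscale_right)
qed

lemma killing_root_spaces:
  assumes "x \<in> root_space H \<alpha>" "y \<in> root_space H \<beta>" "\<alpha> \<in> roots H" "\<beta> \<in> roots H" "\<beta> \<noteq> (\<lambda>h. - \<alpha> h)"
  shows "killing x y = 0"
proof -
  obtain B w where "weight_basis H B w" using ex_weight_basis by blast
  then interpret weight_basis H B w .
  have "(\<lambda>h. \<alpha> h + \<beta> h) \<noteq> (\<lambda>h. 0)" using assms(5) by (auto simp: fun_eq_iff eq_neg_iff_add_eq_0 add.commute)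
  then show ?thesis
    using killing_gws[of x \<alpha> y \<beta>] assms root_space_subset_gws root_supported by blast
qed

lemma killing_H_root_space:
  assumes "h \<in> H" "y \<in> root_space H \<beta>" "\<beta> \<in> roots H"
  shows "killing h y = 0"
proof -
  obtain B w where "weight_basis H B w" using ex_weight_basis by blast
  then interpret weight_basis H B w .
  have "supported (\<lambda>h. 0)" by (simp add: supported_def)
  then show ?thesis
    using killing_gws[of h "\<lambda>h. 0" y \<beta>] assms root_space_subset_gws root_supported root_nonzero gws_0 by auto
qed

lemma span_H_root_spaces: "cspan (H \<union> (\<Union>\<alpha>\<in>roots H. root_space H \<alpha>)) = UNIV"
proof -
  obtain B w where "weight_basis H B w" using ex_weight_basis by blast
  then interpret weight_basis H B w .
  have "B \<subseteq> H \<union> (\<Union>\<alpha>\<in>roots H. root_space H \<alpha>)"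
  proof
    fix b assume b: "b \<in> B"
    then have b0: "b \<noteq> 0" using indep cvec.dependent_zero by blast
    show "b \<in> H \<union> (\<Union>\<alpha>\<in>roots H. root_space H \<alpha>)"
    proof (cases "w b = (\<lambda>h. 0)")
      case True
      then show ?thesis using w_gws[OF b] gws_0 by simp
    next
      case False
      then have "w b \<in> roots H" using b0 w_gws[OF b] w_supported[OF b] by (auto simp: roots_iff)
      then show ?thesis using w_gws[OF b] root_space_gws by blast
    qed
  qed
  then show ?thesis using span_B cvec.span_mono by blast
qed

end

context weight_basis
begin

text \<open>Root spaces are one-dimensional, so sums over basis vectors of nonzero weight become
  sums over roots.\<close>

lemma bij_roots: "bij_betw w {b\<in>B. w b \<noteq> (\<lambda>h. 0)} (roots H)"
proof (rule bij_betw_imageI)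
  have r: "w b \<in> roots H" if "b \<in> B" "w b \<noteq> (\<lambda>h. 0)" for b
  proof -
    have "b \<noteq> 0" using that indep cvec.dependent_zero by blast
    then show ?thesis using that w_gws w_supported by (auto simp: roots_iff)
  qed
  show "inj_on w {b\<in>B. w b \<noteq> (\<lambda>h. 0)}"
  proof (rule inj_onI)
    fix b c assume b: "b \<in> {b\<in>B. w b \<noteq> (\<lambda>h. 0)}" and c: "c \<in> {b\<in>B. w b \<noteq> (\<lambda>h. 0)}" and eq: "w b = w c"
    have rb: "w b \<in> roots H" using b r by blast
    have ne: "b \<noteq> 0" using b indep cvec.dependent_zero by blast
    have "c \<in> root_space H (w b)" "b \<in> root_space H (w b)"
      using b c eq w_gws[of b] w_gws[of c] root_space_gws[OF rb] by auto
    then have "c \<in> cspan {b}" using root_space_span[OF rb _ ne] by blast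
    show "b = c"
    proof (rule ccontr)
      assume "b \<noteq> c"
      then have "cspan {b} \<subseteq> cspan (B - {c})" using b by (intro cvec.span_mono) auto
      then have "cdependent B" using \<open>c \<in> cspan {b}\<close> c by (auto simp: cvec.dependent_def)
      then show False using indep by blast
    qed
  qed
  show "w ` {b\<in>B. w b \<noteq> (\<lambda>h. 0)} = roots H"
  proof
    show "w ` {b\<in>B. w b \<noteq> (\<lambda>h. 0)} \<subseteq> roots H" using r by auto
    show "roots H \<subseteq> w ` {b\<in>B. w b \<noteq> (\<lambda>h. 0)}"
    proof
      fix \<alpha> assume a: "\<alpha> \<in> roots H"
      obtain x where "x \<in> gws \<alpha>" "x \<noteq> 0" using root_space_nonzero[OF a] root_space_subset_gws by blast
      then obtain b where "b \<in> B" "w b = \<alpha>" using gws_nontrivial root_supported[OF a] by blast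
      then show "\<alpha> \<in> w ` {b\<in>B. w b \<noteq> (\<lambda>h. 0)}" using root_nonzero[OF a] by blast
    qed
  qed
qed

lemma sum_weights: "S \<subseteq> roots H \<Longrightarrow> (\<Sum>b\<in>{b\<in>B. w b \<in> S}. g (w b)) = (\<Sum>\<alpha>\<in>S. g \<alpha>)"
proof -
  assume S: "S \<subseteq> roots H"
  have eq: "{b\<in>B. w b \<in> S} = {b\<in>{b\<in>B. w b \<noteq> (\<lambda>h. 0)}. w b \<in> S}" using S root_nonzero by blast
  have "bij_betw w {b\<in>B. w b \<in> S} S"
    unfolding eq using bij_roots S unfolding bij_betw_def
    by (auto intro: inj_on_subset simp: set_eq_iff image_iff) (metis (no_types, lifting) mem_Collect_eq subsetD)
  then show ?thesis by (rule sum.reindex_bij_betw)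
qed

end

context simple_cartan
begin

lemma finite_roots: "finite (roots H)"
proof -
  obtain B w where "weight_basis H B w" using ex_weight_basis by blast
  then interpret weight_basis H B w .
  show ?thesis using bij_roots finite_B bij_betw_finite by fastforce
qed

lemma killing_H_roots: "h \<in> H \<Longrightarrow> k \<in> H \<Longrightarrow> killing h k = (\<Sum>\<alpha>\<in>roots H. \<alpha> h * \<alpha> k)"
proof -
  assume h: "h \<in> H" and k: "k \<in> H"
  obtain B w where "weight_basis H B w" using ex_weight_basis by blast
  then interpret weight_basis H B w .
  have "(\<Sum>b\<in>B. w b h * w b k) = (\<Sum>b\<in>{b\<in>B. w b \<noteq> (\<lambda>h. 0)}. w b h * w b k)"
    by (rule sum.mono_neutral_right) (use finite_B in auto)
  also have "\<dots> = (\<Sum>\<alpha>\<in>roots H. \<alpha> h * \<alpha> k)"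
    using sum.reindex_bij_betw[OF bij_roots, of "\<lambda>\<alpha>. \<alpha> h * \<alpha> k"] .
  finally show ?thesis using killing_H[OF h k] by simp
qed

lemma root_ratio: "\<alpha> \<in> roots H \<Longrightarrow> \<beta> \<in> roots H \<Longrightarrow> \<exists>r::real. \<beta> (tt \<alpha>) = of_real r * \<alpha> (tt \<alpha>)"
proof -
  assume a: "\<alpha> \<in> roots H" and b: "\<beta> \<in> roots H"
  obtain B w where "weight_basis H B w" using ex_weight_basis by blast
  then interpret weight_basis H B w .
  obtain e x t where ex: "e \<in> root_space H (\<lambda>h. - \<alpha> h)" "x \<in> gws \<alpha>" "killing x e = 1" "t = \<lbrakk>x, e\<rbrakk>"
    by (rule root_multiplicity[OF a]) (rule that; assumption)
  have x: "x \<in> root_space H \<alpha>" using ex root_space_gws[OF a] by simp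
  have t: "\<lbrakk>x, e\<rbrakk> = tt \<alpha>" using root_bracket[OF a x ex(1)] ex(3) by (simp add: scaleC_one)
  have "\<beta> \<in> w ` {b\<in>B. w b \<noteq> (\<lambda>h. 0)}" using bij_betw_imp_surj_on[OF bij_roots] b by simp
  then obtain c where "c \<in> B" "w c = \<beta>" by auto
  then show ?thesis using w_rational[OF ex(2) _ _ root_supported[OF a], of e c] ex(1) root_space_subset_gws t by auto
qed

text \<open>Writing \<open>\<beta> (tt \<alpha>) = r \<beta> * \<alpha> (tt \<alpha>)\<close> with
  real \<open>r \<beta>\<close>, the trace formula for
  \<open>killing (tt \<alpha>) (tt \<alpha>)\<close> gives
  \<open>1 = s * \<alpha> (tt \<alpha>)\<close> with \<open>s\<close> a sum of squares. The value is
  thus real as well as positive.\<close>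

lemma root_self_pos: "\<alpha> \<in> roots H \<Longrightarrow> 0 < \<alpha> (tt \<alpha>)"
proof -
  assume a: "\<alpha> \<in> roots H"
  have "\<forall>\<beta>\<in>roots H. \<exists>r::real. \<beta> (tt \<alpha>) = of_real r * \<alpha> (tt \<alpha>)" using root_ratio[OF a] by blast
  from bchoice[OF this] obtain r :: "('g \<Rightarrow> complex) \<Rightarrow> real"
    where r: "\<forall>\<beta>\<in>roots H. \<beta> (tt \<alpha>) = of_real (r \<beta>) * \<alpha> (tt \<alpha>)" by blast
  have "\<alpha> (tt \<alpha>) = killing (tt \<alpha>) (tt \<alpha>)" using killing_tt[OF a] tt_H[OF a] by simp
  also have "\<dots> = (\<Sum>\<beta>\<in>roots H. \<beta> (tt \<alpha>) * \<beta> (tt \<alpha>))" using killing_H_roots tt_H[OF a] by simp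
  also have "\<dots> = (\<Sum>\<beta>\<in>roots H. of_real (r \<beta> * r \<beta>) * (\<alpha> (tt \<alpha>) * \<alpha> (tt \<alpha>)))"
    by (rule sum.cong[OF refl]) (subst (1 2) r[rule_format], auto simp: mult_ac)
  also have "\<dots> = of_real (\<Sum>\<beta>\<in>roots H. r \<beta> * r \<beta>) * (\<alpha> (tt \<alpha>) * \<alpha> (tt \<alpha>))"
    by (simp add: sum_distrib_right)
  finally have eq1: "1 = of_real (\<Sum>\<beta>\<in>roots H. r \<beta> * r \<beta>) * \<alpha> (tt \<alpha>)"
    using root_self_nonzero[OF a] by simp
  define s where "s = (\<Sum>\<beta>\<in>roots H. r \<beta> * r \<beta>)"
  have eq1: "1 = of_real s * \<alpha> (tt \<alpha>)" using eq1 by (simp add: s_def)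
  then have s0: "s \<noteq> 0" by auto
  then have eq: "\<alpha> (tt \<alpha>) = of_real (1 / s)" using eq1 by (simp add: field_simps)
  have "0 \<le> s" unfolding s_def by (rule sum_nonneg) simp
  then have "0 < 1 / s" using s0 by simp
  then show ?thesis unfolding eq by (simp add: less_complex_def)
qed

subsection \<open>Root strings\<close>

text \<open>Keeps the weight 0 out of the string, so that a member which is not a root has a trivial
  weight space. It rests on the fact that multiples of a root by 2 or more are not roots.\<close>

lemma string_nonzero:
  assumes a: "\<alpha> \<in> roots H" and b: "\<beta> \<in> roots H" "\<beta> \<noteq> \<alpha>" "\<beta> \<noteq> (\<lambda>h. - \<alpha> h)"
  shows "(\<lambda>h. \<beta> h + of_int i * \<alpha> h) \<noteq> (\<lambda>h. 0)"
proof
  assume eq: "(\<lambda>h. \<beta> h + of_int i * \<alpha> h) = (\<lambda>h. 0)"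
  then have bi: "\<beta> = (\<lambda>h. of_int (- i) * \<alpha> h)" by (auto simp: fun_eq_iff eq_neg_iff_add_eq_0)
  consider "i = 0" | "i = 1" | "i = -1" | "i \<ge> 2" | "i \<le> -2" by linarith
  then show False
  proof cases
    case 1 then show False using bi root_nonzero[OF b(1)] by simp
  next
    case 2 then show False using bi b by simp
  next
    case 3 then show False using bi b by simp
  next
    case 4
    have "(\<lambda>h. of_nat (nat i) * (\<lambda>h. - \<alpha> h) h) \<notin> roots H" by (rule multiple_root[OF uminus_root[OF a]]) (use 4 in simp)
    moreover have "(\<lambda>h. of_nat (nat i) * (\<lambda>h. - \<alpha> h) h) = \<beta>" using 4 bi by (simp add: fun_eq_iff)
    ultimately show False using b by simp
  next
    case 5
    have "(\<lambda>h. of_nat (nat (- i)) * \<alpha> h) \<notin> roots H" by (rule multiple_root[OF a]) (use 5 in simp)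
    moreover have "(\<lambda>h. of_nat (nat (- i)) * \<alpha> h) = \<beta>" using 5 bi by (simp add: fun_eq_iff)
    ultimately show False using b by simp
  qed
qed

lemma sum_int_interval: "2 * (\<Sum>i\<in>{- int q..int p}. of_int i) = (of_nat (p + q + 1) * (of_nat p - of_nat q) :: complex)"
proof -
  have "2 * (\<Sum>i\<in>{- int q..int p}. i) = int (p + q + 1) * (int p - int q)"
  proof (induction p)
    case 0
    show ?case
    proof (induction q)
      case (Suc q)
      have "{- int (Suc q)..int 0} = insert (- int (Suc q)) {- int q..int 0}" by auto
      then show ?case using Suc by (simp add: algebra_simps)
    qed simp
  next
    case (Suc p)
    have "{- int q..int (Suc p)} = insert (int (Suc p)) {- int q..int p}" by auto
    then show ?case using Suc by (simp add: algebra_simps)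
  qed
  then have "(of_int (2 * (\<Sum>i\<in>{- int q..int p}. i)) :: complex) = of_int (int (p + q + 1) * (int p - int q))"
    by (simp only:)
  then show ?thesis by simp
qed

text \<open>The trace of \<open>[e, f]\<close> on a segment of the \<open>\<alpha>\<close>-string that is stable under \<open>e\<close> and \<open>f\<close>.\<close>

lemma string_trace:
  assumes a: "\<alpha> \<in> roots H" and b: "\<beta> \<in> roots H" "\<beta> \<noteq> \<alpha>" "\<beta> \<noteq> (\<lambda>h. - \<alpha> h)"
    and e: "e \<in> root_space H \<alpha>" "e \<noteq> 0" and f: "f \<in> root_space H (\<lambda>h. - \<alpha> h)" "f \<noteq> 0"
    and str: "\<And>i. - int q \<le> i \<Longrightarrow> i \<le> int p \<Longrightarrow> (\<lambda>h. \<beta> h + of_int i * \<alpha> h) \<in> roots H"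
    and top: "\<And>x. x \<in> root_space H (\<lambda>h. \<beta> h + of_int (int p) * \<alpha> h) \<Longrightarrow> \<lbrakk>e, x\<rbrakk> = 0"
    and bot: "\<And>x. x \<in> root_space H (\<lambda>h. \<beta> h + of_int (- int q) * \<alpha> h) \<Longrightarrow> \<lbrakk>f, x\<rbrakk> = 0"
  shows "2 * \<beta> (tt \<alpha>) = (of_nat q - of_nat p) * \<alpha> (tt \<alpha>)"
proof -
  obtain B w where "weight_basis H B w" using ex_weight_basis by blast
  then interpret weight_basis H B w .
  let ?r = "\<lambda>i::int. (\<lambda>h. \<beta> h + of_int i * \<alpha> h)"
  let ?I = "{- int q..int p}"
  let ?S = "?r ` ?I"
  let ?C = "{c\<in>B. w c \<in> ?S}"
  have C: "\<not> cdependent ?C" "finite ?C" using indep_subset[of ?C] by auto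
  have gC: "gws (?r i) \<subseteq> cspan ?C" if "i \<in> ?I" for i
  proof
    fix y assume "y \<in> gws (?r i)"
    then have "y \<in> cspan {c\<in>B. w c = ?r i}"
      by (rule gws_span[rotated]) (use str that root_supported in auto)
    moreover have "cspan {c\<in>B. w c = ?r i} \<subseteq> cspan ?C" by (rule cvec.span_mono) (use that in blast)
    ultimately show "y \<in> cspan ?C" by blast
  qed
  have cs: "\<exists>i\<in>?I. c \<in> root_space H (?r i) \<and> c \<in> gws (?r i)" if "c \<in> ?C" for c
    using that w_gws[of c] root_space_gws str by force
  have eC: "\<lbrakk>e, c\<rbrakk> \<in> cspan ?C" if c: "c \<in> ?C" for c
  proof -
    obtain i where i: "i \<in> ?I" "c \<in> root_space H (?r i)" "c \<in> gws (?r i)" using cs[OF c] by blast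
    show ?thesis
    proof (cases "i = int p")
      case True
      then show ?thesis using top i by (simp add: cvec.span_zero)
    next
      case False
      have "\<lbrakk>e, c\<rbrakk> \<in> gws (\<lambda>h. \<alpha> h + ?r i h)" using bracket_gws e(1) i(3) root_space_subset_gws by blast
      also have "(\<lambda>h. \<alpha> h + ?r i h) = ?r (i + 1)" by (simp add: algebra_simps)
      finally show ?thesis using gC[of "i + 1"] i(1) False by auto
    qed
  qed
  have fC: "\<lbrakk>f, c\<rbrakk> \<in> cspan ?C" if c: "c \<in> ?C" for c
  proof -
    obtain i where i: "i \<in> ?I" "c \<in> root_space H (?r i)" "c \<in> gws (?r i)" using cs[OF c] by blast
    show ?thesis
    proof (cases "i = - int q")
      case True
      then show ?thesis using bot i by (simp add: cvec.span_zero)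
    next
      case False
      have "\<lbrakk>f, c\<rbrakk> \<in> gws (\<lambda>h. - \<alpha> h + ?r i h)" using bracket_gws f(1) i(3) root_space_subset_gws by blast
      also have "(\<lambda>h. - \<alpha> h + ?r i h) = ?r (i - 1)" by (simp add: algebra_simps)
      finally show ?thesis using gC[of "i - 1"] i(1) False by auto
    qed
  qed
  have span: "\<lbrakk>g, y\<rbrakk> \<in> cspan ?C" if "y \<in> cspan ?C" "\<And>c. c \<in> ?C \<Longrightarrow> \<lbrakk>g, c\<rbrakk> \<in> cspan ?C" for g y
    by (rule clinear_span_into[OF clinear_bracket_right that(1) cvec.subspace_span that(2)])
  let ?h = "\<lbrakk>e, f\<rbrakk>"
  have h: "?h = killing e f *\<^sub>C tt \<alpha>" by (rule root_bracket[OF a e(1) f(1)])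
  have hH: "?h \<in> H" unfolding h using tt_H[OF a] subspace_H by (simp add: cvec.subspace_scale)
  have "lie_bracket ?h = (\<lambda>y. \<lbrakk>e, \<lbrakk>f, y\<rbrakk>\<rbrakk> - \<lbrakk>f, \<lbrakk>e, y\<rbrakk>\<rbrakk>)" by (auto simp: bracket_bracket)
  then have "trc ?C (lie_bracket ?h) = trc ?C (\<lambda>y. \<lbrakk>e, \<lbrakk>f, y\<rbrakk>\<rbrakk>) - trc ?C (\<lambda>y. \<lbrakk>f, \<lbrakk>e, y\<rbrakk>\<rbrakk>)"
    using trc_diff[OF C, of "\<lambda>y. \<lbrakk>e, \<lbrakk>f, y\<rbrakk>\<rbrakk>" "\<lambda>y. \<lbrakk>f, \<lbrakk>e, y\<rbrakk>\<rbrakk>"] span[OF fC eC] span[OF eC fC] by simp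
  also have "trc ?C (\<lambda>y. \<lbrakk>e, \<lbrakk>f, y\<rbrakk>\<rbrakk>) = trc ?C (\<lambda>y. \<lbrakk>f, \<lbrakk>e, y\<rbrakk>\<rbrakk>)"
    by (rule trc_commute[OF C clinear_bracket_right clinear_bracket_right]) (use eC fC in auto)
  finally have "(\<Sum>c\<in>?C. w c ?h) = 0" using trc_ad[OF hH, of ?S] by simp
  moreover have "(\<Sum>c\<in>?C. w c ?h) = (\<Sum>\<gamma>\<in>?S. \<gamma> ?h)"
    by (rule sum_weights) (use str in auto)
  moreover have "(\<Sum>\<gamma>\<in>?S. \<gamma> ?h) = (\<Sum>i\<in>?I. ?r i ?h)"
  proof (rule sum.reindex[unfolded o_def])
    show "inj_on ?r ?I"
      by (rule inj_onI) (use root_self_nonzero[OF a] in \<open>auto dest: fun_cong[of _ _ "tt \<alpha>"]\<close>)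
  qed
  moreover have "?r i ?h = killing e f * ?r i (tt \<alpha>)" for i
    unfolding h using root_dual[OF a] root_dual[OF b(1)] tt_H[OF a]
    by (simp add: dual_space_def algebra_simps)
  ultimately have "killing e f * (\<Sum>i\<in>?I. ?r i (tt \<alpha>)) = 0" by (simp add: sum_distrib_left)
  then have "(\<Sum>i\<in>?I. ?r i (tt \<alpha>)) = 0" using root_pairing[OF a e f] by simp
  then have "of_nat (p + q + 1) * \<beta> (tt \<alpha>) + (\<Sum>i\<in>?I. of_int i) * \<alpha> (tt \<alpha>) = 0"
    by (simp add: sum.distrib sum_distrib_right add.commute)
  then have "2 * (of_nat (p + q + 1) * \<beta> (tt \<alpha>) + (\<Sum>i\<in>?I. of_int i) * \<alpha> (tt \<alpha>)) = 0"
    by (simp only: mult_zero_right)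
  then have "of_nat (p + q + 1) * (2 * \<beta> (tt \<alpha>)) + (2 * (\<Sum>i\<in>?I. of_int i)) * \<alpha> (tt \<alpha>) = 0"
    by (simp only: distrib_left mult_ac)
  then have "of_nat (p + q + 1) * (2 * \<beta> (tt \<alpha>) + (of_nat p - of_nat q) * \<alpha> (tt \<alpha>)) = 0"
    unfolding sum_int_interval by (simp add: algebra_simps)
  then have "2 * \<beta> (tt \<alpha>) + (of_nat p - of_nat q) * \<alpha> (tt \<alpha>) = 0"
    by (simp only: mult_eq_0_iff of_nat_eq_0_iff) simp
  then show ?thesis by (simp add: algebra_simps)
qed

text \<open>\<open>p\<close> and \<open>q\<close> measure the unbroken run of roots through
  \<open>\<beta>\<close>. Just beyond its ends the weight spaces are trivial, so the root vectors of
  \<open>\<alpha>\<close> and \<open>-\<alpha>\<close> preserve the run and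
  \<open>string_trace\<close> applies.\<close>

lemma root_string:
  assumes a: "\<alpha> \<in> roots H" and b: "\<beta> \<in> roots H" "\<beta> \<noteq> \<alpha>" "\<beta> \<noteq> (\<lambda>h. - \<alpha> h)"
  obtains p q :: nat where
    "\<And>i. - int q \<le> i \<Longrightarrow> i \<le> int p \<Longrightarrow> (\<lambda>h. \<beta> h + of_int i * \<alpha> h) \<in> roots H"
    "(\<lambda>h. \<beta> h + of_int (int p + 1) * \<alpha> h) \<notin> roots H"
    "(\<lambda>h. \<beta> h + of_int (- int q - 1) * \<alpha> h) \<notin> roots H"
    "2 * \<beta> (tt \<alpha>) = (of_nat q - of_nat p) * \<alpha> (tt \<alpha>)"
proof -
  let ?r = "\<lambda>i::int. (\<lambda>h. \<beta> h + of_int i * \<alpha> h)"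
  have inj: "inj ?r"
    by (rule injI) (use root_self_nonzero[OF a] in \<open>auto dest: fun_cong[of _ _ "tt \<alpha>"]\<close>)
  have ex: "\<exists>n::nat. ?r (s * int n + s) \<notin> roots H" if "s = 1 \<or> s = -1" for s :: int
  proof (rule ccontr)
    assume "\<not> ?thesis"
    then have "range (\<lambda>n::nat. ?r (s * int n + s)) \<subseteq> roots H" by auto
    then have "finite (range (\<lambda>n::nat. ?r (s * int n + s)))" using finite_roots finite_subset by blast
    moreover have "inj (\<lambda>n::nat. ?r (s * int n + s))"
    proof (rule injI)
      fix m n :: nat
      assume "?r (s * int m + s) = ?r (s * int n + s)"
      then have "s * int m + s = s * int n + s" by (rule injD[OF inj])
      then show "m = n" using that by auto
    qed
    ultimately show False using finite_imageD infinite_UNIV_nat by blast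
  qed
  define p where "p = (LEAST n::nat. ?r (1 * int n + 1) \<notin> roots H)"
  define q where "q = (LEAST n::nat. ?r (- 1 * int n + - 1) \<notin> roots H)"
  have p: "?r (int p + 1) \<notin> roots H" unfolding p_def using LeastI_ex[OF ex[of 1]] by simp
  have q: "?r (- int q - 1) \<notin> roots H" unfolding q_def using LeastI_ex[OF ex[of "-1"]] by simp
  have str: "?r i \<in> roots H" if "- int q \<le> i" "i \<le> int p" for i
  proof -
    consider "i = 0" | "i > 0" | "i < 0" by linarith
    then show ?thesis
    proof cases
      case 1 then show ?thesis using b by simp
    next
      case 2
      then have "nat (i - 1) < p" using that by linarith
      then have "?r (1 * int (nat (i - 1)) + 1) \<in> roots H" unfolding p_def by (blast dest: not_less_Least)
      then show ?thesis using 2 by simp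
    next
      case 3
      then have "nat (- i - 1) < q" using that by linarith
      then have "?r (- 1 * int (nat (- i - 1)) + - 1) \<in> roots H" unfolding q_def by (blast dest: not_less_Least)
      moreover have "- 1 * int (nat (- i - 1)) + - 1 = i" using 3 by simp
      ultimately show ?thesis by (simp only:)
    qed
  qed
  obtain e where e: "e \<in> root_space H \<alpha>" "e \<noteq> 0" using root_space_nonzero[OF a] by blast
  obtain f where f: "f \<in> root_space H (\<lambda>h. - \<alpha> h)" "f \<noteq> 0" using root_space_nonzero[OF uminus_root[OF a]] by blast
  have sup: "supported (?r i)" for i
    using root_supported[OF a] root_supported[OF b(1)] by (simp add: supported_def)
  have triv: "gws (?r i) = {0}" if "?r i \<notin> roots H" for i
    by (rule gws_trivial[OF sup string_nonzero[OF a b] that])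
  have top: "\<lbrakk>e, x\<rbrakk> = 0" if "x \<in> root_space H (?r (int p))" for x
  proof -
    have "\<lbrakk>e, x\<rbrakk> \<in> gws (\<lambda>h. \<alpha> h + ?r (int p) h)" using bracket_gws e that root_space_subset_gws by blast
    also have "(\<lambda>h. \<alpha> h + ?r (int p) h) = ?r (int p + 1)" by (simp add: algebra_simps)
    finally show ?thesis using triv[OF p] by blast
  qed
  have bot: "\<lbrakk>f, x\<rbrakk> = 0" if "x \<in> root_space H (?r (- int q))" for x
  proof -
    have "\<lbrakk>f, x\<rbrakk> \<in> gws (\<lambda>h. - \<alpha> h + ?r (- int q) h)" using bracket_gws f that root_space_subset_gws by blast
    also have "(\<lambda>h. - \<alpha> h + ?r (- int q) h) = ?r (- int q - 1)" by (simp add: algebra_simps)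
    finally show ?thesis using triv[OF q] by blast
  qed
  have "2 * \<beta> (tt \<alpha>) = (of_nat q - of_nat p) * \<alpha> (tt \<alpha>)"
    by (rule string_trace[OF a b e f str top bot])
  then show ?thesis using that[OF str p q] by blast
qed

text \<open>The reflected root is \<open>\<beta> + (p - q) \<alpha>\<close>, and
  \<open>p - q\<close> lies between \<open>-q\<close> and \<open>p\<close>. For
  \<open>\<beta> = \<alpha>\<close> and \<open>\<beta> = -\<alpha>\<close> the integer is 2 and
  -2.\<close>

lemma root_reflection:
  assumes a: "\<alpha> \<in> roots H" and b: "\<beta> \<in> roots H"
  obtains n :: int where "2 * \<beta> (tt \<alpha>) = of_int n * \<alpha> (tt \<alpha>)" "(\<lambda>h. \<beta> h - of_int n * \<alpha> h) \<in> roots H"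
proof -
  consider "\<beta> = \<alpha>" | "\<beta> = (\<lambda>h. - \<alpha> h)" | "\<beta> \<noteq> \<alpha>" "\<beta> \<noteq> (\<lambda>h. - \<alpha> h)" by blast
  then show ?thesis
  proof cases
    case 1
    then show ?thesis using that[of 2] uminus_root[OF a] by simp
  next
    case 2
    then show ?thesis using that[of "-2"] a by simp
  next
    case 3
    obtain p q :: nat where pq: "\<And>i. - int q \<le> i \<Longrightarrow> i \<le> int p \<Longrightarrow> (\<lambda>h. \<beta> h + of_int i * \<alpha> h) \<in> roots H"
      "2 * \<beta> (tt \<alpha>) = (of_nat q - of_nat p) * \<alpha> (tt \<alpha>)" by (rule root_string[OF a b 3]) (rule that; assumption)
    have "(\<lambda>h. \<beta> h + of_int (int p - int q) * \<alpha> h) \<in> roots H" by (rule pq(1)) auto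
    also have "(\<lambda>h. \<beta> h + of_int (int p - int q) * \<alpha> h) = (\<lambda>h. \<beta> h - of_int (int q - int p) * \<alpha> h)"
      by (simp add: algebra_simps)
    finally show ?thesis using that[of "int q - int p"] pq(2) by simp
  qed
qed

text \<open>If the bracket were 0, the lower part of the string, from \<open>-q\<close> up to
  \<open>\<beta>\<close> itself, would already be stable. Its trace formula and that of the whole
  run together force \<open>p = 0\<close>, although \<open>\<alpha> + \<beta>\<close> is a
  root.\<close>

lemma root_bracket_nonzero:
  assumes a: "\<alpha> \<in> roots H" and b: "\<beta> \<in> roots H" and ab: "(\<lambda>h. \<alpha> h + \<beta> h) \<in> roots H"
    and x: "x \<in> root_space H \<alpha>" "x \<noteq> 0" and y: "y \<in> root_space H \<beta>" "y \<noteq> 0"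
  shows "\<lbrakk>x, y\<rbrakk> \<noteq> 0"
proof
  assume 0: "\<lbrakk>x, y\<rbrakk> = 0"
  have ne: "\<beta> \<noteq> \<alpha>" using ab multiple_root[OF a, of 2] by auto
  have ne': "\<beta> \<noteq> (\<lambda>h. - \<alpha> h)" using root_nonzero[OF ab] by auto
  obtain p q :: nat where pq: "\<And>i. - int q \<le> i \<Longrightarrow> i \<le> int p \<Longrightarrow> (\<lambda>h. \<beta> h + of_int i * \<alpha> h) \<in> roots H"
    "(\<lambda>h. \<beta> h + of_int (int p + 1) * \<alpha> h) \<notin> roots H"
    "(\<lambda>h. \<beta> h + of_int (- int q - 1) * \<alpha> h) \<notin> roots H"
    "2 * \<beta> (tt \<alpha>) = (of_nat q - of_nat p) * \<alpha> (tt \<alpha>)" by (rule root_string[OF a b ne ne']) (rule that; assumption)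
  have "p \<noteq> 0"
  proof
    assume "p = 0"
    then have "(\<lambda>h. \<beta> h + \<alpha> h) \<notin> roots H" using pq(2) by simp
    then show False using ab by (simp add: add.commute)
  qed
  obtain f where f: "f \<in> root_space H (\<lambda>h. - \<alpha> h)" "f \<noteq> 0" using root_space_nonzero[OF uminus_root[OF a]] by blast
  have "2 * \<beta> (tt \<alpha>) = (of_nat q - of_nat 0) * \<alpha> (tt \<alpha>)"
  proof (rule string_trace[OF a b ne ne' x f])
    show "(\<lambda>h. \<beta> h + of_int i * \<alpha> h) \<in> roots H" if "- int q \<le> i" "i \<le> int 0" for i
      using pq(1)[of i] that by simp
    show "\<lbrakk>x, z\<rbrakk> = 0" if z: "z \<in> root_space H (\<lambda>h. \<beta> h + of_int (int 0) * \<alpha> h)" for z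
    proof -
      obtain c where "z = c *\<^sub>C y" using root_space_scale[OF b y, of z] z by auto
      then show ?thesis using 0 by (simp add: bracket_scale_right)
    qed
    show "\<lbrakk>f, z\<rbrakk> = 0" if "z \<in> root_space H (\<lambda>h. \<beta> h + of_int (- int q) * \<alpha> h)" for z
    proof -
      have "\<lbrakk>f, z\<rbrakk> \<in> gws (\<lambda>h. - \<alpha> h + (\<beta> h + of_int (- int q) * \<alpha> h))"
        using bracket_gws[of f "\<lambda>h. - \<alpha> h" z "\<lambda>h. \<beta> h + of_int (- int q) * \<alpha> h"] f that
          root_space_subset_gws by auto
      also have "(\<lambda>h. - \<alpha> h + (\<beta> h + of_int (- int q) * \<alpha> h)) = (\<lambda>h. \<beta> h + of_int (- int q - 1) * \<alpha> h)"
        by (simp add: algebra_simps)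
      also have "gws \<dots> = {0}"
        by (rule gws_trivial[OF _ string_nonzero[OF a b ne ne'] pq(3)])
          (use root_supported[OF a] root_supported[OF b] in \<open>simp add: supported_def\<close>)
      finally show ?thesis by simp
    qed
  qed
  then have "(of_nat q - of_nat p) * \<alpha> (tt \<alpha>) = of_nat q * \<alpha> (tt \<alpha>)" using pq(4) by simp
  then have "of_nat p * \<alpha> (tt \<alpha>) = 0" by (simp add: algebra_simps)
  then show False using \<open>p \<noteq> 0\<close> root_self_nonzero[OF a] by simp
qed

end

section \<open>Positive systems and centralizers\<close>

lemma of_nat_complex_nonneg: "0 \<le> (of_nat n :: complex)"
  by (simp add: less_eq_complex_def)

abbreviation neg :: "('g \<Rightarrow> complex) \<Rightarrow> 'g \<Rightarrow> complex" where
  "neg \<alpha> \<equiv> (\<lambda>h. - \<alpha> h)"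

locale pos_cartan = simple_cartan H for H :: "'g::complex_lie_algebra set" +
  fixes P :: "('g \<Rightarrow> complex) set"
  assumes pos: "positive_system H P"
begin

lemma P_roots: "\<alpha> \<in> P \<Longrightarrow> \<alpha> \<in> roots H"
  using pos by (auto simp: positive_system_def)

lemma P_cases: "\<alpha> \<in> roots H \<Longrightarrow> \<alpha> \<in> P \<or> neg \<alpha> \<in> P"
  using pos by (auto simp: positive_system_def)

lemma P_not_both: "\<alpha> \<in> P \<Longrightarrow> neg \<alpha> \<notin> P"
  using pos P_roots by (auto simp: positive_system_def)

lemma P_add: "\<alpha> \<in> P \<Longrightarrow> \<beta> \<in> P \<Longrightarrow> (\<lambda>h. \<alpha> h + \<beta> h) \<in> roots H \<Longrightarrow> (\<lambda>h. \<alpha> h + \<beta> h) \<in> P"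
  using pos by (auto simp: positive_system_def)

lemma ex_root_vectors:
  "\<exists>X. \<forall>\<alpha>\<in>roots H. X \<alpha> \<in> root_space H \<alpha> \<and> killing (X \<alpha>) (X (neg \<alpha>)) = 1"
proof -
  have "\<forall>\<alpha>\<in>roots H. \<exists>x. x \<in> root_space H \<alpha> \<and> x \<noteq> 0" using root_space_nonzero by blast
  from bchoice[OF this] obtain x where x: "x \<alpha> \<in> root_space H \<alpha>" "x \<alpha> \<noteq> 0" if "\<alpha> \<in> roots H" for \<alpha> by blast
  \<comment> \<open>Only the negative root of each pair is rescaled, which gives both orders of the
    pair the value 1.\<close>
  define X where "X \<alpha> = (if \<alpha> \<in> P then x \<alpha> else (1 / killing (x (neg \<alpha>)) (x \<alpha>)) *\<^sub>C x \<alpha>)" for \<alpha>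
  have "X \<alpha> \<in> root_space H \<alpha>" if "\<alpha> \<in> roots H" for \<alpha>
    using x[OF that] cvec.subspace_scale[OF subspace_root_space] by (simp add: X_def)
  moreover have "killing (X \<alpha>) (X (neg \<alpha>)) = 1" if a: "\<alpha> \<in> roots H" for \<alpha>
  proof -
    have ne: "killing (x \<alpha>) (x (neg \<alpha>)) \<noteq> 0"
      using root_pairing[OF a x[OF a] x[OF uminus_root[OF a]]] .
    show ?thesis
    proof (cases "\<alpha> \<in> P")
      case True
      then have "neg \<alpha> \<notin> P" by (rule P_not_both)
      then show ?thesis using True ne by (simp add: X_def kscale_right)
    next
      case False
      then have "neg \<alpha> \<in> P" using P_cases[OF a] by blast
      then show ?thesis using False ne kcommute[of "x \<alpha>" "x (neg \<alpha>)"] by (simp add: X_def kscale_left)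
    qed
  qed
  ultimately show ?thesis by blast
qed

definition rv :: "('g \<Rightarrow> complex) \<Rightarrow> 'g" where
  "rv = (SOME X. \<forall>\<alpha>\<in>roots H. X \<alpha> \<in> root_space H \<alpha> \<and> killing (X \<alpha>) (X (neg \<alpha>)) = 1)"

lemma rv_all: "\<forall>\<alpha>\<in>roots H. rv \<alpha> \<in> root_space H \<alpha> \<and> killing (rv \<alpha>) (rv (neg \<alpha>)) = 1"
  unfolding rv_def by (rule someI_ex[OF ex_root_vectors])

lemma rv_root_space: "\<alpha> \<in> roots H \<Longrightarrow> rv \<alpha> \<in> root_space H \<alpha>"
  and killing_rv: "\<alpha> \<in> roots H \<Longrightarrow> killing (rv \<alpha>) (rv (neg \<alpha>)) = 1"
  using rv_all by auto

lemma killing_rv': "\<alpha> \<in> roots H \<Longrightarrow> killing (rv (neg \<alpha>)) (rv \<alpha>) = 1"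
  using killing_rv kcommute by metis

lemma rv_nonzero: "\<alpha> \<in> roots H \<Longrightarrow> rv \<alpha> \<noteq> 0"
  using killing_rv[of \<alpha>] by (auto simp: k0)

lemma bracket_rv: "\<alpha> \<in> roots H \<Longrightarrow> h \<in> H \<Longrightarrow> \<lbrakk>h, rv \<alpha>\<rbrakk> = \<alpha> h *\<^sub>C rv \<alpha>"
  using rv_root_space by (simp add: root_space_def)

lemma rv_bracket_neg: "\<alpha> \<in> roots H \<Longrightarrow> \<lbrakk>rv \<alpha>, rv (neg \<alpha>)\<rbrakk> = tt \<alpha>"
  using root_bracket[of \<alpha> "rv \<alpha>" "rv (neg \<alpha>)"] rv_root_space uminus_root killing_rv by (simp add: scaleC_one)

lemma root_space_rv: "\<alpha> \<in> roots H \<Longrightarrow> root_space H \<alpha> = cspan {rv \<alpha>}"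
  by (rule root_space_span) (auto simp: rv_root_space rv_nonzero)

lemma killing_rv_rv: "\<alpha> \<in> roots H \<Longrightarrow> \<beta> \<in> roots H \<Longrightarrow> killing (rv \<alpha>) (rv (neg \<beta>)) = (if \<alpha> = \<beta> then 1 else 0)"
proof (cases "\<alpha> = \<beta>")
  case False
  assume a: "\<alpha> \<in> roots H" "\<beta> \<in> roots H"
  have "neg \<beta> \<noteq> neg \<alpha>" using False by (auto simp: fun_eq_iff) metis
  then show ?thesis
    using killing_root_spaces[OF rv_root_space rv_root_space a(1) uminus_root[OF a(2)]] a uminus_root False
    by auto
qed (simp add: killing_rv)

lemma killing_H_rv: "h \<in> H \<Longrightarrow> \<alpha> \<in> roots H \<Longrightarrow> killing h (rv \<alpha>) = 0"
  using killing_H_root_space rv_root_space by blast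

lemma root_decomposition:
  "z - (\<Sum>\<alpha>\<in>roots H. killing z (rv (neg \<alpha>)) *\<^sub>C rv \<alpha>) \<in> H"
proof -
  let ?f = "\<lambda>z. z - (\<Sum>\<alpha>\<in>roots H. killing z (rv (neg \<alpha>)) *\<^sub>C rv \<alpha>)"
  have lin: "clinear ?f"
    by (intro clinear_minus clinear_id clinear_sum_fun clinearI)
      (auto simp: kadd_left kscale_left scaleC_add_left scaleC_scaleC)
  show ?thesis
  proof (rule clinear_span_into[OF lin _ subspace_H])
    show "z \<in> cspan (H \<union> (\<Union>\<alpha>\<in>roots H. root_space H \<alpha>))" using span_H_root_spaces by simp
    fix b assume "b \<in> H \<union> (\<Union>\<alpha>\<in>roots H. root_space H \<alpha>)"
    then consider "b \<in> H" | \<alpha> where "\<alpha> \<in> roots H" "b \<in> root_space H \<alpha>" by blast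
    then show "?f b \<in> H"
    proof cases
      case 1
      have "(\<Sum>\<alpha>\<in>roots H. killing b (rv (neg \<alpha>)) *\<^sub>C rv \<alpha>) = 0"
        by (rule sum.neutral) (use 1 killing_H_rv uminus_root in auto)
      then show ?thesis using 1 by simp
    next
      case 2
      then obtain c where c: "b = c *\<^sub>C rv \<alpha>" using root_space_rv by (auto simp: cvec.span_singleton)
      have "(\<Sum>\<beta>\<in>roots H. killing b (rv (neg \<beta>)) *\<^sub>C rv \<beta>) = (\<Sum>\<beta>\<in>roots H. if \<beta> = \<alpha> then b else 0)"
        by (rule sum.cong[OF refl]) (use 2 in \<open>auto simp: c kscale_left killing_rv_rv\<close>)
      then show ?thesis using 2 finite_roots cvec.subspace_0[OF subspace_H] by simp
    qed
  qed
qed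

text \<open>Supplies the Cartan part of the Casimir element. The map that sends \<open>x\<close> to
  the combination of \<open>B\<close> with coefficients \<open>killing x b\<close> is injective on
  \<open>H\<close> by nondegeneracy, hence onto; the preimages of the \<open>b\<close> form the dual
  basis.\<close>

lemma ex_dual_bases:
  "\<exists>B D. finite B \<and> B \<subseteq> H \<and> D ` B \<subseteq> H \<and>
     (\<forall>h\<in>H. h = (\<Sum>b\<in>B. killing h (D b) *\<^sub>C b)) \<and> (\<forall>h\<in>H. h = (\<Sum>b\<in>B. killing h b *\<^sub>C D b))"
proof -
  obtain B where B: "B \<subseteq> H" "\<not> cdependent B" "H \<subseteq> cspan B"
    using cvec.maximal_independent_subset by blast
  have fin: "finite B" by (rule independent_finite[OF B(2)])
  have span: "cspan B = H" using B cvec.span_minimal[OF B(1) subspace_H] by blast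
  let ?\<phi> = "\<lambda>x. \<Sum>b\<in>B. killing x b *\<^sub>C b"
  have lin: "clinear ?\<phi>"
    by (intro clinear_sum_fun clinearI) (auto simp: kadd_left kscale_left scaleC_add_left scaleC_scaleC)
  have \<phi>H: "?\<phi> x \<in> H" for x
    using B(1) by (intro cvec.subspace_sum[OF subspace_H] cvec.subspace_scale[OF subspace_H]) auto
  have zero: "x = 0" if "x \<in> H" "?\<phi> x = 0" for x
  proof (rule knondeg_H[OF that(1)])
    fix k assume "k \<in> H"
    then obtain c where c: "k = (\<Sum>b\<in>B. c b *\<^sub>C b)" using cspan_finite_sum[OF fin] span by blast
    have "killing x b = 0" if "b \<in> B" for b
      using cvec.independentD[OF B(2) fin order_refl \<open>?\<phi> x = 0\<close> that] .
    then show "killing x k = 0" by (simp add: c ksum kscale_right)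
  qed
  \<comment> \<open>A proper image would have smaller dimension, but an injective map keeps a basis
    independent.\<close>
  have "?\<phi> ` H = H"
  proof (rule ccontr)
    assume ne: "?\<phi> ` H \<noteq> H"
    have inj: "inj_on ?\<phi> H"
    proof (rule inj_onI)
      fix x y assume "x \<in> H" "y \<in> H" "?\<phi> x = ?\<phi> y"
      then have "x - y \<in> H" "?\<phi> (x - y) = 0"
        using cvec.subspace_diff[OF subspace_H] clinear_diff[OF lin, of x y] by auto
      then have "x - y = 0" by (rule zero)
      then show "x = y" by simp
    qed
    have "?\<phi> ` H \<subset> H" using ne \<phi>H by auto
    then have "cvec.dim (?\<phi> ` H) < cvec.dim H"
      using dim_psubset[OF csubspace_image[OF lin subspace_H] subspace_H] by blast
    moreover have ind\<phi>: "\<not> cdependent (?\<phi> ` B)"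
    proof -
      interpret module_hom "scaleC :: complex \<Rightarrow> 'g \<Rightarrow> 'g" scaleC ?\<phi>
        using lin by (simp only: module_hom_iff_linear)
      show ?thesis
        using independent_injective_image[of B] B(2) inj span by (simp add: cspan_def cdependent_def)
    qed
    moreover have "card (?\<phi> ` B) = card B"
      by (rule card_image) (use inj B(1) inj_on_subset in blast)
    moreover have "?\<phi> ` H = cspan (?\<phi> ` B)"
    proof
      show "?\<phi> ` H \<subseteq> cspan (?\<phi> ` B)"
      proof
        fix y assume "y \<in> ?\<phi> ` H"
        then obtain x where x: "x \<in> cspan B" "y = ?\<phi> x" using span by blast
        have "?\<phi> b \<in> cspan (?\<phi> ` B)" if "b \<in> B" for b using that by (intro cvec.span_base) blast
        then show "y \<in> cspan (?\<phi> ` B)"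
          unfolding x(2) by (rule clinear_span_into[OF lin x(1) cvec.subspace_span])
      qed
      show "cspan (?\<phi> ` B) \<subseteq> ?\<phi> ` H"
        by (rule cvec.span_minimal[OF _ csubspace_image[OF lin subspace_H]]) (use B(1) in blast)
    qed
    ultimately have "cvec.dim H > card B"
      using cvec.dim_span_eq_card_independent[OF ind\<phi>] by simp
    then show False using cvec.dim_span_eq_card_independent[OF B(2)] span by simp
  qed
  then have im: "b \<in> ?\<phi> ` H" if "b \<in> B" for b using that B(1) by auto
  have "\<exists>d. d \<in> H \<and> ?\<phi> d = b" if b: "b \<in> B" for b
  proof -
    obtain d where d: "b = ?\<phi> d" "d \<in> H" by (rule imageE[OF im[OF b]])
    show ?thesis by (rule exI[of _ d]) (use d(2) d(1)[symmetric] in \<open>rule conjI\<close>)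
  qed
  then have "\<forall>b\<in>B. \<exists>d. d \<in> H \<and> ?\<phi> d = b" by blast
  from bchoice[OF this] obtain D where D: "D b \<in> H" "?\<phi> (D b) = b" if "b \<in> B" for b by blast
  have KD: "killing (D b) c = (if c = b then 1 else 0)" if b: "b \<in> B" and c: "c \<in> B" for b c
  proof -
    have "(\<Sum>c\<in>B. (if c = b then 1 else 0) *\<^sub>C c) = (\<Sum>c\<in>B. if c = b then b else 0)"
      by (rule sum.cong) (auto simp: scaleC_one)
    also have "\<dots> = b" using fin b by simp
    finally have "(\<Sum>c\<in>B. (killing (D b) c - (if c = b then 1 else 0)) *\<^sub>C c) = 0"
      using D(2)[OF b] by (simp add: cvec.scale_left_diff_distrib sum_subtractf)
    then have "killing (D b) c - (if c = b then 1 else 0) = 0"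
      using cvec.independentD[OF B(2) fin order_refl _ c, of "\<lambda>c. killing (D b) c - (if c = b then 1 else 0)"]
      by blast
    then show ?thesis by simp
  qed
  have 1: "h = (\<Sum>b\<in>B. killing h (D b) *\<^sub>C b)" if h: "h \<in> H" for h
  proof -
    obtain c where c: "h = (\<Sum>b\<in>B. c b *\<^sub>C b)" using cspan_finite_sum[OF fin] span h by blast
    have "killing h (D b) = c b" if "b \<in> B" for b
    proof -
      have "killing h (D b) = (\<Sum>x\<in>B. c x * killing (D b) x)"
        by (simp add: c ksum kscale_left kscale_right kcommute[of _ "D b"])
      also have "\<dots> = (\<Sum>x\<in>B. if x = b then c b else 0)" by (rule sum.cong) (use that KD in auto)
      finally show ?thesis using fin that by simp
    qed
    then show ?thesis using c by simp
  qed
  have 2: "h = (\<Sum>b\<in>B. killing h b *\<^sub>C D b)" if h: "h \<in> H" for h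
  proof -
    let ?g = "\<Sum>b\<in>B. killing h b *\<^sub>C D b"
    have gH: "?g \<in> H"
      by (intro cvec.subspace_sum[OF subspace_H] cvec.subspace_scale[OF subspace_H] D(1))
    have g: "killing ?g c = killing h c" if c: "c \<in> B" for c
    proof -
      have "killing ?g c = (\<Sum>b\<in>B. killing h b * killing (D b) c)" by (simp add: ksum kscale_left)
      also have "\<dots> = (\<Sum>b\<in>B. if b = c then killing h c else 0)" by (rule sum.cong) (use c KD in auto)
      finally show ?thesis using fin c by simp
    qed
    have "h - ?g = 0"
    proof (rule knondeg_H)
      show "h - ?g \<in> H" using h gH cvec.subspace_diff[OF subspace_H] by blast
      fix k assume "k \<in> H"
      then obtain c where c: "k = (\<Sum>b\<in>B. c b *\<^sub>C b)" using cspan_finite_sum[OF fin] span by blast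
      have "killing (h - ?g) b = 0" if "b \<in> B" for b using g[OF that] by (simp add: kdiff)
      then show "killing (h - ?g) k = 0" unfolding c ksum(1) kscale_right by simp
    qed
    then show ?thesis by simp
  qed
  show ?thesis
    by (rule exI[of _ B], rule exI[of _ D], intro conjI ballI fin B(1) 1 2) (use D(1) in auto)
qed

end

section \<open>Centralizers of elements of the Cartan subalgebra\<close>

locale levi = pos_cartan H P for H :: "'g::complex_lie_algebra set" and P +
  fixes t :: 'g
  assumes t: "t \<in> H"
begin

definition \<Delta> :: "('g \<Rightarrow> complex) set" where "\<Delta> = {\<alpha> \<in> roots H. \<alpha> t = 0}"

definition \<Delta>p :: "('g \<Rightarrow> complex) set" where "\<Delta>p = {\<alpha> \<in> P. \<alpha> t = 0}"

definition lv :: "'g set" where "lv = {z. \<lbrakk>t, z\<rbrakk> = 0}"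

lemma \<Delta>_roots: "\<alpha> \<in> \<Delta> \<Longrightarrow> \<alpha> \<in> roots H" by (simp add: \<Delta>_def)
lemma \<Delta>p_\<Delta>: "\<alpha> \<in> \<Delta>p \<Longrightarrow> \<alpha> \<in> \<Delta>" using P_roots by (simp add: \<Delta>_def \<Delta>p_def)
lemma \<Delta>p_P: "\<alpha> \<in> \<Delta>p \<Longrightarrow> \<alpha> \<in> P" by (simp add: \<Delta>p_def)
lemma neg_\<Delta>: "\<alpha> \<in> \<Delta> \<Longrightarrow> neg \<alpha> \<in> \<Delta>" using uminus_root by (simp add: \<Delta>_def)
lemma finite_\<Delta>: "finite \<Delta>" using finite_roots by (simp add: \<Delta>_def)
lemma finite_\<Delta>p: "finite \<Delta>p" 
  by (rule finite_subset[OF _ finite_\<Delta>]) (use \<Delta>p_\<Delta> in blast)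

lemma \<Delta>_split: "\<Delta> = \<Delta>p \<union> neg ` \<Delta>p" "\<Delta>p \<inter> neg ` \<Delta>p = {}"
proof -
  have "\<alpha> \<in> \<Delta>p \<union> neg ` \<Delta>p" if "\<alpha> \<in> \<Delta>" for \<alpha>
  proof -
    have "\<alpha> \<in> P \<or> neg \<alpha> \<in> P" by (rule P_cases[OF \<Delta>_roots[OF that]])
    then consider "\<alpha> \<in> P" | "neg \<alpha> \<in> P" by blast
    then show ?thesis
    proof cases
      case 1 then show ?thesis using that by (simp add: \<Delta>_def \<Delta>p_def)
    next
      case 2
      then have "neg \<alpha> \<in> \<Delta>p" using that by (simp add: \<Delta>_def \<Delta>p_def)
      then have "neg (neg \<alpha>) \<in> neg ` \<Delta>p" by (rule imageI)
      then show ?thesis by simp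
    qed
  qed
  then show "\<Delta> = \<Delta>p \<union> neg ` \<Delta>p" using \<Delta>p_\<Delta> neg_\<Delta> by blast
  show "\<Delta>p \<inter> neg ` \<Delta>p = {}" using P_not_both \<Delta>p_P by force
qed

lemma subspace_lv: "csubspace lv"
  by (simp add: lv_def cvec.subspace_def bracket_0 bracket_add_right bracket_scale_right)

lemma bracket_lv: "x \<in> lv \<Longrightarrow> y \<in> lv \<Longrightarrow> \<lbrakk>x, y\<rbrakk> \<in> lv"
  by (simp add: lv_def bracket_derivation[of t x y] bracket_0)

lemma H_lv: "h \<in> H \<Longrightarrow> h \<in> lv"
  using abelian_H[OF t] by (simp add: lv_def)

lemma rv_lv: "\<alpha> \<in> \<Delta> \<Longrightarrow> rv \<alpha> \<in> lv"
  using bracket_rv[OF _ t] by (simp add: lv_def \<Delta>_def)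

lemma killing_lv:
  assumes "z \<in> lv" "\<alpha> \<in> roots H" "\<alpha> \<notin> \<Delta>"
  shows "killing z (rv (neg \<alpha>)) = 0"
proof -
  have "0 = killing \<lbrakk>t, z\<rbrakk> (rv (neg \<alpha>))" using assms by (simp add: lv_def k0)
  also have "\<dots> = - killing z \<lbrakk>t, rv (neg \<alpha>)\<rbrakk>" by (rule kinvariant_left)
  also have "\<dots> = \<alpha> t * killing z (rv (neg \<alpha>))"
    using bracket_rv[OF uminus_root[OF assms(2)] t] by (simp add: kscale_right kneg)
  finally show ?thesis using assms by (simp add: \<Delta>_def)
qed

lemma lv_decomposition:
  assumes "z \<in> lv"
  shows "z - (\<Sum>\<alpha>\<in>\<Delta>. killing z (rv (neg \<alpha>)) *\<^sub>C rv \<alpha>) \<in> H"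
proof -
  have "(\<Sum>\<alpha>\<in>roots H. killing z (rv (neg \<alpha>)) *\<^sub>C rv \<alpha>) = (\<Sum>\<alpha>\<in>\<Delta>. killing z (rv (neg \<alpha>)) *\<^sub>C rv \<alpha>)"
    by (rule sum.mono_neutral_right) (use finite_roots \<Delta>_roots killing_lv[OF assms] in auto)
  then show ?thesis using root_decomposition[of z] by simp
qed

lemma lv_span: "z \<in> lv \<Longrightarrow> z \<in> cspan (H \<union> rv ` \<Delta>)"
proof -
  assume z: "z \<in> lv"
  let ?s = "\<Sum>\<alpha>\<in>\<Delta>. killing z (rv (neg \<alpha>)) *\<^sub>C rv \<alpha>"
  have "z - ?s \<in> cspan (H \<union> rv ` \<Delta>)" using lv_decomposition[OF z] by (intro cvec.span_base) blast
  moreover have "?s \<in> cspan (H \<union> rv ` \<Delta>)" by (intro cvec.span_sum cvec.span_scale cvec.span_base) blast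
  ultimately have "(z - ?s) + ?s \<in> cspan (H \<union> rv ` \<Delta>)" by (rule cvec.span_add)
  then show ?thesis by simp
qed

text \<open>Reflecting in \<open>\<gamma>\<close> cancels the roots that stay positive; those that become negative pair
  positively with \<open>\<gamma>\<close>.\<close>

lemma two_rho_pos:
  assumes g: "\<gamma> \<in> \<Delta>p"
  shows "0 < (\<Sum>\<alpha>\<in>\<Delta>p. \<gamma> (tt \<alpha>))"
proof -
  have gr: "\<gamma> \<in> roots H" and gP: "\<gamma> \<in> P" and gt: "\<gamma> t = 0" using g P_roots by (auto simp: \<Delta>p_def)
  have "\<forall>\<beta>\<in>roots H. \<exists>n::int. 2 * \<beta> (tt \<gamma>) = of_int n * \<gamma> (tt \<gamma>) \<and> (\<lambda>h. \<beta> h - of_int n * \<gamma> h) \<in> roots H"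
    using root_reflection[OF gr] by metis
  from bchoice[OF this] obtain n :: "('g \<Rightarrow> complex) \<Rightarrow> int" where
    n: "2 * \<beta> (tt \<gamma>) = of_int (n \<beta>) * \<gamma> (tt \<gamma>)" "(\<lambda>h. \<beta> h - of_int (n \<beta>) * \<gamma> h) \<in> roots H"
    if "\<beta> \<in> roots H" for \<beta> by blast
  have g0: "\<gamma> (tt \<gamma>) \<noteq> 0" by (rule root_self_nonzero[OF gr])
  define s where "s \<beta> = (\<lambda>h. \<beta> h - of_int (n \<beta>) * \<gamma> h)" for \<beta>
  have sr: "s \<beta> \<in> roots H" if "\<beta> \<in> roots H" for \<beta> using n(2)[OF that] by (simp add: s_def)
  have ns: "n (s \<beta>) = - n \<beta>" if b: "\<beta> \<in> roots H" for \<beta>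
  proof -
    have "of_int (n (s \<beta>)) * \<gamma> (tt \<gamma>) = 2 * s \<beta> (tt \<gamma>)" using n(1)[OF sr[OF b]] by simp
    also have "\<dots> = of_int (- n \<beta>) * \<gamma> (tt \<gamma>)" using n(1)[OF b] by (simp add: s_def algebra_simps)
    finally show ?thesis using g0 by (simp only: mult_cancel_right of_int_eq_iff) simp
  qed
  have ss: "s (s \<beta>) = \<beta>" if "\<beta> \<in> roots H" for \<beta>
    unfolding s_def[of "s \<beta>"] ns[OF that] by (simp add: s_def)
  have "n \<gamma> = 2" using n(1)[OF gr] g0 by (simp only: mult_cancel_right) (metis of_int_eq_iff of_int_numeral)
  \<comment> \<open>For \<open>n \<alpha> \<le> 0\<close> the reflection adds copies of
    \<open>\<gamma>\<close>. All intermediate sums belong to the root string, so positivity passes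
    along it.\<close>
  have sP: "s \<alpha> \<in> P" if a: "\<alpha> \<in> P" and na: "n \<alpha> \<le> 0" for \<alpha>
  proof -
    have ar: "\<alpha> \<in> roots H" using P_roots a by blast
    have "\<alpha> \<noteq> \<gamma>" using \<open>n \<gamma> = 2\<close> na by auto
    moreover have "\<alpha> \<noteq> neg \<gamma>" using P_not_both gP a by blast
    ultimately obtain p q :: nat where pq: "\<And>i. - int q \<le> i \<Longrightarrow> i \<le> int p \<Longrightarrow> (\<lambda>h. \<alpha> h + of_int i * \<gamma> h) \<in> roots H"
      "2 * \<alpha> (tt \<gamma>) = (of_nat q - of_nat p) * \<gamma> (tt \<gamma>)"
      by (rule root_string[OF gr ar]) (rule that; assumption)
    have "of_int (n \<alpha>) * \<gamma> (tt \<gamma>) = of_int (int q - int p) * \<gamma> (tt \<gamma>)" using pq(2) n(1)[OF ar] by simp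
    then have nq: "n \<alpha> = int q - int p" using g0 by (simp only: mult_cancel_right of_int_eq_iff) simp
    have "(\<lambda>h. \<alpha> h + of_int (int i) * \<gamma> h) \<in> P" if "i \<le> nat (- n \<alpha>)" for i
      using that
    proof (induction i)
      case (Suc i)
      then have "(\<lambda>h. \<alpha> h + of_int (int i) * \<gamma> h) \<in> P" by simp
      moreover have "(\<lambda>h. \<alpha> h + of_int (int (Suc i)) * \<gamma> h) \<in> roots H"
        by (rule pq(1)) (use Suc.prems nq in auto)
      moreover have "(\<lambda>h. \<alpha> h + of_int (int (Suc i)) * \<gamma> h) = (\<lambda>h. (\<lambda>h. \<alpha> h + of_int (int i) * \<gamma> h) h + \<gamma> h)"
        by (simp add: algebra_simps)
      ultimately show ?case using P_add[OF _ gP] by metis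
    qed (use a in simp)
    from this[of "nat (- n \<alpha>)"] show ?thesis using na by (simp add: s_def)
  qed
  let ?A = "{\<alpha>\<in>\<Delta>p. s \<alpha> \<in> P}"
  have At: "s \<alpha> t = 0" if "\<alpha> \<in> \<Delta>p" for \<alpha> using that gt by (simp add: s_def \<Delta>p_def)
  \<comment> \<open>\<open>s\<close> is an involution of \<open>?A\<close> that negates
    \<open>n\<close>, so this part of the sum is its own negative.\<close>
  have "bij_betw s ?A ?A"
    by (rule bij_betw_byWitness[of _ s]) (use ss P_roots At in \<open>auto simp: \<Delta>p_def\<close>)
  then have "(\<Sum>\<alpha>\<in>?A. n (s \<alpha>)) = (\<Sum>\<alpha>\<in>?A. n \<alpha>)" by (rule sum.reindex_bij_betw)
  moreover have "(\<Sum>\<alpha>\<in>?A. n (s \<alpha>)) = - (\<Sum>\<alpha>\<in>?A. n \<alpha>)"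
    unfolding sum_negf[symmetric] by (rule sum.cong) (use ns P_roots \<Delta>p_P in auto)
  ultimately have A0: "(\<Sum>\<alpha>\<in>?A. n \<alpha>) = 0" by simp
  have "(\<Sum>\<alpha>\<in>\<Delta>p. n \<alpha>) = (\<Sum>\<alpha>\<in>\<Delta>p - ?A. n \<alpha>)"
    using sum.subset_diff[of ?A \<Delta>p n] finite_\<Delta>p A0 by simp
  moreover have "(\<Sum>\<alpha>\<in>\<Delta>p - ?A. n \<alpha>) > 0"
  proof (rule sum_pos2[of _ \<gamma>])
    have "s \<gamma> = neg \<gamma>" using \<open>n \<gamma> = 2\<close> by (simp add: s_def)
    then show "\<gamma> \<in> \<Delta>p - ?A" using g P_not_both[OF gP] by simp
    show "0 < n \<gamma>" using \<open>n \<gamma> = 2\<close> by simp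
    show "0 \<le> n \<alpha>" if "\<alpha> \<in> \<Delta>p - ?A" for \<alpha> using sP[of \<alpha>] that \<Delta>p_P by fastforce
  qed (use finite_\<Delta>p in simp)
  ultimately have pos: "(\<Sum>\<alpha>\<in>\<Delta>p. n \<alpha>) > 0" by (simp only:)
  have "2 * (\<Sum>\<alpha>\<in>\<Delta>p. \<gamma> (tt \<alpha>)) = (\<Sum>\<alpha>\<in>\<Delta>p. of_int (n \<alpha>) * \<gamma> (tt \<gamma>))"
    unfolding sum_distrib_left
    by (rule sum.cong[OF refl]) (use n(1) P_roots \<Delta>p_P root_tt_commute[OF gr] in auto)
  also have "\<dots> = of_int (\<Sum>\<alpha>\<in>\<Delta>p. n \<alpha>) * \<gamma> (tt \<gamma>)" by (simp add: sum_distrib_right)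
  finally have "2 * (\<Sum>\<alpha>\<in>\<Delta>p. \<gamma> (tt \<alpha>)) = of_int (\<Sum>\<alpha>\<in>\<Delta>p. n \<alpha>) * \<gamma> (tt \<gamma>)" .
  moreover have "0 < of_int (\<Sum>\<alpha>\<in>\<Delta>p. n \<alpha>) * \<gamma> (tt \<gamma>)"
    using pos root_self_pos[OF gr] by (auto simp: less_complex_def simp del: of_int_sum)
  ultimately have "0 < 2 * (\<Sum>\<alpha>\<in>\<Delta>p. \<gamma> (tt \<alpha>))" by (simp only:)
  then show ?thesis by (simp add: less_complex_def)
qed

text \<open>The vector dual to twice the half sum of the positive roots of the centralizer. All of
  \<open>\<Delta>p\<close> is positive on it, so its eigenvalue serves as a height for weights in
  place of an expansion in simple roots.\<close>

definition t\<rho> :: 'g where "t\<rho> = (\<Sum>\<alpha>\<in>\<Delta>p. tt \<alpha>)"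

lemma t\<rho>_H: "t\<rho> \<in> H"
  unfolding t\<rho>_def by (rule cvec.subspace_sum[OF subspace_H]) (use tt_H \<Delta>_roots \<Delta>p_\<Delta> in blast)

lemma dual_sum: "\<alpha> \<in> dual_space H \<Longrightarrow> (\<And>i. i \<in> I \<Longrightarrow> f i \<in> H) \<Longrightarrow> \<alpha> (\<Sum>i\<in>I. f i) = (\<Sum>i\<in>I. \<alpha> (f i))"
proof (induction I rule: infinite_finite_induct)
  case (insert i I)
  then show ?case using cvec.subspace_sum[OF subspace_H, of I f] by (auto simp: dual_space_def)
next
  case empty
  have "\<alpha> (0 *\<^sub>C 0) = 0 * \<alpha> 0" using empty(1) cvec.subspace_0[OF subspace_H] unfolding dual_space_def by blast
  then show ?case by simp
next
  case (infinite A)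
  have "\<alpha> (0 *\<^sub>C 0) = 0 * \<alpha> 0" using infinite(2) cvec.subspace_0[OF subspace_H] unfolding dual_space_def by blast
  then show ?case using infinite by simp
qed

lemma t\<rho>_pos: "\<gamma> \<in> \<Delta>p \<Longrightarrow> 0 < \<gamma> t\<rho>"
  using two_rho_pos[of \<gamma>] dual_sum[OF root_dual, of \<gamma> \<Delta>p tt] \<Delta>p_\<Delta> \<Delta>_roots tt_H by (simp add: t\<rho>_def)

end

section \<open>Highest weight modules\<close>

lemma scaleC_two: "2 *\<^sub>C x = x + (x::'v::complex_vector)"
  using scaleC_add_left[of 1 1 x] by (simp add: scaleC_one)

text \<open>A centralizer is only reductive, and its centre need not act diagonalizably; hence the
  assumption \<open>V_weights\<close>. The bracket rule is asked for on \<open>lv\<close> only,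
  because the twisted action used later is shown to respect brackets there.\<close>

locale weight_module = levi H P t for H :: "'g::complex_lie_algebra set" and P and t +
  fixes \<rho> :: "'g \<Rightarrow> 'v::complex_vector \<Rightarrow> 'v" and V :: "'v set"
  assumes \<rho>_lin: "clinear (\<rho> x)"
    and \<rho>_lin_left: "clinear (\<lambda>x. \<rho> x v)"
    and \<rho>_bracket: "x \<in> lv \<Longrightarrow> y \<in> lv \<Longrightarrow> \<rho> \<lbrakk>x, y\<rbrakk> v = \<rho> x (\<rho> y v) - \<rho> y (\<rho> x v)"
    and \<rho>_V: "x \<in> lv \<Longrightarrow> v \<in> V \<Longrightarrow> \<rho> x v \<in> V"
    and V_sub: "csubspace V"
    and V_fd: "\<exists>B. finite B \<and> V \<subseteq> cspan B"
    and V_weights: "V \<subseteq> cspan {v\<in>V. \<exists>\<mu>. \<forall>h\<in>H. \<rho> h v = \<mu> h *\<^sub>C v}"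
begin

definition wv :: "('g \<Rightarrow> complex) \<Rightarrow> 'v \<Rightarrow> bool" where
  "wv \<mu> v \<longleftrightarrow> (\<forall>h\<in>H. \<rho> h v = \<mu> h *\<^sub>C v)"

definition submod :: "'v set \<Rightarrow> bool" where
  "submod X \<longleftrightarrow> csubspace X \<and> (\<forall>x\<in>lv. \<forall>v\<in>X. \<rho> x v \<in> X)"

lemma submod_sub: "submod X \<Longrightarrow> csubspace X" by (simp add: submod_def)
lemma submod_act: "submod X \<Longrightarrow> x \<in> lv \<Longrightarrow> v \<in> X \<Longrightarrow> \<rho> x v \<in> X" by (simp add: submod_def)

lemma submod_V: "submod V" using \<rho>_V V_sub by (simp add: submod_def)
lemma submod_0: "submod {0}" using clinear_0[OF \<rho>_lin] by (simp add: submod_def)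

lemma submod_inter: "submod X \<Longrightarrow> submod Y \<Longrightarrow> submod (X \<inter> Y)"
  by (simp add: submod_def cvec.subspace_inter)

lemmas \<rho>_simps = clinear_0[OF \<rho>_lin] clinear_add[OF \<rho>_lin] clinear_diff[OF \<rho>_lin] clinear_scale[OF \<rho>_lin]
  clinear_0[OF \<rho>_lin_left] clinear_add[OF \<rho>_lin_left] clinear_diff[OF \<rho>_lin_left] clinear_scale[OF \<rho>_lin_left]

lemma submodI:
  assumes "csubspace X" "\<And>h v. h \<in> H \<Longrightarrow> v \<in> X \<Longrightarrow> \<rho> h v \<in> X" "\<And>\<alpha> v. \<alpha> \<in> \<Delta> \<Longrightarrow> v \<in> X \<Longrightarrow> \<rho> (rv \<alpha>) v \<in> X"
  shows "submod X"
  unfolding submod_def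
proof (intro conjI ballI)
  fix x v assume x: "x \<in> lv" and v: "v \<in> X"
  show "\<rho> x v \<in> X"
    by (rule clinear_span_into[OF \<rho>_lin_left lv_span[OF x] assms(1)]) (use v assms in auto)
qed (rule assms(1))

lemma \<rho>_swap: "x \<in> lv \<Longrightarrow> y \<in> lv \<Longrightarrow> \<rho> x (\<rho> y v) = \<rho> y (\<rho> x v) + \<rho> \<lbrakk>x, y\<rbrakk> v"
  by (simp add: \<rho>_bracket)

lemma wv_root: "wv \<mu> v \<Longrightarrow> \<alpha> \<in> \<Delta> \<Longrightarrow> wv (\<lambda>h. \<mu> h + \<alpha> h) (\<rho> (rv \<alpha>) v)"
  unfolding wv_def
  using \<rho>_swap[OF H_lv rv_lv] bracket_rv[OF \<Delta>_roots]
  by (simp add: \<rho>_simps scaleC_add_left)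

lemma wv_tt: "wv \<mu> v \<Longrightarrow> \<alpha> \<in> \<Delta> \<Longrightarrow> \<rho> (tt \<alpha>) v = \<mu> (tt \<alpha>) *\<^sub>C v"
  using tt_H \<Delta>_roots by (simp add: wv_def)

lemma finite_eigenvalues:
  assumes "s \<in> H"
  shows "finite {a. \<exists>v\<in>V. v \<noteq> 0 \<and> \<rho> s v = a *\<^sub>C v}"
proof -
  let ?W = "{v\<in>V. \<exists>\<mu>. \<forall>h\<in>H. \<rho> h v = \<mu> h *\<^sub>C v}"
  obtain C where C: "C \<subseteq> ?W" "\<not> cdependent C" "?W \<subseteq> cspan C"
    using cvec.maximal_independent_subset by blast
  obtain B where B: "finite B" "V \<subseteq> cspan B" using V_fd by blast
  have "C \<subseteq> cspan B" using C(1) B(2) by auto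
  then have fin: "finite C" using cvec.independent_span_bound[OF B(1) C(2)] by blast
  have span: "V \<subseteq> cspan C" using V_weights cvec.span_minimal[OF C(3)] by auto
  have "\<forall>c\<in>C. \<exists>e. \<rho> s c = e *\<^sub>C c" using C(1) assms by blast
  from bchoice[OF this] obtain e where e: "\<rho> s c = e c *\<^sub>C c" if "c \<in> C" for c by blast
  have "a \<in> e ` C" if v: "v \<in> V" "v \<noteq> 0" "\<rho> s v = a *\<^sub>C v" for a v
  proof -
    obtain k where k: "v = (\<Sum>c\<in>C. k c *\<^sub>C c)" using cspan_finite_sum[OF fin, of v] span v(1) by blast
    have "(\<Sum>c\<in>C. (k c * (e c - a)) *\<^sub>C c) = \<rho> s v - a *\<^sub>C v"
      unfolding k clinear_sum[OF \<rho>_lin] cvec.scale_sum_right sum_subtractf[symmetric]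
      by (rule sum.cong[OF refl])
        (simp add: \<rho>_simps e scaleC_scaleC cvec.scale_left_diff_distrib right_diff_distrib mult.commute)
    then have "(\<Sum>c\<in>C. (k c * (e c - a)) *\<^sub>C c) = 0" using v by simp
    then have z: "k c * (e c - a) = 0" if "c \<in> C" for c
      using cvec.independentD[OF C(2) fin order_refl _ that, of "\<lambda>c. k c * (e c - a)"] by blast
    have "\<exists>c\<in>C. k c \<noteq> 0"
    proof (rule ccontr)
      assume "\<not> ?thesis"
      then have "v = 0" unfolding k by (intro sum.neutral) auto
      then show False using v by simp
    qed
    then show ?thesis using z by auto
  qed
  then have "{a. \<exists>v\<in>V. v \<noteq> 0 \<and> \<rho> s v = a *\<^sub>C v} \<subseteq> e ` C" by blast
  then show ?thesis using fin finite_subset by blast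
qed

text \<open>If two weights in the expansion of \<open>x\<close> differ at some \<open>h\<close>,
  then \<open>\<rho> h - \<omega> d h\<close> removes the term \<open>d\<close>. Repeating this
  shortens the expansion until one weight remains, always staying in \<open>X\<close> and outside
  \<open>N\<close>.\<close>

lemma ex_weight_vector:
  assumes "finite C" "\<And>c. c \<in> C \<Longrightarrow> wv (\<omega> c) c"
    and X: "csubspace X" "\<And>h v. h \<in> H \<Longrightarrow> v \<in> X \<Longrightarrow> \<rho> h v \<in> X" and N: "csubspace N"
    and "x \<in> X" "x \<notin> N" "x = (\<Sum>c\<in>C. a c *\<^sub>C c)"
  shows "\<exists>u \<mu>. u \<in> X \<and> u \<notin> N \<and> wv \<mu> u"
  using assms(1,2,6-)
proof (induction "card C" arbitrary: C x a rule: less_induct)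
  case less
  have "C \<noteq> {}" using less.prems cvec.subspace_0[OF N] by auto
  show ?case
  proof (cases "\<exists>c0\<in>C. \<exists>c1\<in>C. \<exists>h\<in>H. \<omega> c0 h \<noteq> \<omega> c1 h")
    case False
    obtain c0 where c0: "c0 \<in> C" using \<open>C \<noteq> {}\<close> by blast
    have "wv (\<omega> c0) x"
      unfolding wv_def
    proof
      fix h assume h: "h \<in> H"
      have "\<rho> h x = (\<Sum>c\<in>C. \<omega> c0 h *\<^sub>C (a c *\<^sub>C c))"
        unfolding less.prems(5) clinear_sum[OF \<rho>_lin]
      proof (rule sum.cong[OF refl])
        fix c assume c: "c \<in> C"
        have "\<omega> c0 h = \<omega> c h" using h False c c0 by blast
        then have "\<rho> h c = \<omega> c0 h *\<^sub>C c" using less.prems(2)[OF c] h by (simp add: wv_def)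
        then show "\<rho> h (a c *\<^sub>C c) = \<omega> c0 h *\<^sub>C (a c *\<^sub>C c)"
          by (simp add: \<rho>_simps scaleC_scaleC mult.commute)
      qed
      then show "\<rho> h x = \<omega> c0 h *\<^sub>C x" by (simp add: less.prems(5) cvec.scale_sum_right)
    qed
    then show ?thesis using less.prems by blast
  next
    case True
    then obtain c0 c1 h where c: "c0 \<in> C" "c1 \<in> C" "h \<in> H" "\<omega> c0 h \<noteq> \<omega> c1 h" by blast
    let ?y = "\<lambda>d. \<rho> h x - \<omega> d h *\<^sub>C x"
    have yX: "?y d \<in> X" for d
      using less.prems(3) X c(3) by (simp add: cvec.subspace_diff cvec.subspace_scale)
    have y: "?y d = (\<Sum>c\<in>C - {d}. (a c * (\<omega> c h - \<omega> d h)) *\<^sub>C c)" if d: "d \<in> C" for d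
    proof -
      have "?y d = (\<Sum>c\<in>C. (a c * (\<omega> c h - \<omega> d h)) *\<^sub>C c)"
        unfolding less.prems(5) clinear_sum[OF \<rho>_lin] cvec.scale_sum_right sum_subtractf[symmetric]
      proof (rule sum.cong[OF refl])
        fix c assume "c \<in> C"
        then have "\<rho> h c = \<omega> c h *\<^sub>C c" using less.prems(2) \<open>h \<in> H\<close> by (auto simp: wv_def)
        then show "\<rho> h (a c *\<^sub>C c) - \<omega> d h *\<^sub>C (a c *\<^sub>C c) = (a c * (\<omega> c h - \<omega> d h)) *\<^sub>C c"
          by (simp add: \<rho>_simps scaleC_scaleC cvec.scale_left_diff_distrib right_diff_distrib mult.commute)
      qed
      then show ?thesis using sum.remove[OF less.prems(1) d, of "\<lambda>c. (a c * (\<omega> c h - \<omega> d h)) *\<^sub>C c"] by simp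
    qed
    \<comment> \<open>The two candidates differ by a nonzero multiple of \<open>x\<close>, so they
      cannot both lie in \<open>N\<close>.\<close>
    have "\<exists>d\<in>C. ?y d \<notin> N"
    proof (rule ccontr)
      assume "\<not> ?thesis"
      then have "?y c0 - ?y c1 \<in> N" using c N cvec.subspace_diff by blast
      moreover have "?y c0 - ?y c1 = (\<omega> c1 h - \<omega> c0 h) *\<^sub>C x" by (simp add: cvec.scale_left_diff_distrib)
      ultimately have "(1 / (\<omega> c1 h - \<omega> c0 h)) *\<^sub>C ((\<omega> c1 h - \<omega> c0 h) *\<^sub>C x) \<in> N"
        using N cvec.subspace_scale by metis
      then show False using c(4) less.prems(4) by (simp add: scaleC_scaleC scaleC_one)
    qed
    then obtain d where d: "d \<in> C" "?y d \<notin> N" by blast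
    show ?thesis
      by (rule less.hyps[OF card_Diff1_less[OF less.prems(1) d(1)] _ _ yX d(2) y[OF d(1)]])
        (use less.prems(1,2) in auto)
  qed
qed

lemma V_weight_sum:
  assumes "x \<in> V"
  obtains C \<omega> a where "finite C" "\<And>c. c \<in> C \<Longrightarrow> wv (\<omega> c) c" "x = (\<Sum>c\<in>C. a c *\<^sub>C c)"
proof -
  have "x \<in> cspan {v\<in>V. \<exists>\<mu>. \<forall>h\<in>H. \<rho> h v = \<mu> h *\<^sub>C v}" using assms V_weights by blast
  then obtain C a where C: "finite C" "C \<subseteq> {v\<in>V. \<exists>\<mu>. \<forall>h\<in>H. \<rho> h v = \<mu> h *\<^sub>C v}" "x = (\<Sum>c\<in>C. a c *\<^sub>C c)"
    by (rule cspan_imp_finite_sum)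
  have "\<forall>c\<in>C. \<exists>\<mu>. wv \<mu> c" using C(2) by (auto simp: wv_def)
  from bchoice[OF this] obtain \<omega> where "\<forall>c\<in>C. wv (\<omega> c) c" by blast
  then show ?thesis using that[of C \<omega> a] C by blast
qed

text \<open>Among the weight vectors of \<open>X\<close> outside \<open>N\<close>, one with the
  largest real part of the \<open>t\<rho>\<close>-eigenvalue is taken. Raising it would increase
  this value, so all raising operators send it into \<open>N\<close>.\<close>

lemma ex_highest_weight_vector:
  assumes X: "submod X" "X \<subseteq> V" and N: "submod N" and "\<not> X \<subseteq> N"
  shows "\<exists>u \<mu>. u \<in> X \<and> u \<notin> N \<and> wv \<mu> u \<and> (\<forall>\<alpha>\<in>\<Delta>p. \<rho> (rv \<alpha>) u \<in> N)"
proof -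
  obtain x where x: "x \<in> X" "x \<notin> N" using assms(4) by blast
  obtain C \<omega> a where "finite C" "\<And>c. c \<in> C \<Longrightarrow> wv (\<omega> c) c" "x = (\<Sum>c\<in>C. a c *\<^sub>C c)"
    using V_weight_sum x(1) X(2) by blast
  then have ex: "\<exists>u \<mu>. u \<in> X \<and> u \<notin> N \<and> wv \<mu> u"
    using ex_weight_vector[of C \<omega> X N x a] x submod_sub[OF X(1)] submod_sub[OF N] submod_act[OF X(1) H_lv] by blast
  let ?E = "{a. \<exists>v\<in>V. v \<noteq> 0 \<and> \<rho> t\<rho> v = a *\<^sub>C v}"
  let ?Q = "{Re (\<mu> t\<rho>) | \<mu> u. u \<in> X \<and> u \<notin> N \<and> wv \<mu> u}"
  have "?Q \<subseteq> Re ` ?E"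
  proof
    fix q assume "q \<in> ?Q"
    then obtain \<mu> u where u: "q = Re (\<mu> t\<rho>)" "u \<in> X" "u \<notin> N" "wv \<mu> u" by blast
    then have "u \<noteq> 0" using submod_sub[OF N] cvec.subspace_0 by blast
    moreover have "\<rho> t\<rho> u = \<mu> t\<rho> *\<^sub>C u" using u(4) t\<rho>_H by (simp add: wv_def)
    ultimately show "q \<in> Re ` ?E" using u(1,2) X(2) by blast
  qed
  then have fin: "finite ?Q" using finite_eigenvalues[OF t\<rho>_H] finite_subset by blast
  moreover have "?Q \<noteq> {}" using ex by blast
  ultimately have "Max ?Q \<in> ?Q" by (rule Max_in)
  then obtain \<mu> u where u: "Max ?Q = Re (\<mu> t\<rho>)" "u \<in> X" "u \<notin> N" "wv \<mu> u" by blast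
  have "\<rho> (rv \<alpha>) u \<in> N" if a: "\<alpha> \<in> \<Delta>p" for \<alpha>
  proof (rule ccontr)
    assume "\<rho> (rv \<alpha>) u \<notin> N"
    moreover have "\<rho> (rv \<alpha>) u \<in> X" using submod_act[OF X(1) rv_lv u(2)] \<Delta>p_\<Delta> a by blast
    moreover have "wv (\<lambda>h. \<mu> h + \<alpha> h) (\<rho> (rv \<alpha>) u)" using wv_root u(4) \<Delta>p_\<Delta> a by blast
    ultimately have "Re ((\<lambda>h. \<mu> h + \<alpha> h) t\<rho>) \<in> ?Q"
      by (intro CollectI exI[of _ "\<lambda>h. \<mu> h + \<alpha> h"] exI[of _ "\<rho> (rv \<alpha>) u"]) simp
    then have "Re (\<mu> t\<rho> + \<alpha> t\<rho>) \<le> Max ?Q" using fin by (simp add: Max_ge)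
    then show False using u(1) t\<rho>_pos[OF a] by (simp add: less_complex_def)
  qed
  then show ?thesis using u by blast
qed

text \<open>The sl2 computation modulo \<open>N\<close>, with the unnormalized
  \<open>tt \<alpha>\<close> in the place of the coroot. The first lowered vector that falls into
  \<open>N\<close> forces a coefficient of the raising formula to vanish.\<close>

lemma weight_dominant:
  assumes N: "submod N" and u: "u \<in> V" "u \<notin> N" "wv \<mu> u" and a: "\<alpha> \<in> \<Delta>" and e: "\<rho> (rv \<alpha>) u \<in> N"
  shows "\<exists>m::nat. 2 * \<mu> (tt \<alpha>) = of_nat m * \<alpha> (tt \<alpha>)"
proof -
  let ?f = "rv (neg \<alpha>)" and ?e = "rv \<alpha>" and ?t = "tt \<alpha>"
  have ar: "\<alpha> \<in> roots H" using \<Delta>_roots a by blast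
  have na: "neg \<alpha> \<in> \<Delta>" using neg_\<Delta> a by blast
  have tH: "?t \<in> H" by (rule tt_H[OF ar])
  define F where "F i = (\<rho> ?f ^^ i) u" for i
  have F0: "F 0 = u" and FS: "F (Suc i) = \<rho> ?f (F i)" for i by (simp_all add: F_def)
  have FV: "F i \<in> V" for i by (induction i) (use u \<rho>_V rv_lv[OF na] in \<open>auto simp: F0 FS\<close>)
  have Fw: "wv (\<lambda>h. \<mu> h - of_nat i * \<alpha> h) (F i)" for i
  proof (induction i)
    case (Suc i)
    then show ?case using wv_root[OF Suc na] by (simp add: FS algebra_simps)
  qed (use u in \<open>simp add: F0\<close>)
  \<comment> \<open>Adding up \<open>(\<mu> - j \<alpha>) (tt \<alpha>)\<close> over
    \<open>j < i\<close>: modulo \<open>N\<close>, raising \<open>F (Suc i)\<close> returns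
    \<open>c (Suc i)\<close> times \<open>F i\<close>.\<close>
  define c where "c i = of_nat i * \<mu> ?t - of_nat i * (of_nat i - 1) / 2 * \<alpha> ?t" for i
  have cS: "c (Suc i) = c i + (\<mu> ?t - of_nat i * \<alpha> ?t)" for i by (simp add: c_def field_simps)
  have e_f: "\<rho> ?e (F (Suc i)) - c (Suc i) *\<^sub>C F i \<in> N" for i
  proof (induction i)
    case 0
    have "\<rho> ?e (F (Suc 0)) = \<rho> ?f (\<rho> ?e u) + \<rho> ?t u"
      unfolding FS F0 using \<rho>_swap[OF rv_lv[OF a] rv_lv[OF na], of u] rv_bracket_neg[OF ar] by simp
    then have "\<rho> ?e (F (Suc 0)) - c (Suc 0) *\<^sub>C F 0 = \<rho> ?f (\<rho> ?e u)"
      using wv_tt[OF u(3) a] by (simp add: c_def F0)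
    then show ?case using submod_act[OF N rv_lv[OF na] e] by simp
  next
    case (Suc i)
    let ?r = "\<rho> ?e (F (Suc i)) - c (Suc i) *\<^sub>C F i"
    have "\<rho> ?e (F (Suc (Suc i))) = \<rho> ?f (\<rho> ?e (F (Suc i))) + \<rho> ?t (F (Suc i))"
      using \<rho>_swap[OF rv_lv[OF a] rv_lv[OF na], of "F (Suc i)"] rv_bracket_neg[OF ar] FS[of "Suc i"] by simp
    also have "\<rho> ?t (F (Suc i)) = (\<mu> ?t - of_nat (Suc i) * \<alpha> ?t) *\<^sub>C F (Suc i)"
      using wv_tt[OF Fw a] .
    finally have "\<rho> ?e (F (Suc (Suc i))) - c (Suc (Suc i)) *\<^sub>C F (Suc i) = \<rho> ?f ?r"
      unfolding cS[of "Suc i"] by (simp add: \<rho>_simps FS[of i, symmetric] scaleC_add_left algebra_simps)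
    then show ?case using submod_act[OF N rv_lv[OF na] Suc] by simp
  qed
  \<comment> \<open>Otherwise \<open>tt \<alpha>\<close> would have infinitely many eigenvalues on
    the finite-dimensional \<open>V\<close>.\<close>
  have "\<exists>i. F i = 0"
  proof (rule ccontr)
    assume *: "\<nexists>i. F i = 0"
    let ?E = "{a. \<exists>v\<in>V. v \<noteq> 0 \<and> \<rho> ?t v = a *\<^sub>C v}"
    let ?g = "\<lambda>i::nat. \<mu> ?t - of_nat i * \<alpha> ?t"
    have "?g i \<in> ?E" for i
    proof -
      have "\<rho> ?t (F i) = ?g i *\<^sub>C F i" using Fw tH by (simp add: wv_def)
      then show ?thesis using * FV[of i] by blast
    qed
    then have "range ?g \<subseteq> ?E" by blast
    then have "finite (range ?g)" using finite_eigenvalues[OF tH] finite_subset by blast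
    moreover have "inj ?g" using root_self_nonzero[OF ar] by (auto intro: injI)
    ultimately show False using finite_imageD infinite_UNIV_nat by blast
  qed
  then have ex: "\<exists>i. F i \<in> N" using submod_sub[OF N] cvec.subspace_0 by metis
  define k where "k = (LEAST i. F i \<in> N)"
  have k: "F k \<in> N" unfolding k_def using ex by (rule LeastI_ex)
  then obtain i where i: "k = Suc i" using u(2) F0 by (cases k) auto
  have Fi: "F i \<notin> N" using not_less_Least[of i "\<lambda>i. F i \<in> N"] i by (simp add: k_def)
  have "\<rho> ?e (F (Suc i)) \<in> N" using submod_act[OF N rv_lv[OF a] k] i by simp
  then have "c (Suc i) *\<^sub>C F i \<in> N"
    using cvec.subspace_diff[OF submod_sub[OF N] _ e_f[of i]] by fastforce
  then have "(1 / c (Suc i)) *\<^sub>C (c (Suc i) *\<^sub>C F i) \<in> N"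
    by (rule cvec.subspace_scale[OF submod_sub[OF N]])
  then have "c (Suc i) = 0"
    using Fi by (cases "c (Suc i) = 0") (simp_all add: scaleC_scaleC scaleC_one)
  then have "of_nat (Suc i) * (2 * \<mu> ?t) = of_nat (Suc i) * (of_nat i * \<alpha> ?t)"
    by (simp add: c_def field_simps)
  then have "2 * \<mu> ?t = of_nat i * \<alpha> ?t" by (simp only: mult_cancel_left of_nat_eq_0_iff) simp
  then show ?thesis by blast
qed

lemma weight_nonneg:
  assumes "submod N" "u \<in> V" "u \<notin> N" "wv \<mu> u" "\<forall>\<alpha>\<in>\<Delta>p. \<rho> (rv \<alpha>) u \<in> N" "\<alpha> \<in> \<Delta>p"
  shows "0 \<le> \<mu> (tt \<alpha>)"
proof -
  obtain m :: nat where m: "2 * \<mu> (tt \<alpha>) = of_nat m * \<alpha> (tt \<alpha>)"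
    using weight_dominant[OF assms(1-4), of \<alpha>] assms(5,6) \<Delta>p_\<Delta> by blast
  have "0 \<le> of_nat m * \<alpha> (tt \<alpha>)"
    using root_self_pos[of \<alpha>] of_nat_complex_nonneg[of m] assms(6) \<Delta>p_\<Delta> \<Delta>_roots
    by (intro mult_nonneg_nonneg) auto
  then have "0 \<le> 2 * \<mu> (tt \<alpha>)" using m by simp
  then show ?thesis by (simp add: less_eq_complex_def)
qed

subsection \<open>The Casimir operator\<close>

definition hb :: "'g set \<times> ('g \<Rightarrow> 'g)" where
  "hb = (SOME (B, D). finite B \<and> B \<subseteq> H \<and> D ` B \<subseteq> H \<and>
     (\<forall>h\<in>H. h = (\<Sum>b\<in>B. killing h (D b) *\<^sub>C b)) \<and> (\<forall>h\<in>H. h = (\<Sum>b\<in>B. killing h b *\<^sub>C D b)))"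

abbreviation "Hb \<equiv> fst hb"
abbreviation "Hd \<equiv> snd hb"

lemma hb: "finite Hb" "b \<in> Hb \<Longrightarrow> b \<in> H" "b \<in> Hb \<Longrightarrow> Hd b \<in> H"
  "h \<in> H \<Longrightarrow> h = (\<Sum>b\<in>Hb. killing h (Hd b) *\<^sub>C b)" "h \<in> H \<Longrightarrow> h = (\<Sum>b\<in>Hb. killing h b *\<^sub>C Hd b)"
proof -
  have "\<exists>BD. (case BD of (B, D) \<Rightarrow> finite B \<and> B \<subseteq> H \<and> D ` B \<subseteq> H \<and>
     (\<forall>h\<in>H. h = (\<Sum>b\<in>B. killing h (D b) *\<^sub>C b)) \<and> (\<forall>h\<in>H. h = (\<Sum>b\<in>B. killing h b *\<^sub>C D b)))"
    using ex_dual_bases by simp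
  then have *: "case hb of (B, D) \<Rightarrow> finite B \<and> B \<subseteq> H \<and> D ` B \<subseteq> H \<and>
     (\<forall>h\<in>H. h = (\<Sum>b\<in>B. killing h (D b) *\<^sub>C b)) \<and> (\<forall>h\<in>H. h = (\<Sum>b\<in>B. killing h b *\<^sub>C D b))"
    unfolding hb_def by (rule someI_ex)
  obtain B D where BD: "hb = (B, D)" by (cases hb)
  have "fst hb = B" "snd hb = D" using BD by simp_all
  then show "finite Hb" "b \<in> Hb \<Longrightarrow> b \<in> H" "b \<in> Hb \<Longrightarrow> Hd b \<in> H"
    "h \<in> H \<Longrightarrow> h = (\<Sum>b\<in>Hb. killing h (Hd b) *\<^sub>C b)" "h \<in> H \<Longrightarrow> h = (\<Sum>b\<in>Hb. killing h b *\<^sub>C Hd b)"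
    using * unfolding BD by auto
qed

definition cas :: "'v \<Rightarrow> 'v" where
  "cas v = (\<Sum>b\<in>Hb. \<rho> b (\<rho> (Hd b) v)) + (\<Sum>\<alpha>\<in>\<Delta>. \<rho> (rv \<alpha>) (\<rho> (rv (neg \<alpha>)) v))"

text \<open>The scalar \<open>(\<mu>, \<mu> + 2 \<rho>)\<close> by which the Casimir operator acts
  on a highest weight vector of weight \<open>\<mu>\<close>.\<close>

definition cw :: "('g \<Rightarrow> complex) \<Rightarrow> complex" where
  "cw \<mu> = (\<Sum>b\<in>Hb. \<mu> b * \<mu> (Hd b)) + (\<Sum>\<alpha>\<in>\<Delta>p. \<mu> (tt \<alpha>))"

lemma clinear_cas: "clinear cas"
  unfolding cas_def by (intro clinear_plus clinear_sum_fun clinear_compose[OF \<rho>_lin] \<rho>_lin)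

lemma neg_\<Delta>_bij: "bij_betw neg \<Delta> \<Delta>"
  by (rule bij_betw_byWitness[of _ neg]) (use neg_\<Delta> in auto)

lemma sum_lv_neg: "(\<Sum>\<alpha>\<in>\<Delta>. killing z (rv (neg \<alpha>)) *\<^sub>C rv \<alpha>) = (\<Sum>\<alpha>\<in>\<Delta>. killing z (rv \<alpha>) *\<^sub>C rv (neg \<alpha>))"
  using sum.reindex_bij_betw[OF neg_\<Delta>_bij, of "\<lambda>\<alpha>. killing z (rv \<alpha>) *\<^sub>C rv (neg \<alpha>)"] by simp

lemma killing_lv_part:
  assumes "k \<in> H" shows "killing (\<Sum>\<alpha>\<in>\<Delta>. c \<alpha> *\<^sub>C rv \<alpha>) k = 0"
  unfolding ksum kscale_left
  by (rule sum.neutral) (use killing_H_rv[OF assms] kcommute \<Delta>_roots in auto)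

lemma kinvariant_swap: "killing \<lbrakk>z, a\<rbrakk> b = - killing \<lbrakk>z, b\<rbrakk> (a::'g)"
  using kinvariant_left[of z a b] kcommute[of a "\<lbrakk>z, b\<rbrakk>"] by simp

text \<open>The pairs \<open>(x\<^sub>i, y\<^sub>i)\<close> indexed by the disjoint union of \<open>Hb\<close> and \<open>\<Delta>\<close> are dual bases of the
  centralizer; invariance of the Casimir element only depends on this.\<close>

lemma cas_commute:
  assumes z: "z \<in> lv"
  shows "\<rho> z (cas v) = cas (\<rho> z v)"
proof -
  let ?I = "Inl ` Hb \<union> Inr ` \<Delta> :: ('g + ('g \<Rightarrow> complex)) set"
  define x where "x = case_sum (\<lambda>b. b) rv"
  define y where "y = case_sum Hd (\<lambda>\<alpha>. rv (neg \<alpha>))"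
  have fin: "finite ?I" using hb(1) finite_\<Delta> by simp
  have split: "(\<Sum>i\<in>?I. g i) = (\<Sum>b\<in>Hb. g (Inl b)) + (\<Sum>\<alpha>\<in>\<Delta>. g (Inr \<alpha>))" for g :: "_ \<Rightarrow> 'w::comm_monoid_add"
    by (subst sum.union_disjoint) (use hb(1) finite_\<Delta> in \<open>auto simp: sum.reindex\<close>)
  have cas: "cas v = (\<Sum>i\<in>?I. \<rho> (x i) (\<rho> (y i) v))" for v
    unfolding split by (simp add: cas_def x_def y_def)
  have xy: "x i \<in> lv" "y i \<in> lv" if "i \<in> ?I" for i
    using that hb H_lv rv_lv neg_\<Delta> by (auto simp: x_def y_def)
  have e1: "u = (\<Sum>i\<in>?I. killing u (y i) *\<^sub>C x i)" if u: "u \<in> lv" for u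
  proof -
    let ?s = "\<Sum>\<alpha>\<in>\<Delta>. killing u (rv (neg \<alpha>)) *\<^sub>C rv \<alpha>"
    have h: "u - ?s \<in> H" by (rule lv_decomposition[OF u])
    have "killing (u - ?s) (Hd b) = killing u (Hd b)" if "b \<in> Hb" for b
      using killing_lv_part[OF hb(3)[OF that]] by (simp add: kdiff)
    then have "u - ?s = (\<Sum>b\<in>Hb. killing u (Hd b) *\<^sub>C b)"
      using hb(4)[OF h] by simp
    then show ?thesis unfolding split x_def y_def by (simp add: algebra_simps)
  qed
  have e2: "u = (\<Sum>i\<in>?I. killing u (x i) *\<^sub>C y i)" if u: "u \<in> lv" for u
  proof -
    let ?s = "\<Sum>\<alpha>\<in>\<Delta>. killing u (rv (neg \<alpha>)) *\<^sub>C rv \<alpha>"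
    have h: "u - ?s \<in> H" by (rule lv_decomposition[OF u])
    have "killing (u - ?s) b = killing u b" if "b \<in> Hb" for b
      using killing_lv_part[OF hb(2)[OF that]] by (simp add: kdiff)
    then have "u - ?s = (\<Sum>b\<in>Hb. killing u b *\<^sub>C Hd b)"
      using hb(5)[OF h] by simp
    then show ?thesis unfolding split x_def y_def by (simp add: algebra_simps sum_lv_neg)
  qed
  have "\<rho> z (cas v) - cas (\<rho> z v) = (\<Sum>i\<in>?I. \<rho> z (\<rho> (x i) (\<rho> (y i) v)) - \<rho> (x i) (\<rho> (y i) (\<rho> z v)))"
    by (simp add: cas clinear_sum[OF \<rho>_lin] sum_subtractf)
  also have "\<dots> = (\<Sum>i\<in>?I. \<rho> \<lbrakk>z, x i\<rbrakk> (\<rho> (y i) v) + \<rho> (x i) (\<rho> \<lbrakk>z, y i\<rbrakk> v))"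
    by (rule sum.cong[OF refl]) (use xy z in \<open>simp add: \<rho>_bracket \<rho>_simps\<close>)
  also have "\<dots> = (\<Sum>i\<in>?I. \<rho> \<lbrakk>z, x i\<rbrakk> (\<rho> (y i) v)) + (\<Sum>i\<in>?I. \<rho> (x i) (\<rho> \<lbrakk>z, y i\<rbrakk> v))"
    by (rule sum.distrib)
  also have "(\<Sum>i\<in>?I. \<rho> \<lbrakk>z, x i\<rbrakk> (\<rho> (y i) v)) =
      (\<Sum>i\<in>?I. \<Sum>j\<in>?I. killing \<lbrakk>z, x i\<rbrakk> (y j) *\<^sub>C \<rho> (x j) (\<rho> (y i) v))"
  proof (rule sum.cong[OF refl])
    fix i assume i: "i \<in> ?I"
    show "\<rho> \<lbrakk>z, x i\<rbrakk> (\<rho> (y i) v) = (\<Sum>j\<in>?I. killing \<lbrakk>z, x i\<rbrakk> (y j) *\<^sub>C \<rho> (x j) (\<rho> (y i) v))"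
      by (subst e1[OF bracket_lv[OF z xy(1)[OF i]]])
        (simp add: clinear_sum[OF \<rho>_lin_left] \<rho>_simps)
  qed
  also have "(\<Sum>i\<in>?I. \<rho> (x i) (\<rho> \<lbrakk>z, y i\<rbrakk> v)) =
      (\<Sum>i\<in>?I. \<Sum>j\<in>?I. killing \<lbrakk>z, y i\<rbrakk> (x j) *\<^sub>C \<rho> (x i) (\<rho> (y j) v))"
  proof (rule sum.cong[OF refl])
    fix i assume i: "i \<in> ?I"
    show "\<rho> (x i) (\<rho> \<lbrakk>z, y i\<rbrakk> v) = (\<Sum>j\<in>?I. killing \<lbrakk>z, y i\<rbrakk> (x j) *\<^sub>C \<rho> (x i) (\<rho> (y j) v))"
      by (subst e2[OF bracket_lv[OF z xy(2)[OF i]]])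
        (simp add: clinear_sum[OF \<rho>_lin_left] clinear_sum[OF \<rho>_lin] \<rho>_simps)
  qed
  also have "\<dots> = (\<Sum>i\<in>?I. \<Sum>j\<in>?I. killing \<lbrakk>z, y j\<rbrakk> (x i) *\<^sub>C \<rho> (x j) (\<rho> (y i) v))"
    by (rule sum.swap)
  \<comment> \<open>Invariance and symmetry of the form make the structure constants antisymmetric
    under exchange of the dual bases, so the two double sums cancel.\<close>
  also have "\<dots> = - (\<Sum>i\<in>?I. \<Sum>j\<in>?I. killing \<lbrakk>z, x i\<rbrakk> (y j) *\<^sub>C \<rho> (x j) (\<rho> (y i) v))"
    unfolding sum_negf[symmetric]
    by (intro sum.cong[OF refl]) (subst kinvariant_swap, simp)
  finally show ?thesis by simp
qed

lemma submod_cas: "submod N \<Longrightarrow> v \<in> N \<Longrightarrow> cas v \<in> N"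
proof -
  assume N: "submod N" and v: "v \<in> N"
  have "\<rho> b (\<rho> (Hd b) v) \<in> N" if "b \<in> Hb" for b
    by (intro submod_act[OF N] H_lv hb that v)
  moreover have "\<rho> (rv \<alpha>) (\<rho> (rv (neg \<alpha>)) v) \<in> N" if "\<alpha> \<in> \<Delta>" for \<alpha>
    by (intro submod_act[OF N] rv_lv neg_\<Delta> that v)
  ultimately show ?thesis
    unfolding cas_def by (intro cvec.subspace_add cvec.subspace_sum submod_sub[OF N])
qed

text \<open>In the products over positive roots the raising operator is moved to the right, where it
  leads into \<open>N\<close>. The commutators add the values \<open>\<mu> (tt \<alpha>)\<close>,
  which is the \<open>2 \<rho>\<close> part of \<open>cw\<close>.\<close>

lemma cas_weight:
  assumes N: "submod N" and u: "wv \<mu> u" "\<forall>\<alpha>\<in>\<Delta>p. \<rho> (rv \<alpha>) u \<in> N"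
  shows "cas u - cw \<mu> *\<^sub>C u \<in> N"
proof -
  have "(\<Sum>b\<in>Hb. \<rho> b (\<rho> (Hd b) u)) = (\<Sum>b\<in>Hb. (\<mu> b * \<mu> (Hd b)) *\<^sub>C u)"
    by (rule sum.cong[OF refl]) (use u hb in \<open>simp add: wv_def \<rho>_simps scaleC_scaleC mult.commute\<close>)
  also have "\<dots> = (\<Sum>b\<in>Hb. \<mu> b * \<mu> (Hd b)) *\<^sub>C u" by (simp add: cvec.scale_sum_left)
  finally have 1: "(\<Sum>b\<in>Hb. \<rho> b (\<rho> (Hd b) u)) = (\<Sum>b\<in>Hb. \<mu> b * \<mu> (Hd b)) *\<^sub>C u" .
  have "(\<Sum>\<alpha>\<in>\<Delta>. \<rho> (rv \<alpha>) (\<rho> (rv (neg \<alpha>)) u)) =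
      (\<Sum>\<alpha>\<in>\<Delta>p. \<rho> (rv \<alpha>) (\<rho> (rv (neg \<alpha>)) u)) + (\<Sum>\<alpha>\<in>neg ` \<Delta>p. \<rho> (rv \<alpha>) (\<rho> (rv (neg \<alpha>)) u))"
    unfolding \<Delta>_split(1) by (rule sum.union_disjoint) (use finite_\<Delta>p \<Delta>_split(2) in auto)
  also have "(\<Sum>\<alpha>\<in>neg ` \<Delta>p. \<rho> (rv \<alpha>) (\<rho> (rv (neg \<alpha>)) u)) = (\<Sum>\<alpha>\<in>\<Delta>p. \<rho> (rv (neg \<alpha>)) (\<rho> (rv \<alpha>) u))"
    by (subst sum.reindex) (auto intro!: inj_onI simp: fun_eq_iff)
  also have "(\<Sum>\<alpha>\<in>\<Delta>p. \<rho> (rv \<alpha>) (\<rho> (rv (neg \<alpha>)) u)) = (\<Sum>\<alpha>\<in>\<Delta>p. \<rho> (rv (neg \<alpha>)) (\<rho> (rv \<alpha>) u) + \<mu> (tt \<alpha>) *\<^sub>C u)"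
  proof (rule sum.cong[OF refl])
    fix \<alpha> assume "\<alpha> \<in> \<Delta>p"
    then have a: "\<alpha> \<in> \<Delta>" by (rule \<Delta>p_\<Delta>)
    show "\<rho> (rv \<alpha>) (\<rho> (rv (neg \<alpha>)) u) = \<rho> (rv (neg \<alpha>)) (\<rho> (rv \<alpha>) u) + \<mu> (tt \<alpha>) *\<^sub>C u"
      using \<rho>_swap[OF rv_lv[OF a] rv_lv[OF neg_\<Delta>[OF a]], of u] rv_bracket_neg[OF \<Delta>_roots[OF a]]
        wv_tt[OF u(1) a] by simp
  qed
  finally have 2: "(\<Sum>\<alpha>\<in>\<Delta>. \<rho> (rv \<alpha>) (\<rho> (rv (neg \<alpha>)) u)) =
      2 *\<^sub>C (\<Sum>\<alpha>\<in>\<Delta>p. \<rho> (rv (neg \<alpha>)) (\<rho> (rv \<alpha>) u)) + (\<Sum>\<alpha>\<in>\<Delta>p. \<mu> (tt \<alpha>)) *\<^sub>C u"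
    by (simp add: sum.distrib cvec.scale_sum_left scaleC_two)
  have "cas u - cw \<mu> *\<^sub>C u = 2 *\<^sub>C (\<Sum>\<alpha>\<in>\<Delta>p. \<rho> (rv (neg \<alpha>)) (\<rho> (rv \<alpha>) u))"
    unfolding cas_def cw_def 1 2 by (simp add: scaleC_add_left)
  also have "\<dots> \<in> N"
  proof (intro cvec.subspace_scale cvec.subspace_sum submod_sub[OF N])
    fix \<alpha> assume a: "\<alpha> \<in> \<Delta>p"
    show "\<rho> (rv (neg \<alpha>)) (\<rho> (rv \<alpha>) u) \<in> N"
      by (rule submod_act[OF N rv_lv[OF neg_\<Delta>[OF \<Delta>p_\<Delta>[OF a]]]]) (use u(2) a in blast)
  qed
  finally show ?thesis .
qed

subsection \<open>Comparison of weights\<close>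

definition le :: "('g \<Rightarrow> complex) \<Rightarrow> ('g \<Rightarrow> complex) \<Rightarrow> bool" where
  "le \<mu> l \<longleftrightarrow> (\<exists>n::('g \<Rightarrow> complex) \<Rightarrow> nat. \<forall>h\<in>H. l h - \<mu> h = (\<Sum>\<gamma>\<in>\<Delta>p. of_nat (n \<gamma>) * \<gamma> h))"

lemma wv_sum:
  assumes v: "wv \<mu> v" "v \<noteq> 0" and I: "finite I" "\<And>i. i \<in> I \<Longrightarrow> x i \<in> H"
  shows "\<mu> (\<Sum>i\<in>I. c i *\<^sub>C x i) = (\<Sum>i\<in>I. c i * \<mu> (x i))"
proof -
  have "(\<Sum>i\<in>I. c i *\<^sub>C x i) \<in> H"
    by (intro cvec.subspace_sum[OF subspace_H] cvec.subspace_scale[OF subspace_H] I)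
  then have "\<mu> (\<Sum>i\<in>I. c i *\<^sub>C x i) *\<^sub>C v = \<rho> (\<Sum>i\<in>I. c i *\<^sub>C x i) v" using v by (simp add: wv_def)
  also have "\<dots> = (\<Sum>i\<in>I. (c i * \<mu> (x i)) *\<^sub>C v)"
    unfolding clinear_sum[OF \<rho>_lin_left]
    by (rule sum.cong[OF refl]) (use v I in \<open>simp add: wv_def \<rho>_simps scaleC_scaleC\<close>)
  also have "\<dots> = (\<Sum>i\<in>I. c i * \<mu> (x i)) *\<^sub>C v" by (simp add: cvec.scale_sum_left)
  finally show ?thesis using v(2) by simp
qed

lemma wv_tt_sum:
  assumes "wv \<mu> v" "v \<noteq> 0" "\<gamma> \<in> \<Delta>"
  shows "(\<Sum>b\<in>Hb. \<gamma> b * \<mu> (Hd b)) = \<mu> (tt \<gamma>)" "(\<Sum>b\<in>Hb. \<mu> b * \<gamma> (Hd b)) = \<mu> (tt \<gamma>)"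
proof -
  have g: "\<gamma> \<in> roots H" using assms \<Delta>_roots by blast
  have "tt \<gamma> = (\<Sum>b\<in>Hb. \<gamma> b *\<^sub>C Hd b)"
    using hb(5)[OF tt_H[OF g]] killing_tt[OF g hb(2)] by simp
  then show "(\<Sum>b\<in>Hb. \<gamma> b * \<mu> (Hd b)) = \<mu> (tt \<gamma>)"
    using wv_sum[OF assms(1,2) hb(1), of Hd \<gamma>] hb by simp
  have "tt \<gamma> = (\<Sum>b\<in>Hb. \<gamma> (Hd b) *\<^sub>C b)"
    using hb(4)[OF tt_H[OF g]] killing_tt[OF g hb(3)] by simp
  then show "(\<Sum>b\<in>Hb. \<mu> b * \<gamma> (Hd b)) = \<mu> (tt \<gamma>)"
    using wv_sum[OF assms(1,2) hb(1), of "\<lambda>b. b" "\<lambda>b. \<gamma> (Hd b)"] hb by (simp add: mult.commute)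
qed

text \<open>The difference of the Casimir values is
  \<open>(l - \<mu>, l + \<mu> + 2 \<rho>)\<close>, a sum of the \<open>n \<gamma>\<close> with
  strictly positive factors. Equal values therefore leave no room between \<open>\<mu>\<close> and
  \<open>l\<close>.\<close>

lemma cw_eq_imp:
  assumes l: "wv l v" "v \<noteq> 0" "\<And>\<alpha>. \<alpha> \<in> \<Delta>p \<Longrightarrow> 0 \<le> l (tt \<alpha>)"
    and m: "wv \<mu> u" "u \<noteq> 0" "\<And>\<alpha>. \<alpha> \<in> \<Delta>p \<Longrightarrow> 0 \<le> \<mu> (tt \<alpha>)"
    and n: "\<And>h. h \<in> H \<Longrightarrow> l h - \<mu> h = (\<Sum>\<gamma>\<in>\<Delta>p. of_nat (n \<gamma>) * \<gamma> h)"
    and eq: "cw l = cw \<mu>" and g: "\<gamma> \<in> \<Delta>p"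
  shows "n \<gamma> = (0::nat)"
proof -
  let ?k = "\<lambda>\<gamma>. l (tt \<gamma>) + \<mu> (tt \<gamma>) + (\<Sum>\<alpha>\<in>\<Delta>p. \<gamma> (tt \<alpha>))"
  have lm: "l h = \<mu> h + (\<Sum>\<gamma>\<in>\<Delta>p. of_nat (n \<gamma>) * \<gamma> h)" if "h \<in> H" for h using n[OF that] by (simp add: algebra_simps)
  have "(\<Sum>b\<in>Hb. l b * l (Hd b)) - (\<Sum>b\<in>Hb. \<mu> b * \<mu> (Hd b)) =
      (\<Sum>b\<in>Hb. (l b - \<mu> b) * l (Hd b) + \<mu> b * (l (Hd b) - \<mu> (Hd b)))"
    unfolding sum_subtractf[symmetric] by (rule sum.cong) (auto simp: algebra_simps)
  also have "\<dots> = (\<Sum>b\<in>Hb. (\<Sum>\<gamma>\<in>\<Delta>p. of_nat (n \<gamma>) * (\<gamma> b * l (Hd b))) + (\<Sum>\<gamma>\<in>\<Delta>p. of_nat (n \<gamma>) * (\<mu> b * \<gamma> (Hd b))))"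
    by (rule sum.cong[OF refl])
      (use n hb in \<open>simp add: sum_distrib_left sum_distrib_right mult_ac\<close>)
  also have "\<dots> = (\<Sum>\<gamma>\<in>\<Delta>p. \<Sum>b\<in>Hb. of_nat (n \<gamma>) * (\<gamma> b * l (Hd b))) + (\<Sum>\<gamma>\<in>\<Delta>p. \<Sum>b\<in>Hb. of_nat (n \<gamma>) * (\<mu> b * \<gamma> (Hd b)))"
    by (simp add: sum.distrib sum.swap[of _ Hb])
  also have "\<dots> = (\<Sum>\<gamma>\<in>\<Delta>p. of_nat (n \<gamma>) * l (tt \<gamma>)) + (\<Sum>\<gamma>\<in>\<Delta>p. of_nat (n \<gamma>) * \<mu> (tt \<gamma>))"
    using wv_tt_sum[OF l(1,2)] wv_tt_sum[OF m(1,2)] \<Delta>p_\<Delta> by (simp flip: sum_distrib_left)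
  finally have 1: "(\<Sum>b\<in>Hb. l b * l (Hd b)) - (\<Sum>b\<in>Hb. \<mu> b * \<mu> (Hd b)) =
      (\<Sum>\<gamma>\<in>\<Delta>p. of_nat (n \<gamma>) * l (tt \<gamma>)) + (\<Sum>\<gamma>\<in>\<Delta>p. of_nat (n \<gamma>) * \<mu> (tt \<gamma>))" .
  have "(\<Sum>\<alpha>\<in>\<Delta>p. l (tt \<alpha>)) - (\<Sum>\<alpha>\<in>\<Delta>p. \<mu> (tt \<alpha>)) = (\<Sum>\<alpha>\<in>\<Delta>p. \<Sum>\<gamma>\<in>\<Delta>p. of_nat (n \<gamma>) * \<gamma> (tt \<alpha>))"
    unfolding sum_subtractf[symmetric] by (rule sum.cong[OF refl]) (use n tt_H \<Delta>p_\<Delta> \<Delta>_roots in auto)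
  also have "\<dots> = (\<Sum>\<gamma>\<in>\<Delta>p. of_nat (n \<gamma>) * (\<Sum>\<alpha>\<in>\<Delta>p. \<gamma> (tt \<alpha>)))"
    by (subst sum.swap) (simp add: sum_distrib_left)
  finally have 2: "(\<Sum>\<alpha>\<in>\<Delta>p. l (tt \<alpha>)) - (\<Sum>\<alpha>\<in>\<Delta>p. \<mu> (tt \<alpha>)) = (\<Sum>\<gamma>\<in>\<Delta>p. of_nat (n \<gamma>) * (\<Sum>\<alpha>\<in>\<Delta>p. \<gamma> (tt \<alpha>)))" .
  have 0: "0 = (\<Sum>\<gamma>\<in>\<Delta>p. of_nat (n \<gamma>) * ?k \<gamma>)"
    using eq 1 2 unfolding cw_def by (simp add: sum.distrib distrib_left algebra_simps)
  have k: "0 < ?k \<gamma>" if "\<gamma> \<in> \<Delta>p" for \<gamma>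
    using two_rho_pos[OF that] l(3)[OF that] m(3)[OF that] by (auto simp: less_complex_def less_eq_complex_def)
  have "0 \<le> of_nat (n \<gamma>) * ?k \<gamma>" if "\<gamma> \<in> \<Delta>p" for \<gamma>
    by (rule mult_nonneg_nonneg[OF of_nat_complex_nonneg less_imp_le[OF k[OF that]]])
  then have "of_nat (n \<gamma>) * ?k \<gamma> = 0"
    by (rule sum_nonneg_0[OF finite_\<Delta>p _ 0[symmetric] g])
  moreover have "?k \<gamma> \<noteq> 0" by (rule not_sym[OF less_imp_neq[OF k[OF g]]])
  ultimately show ?thesis by simp
qed

subsection \<open>Cyclic submodules\<close>

definition word :: "'v \<Rightarrow> ('g \<Rightarrow> complex) list \<Rightarrow> 'v" where
  "word u \<alpha>s = foldr (\<lambda>\<alpha>. \<rho> (rv (neg \<alpha>))) \<alpha>s u"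

definition wt :: "('g \<Rightarrow> complex) \<Rightarrow> ('g \<Rightarrow> complex) list \<Rightarrow> 'g \<Rightarrow> complex" where
  "wt \<mu> \<alpha>s = (\<lambda>h. \<mu> h - sum_list (map (\<lambda>\<alpha>. \<alpha> h) \<alpha>s))"

text \<open>A relative version: if raising operators send the weight vector \<open>u\<close> into
  the submodule \<open>N\<close>, then \<open>N\<close> and the lowered vectors already span the
  submodule generated by \<open>N\<close> and \<open>u\<close>. The case \<open>N = {0}\<close> is
  the usual highest weight module.\<close>

definition cyc :: "'v set \<Rightarrow> 'v \<Rightarrow> 'v set" where
  "cyc N u = cspan (N \<union> word u ` lists \<Delta>p)"

lemma word_Nil: "word u [] = u" and word_Cons: "word u (\<alpha> # \<alpha>s) = \<rho> (rv (neg \<alpha>)) (word u \<alpha>s)"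
  by (simp_all add: word_def)

lemma word_weight: "wv \<mu> u \<Longrightarrow> \<alpha>s \<in> lists \<Delta>p \<Longrightarrow> wv (wt \<mu> \<alpha>s) (word u \<alpha>s)"
proof (induction \<alpha>s)
  case (Cons \<alpha> \<alpha>s)
  then have "wv (\<lambda>h. wt \<mu> \<alpha>s h + neg \<alpha> h) (word u (\<alpha> # \<alpha>s))"
    unfolding word_Cons by (intro wv_root) (use neg_\<Delta> \<Delta>p_\<Delta> in auto)
  moreover have "(\<lambda>h. wt \<mu> \<alpha>s h + neg \<alpha> h) = wt \<mu> (\<alpha> # \<alpha>s)" by (simp add: wt_def fun_eq_iff)
  ultimately show ?case by simp
qed (simp add: word_Nil wt_def)

lemma cyc_subset: "N \<subseteq> cyc N u" "u \<in> cyc N u"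
proof -
  show "N \<subseteq> cyc N u" unfolding cyc_def using cvec.span_superset[of "N \<union> word u ` lists \<Delta>p"] by auto
  have "word u [] \<in> word u ` lists \<Delta>p" by (rule imageI) simp
  then show "u \<in> cyc N u" unfolding cyc_def word_Nil by (intro cvec.span_base) blast
qed

lemma cyc_word: "\<alpha>s \<in> lists \<Delta>p \<Longrightarrow> word u \<alpha>s \<in> cyc N u"
  unfolding cyc_def by (intro cvec.span_base) blast

lemma subspace_cyc: "csubspace (cyc N u)" by (simp add: cyc_def)

lemma cyc_minimal: "submod X \<Longrightarrow> N \<subseteq> X \<Longrightarrow> u \<in> X \<Longrightarrow> cyc N u \<subseteq> X"
proof -
  assume X: "submod X" and NX: "N \<subseteq> X" and uX: "u \<in> X"
  have "word u \<alpha>s \<in> X" if "\<alpha>s \<in> lists \<Delta>p" for \<alpha>s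
    using that by (induction \<alpha>s) (use uX submod_act[OF X rv_lv] neg_\<Delta> \<Delta>p_\<Delta> in \<open>auto simp: word_Nil word_Cons\<close>)
  then show ?thesis unfolding cyc_def using NX submod_sub[OF X] by (intro cvec.span_minimal) auto
qed

text \<open>Moving \<open>x\<close> past the first letter of a word leaves its bracket with a
  lowering operator. That bracket is in \<open>lv\<close> again, so the induction on the word treats
  all \<open>x\<close> in \<open>lv\<close> at once.\<close>

lemma submod_cyc:
  assumes N: "submod N" and u: "wv \<mu> u" "\<forall>\<alpha>\<in>\<Delta>p. \<rho> (rv \<alpha>) u \<in> N"
  shows "submod (cyc N u)"
proof -
  have f: "\<rho> (rv (neg \<alpha>)) v \<in> cyc N u" if v: "v \<in> cyc N u" and a: "\<alpha> \<in> \<Delta>p" for \<alpha> v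
  proof (rule clinear_span_into[OF \<rho>_lin v[unfolded cyc_def] subspace_cyc])
    fix b assume "b \<in> N \<union> word u ` lists \<Delta>p"
    then show "\<rho> (rv (neg \<alpha>)) b \<in> cyc N u"
    proof
      assume "b \<in> N"
      then show ?thesis using submod_act[OF N rv_lv] neg_\<Delta> \<Delta>p_\<Delta> a cyc_subset by blast
    next
      assume "b \<in> word u ` lists \<Delta>p"
      then obtain \<alpha>s where "b = word u \<alpha>s" "\<alpha>s \<in> lists \<Delta>p" by blast
      then show ?thesis using cyc_word[of "\<alpha> # \<alpha>s"] a by (simp add: word_Cons)
    qed
  qed
  have w: "\<rho> x (word u \<alpha>s) \<in> cyc N u" if "\<alpha>s \<in> lists \<Delta>p" "x \<in> lv" for x \<alpha>s
    using that
  proof (induction \<alpha>s arbitrary: x)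
    case Nil
    show ?case
    proof (rule clinear_span_into[OF \<rho>_lin_left lv_span[OF Nil] subspace_cyc])
      fix b assume "b \<in> H \<union> rv ` \<Delta>"
      then consider "b \<in> H" | \<alpha> where "\<alpha> \<in> \<Delta>p" "b = rv \<alpha>" | \<alpha> where "\<alpha> \<in> \<Delta>p" "b = rv (neg \<alpha>)"
        using \<Delta>_split(1) by auto
      then show "\<rho> b (word u []) \<in> cyc N u"
      proof cases
        case 1
        then show ?thesis using u(1) cvec.subspace_scale[OF subspace_cyc cyc_subset(2)] by (simp add: word_Nil wv_def)
      next
        case 2
        then show ?thesis using u(2) cyc_subset by (auto simp: word_Nil)
      next
        case 3
        then show ?thesis using f[OF cyc_subset(2)] by (simp add: word_Nil)
      qed
    qed
  next
    case (Cons \<alpha> \<alpha>s)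
    have a: "\<alpha> \<in> \<Delta>p" "rv (neg \<alpha>) \<in> lv" using Cons.hyps rv_lv neg_\<Delta> \<Delta>p_\<Delta> by auto
    have "\<rho> x (word u (\<alpha> # \<alpha>s)) = \<rho> (rv (neg \<alpha>)) (\<rho> x (word u \<alpha>s)) + \<rho> \<lbrakk>x, rv (neg \<alpha>)\<rbrakk> (word u \<alpha>s)"
      unfolding word_Cons by (rule \<rho>_swap[OF Cons.prems a(2)])
    moreover have "\<rho> (rv (neg \<alpha>)) (\<rho> x (word u \<alpha>s)) \<in> cyc N u" using f Cons a by simp
    moreover have "\<rho> \<lbrakk>x, rv (neg \<alpha>)\<rbrakk> (word u \<alpha>s) \<in> cyc N u" using Cons bracket_lv a by simp
    ultimately show ?case using cvec.subspace_add[OF subspace_cyc] by simp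
  qed
  show ?thesis
    unfolding submod_def
  proof (intro conjI ballI subspace_cyc)
    fix x v assume x: "x \<in> lv" and v: "v \<in> cyc N u"
    show "\<rho> x v \<in> cyc N u"
    proof (rule clinear_span_into[OF \<rho>_lin v[unfolded cyc_def] subspace_cyc])
      fix b assume "b \<in> N \<union> word u ` lists \<Delta>p"
      then show "\<rho> x b \<in> cyc N u" using w x submod_act[OF N x] cyc_subset by blast
    qed
  qed
qed

text \<open>A projection to one weight done term by term: terms of a weight other than
  \<open>\<nu>\<close> are removed, at the price of changing the part in \<open>N\<close>.\<close>

lemma weight_component:
  assumes N: "csubspace N" "\<And>h v. h \<in> H \<Longrightarrow> v \<in> N \<Longrightarrow> \<rho> h v \<in> N"
    and "finite C" "\<And>c. c \<in> C \<Longrightarrow> wv (\<omega> c) c" "n \<in> N" "x = n + (\<Sum>c\<in>C. a c *\<^sub>C c)" "wv \<nu> x"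
  shows "x \<in> cspan (N \<union> {c\<in>C. \<forall>h\<in>H. \<omega> c h = \<nu> h})"
  using assms(3-)
proof (induction "card C" arbitrary: C x n a rule: less_induct)
  case less
  show ?case
  proof (cases "\<forall>c\<in>C. \<forall>h\<in>H. \<omega> c h = \<nu> h")
    case True
    then have "{c\<in>C. \<forall>h\<in>H. \<omega> c h = \<nu> h} = C" by blast
    then show ?thesis unfolding less.prems(4)
      by (simp only:) (intro cvec.span_add cvec.span_sum cvec.span_scale cvec.span_base, use less.prems in auto)
  next
    case False
    then obtain d h where d: "d \<in> C" "h \<in> H" "\<omega> d h \<noteq> \<nu> h" by blast
    \<comment> \<open>\<open>?k\<close> times the operator \<open>\<rho> h - \<omega> d h\<close>
      fixes \<open>x\<close> and annihilates \<open>d\<close>.\<close>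
    let ?k = "1 / (\<nu> h - \<omega> d h)"
    let ?n = "?k *\<^sub>C (\<rho> h n - \<omega> d h *\<^sub>C n)"
    have nN: "?n \<in> N" using less.prems(3) N d by (intro cvec.subspace_scale cvec.subspace_diff) auto
    have ch: "\<rho> h c = \<omega> c h *\<^sub>C c" if "c \<in> C" for c using less.prems(2)[OF that] d(2) by (simp add: wv_def)
    have "x = ?k *\<^sub>C ((\<nu> h - \<omega> d h) *\<^sub>C x)" using d by (simp add: scaleC_scaleC scaleC_one)
    also have "(\<nu> h - \<omega> d h) *\<^sub>C x = \<rho> h x - \<omega> d h *\<^sub>C x"
      using less.prems(5) d by (simp add: wv_def cvec.scale_left_diff_distrib)
    also have "\<dots> = (\<rho> h n - \<omega> d h *\<^sub>C n) + (\<Sum>c\<in>C. \<rho> h (a c *\<^sub>C c) - \<omega> d h *\<^sub>C (a c *\<^sub>C c))"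
      unfolding less.prems(4)
      by (simp add: \<rho>_simps clinear_sum[OF \<rho>_lin] scaleC_add_right cvec.scale_sum_right sum_subtractf)
    also have "(\<Sum>c\<in>C. \<rho> h (a c *\<^sub>C c) - \<omega> d h *\<^sub>C (a c *\<^sub>C c)) = (\<Sum>c\<in>C. (a c * (\<omega> c h - \<omega> d h)) *\<^sub>C c)"
      by (rule sum.cong[OF refl])
        (simp add: \<rho>_simps ch scaleC_scaleC cvec.scale_left_diff_distrib right_diff_distrib mult.commute)
    also have "\<dots> = (\<Sum>c\<in>C - {d}. (a c * (\<omega> c h - \<omega> d h)) *\<^sub>C c)"
      using sum.remove[OF less.prems(1) d(1), of "\<lambda>c. (a c * (\<omega> c h - \<omega> d h)) *\<^sub>C c"] by simp
    also have "?k *\<^sub>C ((\<rho> h n - \<omega> d h *\<^sub>C n) + \<dots>) = ?n + (\<Sum>c\<in>C - {d}. (?k * (a c * (\<omega> c h - \<omega> d h))) *\<^sub>C c)"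
      by (simp add: scaleC_add_right cvec.scale_sum_right scaleC_scaleC)
    finally have x: "x = ?n + (\<Sum>c\<in>C - {d}. (?k * (a c * (\<omega> c h - \<omega> d h))) *\<^sub>C c)" .
    have "x \<in> cspan (N \<union> {c\<in>C - {d}. \<forall>h\<in>H. \<omega> c h = \<nu> h})"
      by (rule less.hyps[OF card_Diff1_less[OF less.prems(1) d(1)] _ _ nN x less.prems(5)])
        (use less.prems in auto)
    moreover have "cspan (N \<union> {c\<in>C - {d}. \<forall>h\<in>H. \<omega> c h = \<nu> h}) \<subseteq> cspan (N \<union> {c\<in>C. \<forall>h\<in>H. \<omega> c h = \<nu> h})"
      by (rule cvec.span_mono) blast
    ultimately show ?thesis by blast
  qed
qed

lemma sum_list_roots: "\<alpha>s \<in> lists \<Delta>p \<Longrightarrow> \<exists>n::('g \<Rightarrow> complex) \<Rightarrow> nat. \<forall>h. sum_list (map (\<lambda>\<alpha>. \<alpha> h) \<alpha>s) = (\<Sum>\<gamma>\<in>\<Delta>p. of_nat (n \<gamma>) * \<gamma> h)"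
proof (induction \<alpha>s)
  case Nil
  show ?case by (intro exI[of _ "\<lambda>_. 0"]) simp
next
  case (Cons \<alpha> \<alpha>s)
  then obtain n :: "('g \<Rightarrow> complex) \<Rightarrow> nat" where
    n: "\<And>h. sum_list (map (\<lambda>\<alpha>. \<alpha> h) \<alpha>s) = (\<Sum>\<gamma>\<in>\<Delta>p. of_nat (n \<gamma>) * \<gamma> h)" by auto
  have "sum_list (map (\<lambda>\<alpha>. \<alpha> h) (\<alpha> # \<alpha>s)) = (\<Sum>\<gamma>\<in>\<Delta>p. of_nat ((n(\<alpha> := Suc (n \<alpha>))) \<gamma>) * \<gamma> h)" for h
  proof -
    have "(\<Sum>\<gamma>\<in>\<Delta>p. of_nat ((n(\<alpha> := Suc (n \<alpha>))) \<gamma>) * \<gamma> h) = (\<Sum>\<gamma>\<in>\<Delta>p. of_nat (n \<gamma>) * \<gamma> h + (if \<gamma> = \<alpha> then \<alpha> h else 0))"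
      by (rule sum.cong[OF refl]) (auto simp: algebra_simps)
    also have "\<dots> = (\<Sum>\<gamma>\<in>\<Delta>p. of_nat (n \<gamma>) * \<gamma> h) + \<alpha> h"
      using Cons.prems finite_\<Delta>p by (simp add: sum.distrib)
    finally show ?thesis using n by simp
  qed
  then show ?case by blast
qed

text \<open>A weight vector outside \<open>N\<close> must share its weight with some word, hence
  lies below \<open>\<mu>\<close>. At the weight \<open>\<mu>\<close> itself only the empty word can
  occur.\<close>

lemma cyc_weights:
  assumes N: "submod N" and u: "wv \<mu> u" and x: "x \<in> cyc N u" "wv \<nu> x" "x \<notin> N"
  shows "le \<nu> \<mu>" and "(\<forall>h\<in>H. \<nu> h = \<mu> h) \<Longrightarrow> x \<in> cspan (N \<union> {u})"
proof -
  have "x \<in> cspan (N \<union> word u ` lists \<Delta>p)" using x(1) by (simp add: cyc_def)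
  then obtain n w where nw: "n \<in> cspan N" "w \<in> cspan (word u ` lists \<Delta>p)" "x = n + w"
    by (auto simp: cvec.span_Un)
  have n: "n \<in> N" using nw(1) cvec.span_eq_iff[THEN iffD2, OF submod_sub[OF N]] by simp
  obtain C a where C: "finite C" "C \<subseteq> word u ` lists \<Delta>p" "w = (\<Sum>c\<in>C. a c *\<^sub>C c)"
    using nw(2) by (rule cspan_imp_finite_sum)
  have "\<forall>c\<in>C. \<exists>\<alpha>s. \<alpha>s \<in> lists \<Delta>p \<and> c = word u \<alpha>s" using C(2) by blast
  from bchoice[OF this] obtain s where s: "s c \<in> lists \<Delta>p" "c = word u (s c)" if "c \<in> C" for c by blast
  let ?D = "{c\<in>C. \<forall>h\<in>H. wt \<mu> (s c) h = \<nu> h}"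
  have xD: "x \<in> cspan (N \<union> ?D)"
  proof (rule weight_component[OF submod_sub[OF N] _ C(1) _ n _ x(2)])
    show "wv (wt \<mu> (s c)) c" if "c \<in> C" for c using word_weight[OF u s(1)[OF that]] s(2)[OF that] by simp
    show "x = n + (\<Sum>c\<in>C. a c *\<^sub>C c)" using nw C by simp
  qed (use submod_act[OF N H_lv] in auto)
  have "?D \<noteq> {}"
  proof
    assume "?D = {}"
    then have "x \<in> cspan N" using xD by (simp only: Un_empty_right)
    then show False using x(3) cvec.span_eq_iff[THEN iffD2, OF submod_sub[OF N]] by simp
  qed
  then obtain c where c: "c \<in> C" "\<forall>h\<in>H. wt \<mu> (s c) h = \<nu> h" by blast
  obtain m :: "('g \<Rightarrow> complex) \<Rightarrow> nat" where "\<forall>h. sum_list (map (\<lambda>\<alpha>. \<alpha> h) (s c)) = (\<Sum>\<gamma>\<in>\<Delta>p. of_nat (m \<gamma>) * \<gamma> h)"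
    using sum_list_roots[OF s(1)[OF c(1)]] by blast
  then have "\<mu> h - \<nu> h = (\<Sum>\<gamma>\<in>\<Delta>p. of_nat (m \<gamma>) * \<gamma> h)" if "h \<in> H" for h
    using c(2)[rule_format, OF that, symmetric] by (simp add: wt_def)
  then show "le \<nu> \<mu>" unfolding le_def by blast
  assume eq: "\<forall>h\<in>H. \<nu> h = \<mu> h"
  have "?D \<subseteq> {u}"
  proof
    fix c assume c: "c \<in> ?D"
    \<comment> \<open>Every letter lowers the height at \<open>t\<rho>\<close> strictly, so a word
      of unchanged height is empty.\<close>
    then have "wt \<mu> (s c) t\<rho> = \<mu> t\<rho>" using eq t\<rho>_H by simp
    then have z: "sum_list (map (\<lambda>\<alpha>. \<alpha> t\<rho>) (s c)) = 0" by (simp add: wt_def)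
    have "\<alpha>s \<in> lists \<Delta>p \<Longrightarrow> \<alpha>s \<noteq> [] \<Longrightarrow> 0 < sum_list (map (\<lambda>\<alpha>. \<alpha> t\<rho>) \<alpha>s)" for \<alpha>s
    proof (induction \<alpha>s)
      case (Cons \<alpha> \<alpha>s)
      then show ?case using t\<rho>_pos[of \<alpha>] by (cases "\<alpha>s = []") (auto intro: add_pos_pos)
    qed simp
    then have "s c = []" using z s(1) c by (metis (no_types, lifting) less_irrefl mem_Collect_eq)
    then show "c \<in> {u}" using s(2) c word_Nil by fastforce
  qed
  then show "x \<in> cspan (N \<union> {u})" using xD cvec.span_mono[of "N \<union> ?D" "N \<union> {u}"] by blast
qed

subsection \<open>Irreducibility and complements\<close>

context
  fixes v l
  assumes v: "v \<in> V" "v \<noteq> 0" "wv l v" "\<And>\<alpha>. \<alpha> \<in> \<Delta>p \<Longrightarrow> \<rho> (rv \<alpha>) v = 0"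
begin

lemma v_killed: "\<forall>\<alpha>\<in>\<Delta>p. \<rho> (rv \<alpha>) v \<in> {0}" using v(4) by simp

lemma submod_cyc_v: "submod (cyc {0} v)"
  by (rule submod_cyc[OF submod_0 v(3) v_killed])

lemma cyc_v_V: "cyc {0} v \<subseteq> V"
  by (rule cyc_minimal[OF submod_V]) (use V_sub cvec.subspace_0 v in auto)

lemma l_nonneg: "\<alpha> \<in> \<Delta>p \<Longrightarrow> 0 \<le> l (tt \<alpha>)"
  by (rule weight_nonneg[OF submod_0 v(1) _ v(3) v_killed]) (use v in auto)

lemma submod_cas_eq: "submod N \<Longrightarrow> submod {x. cas x - c *\<^sub>C x \<in> N}"
proof -
  assume N: "submod N"
  have lin: "clinear (\<lambda>x. cas x - c *\<^sub>C x)" by (intro clinear_minus clinear_cas clinear_scaleC clinear_id)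
  have "cas (\<rho> x v) - c *\<^sub>C \<rho> x v = \<rho> x (cas v - c *\<^sub>C v)" if "x \<in> lv" for x v
    using cas_commute[OF that] by (simp add: \<rho>_simps)
  then show ?thesis
    using csubspace_vimage[OF lin submod_sub[OF N]] submod_act[OF N] by (simp add: submod_def)
qed

lemma cas_cyc_v: "w \<in> cyc {0} v \<Longrightarrow> cas w = cw l *\<^sub>C w"
proof -
  have "cyc {0} v \<subseteq> {x. cas x - cw l *\<^sub>C x \<in> {0}}"
    by (rule cyc_minimal[OF submod_cas_eq[OF submod_0]])
      (use cas_weight[OF submod_0 v(3) v_killed] clinear_0[OF clinear_cas] in auto)
  then show "w \<in> cyc {0} v \<Longrightarrow> cas w = cw l *\<^sub>C w" by auto
qed

text \<open>A highest weight vector of \<open>Y\<close> has the same Casimir value as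
  \<open>v\<close> and a weight below \<open>l\<close>; by \<open>cw_eq_imp\<close> the weights
  agree, and then it is a multiple of \<open>v\<close>.\<close>

lemma irreducible_cyc:
  assumes Y: "submod Y" "Y \<subseteq> cyc {0} v" "Y \<noteq> {0}"
  shows "Y = cyc {0} v"
proof -
  have "\<not> Y \<subseteq> {0}" using Y cvec.subspace_0[OF submod_sub[OF Y(1)]] by blast
  then obtain u \<mu> where u: "u \<in> Y" "u \<notin> {0}" "wv \<mu> u" "\<forall>\<alpha>\<in>\<Delta>p. \<rho> (rv \<alpha>) u \<in> {0}"
    using ex_highest_weight_vector[OF Y(1) _ submod_0] Y(2) cyc_v_V by blast
  have uc: "u \<in> cyc {0} v" using u Y by blast
  have "cas u - cw \<mu> *\<^sub>C u \<in> {0}" by (rule cas_weight[OF submod_0 u(3,4)])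
  then have "cw l = cw \<mu>" using cas_cyc_v[OF uc] u(2) by simp
  have "le \<mu> l" by (rule cyc_weights(1)[OF submod_0 v(3) uc u(3,2)])
  then obtain n :: "('g \<Rightarrow> complex) \<Rightarrow> nat" where n: "l h - \<mu> h = (\<Sum>\<gamma>\<in>\<Delta>p. of_nat (n \<gamma>) * \<gamma> h)" if "h \<in> H" for h
    unfolding le_def by blast
  have "0 \<le> \<mu> (tt \<alpha>)" if "\<alpha> \<in> \<Delta>p" for \<alpha>
    by (rule weight_nonneg[OF submod_0 _ u(2,3,4) that]) (use uc cyc_v_V in blast)
  then have "n \<gamma> = 0" if "\<gamma> \<in> \<Delta>p" for \<gamma>
    using cw_eq_imp[OF v(3,2) l_nonneg u(3) _ _ n \<open>cw l = cw \<mu>\<close> that] u(2) by blast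
  then have "\<forall>h\<in>H. \<mu> h = l h" using n by simp
  then have "u \<in> cspan ({0} \<union> {v})" by (rule cyc_weights(2)[OF submod_0 v(3) uc u(3,2)])
  then obtain k where k: "u = k *\<^sub>C v" by (auto simp: insert_commute[of v 0] cvec.span_insert_0 cvec.span_singleton)
  then have "v = (1 / k) *\<^sub>C u" using u(2) by (auto simp: scaleC_scaleC scaleC_one)
  then have "v \<in> Y" using u(1) cvec.subspace_scale[OF submod_sub[OF Y(1)]] by simp
  then have "cyc {0} v \<subseteq> Y" using cvec.subspace_0[OF submod_sub[OF Y(1)]] by (intro cyc_minimal[OF Y(1)]) auto
  then show ?thesis using Y(2) by blast
qed

text \<open>Let \<open>U\<close> be maximal among the submodules meeting \<open>cyc {0} v\<close>
  only in 0. If the sum fell short of \<open>V\<close>, a highest weight vector \<open>u\<close>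
  modulo the sum would exist, and comparing its weight and Casimir value with those of
  \<open>v\<close> gives a contradiction in each case.\<close>

lemma ex_complement:
  "\<exists>U. submod U \<and> cyc {0} v \<inter> U = {0} \<and> V = {w + u |w u. w \<in> cyc {0} v \<and> u \<in> U}"
proof -
  let ?W = "cyc {0} v"
  let ?A = "{U. submod U \<and> U \<subseteq> V \<and> U \<inter> ?W = {0}}"
  have "{0} \<in> ?A" using submod_0 V_sub cvec.subspace_0 cyc_subset(1)[of "{0}" v] by auto
  then have "?A \<noteq> {}" by blast
  moreover have "\<Union>K \<in> ?A" if K: "K \<noteq> {}" "subset.chain ?A K" for K
  proof -
    have KA: "U \<in> ?A" if "U \<in> K" for U using K(2) that by (auto simp: subset.chain_def)
    have tot: "U \<subseteq> U' \<or> U' \<subseteq> U" if "U \<in> K" "U' \<in> K" for U U' using K(2) that by (auto simp: subset.chain_def)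
    have "csubspace (\<Union>K)"
    proof (rule cvec.subspaceI)
      show "0 \<in> \<Union>K" using K(1) KA submod_sub cvec.subspace_0 by blast
      show "x + y \<in> \<Union>K" if xy: "x \<in> \<Union>K" "y \<in> \<Union>K" for x y
      proof -
        obtain U U' where U: "U \<in> K" "x \<in> U" "U' \<in> K" "y \<in> U'" using xy by blast
        then obtain U'' where "U'' \<in> K" "x \<in> U''" "y \<in> U''" using tot by blast
        moreover have "csubspace U''" using KA[OF \<open>U'' \<in> K\<close>] submod_sub by blast
        ultimately show ?thesis using cvec.subspace_add by blast
      qed
      show "c *\<^sub>C x \<in> \<Union>K" if "x \<in> \<Union>K" for c x
        using that KA submod_sub cvec.subspace_scale by blast
    qed
    then have "submod (\<Union>K)" using KA submod_act unfolding submod_def by blast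
    moreover have "\<Union>K \<inter> ?W = {0}" using K(1) KA by blast
    ultimately show ?thesis using KA by blast
  qed
  ultimately have "\<exists>M\<in>?A. \<forall>X\<in>?A. M \<subseteq> X \<longrightarrow> X = M" by (rule subset_Zorn_nonempty)
  then obtain U where U0: "U \<in> ?A" "\<forall>X\<in>?A. U \<subseteq> X \<longrightarrow> X = U" by (rule bexE)
  then have U: "submod U" "U \<subseteq> V" "U \<inter> ?W = {0}" by auto
  have max: "X = U" if "submod X" "X \<subseteq> V" "X \<inter> ?W = {0}" "U \<subseteq> X" for X
    using U0(2) that by blast
  let ?N = "{w + u |w u. w \<in> ?W \<and> u \<in> U}"
  have Wsub: "csubspace ?W" and Usub: "csubspace U" using submod_sub submod_cyc_v U(1) by blast+
  have vU: "v \<notin> U" using v(2) U(3) cyc_subset(2)[of v "{0}"] by blast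
  have N: "submod ?N"
    unfolding submod_def
  proof (intro conjI ballI cvec.subspace_sums Wsub Usub)
    fix x n assume x: "x \<in> lv" and "n \<in> ?N"
    then obtain w u where "n = w + u" "w \<in> ?W" "u \<in> U" by blast
    then show "\<rho> x n \<in> ?N" using submod_act[OF submod_cyc_v x] submod_act[OF U(1) x] by (auto simp: \<rho>_simps)
  qed
  have WN: "?W \<subseteq> ?N"
  proof
    fix w assume "w \<in> ?W"
    then have "w + 0 \<in> ?N" using cvec.subspace_0[OF Usub] by blast
    then show "w \<in> ?N" by simp
  qed
  have UN: "U \<subseteq> ?N"
  proof
    fix u assume "u \<in> U"
    then have "0 + u \<in> ?N" using cvec.subspace_0[OF Wsub] by blast
    then show "u \<in> ?N" by simp
  qed
  have NV: "?N \<subseteq> V" using cyc_v_V U(2) cvec.subspace_add[OF V_sub] by blast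
  \<comment> \<open>By maximality every submodule properly larger than \<open>U\<close> meets
    \<open>cyc {0} v\<close>, and by irreducibility it then contains \<open>v\<close>.\<close>
  have meet: "v \<in> X" if X: "submod X" "X \<subseteq> V" "U \<subseteq> X" "x \<in> X" "x \<notin> U" for X x
  proof -
    have "X \<inter> ?W \<noteq> {0}" using max[OF X(1-2) _ X(3)] X(4,5) by blast
    then have "X \<inter> ?W = ?W" by (intro irreducible_cyc submod_inter X submod_cyc_v) auto
    then show ?thesis using cyc_subset(2)[of v "{0}"] by blast
  qed
  have "V \<subseteq> ?N"
  proof (rule ccontr)
    assume "\<not> V \<subseteq> ?N"
    then obtain u \<mu> where u: "u \<in> V" "u \<notin> ?N" "wv \<mu> u" "\<forall>\<alpha>\<in>\<Delta>p. \<rho> (rv \<alpha>) u \<in> ?N"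
      using ex_highest_weight_vector[OF submod_V _ N] by blast
    have u0: "u \<noteq> 0" using u(2) cvec.subspace_0[OF submod_sub[OF N]] by blast
    have m0: "0 \<le> \<mu> (tt \<alpha>)" if "\<alpha> \<in> \<Delta>p" for \<alpha> by (rule weight_nonneg[OF N u that])
    have casN: "cas n - cw l *\<^sub>C n \<in> U" if n: "n \<in> ?N" for n
    proof -
      obtain w y where wy: "n = w + y" "w \<in> ?W" "y \<in> U" using n by blast
      have "cas n - cw l *\<^sub>C n = cas y - cw l *\<^sub>C y"
        unfolding wy(1) clinear_add[OF clinear_cas] cas_cyc_v[OF wy(2)] by (simp add: scaleC_add_right)
      also have "\<dots> \<in> U" using submod_cas[OF U(1) wy(3)] Usub wy(3) by (simp add: cvec.subspace_diff cvec.subspace_scale)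
      finally show ?thesis .
    qed
    have cu: "cas u - cw \<mu> *\<^sub>C u \<in> ?N" by (rule cas_weight[OF N u(3,4)])
    \<comment> \<open>If the values differed, \<open>cas u - cw l u\<close> would be an eigenvector
      for \<open>cw \<mu>\<close> modulo \<open>U\<close>. The eigenvectors of this kind form a
      submodule larger than \<open>U\<close>, so it would contain \<open>v\<close>, whose value is
      \<open>cw l\<close>.\<close>
    have eq: "cw l = cw \<mu>"
    proof (rule ccontr)
      assume ne: "cw l \<noteq> cw \<mu>"
      let ?u = "cas u - cw l *\<^sub>C u"
      let ?X = "V \<inter> {x. cas x - cw \<mu> *\<^sub>C x \<in> U}"
      have X: "submod ?X" by (intro submod_inter submod_V submod_cas_eq U(1))
      have "cas ?u - cw \<mu> *\<^sub>C ?u = cas (cas u - cw \<mu> *\<^sub>C u) - cw l *\<^sub>C (cas u - cw \<mu> *\<^sub>C u)"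
        by (simp add: clinear_diff[OF clinear_cas] clinear_scale[OF clinear_cas] cvec.scale_right_diff_distrib
            scaleC_scaleC algebra_simps)
      then have "cas ?u - cw \<mu> *\<^sub>C ?u \<in> U" using casN[OF cu] by simp
      moreover have "?u \<in> V" using submod_cas[OF submod_V u(1)] u(1) V_sub by (simp add: cvec.subspace_diff cvec.subspace_scale)
      ultimately have uX: "?u \<in> ?X" by blast
      have "?u \<notin> ?N"
      proof
        assume "?u \<in> ?N"
        then have "?u - (cas u - cw \<mu> *\<^sub>C u) \<in> ?N" using cu submod_sub[OF N] cvec.subspace_diff by blast
        then have "(cw \<mu> - cw l) *\<^sub>C u \<in> ?N" by (simp add: cvec.scale_left_diff_distrib)
        then have "(1 / (cw \<mu> - cw l)) *\<^sub>C ((cw \<mu> - cw l) *\<^sub>C u) \<in> ?N"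
          using submod_sub[OF N] cvec.subspace_scale by blast
        then show False using u(2) ne by (simp add: scaleC_scaleC scaleC_one)
      qed
      then have "?u \<notin> U" using UN by blast
      moreover have "U \<subseteq> ?X"
        using U(2) submod_cas[OF U(1)] Usub by (auto simp: cvec.subspace_diff cvec.subspace_scale)
      ultimately have "v \<in> ?X" using meet[OF X _ _ uX] by blast
      then have "(cw l - cw \<mu>) *\<^sub>C v \<in> U"
        using cas_cyc_v[OF cyc_subset(2)] by (simp add: cvec.scale_left_diff_distrib)
      then have "(1 / (cw l - cw \<mu>)) *\<^sub>C ((cw l - cw \<mu>) *\<^sub>C v) \<in> U" using Usub cvec.subspace_scale by blast
      then show False using vU ne by (simp add: scaleC_scaleC scaleC_one)
    qed
    show False
    proof (cases "\<exists>\<alpha>\<in>\<Delta>p. \<rho> (rv \<alpha>) u \<notin> U")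
      \<comment> \<open>The raised vector is a weight vector of \<open>cyc U v\<close> outside
        \<open>U\<close>, so \<open>\<mu> + \<alpha>\<close> lies below \<open>l\<close>. With equal
        Casimir values there is no room for the extra \<open>\<alpha>\<close>.\<close>
      case True
      then obtain \<alpha> where a: "\<alpha> \<in> \<Delta>p" "\<rho> (rv \<alpha>) u \<notin> U" by blast
      have "?N \<subseteq> cyc U v"
      proof -
        have "?W \<subseteq> cyc U v"
          unfolding cyc_def[of "{0}"]
          by (rule cvec.span_minimal[OF _ subspace_cyc]) (use cyc_word cvec.subspace_0[OF subspace_cyc] in auto)
        then show ?thesis using cyc_subset(1)[of U v] cvec.subspace_add[OF subspace_cyc] by blast
      qed
      then have "\<rho> (rv \<alpha>) u \<in> cyc U v" using u(4) a by blast
      moreover have "wv (\<lambda>h. \<mu> h + \<alpha> h) (\<rho> (rv \<alpha>) u)" using wv_root u(3) \<Delta>p_\<Delta> a by blast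
      ultimately have "le (\<lambda>h. \<mu> h + \<alpha> h) l" using cyc_weights(1)[OF U(1) v(3)] a by blast
      then obtain n :: "('g \<Rightarrow> complex) \<Rightarrow> nat" where
        n: "l h - (\<mu> h + \<alpha> h) = (\<Sum>\<gamma>\<in>\<Delta>p. of_nat (n \<gamma>) * \<gamma> h)" if "h \<in> H" for h unfolding le_def by blast
      have n': "l h - \<mu> h = (\<Sum>\<gamma>\<in>\<Delta>p. of_nat ((n(\<alpha> := Suc (n \<alpha>))) \<gamma>) * \<gamma> h)" if "h \<in> H" for h
      proof -
        have "(\<Sum>\<gamma>\<in>\<Delta>p. of_nat ((n(\<alpha> := Suc (n \<alpha>))) \<gamma>) * \<gamma> h) = (\<Sum>\<gamma>\<in>\<Delta>p. of_nat (n \<gamma>) * \<gamma> h + (if \<gamma> = \<alpha> then \<alpha> h else 0))"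
          by (rule sum.cong[OF refl]) (auto simp: algebra_simps)
        also have "\<dots> = (\<Sum>\<gamma>\<in>\<Delta>p. of_nat (n \<gamma>) * \<gamma> h) + \<alpha> h"
          using a finite_\<Delta>p by (simp add: sum.distrib)
        finally show ?thesis using n[OF that] by (simp add: algebra_simps)
      qed
      have "(n(\<alpha> := Suc (n \<alpha>))) \<alpha> = 0"
        by (rule cw_eq_imp[OF v(3,2) l_nonneg u(3) u0 m0 n' eq a(1)])
      then show False by simp
    next
      \<comment> \<open>Now \<open>u\<close> is a highest weight vector modulo \<open>U\<close>, so
        \<open>cyc U u\<close> is a submodule larger than \<open>U\<close> and contains
        \<open>v\<close>. The weights agree, and solving for \<open>u\<close> puts it into the sum
        after all.\<close>
      case False
      then have uU: "\<forall>\<alpha>\<in>\<Delta>p. \<rho> (rv \<alpha>) u \<in> U" by blast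
      have X: "submod (cyc U u)" by (rule submod_cyc[OF U(1) u(3) uU])
      have "cyc U u \<subseteq> V" by (rule cyc_minimal[OF submod_V U(2) u(1)])
      moreover have "u \<notin> U" using u(2) UN by blast
      ultimately have vX: "v \<in> cyc U u" using meet[OF X _ cyc_subset(1) cyc_subset(2)] by blast
      then have "le l \<mu>" using cyc_weights(1)[OF U(1) u(3) vX v(3) vU] by blast
      then obtain n :: "('g \<Rightarrow> complex) \<Rightarrow> nat" where
        n: "\<mu> h - l h = (\<Sum>\<gamma>\<in>\<Delta>p. of_nat (n \<gamma>) * \<gamma> h)" if "h \<in> H" for h unfolding le_def by blast
      have "n \<gamma> = 0" if "\<gamma> \<in> \<Delta>p" for \<gamma>
        by (rule cw_eq_imp[OF u(3) u0 m0 v(3,2) l_nonneg n eq[symmetric] that])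
      then have "\<forall>h\<in>H. l h = \<mu> h" using n by simp
      then have "v \<in> cspan (U \<union> {u})" by (rule cyc_weights(2)[OF U(1) u(3) vX v(3) vU])
      then obtain k where k: "v - k *\<^sub>C u \<in> U"
        using cvec.span_breakdown_eq[of v u U] cvec.span_eq_iff[THEN iffD2, OF Usub] by auto
      then have "k \<noteq> 0" using vU by auto
      have "v \<in> ?N" using WN cyc_subset(2) by (rule subsetD)
      moreover have "v - k *\<^sub>C u \<in> ?N" using UN k by (rule subsetD)
      ultimately have "v - (v - k *\<^sub>C u) \<in> ?N" by (rule cvec.subspace_diff[OF submod_sub[OF N]])
      then have "(1 / k) *\<^sub>C (v - (v - k *\<^sub>C u)) \<in> ?N" by (rule cvec.subspace_scale[OF submod_sub[OF N]])
      then show False using u(2) \<open>k \<noteq> 0\<close> by (simp add: scaleC_scaleC scaleC_one)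
    qed
  qed
  then have "V = ?N" using NV by blast
  then show ?thesis using U by (intro exI[of _ U]) auto
qed

end

end

section \<open>Derivations of the symmetric algebra\<close>

lemma sym_scale_mult_left: "(c *\<^sub>C a) * b = c *\<^sub>C (a * (b::'a::complex_vector sym_alg))"
  by transfer (simp add: mult.assoc sym_rel_def sym_ideal.zero)

lemma sym_scale_mult_right: "a * (c *\<^sub>C b) = c *\<^sub>C (a * (b::'a::complex_vector sym_alg))"
  using sym_scale_mult_left[of c b a] by (simp add: mult.commute)

lemma clinear_mult_left: "clinear (\<lambda>a. b * (a::'a::complex_vector sym_alg))"
  by (rule clinearI) (simp_all add: distrib_left sym_scale_mult_right)

lemma clinear_mult_right: "clinear (\<lambda>a. (a::'a::complex_vector sym_alg) * b)"
  by (rule clinearI) (simp_all add: distrib_right sym_scale_mult_left)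

lemma clinear_sym_inj: "clinear sym_inj"
  by (rule clinearI) (simp_all add: sym_inj_add sym_inj_scale)

lemma abs_surj: "\<exists>p. a = abs_sym_alg p"
  using Quotient_abs_rep[OF Quotient_sym_alg, of a] by metis

lemma abs_single:
  "abs_sym_alg (Poly_Mapping.single m c) = c *\<^sub>C prod_mset (image_mset sym_inj m)"
proof (induction m)
  case empty
  have "Poly_Mapping.single {#} c = vconst c * (1 :: 'a vpoly)" by simp
  then show ?case by (simp add: scaleC_sym_alg.abs_eq one_sym_alg_def)
next
  case (add x m)
  have "Poly_Mapping.single (add_mset x m) c = indet x * Poly_Mapping.single m c"
    by (simp add: mult_single)
  then have "abs_sym_alg (Poly_Mapping.single (add_mset x m) c) = sym_inj x * abs_sym_alg (Poly_Mapping.single m c)"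
    by (simp add: times_sym_alg.abs_eq sym_inj.abs_eq)
  then show ?case using add by (simp add: sym_scale_mult_right)
qed

lemma sym_alg_induct:
  assumes "\<And>m c. Q (c *\<^sub>C prod_mset (image_mset sym_inj m))" "\<And>a b. Q a \<Longrightarrow> Q b \<Longrightarrow> Q (a + b)"
  shows "Q a"
proof -
  have "Q (abs_sym_alg p)" for p
  proof (induction p rule: vpoly_induct)
    case (single m c)
    show ?case using assms(1) by (simp add: abs_single)
  next
    case (add p q)
    then show ?case using assms(2) by (simp flip: plus_sym_alg.abs_eq)
  qed
  moreover obtain p where "a = abs_sym_alg p" using abs_surj by blast
  ultimately show ?thesis by simp
qed

definition derivation :: "('a::complex_vector sym_alg \<Rightarrow> 'a sym_alg) \<Rightarrow> bool" where
  "derivation D \<longleftrightarrow> clinear D \<and> (\<forall>a b. D (a * b) = D a * b + a * D b)"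

lemma derivation_linear: "derivation D \<Longrightarrow> clinear D" by (simp add: derivation_def)
lemma derivation_mult: "derivation D \<Longrightarrow> D (a * b) = D a * b + a * D b" by (simp add: derivation_def)

lemma derivation_1: "derivation D \<Longrightarrow> D 1 = 0"
  using derivation_mult[of D 1 1] by (simp del: mult_1_left mult_1_right add: mult_1[of 1]) simp

lemma derivation_add: "derivation D \<Longrightarrow> derivation E \<Longrightarrow> derivation (\<lambda>a. D a + E a)"
  unfolding derivation_def by (auto intro: clinear_plus simp: algebra_simps)

lemma derivation_diff: "derivation D \<Longrightarrow> derivation E \<Longrightarrow> derivation (\<lambda>a. D a - E a)"
  unfolding derivation_def by (auto intro: clinear_minus simp: algebra_simps)

lemma derivation_scale: "derivation D \<Longrightarrow> derivation (\<lambda>a. c *\<^sub>C D a)"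
  unfolding derivation_def
  by (auto intro: clinear_scaleC simp: scaleC_add_right sym_scale_mult_left sym_scale_mult_right)

lemma derivation_commutator: "derivation D \<Longrightarrow> derivation E \<Longrightarrow> derivation (\<lambda>a. D (E a) - E (D a))"
  unfolding derivation_def
  by (auto intro: clinear_minus clinear_compose simp: clinear_add algebra_simps)

lemma derivation_eq_0:
  assumes D: "derivation D" and "\<And>x. D (sym_inj x) = 0"
  shows "D a = 0"
proof (induction a rule: sym_alg_induct)
  case (1 m c)
  have "D (prod_mset (image_mset sym_inj m)) = 0"
    by (induction m) (auto simp: derivation_1[OF D] derivation_mult[OF D] assms(2))
  then show ?case by (simp add: clinear_scale[OF derivation_linear[OF D]])
next
  case (2 a b)
  then show ?case by (simp add: clinear_add[OF derivation_linear[OF D]])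
qed

text \<open>Linearity and the Leibniz rule determine a derivation by its values on generators, which
  reduces the identities below to identities in g.\<close>

lemma derivation_eqI:
  assumes "derivation D" "derivation E" "\<And>x. D (sym_inj x) = E (sym_inj x)"
  shows "D a = E a"
  using derivation_eq_0[OF derivation_diff[OF assms(1,2)], of a] assms(3) by simp

lemma derivation_sym_act: "derivation (sym_act x)"
  unfolding derivation_def
  by (auto intro: clinearI simp: sym_act_add sym_act_scale sym_act_mult)

lemma sym_act_add_left: "sym_act (x + y) a = sym_act x a + sym_act y a"
  by (rule derivation_eqI[of "sym_act (x + y)" "\<lambda>a. sym_act x a + sym_act y a"])
    (auto intro: derivation_add derivation_sym_act simp: sym_act_sym_inj bracket_add_left sym_inj_add)

lemma sym_act_scale_left: "sym_act (c *\<^sub>C x) a = c *\<^sub>C sym_act x a"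
  by (rule derivation_eqI[of "sym_act (c *\<^sub>C x)" "\<lambda>a. c *\<^sub>C sym_act x a"])
    (auto intro: derivation_scale derivation_sym_act simp: sym_act_sym_inj bracket_scale_left sym_inj_scale)

lemma clinear_sym_act_left: "clinear (\<lambda>x. sym_act x a)"
  by (rule clinearI) (simp_all add: sym_act_add_left sym_act_scale_left)

lemma clinear_sym_act: "clinear (sym_act x)"
  by (rule derivation_linear[OF derivation_sym_act])

lemma sym_act_bracket: "sym_act \<lbrakk>x, y\<rbrakk> a = sym_act x (sym_act y a) - sym_act y (sym_act x a)"
  by (rule derivation_eqI[of "sym_act \<lbrakk>x, y\<rbrakk>" "\<lambda>a. sym_act x (sym_act y a) - sym_act y (sym_act x a)"])
    (auto intro: derivation_commutator derivation_sym_act simp: sym_act_sym_inj bracket_bracket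
      clinear_diff[OF clinear_sym_inj])

subsection \<open>Contraction with a linear functional\<close>

definition mono_der :: "('a \<Rightarrow> complex) \<Rightarrow> 'a multiset \<Rightarrow> 'a vpoly" where
  "mono_der \<phi> m = (\<Sum>y\<in>#m. Poly_Mapping.single (m - {#y#}) (\<phi> y))"

definition vpoly_der :: "('a \<Rightarrow> complex) \<Rightarrow> 'a vpoly \<Rightarrow> 'a vpoly" where
  "vpoly_der \<phi> p = (\<Sum>m\<in>Poly_Mapping.keys p. vconst (Poly_Mapping.lookup p m) * mono_der \<phi> m)"

lemma vpoly_der_superset:
  assumes "finite A" "Poly_Mapping.keys p \<subseteq> A"
  shows "vpoly_der \<phi> p = (\<Sum>m\<in>A. vconst (Poly_Mapping.lookup p m) * mono_der \<phi> m)"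
  unfolding vpoly_der_def
  by (rule sum.mono_neutral_left) (use assms in \<open>auto simp: in_keys_iff\<close>)

lemma vpoly_der_add: "vpoly_der \<phi> (p + q) = vpoly_der \<phi> p + vpoly_der \<phi> q"
proof -
  let ?A = "Poly_Mapping.keys p \<union> Poly_Mapping.keys q"
  have "Poly_Mapping.keys (p + q) \<subseteq> ?A" by (rule keys_add)
  then show ?thesis
    by (simp add: vpoly_der_superset[of ?A] lookup_add single_add distrib_right sum.distrib)
qed

lemma vpoly_der_0: "vpoly_der \<phi> 0 = 0"
  by (simp add: vpoly_der_def)

lemma vpoly_der_diff: "vpoly_der \<phi> (p - q) = vpoly_der \<phi> p - vpoly_der \<phi> q"
  using vpoly_der_add[of \<phi> "p - q" q] by (simp add: eq_diff_eq)

lemma vpoly_der_single: "vpoly_der \<phi> (Poly_Mapping.single m c) = vconst c * mono_der \<phi> m"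
  by (simp add: vpoly_der_superset[of "{m}"])

lemma mono_der_union:
  "mono_der \<phi> (m + n) =
     mono_der \<phi> m * Poly_Mapping.single n 1 + Poly_Mapping.single m 1 * mono_der \<phi> n"
proof -
  have 1: "(\<Sum>y\<in>#m. Poly_Mapping.single (m + n - {#y#}) (\<phi> y)) =
      (\<Sum>y\<in>#m. Poly_Mapping.single (m - {#y#}) (\<phi> y) * Poly_Mapping.single n 1)"
    by (intro arg_cong[where f = sum_mset] image_mset_cong)
      (auto simp: mult_single dest!: multi_member_split)
  have 2: "(\<Sum>y\<in>#n. Poly_Mapping.single (m + n - {#y#}) (\<phi> y)) =
      (\<Sum>y\<in>#n. Poly_Mapping.single m 1 * Poly_Mapping.single (n - {#y#}) (\<phi> y))"
    by (intro arg_cong[where f = sum_mset] image_mset_cong)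
      (auto simp: mult_single dest!: multi_member_split)
  show ?thesis
    unfolding mono_der_def by (simp only: image_mset_union sum_mset.union 1 2 sum_mset_distrib_left
        sum_mset_distrib_right)
qed

lemma vpoly_der_mult: "vpoly_der \<phi> (p * q) = vpoly_der \<phi> p * q + p * vpoly_der \<phi> q"
proof (induction p rule: vpoly_induct)
  case (single m c)
  show ?case
  proof (induction q rule: vpoly_induct)
    case (single n d)
    have m: "Poly_Mapping.single m c = vconst c * Poly_Mapping.single m 1"
      and n: "Poly_Mapping.single n d = vconst d * Poly_Mapping.single n 1"
      and cd: "vconst (c * d) = vconst c * (vconst d :: 'a vpoly)"
      by (simp_all add: mult_single)
    have "vpoly_der \<phi> (Poly_Mapping.single m c * Poly_Mapping.single n d) =
        vconst c * vconst d *
          (mono_der \<phi> m * Poly_Mapping.single n 1 + Poly_Mapping.single m 1 * mono_der \<phi> n)"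
      by (simp only: mult_single vpoly_der_single mono_der_union cd)
    also have "\<dots> = vpoly_der \<phi> (Poly_Mapping.single m c) * Poly_Mapping.single n d +
        Poly_Mapping.single m c * vpoly_der \<phi> (Poly_Mapping.single n d)"
      by (simp only: vpoly_der_single) (simp only: m n algebra_simps)
    finally show ?case .
  qed (simp add: vpoly_der_add algebra_simps)
qed (simp add: vpoly_der_add algebra_simps)

lemma vpoly_der_indet: "vpoly_der \<phi> (indet x) = vconst (\<phi> x)"
  by (simp add: vpoly_der_single mono_der_def)

lemma vpoly_der_vconst: "vpoly_der \<phi> (vconst c) = 0"
  by (simp add: vpoly_der_single mono_der_def)

lemma vpoly_der_sym_ideal:
  assumes "\<And>x y. \<phi> (x + y) = \<phi> x + \<phi> y" "\<And>c x. \<phi> (c *\<^sub>C x) = c * \<phi> x"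
  shows "p \<in> sym_ideal \<Longrightarrow> vpoly_der \<phi> p \<in> sym_ideal"
proof (induction rule: sym_ideal.induct)
  case (mult p q)
  then show ?case
    by (metis vpoly_der_mult sym_ideal.add sym_ideal.mult)
next
  case (gen_add y z)
  have "vconst (\<phi> y + \<phi> z) = vconst (\<phi> y) + (vconst (\<phi> z) :: 'a vpoly)" by (rule single_add)
  then have "vpoly_der \<phi> (indet (y + z) - indet y - indet z) = 0"
    by (simp add: vpoly_der_diff vpoly_der_indet assms(1))
  then show ?case by (simp only: sym_ideal.zero)
next
  case (gen_scale c y)
  have "vpoly_der \<phi> (indet (c *\<^sub>C y) - vconst c * indet y) = 0"
    by (simp only: vpoly_der_diff vpoly_der_mult vpoly_der_indet vpoly_der_vconst assms(2)) (simp add: mult_single)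
  then show ?case by (simp only: sym_ideal.zero)
qed (simp_all add: vpoly_der_add vpoly_der_0 sym_ideal.zero sym_ideal.add)

text \<open>Contraction respects the defining relations only for linear \<open>\<phi>\<close>, so it
  is defined through representatives; \<open>sym_der_abs\<close> gives the independence of the
  choice once \<open>\<phi>\<close> is linear.\<close>

definition sym_der :: "('a::complex_vector \<Rightarrow> complex) \<Rightarrow> 'a sym_alg \<Rightarrow> 'a sym_alg" where
  "sym_der \<phi> a = abs_sym_alg (vpoly_der \<phi> (rep_sym_alg a))"

context
  fixes \<phi> :: "'a::complex_vector \<Rightarrow> complex"
  assumes \<phi>: "\<And>x y. \<phi> (x + y) = \<phi> x + \<phi> y" "\<And>c x. \<phi> (c *\<^sub>C x) = c * \<phi> x"
begin

lemma sym_der_abs: "sym_der \<phi> (abs_sym_alg p) = abs_sym_alg (vpoly_der \<phi> p)"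
proof -
  have "sym_rel (rep_sym_alg (abs_sym_alg p)) p"
    by (rule Quotient_rep_abs[OF Quotient_sym_alg]) (rule equivp_reflp[OF equivp_sym_rel])
  then have "sym_rel (vpoly_der \<phi> (rep_sym_alg (abs_sym_alg p))) (vpoly_der \<phi> p)"
    unfolding sym_rel_def vpoly_der_diff[symmetric] by (rule vpoly_der_sym_ideal[OF \<phi>])
  then show ?thesis unfolding sym_der_def by (simp add: sym_alg.abs_eq_iff)
qed

lemma derivation_sym_der: "derivation (sym_der \<phi>)"
  unfolding derivation_def
proof (intro conjI allI clinearI)
  fix a b :: "'a sym_alg" and c
  obtain p q where a: "a = abs_sym_alg p" and b: "b = abs_sym_alg q" using abs_surj by metis
  show "sym_der \<phi> (a + b) = sym_der \<phi> a + sym_der \<phi> b"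
    unfolding a b by (simp add: plus_sym_alg.abs_eq sym_der_abs vpoly_der_add)
  show "sym_der \<phi> (a * b) = sym_der \<phi> a * b + a * sym_der \<phi> b"
    unfolding a b by (simp add: plus_sym_alg.abs_eq times_sym_alg.abs_eq sym_der_abs vpoly_der_mult)
  show "sym_der \<phi> (c *\<^sub>C a) = c *\<^sub>C sym_der \<phi> a"
    unfolding a by (simp add: scaleC_sym_alg.abs_eq sym_der_abs vpoly_der_mult vpoly_der_vconst)
qed

lemma sym_der_sym_inj: "sym_der \<phi> (sym_inj x) = \<phi> x *\<^sub>C 1"
proof -
  have "vconst (\<phi> x) = vconst (\<phi> x) * (1 :: 'a vpoly)" by simp
  then show ?thesis
    by (simp add: sym_inj.abs_eq sym_der_abs vpoly_der_indet scaleC_sym_alg.abs_eq one_sym_alg_def)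
qed

end

lemma lookup_mult_empty:
  "Poly_Mapping.lookup (q * p) {#} = Poly_Mapping.lookup q {#} * Poly_Mapping.lookup (p :: 'a vpoly) {#}"
proof (induction q rule: vpoly_induct)
  case (single m c)
  show ?case
    by (induction p rule: vpoly_induct)
      (auto simp: mult_single lookup_single when_def lookup_add algebra_simps)
qed (simp add: lookup_add algebra_simps)

text \<open>The constant term is multiplicative and vanishes on the generating relations. This
  separates 1 from 0 in the quotient, which the nonvanishing argument finally needs.\<close>

lemma sym_ideal_constant_term: "p \<in> sym_ideal \<Longrightarrow> Poly_Mapping.lookup p {#} = 0"
  by (induction rule: sym_ideal.induct) (auto simp: lookup_add lookup_minus lookup_mult_empty lookup_single)

lemma sym_alg_one_neq_zero: "(1 :: 'a::complex_vector sym_alg) \<noteq> 0"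
proof
  assume "(1 :: 'a sym_alg) = 0"
  then have "sym_rel (1 :: 'a vpoly) 0" by (simp add: one_sym_alg_def zero_sym_alg_def sym_alg.abs_eq_iff)
  then have "(1 :: 'a vpoly) \<in> sym_ideal" by (simp add: sym_rel_def)
  then show False using sym_ideal_constant_term by fastforce
qed

subsection \<open>Symmetric powers\<close>

lemma sym_power_0: "sym_power 0 = cspan {1}"
  by (simp add: sym_power_def)

lemma subspace_sym_power: "csubspace (sym_power k)"
  by (simp add: sym_power_def)

lemma sym_power_mult: "a \<in> sym_power k \<Longrightarrow> sym_inj x * a \<in> sym_power (Suc k)"
proof -
  assume a: "a \<in> sym_power k"
  show ?thesis
  proof (rule clinear_span_into[OF clinear_mult_left a[unfolded sym_power_def] subspace_sym_power])
    fix b :: "'a sym_alg" assume "b \<in> {prod_list (map sym_inj xs) |xs. length xs = k}"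
    then obtain xs where "b = prod_list (map sym_inj xs)" "length xs = k" by blast
    then have "sym_inj x * b = prod_list (map sym_inj (x # xs))" "length (x # xs) = Suc k" by simp_all
    then show "sym_inj x * b \<in> sym_power (Suc k)"
      unfolding sym_power_def by (intro cvec.span_base) blast
  qed
qed

lemma sym_power_Suc_span: "(sym_power (Suc k) :: 'a::complex_vector sym_alg set) \<subseteq> cspan {sym_inj x * a |x a. a \<in> sym_power k}"
  unfolding sym_power_def[of "Suc k"]
proof (rule cvec.span_minimal)
  show "{prod_list (map sym_inj xs) |xs. length xs = Suc k} \<subseteq> cspan {sym_inj x * a |x a::'a sym_alg. a \<in> sym_power k}"
  proof
    fix p :: "'a sym_alg" assume "p \<in> {prod_list (map sym_inj xs) |xs. length xs = Suc k}"
    then obtain xs where "p = prod_list (map sym_inj xs)" "length xs = Suc k" by blast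
    then obtain x ys where xs: "p = sym_inj x * prod_list (map sym_inj ys)" "length ys = k"
      by (cases xs) auto
    have "prod_list (map sym_inj ys) \<in> sym_power k"
      unfolding sym_power_def by (rule cvec.span_base) (use xs in blast)
    then show "p \<in> cspan {sym_inj x * a |x a. a \<in> sym_power k}" using xs by (intro cvec.span_base) blast
  qed
qed simp

lemma sym_power_induct:
  assumes D: "clinear D" and S: "csubspace S" "\<And>x b. b \<in> sym_power k \<Longrightarrow> D (sym_inj x * b) \<in> S" and "a \<in> sym_power (Suc k)"
  shows "D a \<in> S"
  by (rule clinear_span_into[OF D subsetD[OF sym_power_Suc_span assms(4)] S(1)]) (use S(2) in auto)

lemma sym_inj_sym_power: "sym_inj x \<in> sym_power 1"
  using sym_power_mult[of 1 0 x] by (simp add: sym_power_0 cvec.span_base)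

lemma derivation_sym_power_0: "derivation D \<Longrightarrow> a \<in> sym_power 0 \<Longrightarrow> D a = 0"
  using clinear_eq_0_on_span[OF derivation_linear, of D a "{1}"] derivation_1 by (auto simp: sym_power_0)

lemma sym_act_sym_power: "a \<in> sym_power k \<Longrightarrow> sym_act x a \<in> sym_power k"
proof (induction k arbitrary: a)
  case 0
  then show ?case
    using derivation_sym_power_0[OF derivation_sym_act 0, of x] cvec.subspace_0[OF subspace_sym_power[of 0]] by simp
next
  case (Suc k)
  show ?case
  proof (rule sym_power_induct[OF clinear_sym_act subspace_sym_power _ Suc.prems])
    fix y and b :: "'a sym_alg" assume "b \<in> sym_power k"
    then show "sym_act x (sym_inj y * b) \<in> sym_power (Suc k)"
      using Suc.IH by (simp add: sym_act_mult sym_act_sym_inj cvec.subspace_add[OF subspace_sym_power] sym_power_mult)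
  qed
qed

lemma sym_der_sym_power:
  assumes \<phi>: "\<And>x y. \<phi> (x + y) = \<phi> x + \<phi> y" "\<And>c x. \<phi> (c *\<^sub>C x) = c * \<phi> x"
  shows "a \<in> sym_power (Suc k) \<Longrightarrow> sym_der \<phi> a \<in> sym_power k"
proof (induction k arbitrary: a)
  case 0
  show ?case
  proof (rule sym_power_induct[OF derivation_linear[OF derivation_sym_der[OF \<phi>]] subspace_sym_power _ 0])
    fix y and b :: "'a sym_alg" assume b: "b \<in> sym_power 0"
    then show "sym_der \<phi> (sym_inj y * b) \<in> sym_power 0"
      using derivation_sym_power_0[OF derivation_sym_der[OF \<phi>] b]
      by (simp add: derivation_mult[OF derivation_sym_der[OF \<phi>]] sym_der_sym_inj[OF \<phi>] sym_scale_mult_left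
          cvec.subspace_scale[OF subspace_sym_power])
  qed
next
  case (Suc k)
  show ?case
  proof (rule sym_power_induct[OF derivation_linear[OF derivation_sym_der[OF \<phi>]] subspace_sym_power _ Suc.prems])
    fix y and b :: "'a sym_alg" assume b: "b \<in> sym_power (Suc k)"
    then show "sym_der \<phi> (sym_inj y * b) \<in> sym_power (Suc k)"
      using Suc.IH[OF b]
      by (simp add: derivation_mult[OF derivation_sym_der[OF \<phi>]] sym_der_sym_inj[OF \<phi>] sym_scale_mult_left
          cvec.subspace_scale[OF subspace_sym_power] cvec.subspace_add[OF subspace_sym_power] sym_power_mult)
  qed
qed

text \<open>Spanning by monomials in a fixed basis of g; with a finite basis of weight vectors this
  yields finite dimension and diagonalizability of symmetric powers.\<close>

lemma sym_power_basis:
  assumes "cspan B = (UNIV :: 'a::complex_vector set)"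
  shows "sym_power k \<subseteq> cspan {prod_list (map sym_inj xs) |xs. set xs \<subseteq> B \<and> length xs = k}"
proof (induction k)
  case 0
  have "{prod_list (map sym_inj xs) |xs. set xs \<subseteq> B \<and> length xs = 0} = {1 :: 'a sym_alg}" by auto
  then show ?case by (simp add: sym_power_0)
next
  case (Suc k)
  let ?M = "\<lambda>k. {prod_list (map sym_inj xs) :: 'a sym_alg |xs. set xs \<subseteq> B \<and> length xs = k}"
  have base: "sym_inj b * m \<in> cspan (?M (Suc k))" if b: "b \<in> B" and m: "m \<in> ?M k" for b m
  proof -
    obtain xs where "m = prod_list (map sym_inj xs)" "set xs \<subseteq> B" "length xs = k" using m by blast
    then have "sym_inj b * m = prod_list (map sym_inj (b # xs))" "set (b # xs) \<subseteq> B" "length (b # xs) = Suc k"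
      using b by simp_all
    then show ?thesis by (intro cvec.span_base) blast
  qed
  have "sym_inj x * a \<in> cspan (?M (Suc k))" if a: "a \<in> sym_power k" for x a
  proof -
    have "sym_inj b * a \<in> cspan (?M (Suc k))" if "b \<in> B" for b
      by (rule clinear_span_into[OF clinear_mult_left subsetD[OF Suc a] cvec.subspace_span base[OF that]])
    then show ?thesis
      using clinear_span_into[OF clinear_compose[OF clinear_mult_right[of a] clinear_sym_inj] _ cvec.subspace_span, of x B]
        assms by blast
  qed
  then have "{sym_inj x * a |x a. a \<in> sym_power k} \<subseteq> cspan (?M (Suc k))" by blast
  then have "cspan {sym_inj x * a |x a. a \<in> sym_power k} \<subseteq> cspan (?M (Suc k))"
    by (rule cvec.span_minimal) simp
  then show ?case using sym_power_Suc_span by blast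
qed

lemma prod_list_weight:
  assumes "\<And>b. b \<in> set xs \<Longrightarrow> \<exists>\<mu>. \<forall>h\<in>H. \<lbrakk>h, b\<rbrakk> = \<mu> h *\<^sub>C b"
  shows "\<exists>\<mu>. \<forall>h\<in>H. sym_act h (prod_list (map sym_inj xs)) = \<mu> h *\<^sub>C prod_list (map sym_inj xs)"
  using assms
proof (induction xs)
  case Nil
  show ?case by (intro exI[of _ "\<lambda>_. 0"]) (simp add: derivation_1[OF derivation_sym_act])
next
  case (Cons x xs)
  then obtain \<mu> where \<mu>: "\<forall>h\<in>H. sym_act h (prod_list (map sym_inj xs)) = \<mu> h *\<^sub>C prod_list (map sym_inj xs)" by auto
  obtain \<nu> where \<nu>: "\<forall>h\<in>H. \<lbrakk>h, x\<rbrakk> = \<nu> h *\<^sub>C x" using Cons.prems by auto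
  show ?case
    by (intro exI[of _ "\<lambda>h. \<nu> h + \<mu> h"])
      (use \<mu> \<nu> in \<open>simp add: sym_act_mult sym_act_sym_inj sym_inj_scale sym_scale_mult_left sym_scale_mult_right scaleC_add_left\<close>)
qed

context simple_cartan
begin

lemma sym_power_weights:
  "\<exists>B. finite B \<and> sym_power k \<subseteq> cspan (B :: 'g sym_alg set)"
  "sym_power k \<subseteq> cspan {v\<in>sym_power k. \<exists>\<mu>. \<forall>h\<in>H. sym_act h v = \<mu> h *\<^sub>C (v :: 'g sym_alg)}"
proof -
  let ?W = "H \<union> (\<Union>\<alpha>\<in>roots H. root_space H \<alpha>)"
  obtain B where B: "B \<subseteq> ?W" "\<not> cdependent B" "?W \<subseteq> cspan B"
    using cvec.maximal_independent_subset by blast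
  have fin: "finite B" by (rule independent_finite[OF B(2)])
  have span: "cspan B = UNIV" using span_H_root_spaces cvec.span_minimal[OF B(3)] by auto
  let ?M = "{prod_list (map sym_inj xs) :: 'g sym_alg |xs. set xs \<subseteq> B \<and> length xs = k}"
  have "?M = (\<lambda>xs. prod_list (map sym_inj xs)) ` {xs. set xs \<subseteq> B \<and> length xs = k}" by blast
  then have "finite ?M" using finite_lists_length_eq[OF fin] by simp
  then show "\<exists>B. finite B \<and> sym_power k \<subseteq> cspan (B :: 'g sym_alg set)" using sym_power_basis[OF span] by blast
  have w: "\<exists>\<mu>. \<forall>h\<in>H. \<lbrakk>h, b\<rbrakk> = \<mu> h *\<^sub>C b" if b: "b \<in> B" for b
  proof -
    consider "b \<in> H" | \<alpha> where "b \<in> root_space H \<alpha>" using b B(1) by blast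
    then show ?thesis
    proof cases
      case 1
      then show ?thesis by (intro exI[of _ "\<lambda>_. 0"]) (use abelian_H in simp)
    next
      case 2
      then show ?thesis by (auto simp: root_space_def)
    qed
  qed
  have "?M \<subseteq> {v\<in>sym_power k. \<exists>\<mu>. \<forall>h\<in>H. sym_act h v = \<mu> h *\<^sub>C v}"
  proof
    fix m assume "m \<in> ?M"
    then obtain xs where xs: "m = prod_list (map sym_inj xs)" "set xs \<subseteq> B" "length xs = k" by blast
    have "m \<in> sym_power k" unfolding sym_power_def xs(1) by (rule cvec.span_base) (use xs in blast)
    moreover have "\<exists>\<mu>. \<forall>h\<in>H. sym_act h m = \<mu> h *\<^sub>C m" unfolding xs(1) by (rule prod_list_weight) (use w xs in blast)
    ultimately show "m \<in> {v\<in>sym_power k. \<exists>\<mu>. \<forall>h\<in>H. sym_act h v = \<mu> h *\<^sub>C v}" by blast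
  qed
  then show "sym_power k \<subseteq> cspan {v\<in>sym_power k. \<exists>\<mu>. \<forall>h\<in>H. sym_act h v = \<mu> h *\<^sub>C (v :: 'g sym_alg)}"
    using sym_power_basis[OF span] cvec.span_mono by blast
qed

section \<open>Contraction with a vector through the Killing form\<close>

definition dd :: "'g \<Rightarrow> 'g sym_alg \<Rightarrow> 'g sym_alg" where "dd y = sym_der (killing y)"

lemma derivation_dd: "derivation (dd y)"
  unfolding dd_def by (rule derivation_sym_der) (simp_all add: kadd_right kscale_right)

lemma dd_sym_inj: "dd y (sym_inj x) = killing y x *\<^sub>C 1"
  unfolding dd_def by (rule sym_der_sym_inj) (simp_all add: kadd_right kscale_right)

lemma dd_sym_power: "a \<in> sym_power (Suc k) \<Longrightarrow> dd y a \<in> sym_power k"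
  unfolding dd_def by (rule sym_der_sym_power) (simp_all add: kadd_right kscale_right)

lemma dd_commute: "dd x (dd y a) = dd y (dd x a)"
proof -
  have z: "dd x (c *\<^sub>C 1) = 0" for x c
    by (simp add: clinear_scale[OF derivation_linear[OF derivation_dd]] derivation_1[OF derivation_dd])
  have "dd x (dd y a) - dd y (dd x a) = 0"
    by (rule derivation_eq_0[OF derivation_commutator[OF derivation_dd derivation_dd]])
      (simp add: dd_sym_inj z)
  then show ?thesis by simp
qed

lemma dd_scale: "dd (c *\<^sub>C y) a = c *\<^sub>C dd y a"
  by (rule derivation_eqI[OF derivation_dd derivation_scale[OF derivation_dd]])
    (simp add: dd_sym_inj kscale_left scaleC_scaleC)

lemma dd_0: "dd 0 a = 0"
  using dd_scale[of 0 0 a] by simp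

text \<open>The form is invariant, so contraction is equivariant: the commutator of the action of
  \<open>z\<close> with the contraction by \<open>y\<close> is the contraction by
  \<open>\<lbrakk>z, y\<rbrakk>\<close>.\<close>

lemma sym_act_dd: "sym_act z (dd y a) = dd y (sym_act z a) + dd \<lbrakk>z, y\<rbrakk> a"
proof -
  have z: "D (c *\<^sub>C 1) = 0" if "derivation D" for D :: "'g sym_alg \<Rightarrow> 'g sym_alg" and c
    using that by (simp add: clinear_scale[OF derivation_linear] derivation_1)
  have "sym_act z (dd y a) - dd y (sym_act z a) = dd \<lbrakk>z, y\<rbrakk> a"
    by (rule derivation_eqI[OF derivation_commutator[OF derivation_sym_act derivation_dd] derivation_dd])
      (simp add: dd_sym_inj sym_act_sym_inj z[OF derivation_sym_act] kinvariant_left cvec.scale_minus_left)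
  then show ?thesis by (simp add: algebra_simps)
qed

end

section \<open>Orthogonal long roots\<close>

context pos_cartan
begin

lemma rv_bracket_gws: "\<alpha> \<in> roots H \<Longrightarrow> \<beta> \<in> roots H \<Longrightarrow> \<lbrakk>rv \<alpha>, rv \<beta>\<rbrakk> \<in> gws (\<lambda>h. \<alpha> h + \<beta> h)"
  using bracket_gws rv_root_space root_space_subset_gws by blast

lemma supported_add: "\<alpha> \<in> roots H \<Longrightarrow> \<beta> \<in> roots H \<Longrightarrow> supported (\<lambda>h. \<alpha> h + \<beta> h)"
  using root_supported[of \<alpha>] root_supported[of \<beta>] by (simp add: supported_def)

lemma rv_bracket_0:
  "\<alpha> \<in> roots H \<Longrightarrow> \<beta> \<in> roots H \<Longrightarrow> (\<lambda>h. \<alpha> h + \<beta> h) \<notin> roots H \<Longrightarrow> (\<lambda>h. \<alpha> h + \<beta> h) \<noteq> (\<lambda>h. 0) \<Longrightarrow> \<lbrakk>rv \<alpha>, rv \<beta>\<rbrakk> = 0"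
  using rv_bracket_gws[of \<alpha> \<beta>] gws_trivial[OF supported_add] by blast

lemma rv_bracket_root:
  assumes "\<alpha> \<in> roots H" "\<beta> \<in> roots H" "(\<lambda>h. \<alpha> h + \<beta> h) \<in> roots H"
  shows "\<exists>c. c \<noteq> 0 \<and> \<lbrakk>rv \<alpha>, rv \<beta>\<rbrakk> = c *\<^sub>C rv (\<lambda>h. \<alpha> h + \<beta> h)"
proof -
  let ?\<gamma> = "\<lambda>h. \<alpha> h + \<beta> h"
  have "\<lbrakk>rv \<alpha>, rv \<beta>\<rbrakk> \<in> root_space H ?\<gamma>" using rv_bracket_gws[OF assms(1,2)] root_space_gws[OF assms(3)] by simp
  then obtain c where c: "\<lbrakk>rv \<alpha>, rv \<beta>\<rbrakk> = c *\<^sub>C rv ?\<gamma>"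
    using root_space_scale[OF assms(3) rv_root_space rv_nonzero] assms(3) by blast
  have "\<lbrakk>rv \<alpha>, rv \<beta>\<rbrakk> \<noteq> 0"
    by (rule root_bracket_nonzero[OF assms]) (use assms rv_root_space rv_nonzero in auto)
  then have "c \<noteq> 0" using c by auto
  then show ?thesis using c by blast
qed

lemma tt_diff:
  assumes "\<alpha> \<in> roots H" "\<beta> \<in> roots H"
  shows "tt (\<lambda>h. \<alpha> h - \<beta> h) = tt \<alpha> - tt \<beta>"
  by (rule killing_dual_eq) (use assms tt_H subspace_H killing_tt in \<open>auto simp: cvec.subspace_diff kdiff\<close>)

lemma dual_diff: "\<alpha> \<in> dual_space H \<Longrightarrow> x \<in> H \<Longrightarrow> y \<in> H \<Longrightarrow> \<alpha> (x - y) = \<alpha> x - \<alpha> y"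
proof -
  assume a: "\<alpha> \<in> dual_space H" "x \<in> H" "y \<in> H"
  have "-y \<in> H" using a cvec.subspace_neg[OF subspace_H] by blast
  moreover have "\<alpha> ((-1) *\<^sub>C y) = (-1) * \<alpha> y" using a unfolding dual_space_def by blast
  then have "\<alpha> (- y) = - \<alpha> y" by (simp add: cvec.scale_minus_left scaleC_one)
  moreover have "\<alpha> (x + - y) = \<alpha> x + \<alpha> (- y)" using a \<open>-y \<in> H\<close> unfolding dual_space_def by blast
  ultimately show ?thesis by simp
qed

lemma norm_diff:
  assumes a: "\<alpha> \<in> roots H" and b: "\<beta> \<in> roots H" and ab: "(\<lambda>h. \<alpha> h - \<beta> h) \<in> roots H"
  shows "(\<lambda>h. \<alpha> h - \<beta> h) (tt (\<lambda>h. \<alpha> h - \<beta> h)) = \<alpha> (tt \<alpha>) - 2 * \<alpha> (tt \<beta>) + \<beta> (tt \<beta>)"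
  unfolding tt_diff[OF a b]
  using dual_diff[OF root_dual[OF a] tt_H[OF a] tt_H[OF b]] dual_diff[OF root_dual[OF b] tt_H[OF a] tt_H[OF b]]
    root_tt_commute[OF a b] by simp

text \<open>If \<open>g = L + G\<close> with \<open>[L, G] \<subseteq> G\<close>, then \<open>G + [G, G]\<close> is an ideal.\<close>

lemma ideal_generated:
  fixes G L :: "'g set"
  assumes G: "csubspace G" and dec: "\<And>z. \<exists>p\<in>L. \<exists>q\<in>G. z = p + q" and LG: "\<And>p q. p \<in> L \<Longrightarrow> q \<in> G \<Longrightarrow> \<lbrakk>p, q\<rbrakk> \<in> G"
  shows "lie_ideal (cspan (G \<union> {\<lbrakk>x, y\<rbrakk> |x y. x \<in> G \<and> y \<in> G}))" (is "lie_ideal (cspan ?S)")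
proof -
  have GS: "x \<in> cspan ?S" if "x \<in> G" for x using that by (intro cvec.span_base) blast
  have GGS: "\<lbrakk>x, y\<rbrakk> \<in> cspan ?S" if "x \<in> G" "y \<in> G" for x y using that by (intro cvec.span_base) blast
  have "\<lbrakk>z, s\<rbrakk> \<in> cspan ?S" if s: "s \<in> ?S" for z s
  proof -
    obtain p q where z: "z = p + q" "p \<in> L" "q \<in> G" using dec by blast
    have "\<lbrakk>p, s\<rbrakk> \<in> cspan ?S"
      using s
    proof
      assume "s \<in> G" then show ?thesis using LG[OF z(2)] GS by blast
    next
      assume "s \<in> {\<lbrakk>x, y\<rbrakk> |x y. x \<in> G \<and> y \<in> G}"
      then obtain x y where xy: "s = \<lbrakk>x, y\<rbrakk>" "x \<in> G" "y \<in> G" by blast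
      show ?thesis unfolding xy(1) bracket_derivation[of p x y]
        by (intro cvec.span_add GGS LG z xy)
    qed
    moreover have "\<lbrakk>q, s\<rbrakk> \<in> cspan ?S"
      using s
    proof
      assume "s \<in> G" then show ?thesis using GGS[OF z(3)] by blast
    next
      assume "s \<in> {\<lbrakk>x, y\<rbrakk> |x y. x \<in> G \<and> y \<in> G}"
      then obtain x y where xy: "s = \<lbrakk>x, y\<rbrakk>" by blast
      obtain p' q' where s': "s = p' + q'" "p' \<in> L" "q' \<in> G" using dec by blast
      have "\<lbrakk>q, p'\<rbrakk> \<in> G" using LG[OF s'(2) z(3)] bracket_anticomm[of q p'] cvec.subspace_neg[OF G] by simp
      then show ?thesis unfolding s'(1) bracket_add_right by (intro cvec.span_add GS GGS z s')
    qed
    ultimately show ?thesis unfolding z(1) bracket_add_left by (rule cvec.span_add)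
  qed
  then have "\<lbrakk>z, x\<rbrakk> \<in> cspan ?S" if "x \<in> cspan ?S" for z x
    by (rule clinear_span_into[OF clinear_bracket_right that cvec.subspace_span])
  then show ?thesis by (simp add: lie_ideal_def)
qed

text \<open>Otherwise all root vectors not orthogonal to \<open>a\<close> commute with
  \<open>tt b\<close>. The ideal they generate contains \<open>rv a\<close>, so it is all of g by
  simplicity, and \<open>tt b\<close> would be central.\<close>

lemma ex_common_nonorthogonal:
  assumes a: "a \<in> roots H" and b: "b \<in> roots H"
  shows "\<exists>\<gamma>\<in>roots H. \<gamma> (tt a) \<noteq> 0 \<and> \<gamma> (tt b) \<noteq> 0"
proof (rule ccontr)
  assume *: "\<not> ?thesis"
  interpret A: levi H P "tt a" by unfold_locales (rule tt_H[OF a])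
  let ?R = "{\<gamma> \<in> roots H. \<gamma> (tt a) \<noteq> 0}"
  let ?G = "cspan (rv ` ?R)"
  have dec: "\<exists>p\<in>A.lv. \<exists>q\<in>?G. z = p + q" for z
  proof -
    let ?g = "\<lambda>\<alpha>. killing z (rv (neg \<alpha>)) *\<^sub>C rv \<alpha>"
    let ?q = "\<Sum>\<alpha>\<in>?R. ?g \<alpha>"
    have q: "?q \<in> ?G" by (intro cvec.span_sum cvec.span_scale cvec.span_base) blast
    have "roots H = A.\<Delta> \<union> ?R" "A.\<Delta> \<inter> ?R = {}" by (auto simp: A.\<Delta>_def)
    then have "(\<Sum>\<alpha>\<in>roots H. ?g \<alpha>) = (\<Sum>\<alpha>\<in>A.\<Delta>. ?g \<alpha>) + ?q"
      using sum.union_disjoint[of A.\<Delta> ?R ?g] A.finite_\<Delta> finite_roots by simp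
    then have "z - ?q = (z - (\<Sum>\<alpha>\<in>roots H. ?g \<alpha>)) + (\<Sum>\<alpha>\<in>A.\<Delta>. ?g \<alpha>)" by simp
    also have "\<dots> \<in> A.lv"
      by (intro cvec.subspace_add[OF A.subspace_lv] A.H_lv root_decomposition
          cvec.subspace_sum[OF A.subspace_lv] cvec.subspace_scale[OF A.subspace_lv] A.rv_lv)
    finally show ?thesis using q by (intro bexI[of _ "z - ?q"] bexI[of _ ?q]) auto
  qed
  have LG: "\<lbrakk>p, q\<rbrakk> \<in> ?G" if p: "p \<in> A.lv" and q: "q \<in> ?G" for p q
  proof (rule clinear_span_into[OF clinear_bracket_right q cvec.subspace_span])
    fix x assume "x \<in> rv ` ?R"
    then obtain \<gamma> where g: "x = rv \<gamma>" "\<gamma> \<in> roots H" "\<gamma> (tt a) \<noteq> 0" by blast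
    show "\<lbrakk>p, x\<rbrakk> \<in> ?G"
    proof (rule clinear_span_into[OF clinear_bracket_left A.lv_span[OF p] cvec.subspace_span])
      fix y assume "y \<in> H \<union> rv ` A.\<Delta>"
      then show "\<lbrakk>y, x\<rbrakk> \<in> ?G"
      proof
        assume "y \<in> H"
        then have "\<lbrakk>y, x\<rbrakk> = \<gamma> y *\<^sub>C x" using bracket_rv g by blast
        moreover have "x \<in> ?G" using g by (intro cvec.span_base) blast
        ultimately show ?thesis by (simp add: cvec.span_scale)
      next
        assume "y \<in> rv ` A.\<Delta>"
        then obtain \<delta> where d: "y = rv \<delta>" "\<delta> \<in> roots H" "\<delta> (tt a) = 0" by (auto simp: A.\<Delta>_def)
        let ?s = "\<lambda>h. \<delta> h + \<gamma> h"
        have s: "?s (tt a) \<noteq> 0" using d g by simp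
        show ?thesis
        proof (cases "?s \<in> roots H")
          case True
          then obtain c where "\<lbrakk>y, x\<rbrakk> = c *\<^sub>C rv ?s" using rv_bracket_root d g by blast
          moreover have "rv ?s \<in> ?G" using True s by (intro cvec.span_base) blast
          ultimately show ?thesis by (simp add: cvec.span_scale)
        next
          case False
          have "?s \<noteq> (\<lambda>h. 0)" using s by (auto dest: fun_cong)
          then show ?thesis using rv_bracket_0[OF d(2) g(2) False] d g by (simp add: cvec.span_zero)
        qed
      qed
    qed
  qed
  let ?I = "cspan (?G \<union> {\<lbrakk>x, y\<rbrakk> |x y. x \<in> ?G \<and> y \<in> ?G})"
  have "lie_ideal ?I" by (rule ideal_generated[OF cvec.subspace_span dec LG])
  moreover have "rv a \<in> ?G" using a root_self_nonzero[OF a] by (intro cvec.span_base) blast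
  then have "rv a \<in> ?I" by (intro cvec.span_base) blast
  then have "?I \<noteq> {0}" using rv_nonzero[OF a] by blast
  ultimately have I: "?I = UNIV" using simple_ideal by blast
  interpret B: levi H P "tt b" by unfold_locales (rule tt_H[OF b])
  \<comment> \<open>By the assumption to be refuted, a root that does not vanish on
    \<open>tt a\<close> vanishes on \<open>tt b\<close>.\<close>
  have GB: "?G \<subseteq> B.lv"
    by (rule cvec.span_minimal[OF _ B.subspace_lv]) (use * in \<open>auto intro!: B.rv_lv simp: B.\<Delta>_def\<close>)
  have "?I \<subseteq> B.lv"
    by (rule cvec.span_minimal[OF _ B.subspace_lv]) (use GB B.bracket_lv in auto)
  then have "\<lbrakk>tt b, rv b\<rbrakk> = 0" using I by (auto simp: B.lv_def)
  then show False using bracket_rv[OF b tt_H[OF b]] root_self_nonzero[OF b] rv_nonzero[OF b] by simp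
qed

end

text \<open>The hypotheses on \<open>\<beta>\<^sub>1, \<dots>, \<beta>\<^sub>k\<close>, \<open>k = m + 1\<close>, that the induction step from \<open>m\<close> to \<open>k\<close> uses.
  The vector \<open>\<Sum>i. tt (\<beta> i)\<close> represents \<open>\<sigma>\<^sub>k\<close>, so the last two say that \<open>\<sigma>\<^sub>k\<close> and \<open>\<sigma>\<^sub>m\<close> are dominant.\<close>

locale cascade = pos_cartan H P for H :: "'g::complex_lie_algebra set" and P +
  fixes \<beta> :: "nat \<Rightarrow> 'g \<Rightarrow> complex" and m :: nat
  assumes \<beta>_root: "i \<in> {1..Suc m} \<Longrightarrow> \<beta> i \<in> roots H"
    and \<beta>_norm: "i \<in> {1..Suc m} \<Longrightarrow> \<beta> i (tt (\<beta> i)) = \<beta> 1 (tt (\<beta> 1))"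
    and \<beta>_long: "\<gamma> \<in> roots H \<Longrightarrow> Re (\<gamma> (tt \<gamma>)) \<le> Re (\<beta> 1 (tt (\<beta> 1)))"
    and \<beta>_orth: "i \<in> {1..Suc m} \<Longrightarrow> j \<in> {1..Suc m} \<Longrightarrow> i \<noteq> j \<Longrightarrow> \<beta> i (tt (\<beta> j)) = 0"
    and \<beta>_highest: "\<gamma> \<in> roots H \<Longrightarrow> \<exists>c. \<forall>h. \<beta> 1 h - \<gamma> h = (\<Sum>\<alpha>\<in>P. of_nat (c \<alpha> :: nat) * \<alpha> h)"
    and \<sigma>_dominant: "\<alpha> \<in> P \<Longrightarrow> 0 \<le> \<alpha> (\<Sum>i\<in>{1..Suc m}. tt (\<beta> i))"
    and \<sigma>_dominant': "\<alpha> \<in> P \<Longrightarrow> 0 \<le> \<alpha> (\<Sum>i\<in>{1..m}. tt (\<beta> i))"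
begin

abbreviation "I \<equiv> {1..Suc m}"

section \<open>Coefficients of roots along the \<beta>_i and the grading by \<open>T\<close>\<close>

definition N :: complex where "N = \<beta> 1 (tt (\<beta> 1))"

definition T :: 'g where "T = (\<Sum>i\<in>I. tt (\<beta> i))"

text \<open>The Cartan integer of \<open>\<gamma>\<close> along \<open>\<beta> i\<close>, where
  \<open>N\<close> is the common squared length of the \<beta>_i. Reflection supplies its existence,
  and \<open>pr_unique\<close> its uniqueness.\<close>

definition pr :: "('g \<Rightarrow> complex) \<Rightarrow> nat \<Rightarrow> int" where
  "pr \<gamma> i = (SOME n. 2 * \<gamma> (tt (\<beta> i)) = of_int n * N)"

lemma N_pos: "0 < N" unfolding N_def by (rule root_self_pos) (use \<beta>_root in auto)

lemma N_nonzero: "N \<noteq> 0" by (rule not_sym[OF less_imp_neq[OF N_pos]])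

lemma norm_N: "i \<in> I \<Longrightarrow> \<beta> i (tt (\<beta> i)) = N" unfolding N_def by (rule \<beta>_norm)

lemma tt_\<beta>_H: "i \<in> I \<Longrightarrow> tt (\<beta> i) \<in> H" using tt_H \<beta>_root by blast

lemma T_H: "T \<in> H" unfolding T_def by (rule cvec.subspace_sum[OF subspace_H]) (rule tt_\<beta>_H)

lemma dual_sum': "\<alpha> \<in> dual_space H \<Longrightarrow> (\<And>i. i \<in> K \<Longrightarrow> f i \<in> H) \<Longrightarrow> \<alpha> (\<Sum>i\<in>K. f i) = (\<Sum>i\<in>K. \<alpha> (f i))"
proof -
  interpret levi H P 0 by unfold_locales (rule cvec.subspace_0[OF subspace_H])
  show "\<alpha> \<in> dual_space H \<Longrightarrow> (\<And>i. i \<in> K \<Longrightarrow> f i \<in> H) \<Longrightarrow> \<alpha> (\<Sum>i\<in>K. f i) = (\<Sum>i\<in>K. \<alpha> (f i))" by (rule dual_sum)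
qed

lemma pr: "\<gamma> \<in> roots H \<Longrightarrow> i \<in> I \<Longrightarrow> 2 * \<gamma> (tt (\<beta> i)) = of_int (pr \<gamma> i) * N"
proof -
  assume g: "\<gamma> \<in> roots H" and i: "i \<in> I"
  obtain n :: int where "2 * \<gamma> (tt (\<beta> i)) = of_int n * \<beta> i (tt (\<beta> i))"
    by (rule root_reflection[OF \<beta>_root[OF i] g]) (rule that; assumption)
  then show ?thesis unfolding pr_def using norm_N[OF i] by (metis (mono_tags, lifting) someI)
qed

lemma pr_unique: "\<gamma> \<in> roots H \<Longrightarrow> i \<in> I \<Longrightarrow> 2 * \<gamma> (tt (\<beta> i)) = of_int n * N \<Longrightarrow> pr \<gamma> i = n"
  using pr[of \<gamma> i] N_nonzero by (simp add: mult_cancel_right)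

lemma pr_comb:
  assumes "\<gamma> \<in> roots H" "\<delta> \<in> roots H" "(\<lambda>h. \<gamma> h + of_int c * \<delta> h) \<in> roots H" "i \<in> I"
  shows "pr (\<lambda>h. \<gamma> h + of_int c * \<delta> h) i = pr \<gamma> i + c * pr \<delta> i"
  by (rule pr_unique[OF assms(3,4)]) (use pr[OF assms(1,4)] pr[OF assms(2,4)] in \<open>simp add: algebra_simps\<close>)

lemma pr_\<beta>: "i \<in> I \<Longrightarrow> j \<in> I \<Longrightarrow> pr (\<beta> i) j = (if i = j then 2 else 0)"
  by (rule pr_unique[OF \<beta>_root]) (use norm_N \<beta>_orth in auto)

lemma reflect: "\<gamma> \<in> roots H \<Longrightarrow> i \<in> I \<Longrightarrow> (\<lambda>h. \<gamma> h + of_int (- pr \<gamma> i) * \<beta> i h) \<in> roots H"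
proof -
  assume g: "\<gamma> \<in> roots H" and i: "i \<in> I"
  obtain n :: int where n: "2 * \<gamma> (tt (\<beta> i)) = of_int n * \<beta> i (tt (\<beta> i))" "(\<lambda>h. \<gamma> h - of_int n * \<beta> i h) \<in> roots H"
    by (rule root_reflection[OF \<beta>_root[OF i] g]) (rule that; assumption)
  then have "pr \<gamma> i = n" using pr_unique[OF g i] norm_N[OF i] by simp
  then show ?thesis using n(2) by simp
qed

lemma root_T: "\<gamma> \<in> roots H \<Longrightarrow> 2 * \<gamma> T = of_int (\<Sum>i\<in>I. pr \<gamma> i) * N"
proof -
  assume g: "\<gamma> \<in> roots H"
  have "\<gamma> T = (\<Sum>i\<in>I. \<gamma> (tt (\<beta> i)))" unfolding T_def by (rule dual_sum'[OF root_dual[OF g] tt_\<beta>_H])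
  then have "2 * \<gamma> T = (\<Sum>i\<in>I. 2 * \<gamma> (tt (\<beta> i)))" by (simp only: sum_distrib_left)
  also have "\<dots> = (\<Sum>i\<in>I. of_int (pr \<gamma> i) * N)" by (rule sum.cong[OF refl]) (rule pr[OF g])
  also have "\<dots> = of_int (\<Sum>i\<in>I. pr \<gamma> i) * N" by (simp only: of_int_sum sum_distrib_right)
  finally show ?thesis .
qed

text \<open>The \<beta>_i are orthogonal, so the reflection in one of them reverses the sign of its
  own coefficient and leaves the others alone.\<close>

lemma reflect_abs:
  assumes "\<gamma> \<in> roots H" "finite J" "J \<subseteq> I"
  shows "\<exists>\<gamma>'\<in>roots H. \<forall>i\<in>I. pr \<gamma>' i = (if i \<in> J then \<bar>pr \<gamma> i\<bar> else pr \<gamma> i)"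
  using assms(2,3)
proof (induction J rule: finite_induct)
  case empty
  then show ?case using assms(1) by auto
next
  case (insert j J)
  then obtain \<gamma>' where g: "\<gamma>' \<in> roots H" "\<forall>i\<in>I. pr \<gamma>' i = (if i \<in> J then \<bar>pr \<gamma> i\<bar> else pr \<gamma> i)" by auto
  have j: "j \<in> I" using insert.prems by simp
  show ?case
  proof (cases "pr \<gamma> j \<ge> 0")
    case True
    then show ?thesis using g insert.hyps by (intro bexI[of _ \<gamma>']) auto
  next
    case False
    let ?r = "\<lambda>h. \<gamma>' h + of_int (- pr \<gamma>' j) * \<beta> j h"
    have r: "?r \<in> roots H" by (rule reflect[OF g(1) j])
    have "pr ?r i = pr \<gamma>' i + (- pr \<gamma>' j) * pr (\<beta> j) i" if "i \<in> I" for i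
      by (rule pr_comb[OF g(1) \<beta>_root[OF j] r that])
    then have "\<forall>i\<in>I. pr ?r i = (if i \<in> insert j J then \<bar>pr \<gamma> i\<bar> else pr \<gamma> i)"
      using g(2) insert.hyps False j pr_\<beta>[OF j] by auto
    then show ?thesis using r by blast
  qed
qed

text \<open>With all coefficients made nonnegative, the root still lies below
  \<open>\<beta> 1\<close>. Positive roots are nonnegative on \<open>T\<close>, so its value at
  \<open>T\<close> is at most that of \<open>\<beta> 1\<close>, whose coefficients are 2, 0, ...,
  0.\<close>

lemma grade_le: "\<gamma> \<in> roots H \<Longrightarrow> (\<Sum>i\<in>I. \<bar>pr \<gamma> i\<bar>) \<le> 2"
proof -
  assume g: "\<gamma> \<in> roots H"
  obtain \<gamma>' where g': "\<gamma>' \<in> roots H" "\<forall>i\<in>I. pr \<gamma>' i = \<bar>pr \<gamma> i\<bar>"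
    using reflect_abs[OF g, of I] by auto
  obtain c :: "('g \<Rightarrow> complex) \<Rightarrow> nat" where c: "\<beta> 1 T - \<gamma>' T = (\<Sum>\<alpha>\<in>P. of_nat (c \<alpha>) * \<alpha> T)"
    using \<beta>_highest[OF g'(1)] by blast
  have "0 \<le> (\<Sum>\<alpha>\<in>P. of_nat (c \<alpha>) * \<alpha> T)"
    by (intro sum_nonneg mult_nonneg_nonneg of_nat_complex_nonneg) (use \<sigma>_dominant in \<open>simp add: T_def\<close>)
  then have "0 \<le> 2 * \<beta> 1 T - 2 * \<gamma>' T" unfolding c[symmetric] by (auto simp: less_eq_complex_def)
  moreover have b1: "\<beta> 1 \<in> roots H" by (rule \<beta>_root) simp
  moreover have "(\<Sum>i\<in>I. pr (\<beta> 1) i) = 2"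
  proof -
    have "(\<Sum>i\<in>I. pr (\<beta> 1) i) = (\<Sum>i\<in>I. if i = 1 then 2 else 0)" by (rule sum.cong) (auto simp: pr_\<beta>)
    then show ?thesis by simp
  qed
  moreover have "(\<Sum>i\<in>I. pr \<gamma>' i) = (\<Sum>i\<in>I. \<bar>pr \<gamma> i\<bar>)" using g'(2) by simp
  ultimately have "0 \<le> (of_int 2 - of_int (\<Sum>i\<in>I. \<bar>pr \<gamma> i\<bar>)) * N"
    using root_T[OF b1] root_T[OF g'(1)] by (simp only: left_diff_distrib)
  then have "0 \<le> of_int (2 - (\<Sum>i\<in>I. \<bar>pr \<gamma> i\<bar>)) * N" by (simp only: of_int_diff)
  then have "0 \<le> real_of_int (2 - (\<Sum>i\<in>I. \<bar>pr \<gamma> i\<bar>)) * Re N"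
    by (simp add: less_eq_complex_def del: of_int_sum of_int_diff)
  moreover have "0 < Re N" using N_pos by (simp add: less_complex_def)
  ultimately have "0 \<le> real_of_int (2 - (\<Sum>i\<in>I. \<bar>pr \<gamma> i\<bar>))" by (simp only: zero_le_mult_iff) auto
  then show ?thesis by (simp only: of_int_0_le_iff)
qed

lemma grade_sub:
  assumes "\<gamma> \<in> roots H" "J \<subseteq> I" shows "(\<Sum>i\<in>J. \<bar>pr \<gamma> i\<bar>) \<le> 2"
proof -
  have "(\<Sum>i\<in>J. \<bar>pr \<gamma> i\<bar>) \<le> (\<Sum>i\<in>I. \<bar>pr \<gamma> i\<bar>)" by (rule sum_mono2) (use assms in auto)
  then show ?thesis using grade_le[OF assms(1)] by simp
qed

lemma root_T_le: "\<gamma> \<in> roots H \<Longrightarrow> \<gamma> T \<le> N"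
proof -
  assume g: "\<gamma> \<in> roots H"
  have "(\<Sum>i\<in>I. pr \<gamma> i) \<le> (\<Sum>i\<in>I. \<bar>pr \<gamma> i\<bar>)" by (rule sum_mono) simp
  then have "(\<Sum>i\<in>I. pr \<gamma> i) \<le> 2" using grade_le[OF g] by simp
  then have "real_of_int (\<Sum>i\<in>I. pr \<gamma> i) * Re N \<le> 2 * Re N"
    using N_pos by (intro mult_right_mono) (auto simp: less_complex_def simp del: of_int_sum)
  moreover have "Re (2 * \<gamma> T) = real_of_int (\<Sum>i\<in>I. pr \<gamma> i) * Re N" "Im (2 * \<gamma> T) = real_of_int (\<Sum>i\<in>I. pr \<gamma> i) * Im N"
    unfolding root_T[OF g] by (simp_all del: of_int_sum)
  moreover have "Im N = 0" using N_pos by (simp add: less_complex_def)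
  ultimately show ?thesis by (simp add: less_eq_complex_def)
qed

lemma \<beta>_T: "i \<in> I \<Longrightarrow> \<beta> i T = N"
proof -
  assume i: "i \<in> I"
  have "(\<Sum>j\<in>I. pr (\<beta> i) j) = (\<Sum>j\<in>I. if j = i then 2 else 0)" by (rule sum.cong) (use i pr_\<beta> in auto)
  then have "2 * \<beta> i T = 2 * N" using root_T[OF \<beta>_root[OF i]] i by simp
  then show ?thesis by simp
qed

lemma K: "Suc m \<in> I" by simp

sublocale L: levi H P T by unfold_locales (rule T_H)

lemma \<Delta>_iff: "\<gamma> \<in> roots H \<Longrightarrow> \<gamma> \<in> L.\<Delta> \<longleftrightarrow> (\<Sum>i\<in>I. pr \<gamma> i) = 0"
proof -
  assume g: "\<gamma> \<in> roots H"
  have "\<gamma> T = 0 \<longleftrightarrow> 2 * \<gamma> T = 0" by simp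
  also have "\<dots> \<longleftrightarrow> (\<Sum>i\<in>I. pr \<gamma> i) = 0"
    unfolding root_T[OF g] by (simp only: mult_eq_0_iff N_nonzero of_int_eq_0_iff simp_thms)
  finally show ?thesis using g by (simp add: L.\<Delta>_def)
qed

text \<open>As \<open>\<alpha> T = 0\<close> and \<open>\<alpha>\<close> is nonnegative on the sum
  of the first \<open>m\<close> vectors, it is nonpositive on \<open>tt (\<beta> (Suc m))\<close>.
  So \<open>\<alpha> - \<beta> (Suc m)\<close> would be longer than a long root, which rules it out
  as a root.\<close>

lemma lowest_in_top_grade:
  assumes "\<alpha> \<in> L.\<Delta>p"
  shows "\<lbrakk>rv \<alpha>, rv (neg (\<beta> (Suc m)))\<rbrakk> = 0"
proof (rule rv_bracket_0)
  have a: "\<alpha> \<in> roots H" "\<alpha> \<in> P" "\<alpha> T = 0" using assms L.\<Delta>p_\<Delta> L.\<Delta>_roots by (auto simp: L.\<Delta>p_def)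
  show "\<alpha> \<in> roots H" "neg (\<beta> (Suc m)) \<in> roots H" using a uminus_root[OF \<beta>_root[OF K]] by auto
  have "(\<lambda>h. \<alpha> h - \<beta> (Suc m) h) T \<noteq> 0" using a \<beta>_T[OF K] N_nonzero by simp
  then show "(\<lambda>h. \<alpha> h + neg (\<beta> (Suc m)) h) \<noteq> (\<lambda>h. 0)" by (auto dest: fun_cong)
  show "(\<lambda>h. \<alpha> h + neg (\<beta> (Suc m)) h) \<notin> roots H"
  proof
    assume "(\<lambda>h. \<alpha> h + neg (\<beta> (Suc m)) h) \<in> roots H"
    then have r: "(\<lambda>h. \<alpha> h - \<beta> (Suc m) h) \<in> roots H" by simp
    have "T = (\<Sum>i\<in>{1..m}. tt (\<beta> i)) + tt (\<beta> (Suc m))" by (simp add: T_def)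
    moreover have "(\<Sum>i\<in>{1..m}. tt (\<beta> i)) \<in> H"
      by (rule cvec.subspace_sum[OF subspace_H]) (use tt_\<beta>_H in auto)
    ultimately have "0 = \<alpha> (\<Sum>i\<in>{1..m}. tt (\<beta> i)) + \<alpha> (tt (\<beta> (Suc m)))"
      using a root_dual[OF a(1)] tt_\<beta>_H[OF K] by (simp add: dual_space_def)
    then have "\<alpha> (tt (\<beta> (Suc m))) = - \<alpha> (\<Sum>i\<in>{1..m}. tt (\<beta> i))"
      by (simp only: eq_neg_iff_add_eq_0 add.commute)
    then have "\<alpha> (tt (\<beta> (Suc m))) \<le> 0" using \<sigma>_dominant'[OF a(2)] by simp
    then have "0 \<le> - (2 * \<alpha> (tt (\<beta> (Suc m))))" by (simp add: less_eq_complex_def)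
    moreover have "Re (\<alpha> (tt \<alpha>)) > 0" using root_self_pos[OF a(1)] by (simp add: less_complex_def)
    ultimately have "Re ((\<lambda>h. \<alpha> h - \<beta> (Suc m) h) (tt (\<lambda>h. \<alpha> h - \<beta> (Suc m) h))) > Re N"
      unfolding norm_diff[OF a(1) \<beta>_root[OF K] r] norm_N[OF K] by (simp add: less_eq_complex_def)
    then show False using \<beta>_long[OF r] by (simp add: N_def)
  qed
qed

text \<open>The roots \<open>\<gamma>\<close>, \<open>\<gamma>'\<close> of the exchange argument: their root vectors commute, carry the root vector
  of \<open>-\<beta>\<^sub>k\<close> to that of \<open>-\<beta>\<^sub>l\<close> and annihilate those of the other \<open>-\<beta>\<^sub>j\<close>.\<close>

lemma ex_exchange:
  assumes l: "l \<in> {1..m}"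
  shows "\<exists>e e' c. e \<in> rv ` L.\<Delta> \<and> e' \<in> rv ` L.\<Delta> \<and> \<lbrakk>e, e'\<rbrakk> = 0 \<and> c \<noteq> 0 \<and>
    \<lbrakk>e, \<lbrakk>e', rv (neg (\<beta> (Suc m)))\<rbrakk>\<rbrakk> = c *\<^sub>C rv (neg (\<beta> l)) \<and>
    (\<forall>j\<in>{1..m} - {l}. \<lbrakk>e, rv (neg (\<beta> j))\<rbrakk> = 0 \<and> \<lbrakk>e', rv (neg (\<beta> j))\<rbrakk> = 0)"
proof -
  let ?k = "Suc m"
  have lI: "l \<in> I" and lk: "l \<noteq> ?k" using l by auto
  have br: "\<beta> ?k \<in> roots H" "\<beta> l \<in> roots H" using \<beta>_root K lI by auto
  obtain \<gamma>0 where g0: "\<gamma>0 \<in> roots H" "\<gamma>0 (tt (\<beta> ?k)) \<noteq> 0" "\<gamma>0 (tt (\<beta> l)) \<noteq> 0"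
    using ex_common_nonorthogonal[OF br] by blast
  have p0: "pr \<gamma>0 ?k \<noteq> 0" "pr \<gamma>0 l \<noteq> 0" using pr[OF g0(1) K] pr[OF g0(1) lI] g0 by auto
  \<comment> \<open>Two nonzero integers whose absolute values add up to at most 2 are both 1 or
    -1.\<close>
  have "(\<Sum>i\<in>{?k, l}. \<bar>pr \<gamma>0 i\<bar>) \<le> 2" by (rule grade_sub[OF g0(1)]) (use lI in auto)
  then have p1: "\<bar>pr \<gamma>0 ?k\<bar> = 1" "\<bar>pr \<gamma>0 l\<bar> = 1" using p0 lk by auto
  \<comment> \<open>Reflections normalize the signs to 1 at \<open>?k\<close> and -1 at
    \<open>l\<close>. All other coefficients are 0 by the bound, so
    \<open>\<gamma> T = 0\<close>.\<close>
  obtain \<gamma>1 where g1: "\<gamma>1 \<in> roots H" "\<forall>i\<in>I. pr \<gamma>1 i = \<bar>pr \<gamma>0 i\<bar>" using reflect_abs[OF g0(1), of I] by auto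
  define \<gamma> where "\<gamma> = (\<lambda>h. \<gamma>1 h + of_int (- pr \<gamma>1 l) * \<beta> l h)"
  have g: "\<gamma> \<in> roots H" unfolding \<gamma>_def by (rule reflect[OF g1(1) lI])
  have prg: "pr \<gamma> i = pr \<gamma>1 i + (- pr \<gamma>1 l) * pr (\<beta> l) i" if "i \<in> I" for i
    unfolding \<gamma>_def by (rule pr_comb[OF g1(1) br(2) g[unfolded \<gamma>_def] that])
  have gk: "pr \<gamma> ?k = 1" using prg[OF K] g1(2) p1 pr_\<beta>[OF lI K] lk by simp
  have gl: "pr \<gamma> l = -1" using prg[OF lI] g1(2) lI p1 pr_\<beta>[OF lI lI] by simp
  have other: "pr \<delta> j = 0" if "\<delta> \<in> roots H" "\<bar>pr \<delta> ?k\<bar> = 1" "\<bar>pr \<delta> l\<bar> = 1" "j \<in> I" "j \<noteq> ?k" "j \<noteq> l" for \<delta> j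
  proof -
    have "(\<Sum>i\<in>{?k, l, j}. \<bar>pr \<delta> i\<bar>) \<le> 2" by (rule grade_sub[OF that(1)]) (use lI that in auto)
    then show ?thesis using that lk by simp
  qed
  have sum0: "\<delta> \<in> L.\<Delta>" if d: "\<delta> \<in> roots H" "pr \<delta> ?k = 1" "pr \<delta> l = -1" for \<delta>
  proof -
    have "(\<Sum>i\<in>I. pr \<delta> i) = (\<Sum>i\<in>{?k, l}. pr \<delta> i)"
      by (rule sum.mono_neutral_right) (use lI other[OF d(1)] d in auto)
    then show ?thesis using \<Delta>_iff[OF d(1)] d lk by simp
  qed
  have gl_root: "(\<lambda>h. \<gamma> h + \<beta> l h) \<in> roots H" using reflect[OF g lI] gl by simp
  have "(\<lambda>h. \<gamma> h + of_int (- 1) * \<beta> ?k h) \<in> roots H" using reflect[OF g K] gk by simp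
  then have gk_root: "(\<lambda>h. \<gamma> h - \<beta> ?k h) \<in> roots H" by simp
  have "pr (\<lambda>h. \<gamma> h + of_int 1 * \<beta> l h) ?k = pr \<gamma> ?k + 1 * pr (\<beta> l) ?k"
    by (rule pr_comb[OF g br(2) _ K]) (use gl_root in simp)
  then have "pr (\<lambda>h. \<gamma> h + \<beta> l h) ?k = 1" using gk pr_\<beta>[OF lI K] lk by simp
  then have "(\<lambda>h. (\<lambda>h. \<gamma> h + \<beta> l h) h + of_int (- 1) * \<beta> ?k h) \<in> roots H" using reflect[OF gl_root K] by simp
  then have "neg (\<lambda>h. \<gamma> h + \<beta> l h - \<beta> ?k h) \<in> roots H" using uminus_root by fastforce
  \<comment> \<open>This is minus the reflection of \<open>\<gamma>\<close> in both
    \<open>\<beta> l\<close> and \<open>\<beta> ?k\<close>, hence a root. By design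
    \<open>\<gamma> + \<gamma>' = \<beta> ?k - \<beta> l\<close>, the shift that carries
    \<open>-\<beta> ?k\<close> to \<open>-\<beta> l\<close>.\<close>
  moreover define \<gamma>' where "\<gamma>' = (\<lambda>h. \<beta> ?k h - \<beta> l h - \<gamma> h)"
  ultimately have g': "\<gamma>' \<in> roots H" by (simp add: \<gamma>'_def algebra_simps)
  have pr': "pr \<gamma>' i = pr (\<beta> ?k) i - pr (\<beta> l) i - pr \<gamma> i" if "i \<in> I" for i
    by (rule pr_unique[OF g' that])
      (use pr[OF br(1) that] pr[OF br(2) that] pr[OF g that] in \<open>simp add: \<gamma>'_def algebra_simps\<close>)
  have g'k: "pr \<gamma>' ?k = 1" and g'l: "pr \<gamma>' l = -1"
    using pr'[OF K] pr'[OF lI] gk gl pr_\<beta> lI K lk by auto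
  have D: "\<gamma> \<in> L.\<Delta>" "\<gamma>' \<in> L.\<Delta>" using sum0 g gk gl g' g'k g'l by auto
  \<comment> \<open>The bound on coefficients used in reverse, for functions that are not known to
    be roots.\<close>
  have not_root: "\<delta> \<notin> roots H" if J: "J \<subseteq> I" "\<And>i. i \<in> J \<Longrightarrow> 2 * \<delta> (tt (\<beta> i)) = of_int (n i) * N" "(\<Sum>i\<in>J. \<bar>n i\<bar>) > 2" for \<delta> n J
  proof
    assume d: "\<delta> \<in> roots H"
    have "(\<Sum>i\<in>J. \<bar>pr \<delta> i\<bar>) = (\<Sum>i\<in>J. \<bar>n i\<bar>)" 
    proof (rule sum.cong[OF refl])
      fix i assume i: "i \<in> J"
      have "pr \<delta> i = n i" by (rule pr_unique[OF d _ J(2)[OF i]]) (use i J(1) in blast)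
      then show "\<bar>pr \<delta> i\<bar> = \<bar>n i\<bar>" by simp
    qed
    then show False using grade_sub[OF d J(1)] J(3) by simp
  qed
  \<comment> \<open>The sum \<open>\<beta> ?k - \<beta> l\<close> would have the coefficients 2 and
    -2.\<close>
  have comm: "\<lbrakk>rv \<gamma>, rv \<gamma>'\<rbrakk> = 0"
  proof (rule rv_bracket_0[OF g g'])
    have eq: "(\<lambda>h. \<gamma> h + \<gamma>' h) = (\<lambda>h. \<beta> ?k h - \<beta> l h)" by (simp add: \<gamma>'_def)
    show "(\<lambda>h. \<gamma> h + \<gamma>' h) \<notin> roots H"
      unfolding eq by (rule not_root[of "{?k, l}" _ "\<lambda>i. pr (\<beta> ?k) i - pr (\<beta> l) i"])
        (use lI lk pr_\<beta> K pr[OF br(1)] pr[OF br(2)] in \<open>auto simp: algebra_simps\<close>)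
    have "(\<lambda>h. \<beta> ?k h - \<beta> l h) (tt (\<beta> ?k)) \<noteq> 0" using norm_N[OF K] \<beta>_orth[OF lI K lk] N_nonzero by simp
    then show "(\<lambda>h. \<gamma> h + \<gamma>' h) \<noteq> (\<lambda>h. 0)" unfolding eq by (auto dest: fun_cong)
  qed
  \<comment> \<open>The coefficients of \<open>\<delta> - \<beta> j\<close> at \<open>?k\<close>,
    \<open>l\<close> and \<open>j\<close> would be 1, -1 and -2.\<close>
  have kill: "\<lbrakk>rv \<delta>, rv (neg (\<beta> j))\<rbrakk> = 0"
    if d: "\<delta> \<in> roots H" "pr \<delta> ?k = 1" "pr \<delta> l = -1" and j: "j \<in> {1..m} - {l}" for \<delta> j
  proof (rule rv_bracket_0[OF d(1) uminus_root])
    have jI: "j \<in> I" "j \<noteq> ?k" "j \<noteq> l" using j by auto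
    show "\<beta> j \<in> roots H" using \<beta>_root jI by blast
    have "pr \<delta> j = 0" using other[OF d(1) _ _ jI] d by simp
    show "(\<lambda>h. \<delta> h + neg (\<beta> j) h) \<notin> roots H"
      by (rule not_root[of "{?k, l, j}" _ "\<lambda>i. pr \<delta> i - pr (\<beta> j) i"])
        (use lI lk jI pr_\<beta> K d \<open>pr \<delta> j = 0\<close> pr[OF d(1)] pr[OF \<open>\<beta> j \<in> roots H\<close>] in \<open>auto simp: algebra_simps\<close>)
    have "2 * (\<lambda>h. \<delta> h + neg (\<beta> j) h) (tt (\<beta> ?k)) = N"
      using pr[OF d(1) K] d(2) \<beta>_orth[OF jI(1) K jI(2)] by simp
    then have "(\<lambda>h. \<delta> h + neg (\<beta> j) h) (tt (\<beta> ?k)) \<noteq> 0"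
      using N_nonzero mult_zero_right[of 2] by metis
    then show "(\<lambda>h. \<delta> h + neg (\<beta> j) h) \<noteq> (\<lambda>h. 0)" by (auto dest: fun_cong)
  qed
  have eq1: "(\<lambda>h. \<gamma>' h + neg (\<beta> ?k) h) = neg (\<lambda>h. \<gamma> h + \<beta> l h)" by (auto simp: \<gamma>'_def)
  have r1: "neg (\<lambda>h. \<gamma> h + \<beta> l h) \<in> roots H" by (rule uminus_root[OF gl_root])
  obtain c1 where c1: "c1 \<noteq> 0" "\<lbrakk>rv \<gamma>', rv (neg (\<beta> ?k))\<rbrakk> = c1 *\<^sub>C rv (neg (\<lambda>h. \<gamma> h + \<beta> l h))"
    using rv_bracket_root[OF g' uminus_root[OF br(1)]] r1 unfolding eq1 by blast
  have eq2: "(\<lambda>h. \<gamma> h + neg (\<lambda>h. \<gamma> h + \<beta> l h) h) = neg (\<beta> l)" by simp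
  obtain c2 where c2: "c2 \<noteq> 0" "\<lbrakk>rv \<gamma>, rv (neg (\<lambda>h. \<gamma> h + \<beta> l h))\<rbrakk> = c2 *\<^sub>C rv (neg (\<beta> l))"
    using rv_bracket_root[OF g r1] uminus_root[OF br(2)] unfolding eq2 by blast
  have "\<lbrakk>rv \<gamma>, \<lbrakk>rv \<gamma>', rv (neg (\<beta> ?k))\<rbrakk>\<rbrakk> = (c1 * c2) *\<^sub>C rv (neg (\<beta> l))"
    unfolding c1(2) bracket_scale_right c2(2) scaleC_scaleC ..
  then show ?thesis
    using D comm c1(1) c2(1) kill[OF g gk gl] kill[OF g' g'k g'l]
    by (intro exI[of _ "rv \<gamma>"] exI[of _ "rv \<gamma>'"] exI[of _ "c1 * c2"]) auto
qed

end

section \<open>Highest weight vectors in symmetric powers\<close>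

instantiation prod :: (complex_vector, complex_vector) complex_vector
begin

definition scaleC_prod :: "complex \<Rightarrow> 'a \<times> 'b \<Rightarrow> 'a \<times> 'b" where
  "scaleC_prod c p = (c *\<^sub>C fst p, c *\<^sub>C snd p)"

instance
  by standard (simp_all add: scaleC_prod_def prod_eq_iff scaleC_add_right scaleC_add_left scaleC_scaleC scaleC_one)

end

lemma fst_scaleC: "fst (c *\<^sub>C p) = c *\<^sub>C fst p" and snd_scaleC: "snd (c *\<^sub>C p) = c *\<^sub>C snd p"
  by (simp_all add: scaleC_prod_def)

lemma clinear_fst: "clinear fst" and clinear_snd: "clinear snd"
  by (simp_all add: clinear_iff fst_scaleC snd_scaleC)

lemma clinear_Pair: "clinear f \<Longrightarrow> clinear g \<Longrightarrow> clinear (\<lambda>x. (f x, g x))"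
  by (simp add: clinear_iff scaleC_prod_def)

context pos_cartan
begin

text \<open>The centralizer of 0 is g itself, so the results on weight modules apply to the full
  adjoint action, and the submodule generated by \<open>v\<close> is the required summand.\<close>

lemma highest_weight_component:
  assumes v: "v \<in> sym_power k" "v \<noteq> 0" "\<And>h. h \<in> H \<Longrightarrow> sym_act h v = \<mu> h *\<^sub>C v"
    "\<And>\<alpha>. \<alpha> \<in> P \<Longrightarrow> sym_act (rv \<alpha>) v = 0"
  shows "\<exists>W. irreducible_component sym_act (sym_power k) W \<and> has_highest_weight H P sym_act W \<mu>"
proof -
  interpret L0: levi H P 0 by unfold_locales (rule cvec.subspace_0[OF subspace_H])
  have lv: "L0.lv = UNIV" by (simp add: L0.lv_def bracket_0)
  have "\<alpha> 0 = 0" if "\<alpha> \<in> P" for \<alpha>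
    using L0.dual_sum[OF root_dual[OF P_roots[OF that]], of "{}" "\<lambda>_. 0"] by simp
  then have \<Delta>p: "L0.\<Delta>p = P" by (auto simp: L0.\<Delta>p_def)
  interpret W: weight_module H P 0 sym_act "sym_power k"
    by (intro weight_module.intro weight_module_axioms.intro L0.levi_axioms)
      (rule clinear_sym_act clinear_sym_act_left sym_act_bracket sym_act_sym_power subspace_sym_power
        sym_power_weights | assumption)+
  have sub: "subrepresentation sym_act X \<longleftrightarrow> W.submod X" for X
    by (simp add: subrepresentation_def W.submod_def lv)
  have wv: "W.wv \<mu> v" using v(3) by (simp add: W.wv_def)
  have kill: "sym_act (rv \<alpha>) v = 0" if "\<alpha> \<in> L0.\<Delta>p" for \<alpha> using v(4) that \<Delta>p by simp
  note hw = v(1,2) wv kill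
  let ?W = "W.cyc {0} v"
  have vW: "v \<in> ?W" by (rule W.cyc_subset(2))
  have "?W \<noteq> {0}" using vW v(2) by blast
  then have irr: "irreducible_representation sym_act ?W"
    unfolding irreducible_representation_def sub
    using W.submod_cyc_v[OF hw] W.irreducible_cyc[OF hw] by blast
  moreover obtain U where "W.submod U" "?W \<inter> U = {0}" "sym_power k = {w + u |w u. w \<in> ?W \<and> u \<in> U}"
    using W.ex_complement[OF hw] by blast
  ultimately have "irreducible_component sym_act (sym_power k) ?W"
    unfolding irreducible_component_def sub by blast
  moreover have "has_highest_weight H P sym_act ?W \<mu>"
    unfolding has_highest_weight_def
  proof (rule bexI[OF _ vW], intro conjI ballI)
    show "v \<noteq> 0" by (rule v(2))
    show "sym_act h v = \<mu> h *\<^sub>C v" if "h \<in> H" for h by (rule v(3)[OF that])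
    fix \<alpha> x assume a: "\<alpha> \<in> P" and "x \<in> root_space H \<alpha>"
    then obtain c where "x = c *\<^sub>C rv \<alpha>" using root_space_rv[OF P_roots[OF a]] by (auto simp: cvec.span_singleton)
    then show "sym_act x v = 0" using v(4)[OF a] by (simp add: sym_act_scale_left)
  qed
  ultimately show ?thesis by blast
qed

section \<open>Iterated contractions and the induction invariant\<close>

definition DD :: "(nat \<Rightarrow> 'g \<Rightarrow> complex) \<Rightarrow> nat list \<Rightarrow> 'g sym_alg \<Rightarrow> 'g sym_alg" where
  "DD \<beta> js = fold (\<lambda>j. dd (rv (neg (\<beta> j)))) js"

lemma DD_Nil: "DD \<beta> [] a = a" and DD_Cons: "DD \<beta> (j # js) a = DD \<beta> js (dd (rv (neg (\<beta> j))) a)"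
  by (simp_all add: DD_def)

lemma clinear_DD: "clinear (DD \<beta> js)"
proof (induction js)
  case Nil
  then show ?case by (simp add: DD_def clinear_id id_def)
next
  case (Cons j js)
  have "DD \<beta> (j # js) = (\<lambda>a. DD \<beta> js (dd (rv (neg (\<beta> j))) a))" by (simp add: fun_eq_iff DD_Cons)
  then show ?case using clinear_compose[OF Cons derivation_linear[OF derivation_dd]] by simp
qed

text \<open>\<open>z\<close> kills every contracting vector, so by equivariance no correction terms
  arise.\<close>

lemma DD_act:
  "(\<And>j. j \<in> set js \<Longrightarrow> \<lbrakk>z, rv (neg (\<beta> j))\<rbrakk> = 0) \<Longrightarrow> DD \<beta> js (sym_act z a) = sym_act z (DD \<beta> js a)"
proof (induction js arbitrary: a)
  case (Cons j js)
  have "dd (rv (neg (\<beta> j))) (sym_act z a) = sym_act z (dd (rv (neg (\<beta> j))) a)"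
    using sym_act_dd[of z "rv (neg (\<beta> j))" a] Cons.prems[of j] by (simp add: dd_0)
  then show ?case using Cons by (simp add: DD_Cons)
qed (simp add: DD_Nil)

lemma DD_sym_power: "a \<in> sym_power (length js + n) \<Longrightarrow> DD \<beta> js a \<in> sym_power n"
  by (induction js arbitrary: a) (simp_all add: DD_Nil DD_Cons dd_sym_power)

lemma DD_perm: "mset js = mset ks \<Longrightarrow> DD \<beta> js = DD \<beta> ks"
  unfolding DD_def by (rule fold_multiset_equiv) (auto simp: fun_eq_iff dd_commute)

text \<open>A factor of degree one can absorb at most one of the contractions: either none hits it,
  or exactly one does and the others go to \<open>b\<close>.\<close>

lemma DD_leibniz:
  "distinct js \<Longrightarrow> DD \<beta> js (sym_inj x * b) =
     sym_inj x * DD \<beta> js b + (\<Sum>j\<in>set js. killing (rv (neg (\<beta> j))) x *\<^sub>C DD \<beta> (remove1 j js) b)"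
proof (induction js arbitrary: b)
  case (Cons j js)
  let ?y = "\<lambda>j. rv (neg (\<beta> j))"
  have "DD \<beta> (j # js) (sym_inj x * b) = DD \<beta> js (killing (?y j) x *\<^sub>C b + sym_inj x * dd (?y j) b)"
    by (simp add: DD_Cons derivation_mult[OF derivation_dd] dd_sym_inj sym_scale_mult_left)
  also have "\<dots> = killing (?y j) x *\<^sub>C DD \<beta> js b + DD \<beta> js (sym_inj x * dd (?y j) b)"
    by (simp add: clinear_add[OF clinear_DD] clinear_scale[OF clinear_DD])
  also have "DD \<beta> js (sym_inj x * dd (?y j) b) =
      sym_inj x * DD \<beta> (j # js) b + (\<Sum>i\<in>set js. killing (?y i) x *\<^sub>C DD \<beta> (remove1 i js) (dd (?y j) b))"
    using Cons by (simp add: DD_Cons)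
  also have "(\<Sum>i\<in>set js. killing (?y i) x *\<^sub>C DD \<beta> (remove1 i js) (dd (?y j) b)) =
      (\<Sum>i\<in>set js. killing (?y i) x *\<^sub>C DD \<beta> (remove1 i (j # js)) b)"
    by (rule sum.cong[OF refl]) (use Cons.prems in \<open>auto simp: DD_Cons\<close>)
  finally show ?case using Cons.prems by (simp add: algebra_simps)
qed (simp add: DD_Nil)

text \<open>The invariant of the induction. Its last conjunct is stronger than
  \<open>v \<noteq> 0\<close>; it is the form of nonvanishing that the step can reproduce.\<close>

definition good :: "(nat \<Rightarrow> 'g \<Rightarrow> complex) \<Rightarrow> nat \<Rightarrow> 'g sym_alg \<Rightarrow> bool" where
  "good \<beta> m v \<longleftrightarrow> v \<in> sym_power m \<and> (\<forall>h\<in>H. sym_act h v = (\<Sum>j=1..m. \<beta> j h) *\<^sub>C v) \<and>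
     (\<forall>\<alpha>\<in>P. sym_act (rv \<alpha>) v = 0) \<and> DD \<beta> [1..<Suc m] v \<noteq> 0"

end

section \<open>The twisted module and the graph of the isomorphism\<close>

context cascade
begin

text \<open>The module \<open>S\<^sup>m(g) \<oplus> g\<close> of the centralizer of \<open>T\<close>, with the second summand twisted by the character
  \<open>killing T\<close>.\<close>

definition tw :: "'g \<Rightarrow> 'g sym_alg \<times> 'g \<Rightarrow> 'g sym_alg \<times> 'g" where
  "tw z p = (sym_act z (fst p), \<lbrakk>z, snd p\<rbrakk> + killing T z *\<^sub>C snd p)"

lemma clinear_tw: "clinear (tw z)"
  unfolding tw_def
  by (intro clinear_Pair clinear_plus clinear_scaleC clinear_compose[OF clinear_sym_act]
      clinear_compose[OF clinear_bracket_right] clinear_fst clinear_snd)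

lemma clinear_tw_left: "clinear (\<lambda>z. tw z p)"
  unfolding tw_def
  by (intro clinear_Pair clinear_plus clinear_sym_act_left clinear_bracket_left)
    (rule clinearI, simp_all add: kadd_right kscale_right scaleC_add_left scaleC_scaleC)

text \<open>The twist is a character of the centralizer: by invariance
  \<open>killing T \<lbrakk>x, y\<rbrakk>\<close> equals
  \<open>killing \<lbrakk>T, x\<rbrakk> y\<close>, which is 0 there.\<close>

lemma tw_bracket:
  assumes "x \<in> L.lv" "y \<in> L.lv"
  shows "tw \<lbrakk>x, y\<rbrakk> p = tw x (tw y p) - tw y (tw x p)"
proof -
  have "killing T \<lbrakk>x, y\<rbrakk> = killing \<lbrakk>T, x\<rbrakk> y" by (simp add: kinvariant)
  then have "killing T \<lbrakk>x, y\<rbrakk> = 0" using assms by (simp add: L.lv_def k0)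
  then show ?thesis
    by (simp add: tw_def prod_eq_iff sym_act_bracket bracket_bracket bracket_add_right bracket_scale_right
        scaleC_add_right scaleC_scaleC mult.commute[of "killing T x"])
qed

lemma killing_T: "h \<in> H \<Longrightarrow> killing T h = (\<Sum>j\<in>I. \<beta> j h)"
  unfolding T_def ksum by (rule sum.cong[OF refl]) (use killing_tt \<beta>_root in blast)

lemma killing_T_rv: "\<alpha> \<in> roots H \<Longrightarrow> killing T (rv \<alpha>) = 0"
  by (rule killing_H_rv[OF T_H])

lemma tw_fd: "\<exists>B. finite B \<and> sym_power m \<times> UNIV \<subseteq> cspan (B :: ('g sym_alg \<times> 'g) set)"
proof -
  obtain B1 :: "'g sym_alg set" where B1: "finite B1" "sym_power m \<subseteq> cspan B1" using sym_power_weights(1) by blast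
  obtain B2 :: "'g set" where B2: "finite B2" "cspan B2 = UNIV" using finite_span by blast
  let ?B = "(\<lambda>s. (s, 0)) ` B1 \<union> (\<lambda>y. (0, y)) ` B2"
  have "p \<in> cspan ?B" if p: "p \<in> sym_power m \<times> UNIV" for p
  proof -
    have "(fst p, 0) \<in> cspan ?B"
      by (rule clinear_span_into[OF clinear_Pair[OF clinear_id clinear_zero] _ cvec.subspace_span, of _ B1])
        (use p B1 in \<open>auto intro: cvec.span_base\<close>)
    moreover have "(0, snd p) \<in> cspan ?B"
      by (rule clinear_span_into[OF clinear_Pair[OF clinear_zero clinear_id] _ cvec.subspace_span, of _ B2])
        (use B2 in \<open>auto intro: cvec.span_base\<close>)
    ultimately have "(fst p, 0) + (0, snd p) \<in> cspan ?B" by (rule cvec.span_add)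
    then show ?thesis by simp
  qed
  then show ?thesis using B1 B2 by (intro exI[of _ ?B]) auto
qed

lemma tw_weights:
  "sym_power m \<times> UNIV \<subseteq> cspan {p \<in> sym_power m \<times> UNIV. \<exists>\<mu>. \<forall>h\<in>H. tw h p = \<mu> h *\<^sub>C p}" (is "_ \<subseteq> cspan ?S")
proof
  fix p :: "'g sym_alg \<times> 'g" assume p: "p \<in> sym_power m \<times> UNIV"
  have "(fst p, 0) \<in> cspan ?S"
  proof (rule clinear_span_into[OF clinear_Pair[OF clinear_id clinear_zero] _ cvec.subspace_span])
    show "fst p \<in> cspan {v\<in>sym_power m. \<exists>\<mu>. \<forall>h\<in>H. sym_act h v = \<mu> h *\<^sub>C v}"
      by (rule subsetD[OF sym_power_weights(2)]) (use p in auto)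
    show "(b, 0) \<in> cspan ?S" if "b \<in> {v\<in>sym_power m. \<exists>\<mu>. \<forall>h\<in>H. sym_act h v = \<mu> h *\<^sub>C v}" for b
      using that by (intro cvec.span_base) (auto simp: tw_def bracket_0 scaleC_prod_def)
  qed
  moreover have "(0, snd p) \<in> cspan ?S"
  proof (rule clinear_span_into[OF clinear_Pair[OF clinear_zero clinear_id] _ cvec.subspace_span])
    show "snd p \<in> cspan (H \<union> (\<Union>\<alpha>\<in>roots H. root_space H \<alpha>))" using span_H_root_spaces by simp
    fix b assume b: "b \<in> H \<union> (\<Union>\<alpha>\<in>roots H. root_space H \<alpha>)"
    have "\<exists>\<mu>. \<forall>h\<in>H. \<lbrakk>h, b\<rbrakk> = \<mu> h *\<^sub>C b"
      using b
    proof
      assume "b \<in> H"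
      then show ?thesis by (intro exI[of _ "\<lambda>_. 0"]) (use abelian_H in simp)
    qed (auto simp: root_space_def)
    then obtain \<mu> where "\<forall>h\<in>H. \<lbrakk>h, b\<rbrakk> = \<mu> h *\<^sub>C b" by blast
    then have "\<forall>h\<in>H. tw h (0, b) = (\<mu> h + killing T h) *\<^sub>C (0, b)"
      by (simp add: tw_def scaleC_prod_def scaleC_add_left clinear_0[OF clinear_sym_act])
    moreover have "(0, b) \<in> sym_power m \<times> UNIV" using cvec.subspace_0[OF subspace_sym_power] by auto
    ultimately show "(0, b) \<in> cspan ?S" 
      by (intro cvec.span_base CollectI conjI exI[of _ "\<lambda>h. \<mu> h + killing T h"])
  qed
  ultimately have "(fst p, 0) + (0, snd p) \<in> cspan ?S" by (rule cvec.span_add)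
  then show "p \<in> cspan ?S" by simp
qed

lemma subspace_tw: "csubspace (sym_power m \<times> (UNIV :: 'g set))"
  using subspace_sym_power by (auto simp: cvec.subspace_def zero_prod_def scaleC_prod_def)

lemma tw_closed: "p \<in> sym_power m \<times> UNIV \<Longrightarrow> tw z p \<in> sym_power m \<times> (UNIV :: 'g set)"
  by (simp add: tw_def mem_Times_iff sym_act_sym_power)

sublocale W: weight_module H P T tw "sym_power m \<times> UNIV"
  by (intro weight_module.intro weight_module_axioms.intro L.levi_axioms)
    (rule clinear_tw clinear_tw_left tw_bracket tw_closed subspace_tw tw_fd tw_weights | assumption)+

context
  fixes v :: "'g sym_alg"
  assumes v: "good \<beta> m v" and m: "1 \<le> m"
begin

abbreviation "bk \<equiv> \<beta> (Suc m)"
abbreviation "v0 \<equiv> (v, rv (neg bk))"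
abbreviation "D \<equiv> W.cyc {0} v0"

lemma v_facts: "v \<in> sym_power m" "h \<in> H \<Longrightarrow> sym_act h v = (\<Sum>j=1..m. \<beta> j h) *\<^sub>C v" "\<alpha> \<in> P \<Longrightarrow> sym_act (rv \<alpha>) v = 0"
    "DD \<beta> [1..<Suc m] v \<noteq> 0"
  using v by (simp_all only: good_def) auto

lemma bk_root: "bk \<in> roots H" by (rule \<beta>_root[OF K])

lemma v0: "v0 \<in> sym_power m \<times> UNIV" "v0 \<noteq> 0" "W.wv (\<lambda>h. \<Sum>j=1..m. \<beta> j h) v0"
  "\<alpha> \<in> L.\<Delta>p \<Longrightarrow> tw (rv \<alpha>) v0 = 0"
proof -
  show "v0 \<in> sym_power m \<times> UNIV" using v_facts by simp
  show "v0 \<noteq> 0" using rv_nonzero[OF uminus_root[OF bk_root]] by (simp add: zero_prod_def)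
  show "W.wv (\<lambda>h. \<Sum>j=1..m. \<beta> j h) v0"
    unfolding W.wv_def
  proof
    fix h assume h: "h \<in> H"
    \<comment> \<open>The twist adds the sum of all \<beta>_j up to \<open>Suc m\<close>;
      subtracting \<open>bk\<close> leaves the weight of \<open>v\<close>.\<close>
    have "\<lbrakk>h, rv (neg bk)\<rbrakk> + killing T h *\<^sub>C rv (neg bk) = (\<Sum>j=1..m. \<beta> j h) *\<^sub>C rv (neg bk)"
      unfolding killing_T[OF h] bracket_rv[OF uminus_root[OF bk_root] h] by (simp add: scaleC_add_left)
    then show "tw h v0 = (\<Sum>j=1..m. \<beta> j h) *\<^sub>C v0" using v_facts(2)[OF h] by (simp add: tw_def scaleC_prod_def)
  qed
  show "tw (rv \<alpha>) v0 = 0" if a: "\<alpha> \<in> L.\<Delta>p"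
    using v_facts(3)[OF L.\<Delta>p_P[OF a]] lowest_in_top_grade[OF a] killing_T_rv[OF P_roots[OF L.\<Delta>p_P[OF a]]]
    by (simp add: tw_def zero_prod_def)
qed

lemmas hw = v0

lemma submod_D: "W.submod D" by (rule W.submod_cyc_v[OF hw])

lemma v0_D: "v0 \<in> D" by (rule W.cyc_subset(2))

lemma D_sym: "p \<in> D \<Longrightarrow> fst p \<in> sym_power m"
  using W.cyc_v_V[OF hw] by auto

text \<open>The elements of \<open>D\<close> with second component 0 form a submodule that misses
  \<open>v0\<close>, hence is zero by irreducibility.\<close>

lemma D_graph: "(s, y) \<in> D \<Longrightarrow> (s', y) \<in> D \<Longrightarrow> s = s'"
proof -
  assume a: "(s, y) \<in> D" "(s', y) \<in> D"
  let ?Y = "D \<inter> {p. snd p = 0}"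
  have "W.submod {p :: 'g sym_alg \<times> 'g. snd p = 0}"
    by (auto simp: W.submod_def cvec.subspace_def snd_scaleC tw_def bracket_0)
  then have Y: "W.submod ?Y" using submod_D W.submod_inter by blast
  have "v0 \<notin> ?Y" using rv_nonzero[OF uminus_root[OF bk_root]] by simp
  then have "?Y = {0}" using W.irreducible_cyc[OF hw Y] v0_D by blast
  moreover have "(s, y) - (s', y) \<in> ?Y" using cvec.subspace_diff[OF W.submod_sub[OF submod_D] a] by simp
  ultimately have "(s, y) - (s', y) = 0" by blast
  then show "s = s'" by (simp add: zero_prod_def)
qed

text \<open>\<open>T\<close> commutes with the whole centralizer, so the eigenvalue of the second
  component of \<open>v0\<close> is shared by all of \<open>D\<close>.\<close>

lemma D_top: "p \<in> D \<Longrightarrow> \<lbrakk>T, snd p\<rbrakk> = - N *\<^sub>C snd p"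
proof -
  let ?X = "{p :: 'g sym_alg \<times> 'g. \<lbrakk>T, snd p\<rbrakk> = - N *\<^sub>C snd p}"
  have "csubspace ?X"
    by (auto simp: cvec.subspace_def snd_scaleC bracket_0 bracket_add_right bracket_scale_right scaleC_add_right
        scaleC_scaleC mult.commute cvec.scale_minus_left)
  moreover have "tw x p \<in> ?X" if "x \<in> L.lv" "p \<in> ?X" for x p
    using that by (simp add: tw_def L.lv_def bracket_add_right bracket_scale_right bracket_derivation[of T x]
        bracket_0 scaleC_add_right scaleC_scaleC mult.commute bracket_neg cvec.scale_minus_left)
  ultimately have X: "W.submod ?X" by (simp add: W.submod_def)
  have "v0 \<in> ?X" using bracket_rv[OF uminus_root[OF bk_root] T_H] \<beta>_T[OF K] by simp
  then have "D \<subseteq> ?X" using W.cyc_minimal[OF X, of "{0}" v0] by (simp add: bracket_0)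
  then show "p \<in> D \<Longrightarrow> \<lbrakk>T, snd p\<rbrakk> = - N *\<^sub>C snd p" by blast
qed

text \<open>The root vectors with positive value at \<open>T\<close> are permuted, up to scalars and
  zero, by brackets with the centralizer. Being killed by all of them is thus a condition on
  submodules, and it suffices to check \<open>v0\<close>.\<close>

lemma D_killed: "p \<in> D \<Longrightarrow> \<alpha> \<in> roots H \<Longrightarrow> 0 < \<alpha> T \<Longrightarrow> sym_act (rv \<alpha>) (fst p) = 0"
proof -
  let ?X = "{p :: 'g sym_alg \<times> 'g. \<forall>\<alpha>\<in>roots H. 0 < \<alpha> T \<longrightarrow> sym_act (rv \<alpha>) (fst p) = 0}"
  have X: "W.submod ?X"
  proof (rule W.submodI)
    show "csubspace ?X"
      by (auto simp: cvec.subspace_def fst_scaleC clinear_0[OF clinear_sym_act] sym_act_add sym_act_scale)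
    show "tw h p \<in> ?X" if h: "h \<in> H" and p: "p \<in> ?X" for h p
    proof -
      have "sym_act (rv \<alpha>) (sym_act h (fst p)) = 0" if a: "\<alpha> \<in> roots H" "0 < \<alpha> T" for \<alpha>
      proof -
        have "\<lbrakk>rv \<alpha>, h\<rbrakk> = (- \<alpha> h) *\<^sub>C rv \<alpha>" using bracket_rv[OF a(1) h] bracket_anticomm[of "rv \<alpha>" h] by simp
        then have "sym_act \<lbrakk>rv \<alpha>, h\<rbrakk> (fst p) = (- \<alpha> h) *\<^sub>C sym_act (rv \<alpha>) (fst p)" by (simp only: sym_act_scale_left)
        moreover have "sym_act (rv \<alpha>) (fst p) = 0" using p a by blast
        ultimately show ?thesis using sym_act_bracket[of "rv \<alpha>" h "fst p"] by (simp add: clinear_0[OF clinear_sym_act])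
      qed
      then show ?thesis by (simp add: tw_def)
    qed
    show "tw (rv \<delta>) p \<in> ?X" if d: "\<delta> \<in> L.\<Delta>" and p: "p \<in> ?X" for \<delta> p
    proof -
      have dr: "\<delta> \<in> roots H" "\<delta> T = 0" using d by (auto simp: L.\<Delta>_def)
      have "sym_act (rv \<alpha>) (sym_act (rv \<delta>) (fst p)) = 0" if a: "\<alpha> \<in> roots H" "0 < \<alpha> T" for \<alpha>
      proof -
        let ?s = "\<lambda>h. \<alpha> h + \<delta> h"
        have s: "0 < ?s T" using a dr by simp
        then have sne: "?s \<noteq> (\<lambda>h. 0)" by (intro notI) (drule fun_cong[of _ _ T], simp)
        have "sym_act \<lbrakk>rv \<alpha>, rv \<delta>\<rbrakk> (fst p) = 0"
        proof (cases "?s \<in> roots H")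
          case True
          then obtain c where "\<lbrakk>rv \<alpha>, rv \<delta>\<rbrakk> = c *\<^sub>C rv ?s" using rv_bracket_root a dr by blast
          moreover have "\<forall>\<alpha>\<in>roots H. 0 < \<alpha> T \<longrightarrow> sym_act (rv \<alpha>) (fst p) = 0" using p by simp
          then have "sym_act (rv ?s) (fst p) = 0" using True s by (elim ballE[of _ _ ?s]) simp_all
          ultimately show ?thesis by (simp only: sym_act_scale_left cvec.scale_zero_right)
        next
          case False
          have "\<lbrakk>rv \<alpha>, rv \<delta>\<rbrakk> = 0" by (rule rv_bracket_0[OF a(1) dr(1) False sne])
          then show ?thesis by (simp only: clinear_0[OF clinear_sym_act_left])
        qed
        moreover have "sym_act (rv \<alpha>) (fst p) = 0" using p a by blast
        ultimately show ?thesis using sym_act_bracket[of "rv \<alpha>" "rv \<delta>" "fst p"] by (simp add: clinear_0[OF clinear_sym_act])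
      qed
      then show ?thesis by (simp add: tw_def)
    qed
  qed
  \<comment> \<open>A negative root is nonpositive on \<open>T\<close> by dominance.\<close>
  have "\<alpha> \<in> P" if "\<alpha> \<in> roots H" "0 < \<alpha> T" for \<alpha>
  proof (rule ccontr)
    assume "\<alpha> \<notin> P"
    then have "neg \<alpha> \<in> P" using P_cases that by blast
    then have "0 \<le> - \<alpha> T" unfolding T_def by (rule \<sigma>_dominant)
    then show False using that(2) by (simp add: less_complex_def less_eq_complex_def)
  qed
  then have "v0 \<in> ?X" using v_facts(3) by simp
  then have "D \<subseteq> ?X" using W.cyc_minimal[OF X, of "{0}" v0] by (simp add: clinear_0[OF clinear_sym_act])
  then show "p \<in> D \<Longrightarrow> \<alpha> \<in> roots H \<Longrightarrow> 0 < \<alpha> T \<Longrightarrow> sym_act (rv \<alpha>) (fst p) = 0" by blast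
qed

section \<open>The isomorphism in coordinates\<close>

definition A :: "('g \<Rightarrow> complex) set" where "A = {\<delta> \<in> roots H. \<exists>s. (s, rv (neg \<delta>)) \<in> D}"

text \<open>The value of the isomorphism at \<open>rv (neg \<delta>)\<close>, read off from the
  graph \<open>D\<close>; the choice is unique for \<open>\<delta>\<close> in \<open>A\<close> by
  \<open>D_graph\<close>.\<close>

definition \<Phi> :: "('g \<Rightarrow> complex) \<Rightarrow> 'g sym_alg" where "\<Phi> \<delta> = (SOME s. (s, rv (neg \<delta>)) \<in> D)"

lemma A_roots: "\<delta> \<in> A \<Longrightarrow> \<delta> \<in> roots H" by (simp add: A_def)

lemma finite_A: "finite A" using finite_roots by (simp add: A_def)

lemma \<Phi>_D: "\<delta> \<in> A \<Longrightarrow> (\<Phi> \<delta>, rv (neg \<delta>)) \<in> D"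
  unfolding \<Phi>_def A_def by (auto intro: someI)

lemma \<Phi>_eq: "(s, rv (neg \<delta>)) \<in> D \<Longrightarrow> \<delta> \<in> roots H \<Longrightarrow> \<delta> \<in> A \<and> \<Phi> \<delta> = s"
proof -
  assume a: "(s, rv (neg \<delta>)) \<in> D" "\<delta> \<in> roots H"
  then have "\<delta> \<in> A" by (auto simp: A_def)
  then show ?thesis using D_graph[OF \<Phi>_D a(1)] by blast
qed

lemma \<Phi>_scaled: "(s, c *\<^sub>C rv (neg \<delta>)) \<in> D \<Longrightarrow> c \<noteq> 0 \<Longrightarrow> \<delta> \<in> roots H \<Longrightarrow> \<delta> \<in> A \<and> s = c *\<^sub>C \<Phi> \<delta>"
proof -
  assume a: "(s, c *\<^sub>C rv (neg \<delta>)) \<in> D" "c \<noteq> 0" "\<delta> \<in> roots H"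
  have "(1 / c) *\<^sub>C (s, c *\<^sub>C rv (neg \<delta>)) \<in> D" by (rule cvec.subspace_scale[OF W.subspace_cyc a(1)])
  then have "((1 / c) *\<^sub>C s, rv (neg \<delta>)) \<in> D" using a(2) by (simp add: scaleC_prod_def scaleC_scaleC scaleC_one)
  then have "\<delta> \<in> A \<and> \<Phi> \<delta> = (1 / c) *\<^sub>C s" using a(3) by (rule \<Phi>_eq)
  then show ?thesis using a(2) by (simp add: scaleC_scaleC scaleC_one)
qed

lemma \<Phi>_bk: "bk \<in> A" "\<Phi> bk = v"
  using \<Phi>_eq[OF v0_D bk_root] by auto

lemma A_T: "\<delta> \<in> A \<Longrightarrow> \<delta> T = N"
proof -
  assume d: "\<delta> \<in> A"
  have "\<lbrakk>T, rv (neg \<delta>)\<rbrakk> = - N *\<^sub>C rv (neg \<delta>)" using D_top[OF \<Phi>_D[OF d]] by simp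
  moreover have "\<lbrakk>T, rv (neg \<delta>)\<rbrakk> = - \<delta> T *\<^sub>C rv (neg \<delta>)" by (rule bracket_rv[OF uminus_root[OF A_roots[OF d]] T_H])
  ultimately have "- \<delta> T *\<^sub>C rv (neg \<delta>) = - N *\<^sub>C rv (neg \<delta>)" by simp
  then have "- \<delta> T = - N" using rv_nonzero[OF uminus_root[OF A_roots[OF d]]] by (simp only: cvec.scale_cancel_right) simp
  then show ?thesis by simp
qed

text \<open>Acting with the root vector of \<open>-\<alpha>\<close> on the graph point over
  \<open>-\<delta>\<close> gives a nonzero multiple over
  \<open>-(\<alpha> + \<delta>)\<close>.\<close>

lemma A_closed: "\<delta> \<in> A \<Longrightarrow> \<alpha> \<in> L.\<Delta> \<Longrightarrow> (\<lambda>h. \<alpha> h + \<delta> h) \<in> roots H \<Longrightarrow> (\<lambda>h. \<alpha> h + \<delta> h) \<in> A"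
proof -
  assume d: "\<delta> \<in> A" and a: "\<alpha> \<in> L.\<Delta>" and s: "(\<lambda>h. \<alpha> h + \<delta> h) \<in> roots H"
  have na: "neg \<alpha> \<in> L.\<Delta>" by (rule L.neg_\<Delta>[OF a])
  have eq: "(\<lambda>h. neg \<alpha> h + neg \<delta> h) = neg (\<lambda>h. \<alpha> h + \<delta> h)" by simp
  obtain c where c: "c \<noteq> 0" "\<lbrakk>rv (neg \<alpha>), rv (neg \<delta>)\<rbrakk> = c *\<^sub>C rv (neg (\<lambda>h. \<alpha> h + \<delta> h))"
    using rv_bracket_root[OF L.\<Delta>_roots[OF na] uminus_root[OF A_roots[OF d]]] uminus_root[OF s]
    unfolding eq by blast
  have "tw (rv (neg \<alpha>)) (\<Phi> \<delta>, rv (neg \<delta>)) \<in> D" by (rule W.submod_act[OF submod_D L.rv_lv[OF na] \<Phi>_D[OF d]])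
  then have "(sym_act (rv (neg \<alpha>)) (\<Phi> \<delta>), c *\<^sub>C rv (neg (\<lambda>h. \<alpha> h + \<delta> h))) \<in> D"
    using c(2) killing_T_rv[OF L.\<Delta>_roots[OF na]] by (simp add: tw_def)
  then show ?thesis using \<Phi>_scaled[OF _ c(1) s] by blast
qed

lemma \<Phi>_weight: "\<delta> \<in> A \<Longrightarrow> h \<in> H \<Longrightarrow> sym_act h (\<Phi> \<delta>) = (killing T h - \<delta> h) *\<^sub>C \<Phi> \<delta>"
proof -
  assume d: "\<delta> \<in> A" and h: "h \<in> H"
  have "tw h (\<Phi> \<delta>, rv (neg \<delta>)) \<in> D" by (rule W.submod_act[OF submod_D L.H_lv[OF h] \<Phi>_D[OF d]])
  moreover have "\<lbrakk>h, rv (neg \<delta>)\<rbrakk> + killing T h *\<^sub>C rv (neg \<delta>) = (killing T h - \<delta> h) *\<^sub>C rv (neg \<delta>)"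
    unfolding bracket_rv[OF uminus_root[OF A_roots[OF d]] h] by (simp add: cvec.scale_left_diff_distrib)
  ultimately have 1: "(sym_act h (\<Phi> \<delta>), (killing T h - \<delta> h) *\<^sub>C rv (neg \<delta>)) \<in> D" by (simp add: tw_def)
  have "(killing T h - \<delta> h) *\<^sub>C (\<Phi> \<delta>, rv (neg \<delta>)) \<in> D" by (rule cvec.subspace_scale[OF W.subspace_cyc \<Phi>_D[OF d]])
  then have 2: "((killing T h - \<delta> h) *\<^sub>C \<Phi> \<delta>, (killing T h - \<delta> h) *\<^sub>C rv (neg \<delta>)) \<in> D" by (simp add: scaleC_prod_def)
  show ?thesis by (rule D_graph[OF 1 2])
qed

lemma bracket_expand:
  assumes "\<alpha> \<in> roots H" "\<delta> \<in> roots H" "finite C" "C \<subseteq> roots H" "(\<lambda>h. \<alpha> h + \<delta> h) \<noteq> (\<lambda>h. 0)"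
    "(\<lambda>h. \<alpha> h + \<delta> h) \<in> roots H \<Longrightarrow> (\<lambda>h. \<alpha> h + \<delta> h) \<in> C"
  shows "\<lbrakk>rv \<alpha>, rv \<delta>\<rbrakk> = (\<Sum>\<epsilon>\<in>C. killing \<lbrakk>rv \<alpha>, rv \<delta>\<rbrakk> (rv (neg \<epsilon>)) *\<^sub>C rv \<epsilon>)"
proof (cases "(\<lambda>h. \<alpha> h + \<delta> h) \<in> roots H")
  case False
  then have "\<lbrakk>rv \<alpha>, rv \<delta>\<rbrakk> = 0" using rv_bracket_0 assms by blast
  then show ?thesis by (simp add: k0)
next
  case True
  let ?s = "\<lambda>h. \<alpha> h + \<delta> h"
  obtain c where c: "\<lbrakk>rv \<alpha>, rv \<delta>\<rbrakk> = c *\<^sub>C rv ?s" using rv_bracket_root assms True by blast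
  have "(\<Sum>\<epsilon>\<in>C. killing \<lbrakk>rv \<alpha>, rv \<delta>\<rbrakk> (rv (neg \<epsilon>)) *\<^sub>C rv \<epsilon>) = (\<Sum>\<epsilon>\<in>C. if \<epsilon> = ?s then c *\<^sub>C rv ?s else 0)"
  proof (rule sum.cong[OF refl])
    fix \<epsilon> assume "\<epsilon> \<in> C"
    then have "killing (rv ?s) (rv (neg \<epsilon>)) = (if ?s = \<epsilon> then 1 else 0)"
      using killing_rv_rv[OF True] assms(4) by blast
    then have "killing \<lbrakk>rv \<alpha>, rv \<delta>\<rbrakk> (rv (neg \<epsilon>)) = c * (if ?s = \<epsilon> then 1 else 0)"
      by (simp only: c kscale_left)
    then show "killing \<lbrakk>rv \<alpha>, rv \<delta>\<rbrakk> (rv (neg \<epsilon>)) *\<^sub>C rv \<epsilon> = (if \<epsilon> = ?s then c *\<^sub>C rv ?s else 0)" by auto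
  qed
  then show ?thesis using assms(3,6) True c by simp
qed

text \<open>Equivariance of the isomorphism: the bracket of root vectors is expanded over
  \<open>A\<close>, and the graph property transfers the same coefficients to
  \<open>\<Phi>\<close>.\<close>

lemma \<Phi>_act:
  assumes a: "\<alpha> \<in> L.\<Delta>" and d: "\<delta> \<in> A"
  shows "sym_act (rv \<alpha>) (\<Phi> \<delta>) = (\<Sum>\<epsilon>\<in>A. killing \<lbrakk>rv \<alpha>, rv (neg \<delta>)\<rbrakk> (rv \<epsilon>) *\<^sub>C \<Phi> \<epsilon>)"
proof -
  let ?c = "\<lambda>\<epsilon>. killing \<lbrakk>rv \<alpha>, rv (neg \<delta>)\<rbrakk> (rv \<epsilon>)"
  have ar: "\<alpha> \<in> roots H" "\<alpha> T = 0" using a by (auto simp: L.\<Delta>_def)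
  have nd: "neg \<delta> \<in> roots H" by (rule uminus_root[OF A_roots[OF d]])
  have "\<lbrakk>rv \<alpha>, rv (neg \<delta>)\<rbrakk> = (\<Sum>\<epsilon>\<in>neg ` A. killing \<lbrakk>rv \<alpha>, rv (neg \<delta>)\<rbrakk> (rv (neg \<epsilon>)) *\<^sub>C rv \<epsilon>)"
  proof (rule bracket_expand[OF ar(1) nd])
    show "finite (neg ` A)" using finite_A by simp
    show "neg ` A \<subseteq> roots H" using A_roots uminus_root by blast
    have "(\<lambda>h. \<alpha> h + neg \<delta> h) T \<noteq> 0" using ar A_T[OF d] N_nonzero by simp
    then show "(\<lambda>h. \<alpha> h + neg \<delta> h) \<noteq> (\<lambda>h. 0)" by (auto dest: fun_cong)
    assume r: "(\<lambda>h. \<alpha> h + neg \<delta> h) \<in> roots H"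
    have "neg (\<lambda>h. \<alpha> h + neg \<delta> h) \<in> roots H" by (rule uminus_root[OF r])
    then have "(\<lambda>h. neg \<alpha> h + \<delta> h) \<in> roots H" by simp
    then have "(\<lambda>h. neg \<alpha> h + \<delta> h) \<in> A" by (rule A_closed[OF d L.neg_\<Delta>[OF a]])
    then have "neg (\<lambda>h. neg \<alpha> h + \<delta> h) \<in> neg ` A" by (rule imageI)
    then show "(\<lambda>h. \<alpha> h + neg \<delta> h) \<in> neg ` A" by simp
  qed
  also have "\<dots> = (\<Sum>\<epsilon>\<in>A. ?c \<epsilon> *\<^sub>C rv (neg \<epsilon>))"
    by (subst sum.reindex) (auto intro!: inj_onI simp: fun_eq_iff)
  finally have y: "\<lbrakk>rv \<alpha>, rv (neg \<delta>)\<rbrakk> = (\<Sum>\<epsilon>\<in>A. ?c \<epsilon> *\<^sub>C rv (neg \<epsilon>))" .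
  have "tw (rv \<alpha>) (\<Phi> \<delta>, rv (neg \<delta>)) \<in> D" by (rule W.submod_act[OF submod_D L.rv_lv[OF a] \<Phi>_D[OF d]])
  then have 1: "(sym_act (rv \<alpha>) (\<Phi> \<delta>), \<lbrakk>rv \<alpha>, rv (neg \<delta>)\<rbrakk>) \<in> D"
    using killing_T_rv[OF ar(1)] by (simp add: tw_def)
  have "(\<Sum>\<epsilon>\<in>A. ?c \<epsilon> *\<^sub>C (\<Phi> \<epsilon>, rv (neg \<epsilon>))) \<in> D"
    by (intro cvec.subspace_sum[OF W.subspace_cyc] cvec.subspace_scale[OF W.subspace_cyc] \<Phi>_D)
  then have "(\<Sum>\<epsilon>\<in>A. ?c \<epsilon> *\<^sub>C \<Phi> \<epsilon>, \<Sum>\<epsilon>\<in>A. ?c \<epsilon> *\<^sub>C rv (neg \<epsilon>)) \<in> D"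
    by (simp add: scaleC_prod_def sum_prod)
  then have 2: "(\<Sum>\<epsilon>\<in>A. ?c \<epsilon> *\<^sub>C \<Phi> \<epsilon>, \<lbrakk>rv \<alpha>, rv (neg \<delta>)\<rbrakk>) \<in> D"
    unfolding y[symmetric] .
  show ?thesis by (rule D_graph[OF 1 2])
qed

section \<open>The new highest weight vector\<close>

definition v' :: "'g sym_alg" where "v' = (\<Sum>\<delta>\<in>A. sym_inj (rv \<delta>) * \<Phi> \<delta>)"

lemma v'_power: "v' \<in> sym_power (Suc m)"
  unfolding v'_def
  by (intro cvec.subspace_sum[OF subspace_sym_power] sym_power_mult) (use D_sym[OF \<Phi>_D] in auto)

text \<open>The weight \<open>\<delta>\<close> of the linear factor cancels against that of
  \<open>\<Phi> \<delta>\<close>, so every summand has the weight given by the twist.\<close>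

lemma v'_weight: "h \<in> H \<Longrightarrow> sym_act h v' = (\<Sum>j=1..Suc m. \<beta> j h) *\<^sub>C v'"
proof -
  assume h: "h \<in> H"
  have "sym_act h (sym_inj (rv \<delta>) * \<Phi> \<delta>) = killing T h *\<^sub>C (sym_inj (rv \<delta>) * \<Phi> \<delta>)" if d: "\<delta> \<in> A" for \<delta>
    using \<Phi>_weight[OF d h] bracket_rv[OF A_roots[OF d] h]
    by (simp add: sym_act_mult sym_act_sym_inj sym_inj_scale sym_scale_mult_left sym_scale_mult_right
        flip: scaleC_add_left)
  then show ?thesis
    unfolding v'_def clinear_sum[OF clinear_sym_act] killing_T[OF h, symmetric] by (simp add: cvec.scale_sum_right)
qed

text \<open>The same cancellation as for the Casimir operator: the matrices of
  \<open>rv \<alpha>\<close> on the two dual families of root vectors are negative transposes of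
  each other.\<close>

lemma v'_killed_\<Delta>:
  assumes a: "\<alpha> \<in> L.\<Delta>" shows "sym_act (rv \<alpha>) v' = 0"
proof -
  have ar: "\<alpha> \<in> roots H" "\<alpha> T = 0" using a by (auto simp: L.\<Delta>_def)
  let ?k = "\<lambda>\<delta> \<epsilon>. killing \<lbrakk>rv \<alpha>, rv \<delta>\<rbrakk> (rv (neg \<epsilon>))"
  have x: "\<lbrakk>rv \<alpha>, rv \<delta>\<rbrakk> = (\<Sum>\<epsilon>\<in>A. ?k \<delta> \<epsilon> *\<^sub>C rv \<epsilon>)" if d: "\<delta> \<in> A" for \<delta>
  proof (rule bracket_expand[OF ar(1) A_roots[OF d] finite_A])
    have "(\<lambda>h. \<alpha> h + \<delta> h) T \<noteq> 0" using ar A_T[OF d] N_nonzero by simp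
    then show "(\<lambda>h. \<alpha> h + \<delta> h) \<noteq> (\<lambda>h. 0)" by (auto dest: fun_cong)
    show "(\<lambda>h. \<alpha> h + \<delta> h) \<in> A" if "(\<lambda>h. \<alpha> h + \<delta> h) \<in> roots H" using A_closed[OF d a that] .
  qed (use A_roots in blast)
  have "sym_act (rv \<alpha>) v' = (\<Sum>\<delta>\<in>A. sym_inj \<lbrakk>rv \<alpha>, rv \<delta>\<rbrakk> * \<Phi> \<delta> + sym_inj (rv \<delta>) * sym_act (rv \<alpha>) (\<Phi> \<delta>))"
    unfolding v'_def clinear_sum[OF clinear_sym_act] by (simp add: sym_act_mult sym_act_sym_inj)
  also have "\<dots> = (\<Sum>\<delta>\<in>A. sym_inj \<lbrakk>rv \<alpha>, rv \<delta>\<rbrakk> * \<Phi> \<delta>) + (\<Sum>\<delta>\<in>A. sym_inj (rv \<delta>) * sym_act (rv \<alpha>) (\<Phi> \<delta>))"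
    by (rule sum.distrib)
  also have "(\<Sum>\<delta>\<in>A. sym_inj \<lbrakk>rv \<alpha>, rv \<delta>\<rbrakk> * \<Phi> \<delta>) = (\<Sum>\<delta>\<in>A. \<Sum>\<epsilon>\<in>A. ?k \<delta> \<epsilon> *\<^sub>C (sym_inj (rv \<epsilon>) * \<Phi> \<delta>))"
  proof (rule sum.cong[OF refl])
    fix \<delta> assume d: "\<delta> \<in> A"
    have "sym_inj \<lbrakk>rv \<alpha>, rv \<delta>\<rbrakk> = (\<Sum>\<epsilon>\<in>A. ?k \<delta> \<epsilon> *\<^sub>C sym_inj (rv \<epsilon>))"
      by (subst x[OF d]) (simp add: clinear_sum[OF clinear_sym_inj] sym_inj_scale)
    then show "sym_inj \<lbrakk>rv \<alpha>, rv \<delta>\<rbrakk> * \<Phi> \<delta> = (\<Sum>\<epsilon>\<in>A. ?k \<delta> \<epsilon> *\<^sub>C (sym_inj (rv \<epsilon>) * \<Phi> \<delta>))"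
      by (simp add: clinear_sum[OF clinear_mult_right] sym_scale_mult_left)
  qed
  also have "(\<Sum>\<delta>\<in>A. sym_inj (rv \<delta>) * sym_act (rv \<alpha>) (\<Phi> \<delta>)) =
      (\<Sum>\<delta>\<in>A. \<Sum>\<epsilon>\<in>A. killing \<lbrakk>rv \<alpha>, rv (neg \<delta>)\<rbrakk> (rv \<epsilon>) *\<^sub>C (sym_inj (rv \<delta>) * \<Phi> \<epsilon>))"
    by (rule sum.cong[OF refl])
      (simp add: \<Phi>_act[OF a] clinear_sum[OF clinear_mult_left] sym_scale_mult_right)
  also have "\<dots> = (\<Sum>\<delta>\<in>A. \<Sum>\<epsilon>\<in>A. killing \<lbrakk>rv \<alpha>, rv (neg \<epsilon>)\<rbrakk> (rv \<delta>) *\<^sub>C (sym_inj (rv \<epsilon>) * \<Phi> \<delta>))"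
    by (rule sum.swap)
  also have "\<dots> = - (\<Sum>\<delta>\<in>A. \<Sum>\<epsilon>\<in>A. ?k \<delta> \<epsilon> *\<^sub>C (sym_inj (rv \<epsilon>) * \<Phi> \<delta>))"
    unfolding sum_negf[symmetric]
    by (intro sum.cong[OF refl]) (subst W.kinvariant_swap, simp)
  finally show ?thesis by simp
qed

text \<open>For \<open>\<alpha> T > 0\<close> each summand is killed separately: the linear factor
  because \<open>\<alpha> + \<delta>\<close> would exceed the top eigenvalue \<open>N\<close>, the
  other one by \<open>D_killed\<close>.\<close>

lemma v'_killed: "\<alpha> \<in> P \<Longrightarrow> sym_act (rv \<alpha>) v' = 0"
proof (cases "\<alpha> T = 0")
  case True
  assume "\<alpha> \<in> P"
  then show ?thesis using v'_killed_\<Delta>[of \<alpha>] True P_roots by (simp add: L.\<Delta>_def)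
next
  case False
  assume a: "\<alpha> \<in> P"
  have ar: "\<alpha> \<in> roots H" by (rule P_roots[OF a])
  have pos: "0 < \<alpha> T" by (rule order_le_neq_trans[OF \<sigma>_dominant[OF a, folded T_def] not_sym[OF False]])
  have "sym_act (rv \<alpha>) (sym_inj (rv \<delta>) * \<Phi> \<delta>) = 0" if d: "\<delta> \<in> A" for \<delta>
  proof -
    let ?s = "\<lambda>h. \<alpha> h + \<delta> h"
    have s: "N < ?s T" using pos A_T[OF d] by (simp add: less_complex_def)
    have "\<lbrakk>rv \<alpha>, rv \<delta>\<rbrakk> = 0"
    proof (rule rv_bracket_0[OF ar A_roots[OF d]])
      show "?s \<notin> roots H" using root_T_le[of ?s] s by (auto simp: less_complex_def less_eq_complex_def)
      show "?s \<noteq> (\<lambda>h. 0)"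
        using less_trans[OF N_pos s] by (intro notI) (drule fun_cong[of _ _ T], simp)
    qed
    moreover have "sym_act (rv \<alpha>) (\<Phi> \<delta>) = 0" using D_killed[OF \<Phi>_D[OF d] ar pos] by simp
    ultimately show ?thesis by (simp add: sym_act_mult sym_act_sym_inj clinear_0[OF clinear_sym_inj])
  qed
  then show ?thesis unfolding v'_def clinear_sum[OF clinear_sym_act] by simp
qed

abbreviation "js \<equiv> [1..<Suc (Suc m)]"

text \<open>Up to the scalar \<open>c\<close>, \<open>\<Phi> (\<beta> l)\<close> is \<open>v\<close>
  acted on by \<open>e\<close> and \<open>e'\<close>. Equivariance shifts both actions from
  \<open>v\<close> to the contracting vector of \<open>-bk\<close>, which turns it into that of
  \<open>-\<beta> l\<close>.\<close>

lemma exchange: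
  assumes l: "l \<in> {1..m}"
  shows "\<beta> l \<in> A" "DD \<beta> (remove1 l js) (\<Phi> (\<beta> l)) = DD \<beta> [1..<Suc m] v"
proof -
  obtain e e' c where ex: "e \<in> rv ` L.\<Delta>" "e' \<in> rv ` L.\<Delta>" "\<lbrakk>e, e'\<rbrakk> = 0" "c \<noteq> 0"
    "\<lbrakk>e, \<lbrakk>e', rv (neg bk)\<rbrakk>\<rbrakk> = c *\<^sub>C rv (neg (\<beta> l))"
    "\<forall>j\<in>{1..m} - {l}. \<lbrakk>e, rv (neg (\<beta> j))\<rbrakk> = 0 \<and> \<lbrakk>e', rv (neg (\<beta> j))\<rbrakk> = 0"
    using ex_exchange[OF l] by blast
  have br: "\<beta> l \<in> roots H" using \<beta>_root l by auto
  have el: "e \<in> L.lv" "e' \<in> L.lv" using ex(1,2) L.rv_lv by auto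
  have k0': "killing T e = 0" "killing T e' = 0" using ex(1,2) killing_T_rv L.\<Delta>_roots by auto
  let ?Y = "rv (neg bk)" and ?Z = "\<lbrakk>e, \<lbrakk>e', rv (neg bk)\<rbrakk>\<rbrakk>"
  let ?s = "sym_act e (sym_act e' v)"
  have "tw e (tw e' v0) \<in> D" by (intro W.submod_act[OF submod_D] el v0_D)
  then have "(?s, c *\<^sub>C rv (neg (\<beta> l))) \<in> D" using ex(5) k0' by (simp add: tw_def)
  then have P: "\<beta> l \<in> A" "?s = c *\<^sub>C \<Phi> (\<beta> l)" using \<Phi>_scaled[OF _ ex(4) br] by auto
  show "\<beta> l \<in> A" by (rule P(1))
  define rs where "rs = filter (\<lambda>j. j \<noteq> l) [1..<Suc m]"
  have srs: "set rs = {1..m} - {l}" by (auto simp: rs_def)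
  have drs: "distinct rs" by (simp add: rs_def)
  have "length rs = card ({1..m} - {l})" using distinct_card[OF drs] srs by simp
  then have len: "length rs = m - 1" using l by simp
  have c1: "DD \<beta> rs (sym_act e a) = sym_act e (DD \<beta> rs a)" for a
    by (rule DD_act) (use ex(6) srs in auto)
  have c2: "DD \<beta> rs (sym_act e' a) = sym_act e' (DD \<beta> rs a)" for a
    by (rule DD_act) (use ex(6) srs in auto)
  \<comment> \<open>The contraction by \<open>y\<close> and the \<open>m - 1\<close> contractions of
    \<open>rs\<close> reduce \<open>a\<close> to a scalar, on which g acts by 0.\<close>
  have zero: "sym_act z (DD \<beta> rs (dd y a)) = 0" if "a \<in> sym_power m" for z y a
  proof -
    have "a \<in> sym_power (Suc (length rs + 0))" using that len m by simp
    then have "DD \<beta> rs (dd y a) \<in> sym_power 0" by (intro DD_sym_power dd_sym_power)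
    then show ?thesis by (rule derivation_sym_power_0[OF derivation_sym_act])
  qed
  have "DD \<beta> rs (dd ?Y ?s) = DD \<beta> rs (sym_act e (dd ?Y (sym_act e' v)) - dd \<lbrakk>e, ?Y\<rbrakk> (sym_act e' v))"
    using sym_act_dd[of e ?Y "sym_act e' v"] by simp
  also have "\<dots> = - DD \<beta> rs (dd \<lbrakk>e, ?Y\<rbrakk> (sym_act e' v))"
    using zero[OF sym_act_sym_power[OF v_facts(1)]] by (simp add: clinear_diff[OF clinear_DD] c1)
  also have "\<dots> = - DD \<beta> rs (sym_act e' (dd \<lbrakk>e, ?Y\<rbrakk> v) - dd \<lbrakk>e', \<lbrakk>e, ?Y\<rbrakk>\<rbrakk> v)"
    using sym_act_dd[of e' "\<lbrakk>e, ?Y\<rbrakk>" v] by simp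
  also have "\<dots> = DD \<beta> rs (dd \<lbrakk>e', \<lbrakk>e, ?Y\<rbrakk>\<rbrakk> v)"
    using zero[OF v_facts(1)] by (simp add: clinear_diff[OF clinear_DD] c2)
  \<comment> \<open>Two shifts give two minus signs but reverse the order of \<open>e\<close> and
    \<open>e'\<close>; the order is restored because they commute.\<close>
  also have "\<lbrakk>e', \<lbrakk>e, ?Y\<rbrakk>\<rbrakk> = ?Z" using bracket_bracket[of e e' ?Y] ex(3) by (simp add: bracket_0)
  also have "DD \<beta> rs (dd ?Z v) = c *\<^sub>C DD \<beta> rs (dd (rv (neg (\<beta> l))) v)"
    unfolding ex(5) dd_scale by (rule clinear_scale[OF clinear_DD])
  finally have "c *\<^sub>C DD \<beta> rs (dd ?Y (\<Phi> (\<beta> l))) = c *\<^sub>C DD \<beta> rs (dd (rv (neg (\<beta> l))) v)"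
    unfolding P(2) by (simp add: clinear_scale[OF derivation_linear[OF derivation_dd]] clinear_scale[OF clinear_DD])
  then have eq: "DD \<beta> (Suc m # rs) (\<Phi> (\<beta> l)) = DD \<beta> (l # rs) v" using ex(4) by (simp add: DD_Cons)
  have "distinct (Suc m # rs)" "distinct (l # rs)" using drs srs by auto
  moreover have "set (Suc m # rs) = set (remove1 l js)"
    using l by (auto simp: srs set_remove1_eq[OF distinct_upt] simp del: upt_Suc)
  moreover have "set (l # rs) = set [1..<Suc m]" using l by (auto simp: srs simp del: upt_Suc)
  ultimately have "mset (Suc m # rs) = mset (remove1 l js)" "mset (l # rs) = mset [1..<Suc m]"
    using set_eq_iff_mset_eq_distinct[of "Suc m # rs" "remove1 l js"]
      set_eq_iff_mset_eq_distinct[of "l # rs" "[1..<Suc m]"] distinct_remove1[OF distinct_upt] distinct_upt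
    by blast+
  then show "DD \<beta> (remove1 l js) (\<Phi> (\<beta> l)) = DD \<beta> [1..<Suc m] v"
    using eq DD_perm by metis
qed

lemma v'_nonzero: "DD \<beta> js v' \<noteq> 0"
proof -
  let ?c = "DD \<beta> [1..<Suc m] v"
  have sjs: "set js = I" by auto
  have bA: "\<beta> j \<in> A \<and> DD \<beta> (remove1 j js) (\<Phi> (\<beta> j)) = ?c" if "j \<in> I" for j
  proof (cases "j = Suc m")
    case True
    have "mset (remove1 (Suc m) js) = mset [1..<Suc m]" by simp
    then show ?thesis using True \<Phi>_bk DD_perm by metis
  next
    case False
    then have "j \<in> {1..m}" using that by auto
    then show ?thesis using exchange by blast
  qed
  \<comment> \<open>\<open>\<Phi> \<delta>\<close> has degree \<open>m\<close> but \<open>js\<close>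
    lists \<open>m + 1\<close> contractions, so the last one meets a scalar.\<close>
  have z: "DD \<beta> js (\<Phi> \<delta>) = 0" if "\<delta> \<in> A" for \<delta>
  proof -
    have p: "\<Phi> \<delta> \<in> sym_power m" using D_sym[OF \<Phi>_D[OF that]] by simp
    have "DD \<beta> [1..<Suc m] (\<Phi> \<delta>) \<in> sym_power 0"
      by (rule DD_sym_power) (use p in \<open>simp del: upt_Suc\<close>)
    then have "dd (rv (neg bk)) (DD \<beta> [1..<Suc m] (\<Phi> \<delta>)) = 0" by (rule derivation_sym_power_0[OF derivation_dd])
    moreover have "js = [1..<Suc m] @ [Suc m]" by simp
    ultimately show ?thesis by (simp add: DD_def del: upt_Suc)
  qed
  have "DD \<beta> js v' = (\<Sum>\<delta>\<in>A. DD \<beta> js (sym_inj (rv \<delta>) * \<Phi> \<delta>))"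
    unfolding v'_def by (rule clinear_sum[OF clinear_DD])
  also have "\<dots> = (\<Sum>\<delta>\<in>A. \<Sum>j\<in>I. killing (rv (neg (\<beta> j))) (rv \<delta>) *\<^sub>C DD \<beta> (remove1 j js) (\<Phi> \<delta>))"
    by (rule sum.cong[OF refl], subst DD_leibniz) (simp_all only: sjs z mult_zero_right distinct_upt add_0)
  also have "\<dots> = (\<Sum>j\<in>I. \<Sum>\<delta>\<in>A. killing (rv (neg (\<beta> j))) (rv \<delta>) *\<^sub>C DD \<beta> (remove1 j js) (\<Phi> \<delta>))"
    by (rule sum.swap)
  \<comment> \<open>The Killing form singles out \<open>\<delta> = \<beta> j\<close>, and the
    remaining contractions give \<open>?c\<close> by \<open>exchange\<close>; for
    \<open>j = Suc m\<close> they give it directly, since \<open>\<Phi> bk = v\<close>.\<close>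
  also have "\<dots> = (\<Sum>j\<in>I. ?c)"
  proof (rule sum.cong[OF refl])
    fix j assume j: "j \<in> I"
    have "(\<Sum>\<delta>\<in>A. killing (rv (neg (\<beta> j))) (rv \<delta>) *\<^sub>C DD \<beta> (remove1 j js) (\<Phi> \<delta>)) = (\<Sum>\<delta>\<in>A. if \<delta> = \<beta> j then ?c else 0)"
      by (rule sum.cong[OF refl])
        (use killing_rv_rv[OF A_roots \<beta>_root[OF j]] kcommute[of "rv (neg (\<beta> j))"] bA[OF j] in \<open>auto simp: scaleC_one simp del: upt_Suc\<close>)
    then show "(\<Sum>\<delta>\<in>A. killing (rv (neg (\<beta> j))) (rv \<delta>) *\<^sub>C DD \<beta> (remove1 j js) (\<Phi> \<delta>)) = ?c"
      using bA[OF j] finite_A by (simp del: upt_Suc)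
  qed
  also have "\<dots> = of_nat (Suc m) *\<^sub>C ?c" by (simp add: cvec.sum_constant_scale del: upt_Suc)
  finally show ?thesis using v_facts(4) by (simp del: upt_Suc of_nat_Suc)
qed

lemma good_Suc: "\<exists>v'. good \<beta> (Suc m) v'"
  unfolding good_def using v'_power v'_weight v'_killed v'_nonzero by blast

end

end

section \<open>The base case and the assembly of the induction\<close>

context pos_cartan
begin

text \<open>The highest root has the largest value at \<open>t\<rho>\<close>, formed here for the
  whole root system. Adding a positive root would exceed it, so all positive root vectors kill
  \<open>rv (\<beta> 1)\<close>.\<close>

lemma good_1:
  assumes "\<beta> 1 \<in> roots H" "\<And>\<gamma>. \<gamma> \<in> roots H \<Longrightarrow> \<exists>c. \<forall>h. \<beta> 1 h - \<gamma> h = (\<Sum>\<alpha>\<in>P. of_nat (c \<alpha> :: nat) * \<alpha> h)"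
  shows "good \<beta> 1 (sym_inj (rv (\<beta> 1)))"
proof -
  interpret L0: levi H P 0 by unfold_locales (rule cvec.subspace_0[OF subspace_H])
  have "\<alpha> 0 = 0" if "\<alpha> \<in> P" for \<alpha>
    using L0.dual_sum[OF root_dual[OF P_roots[OF that]], of "{}" "\<lambda>_. 0"] by simp
  then have \<Delta>p: "L0.\<Delta>p = P" by (auto simp: L0.\<Delta>p_def)
  have le: "\<gamma> L0.t\<rho> \<le> \<beta> 1 L0.t\<rho>" if g: "\<gamma> \<in> roots H" for \<gamma>
  proof -
    obtain c :: "('g \<Rightarrow> complex) \<Rightarrow> nat" where "\<beta> 1 L0.t\<rho> - \<gamma> L0.t\<rho> = (\<Sum>\<alpha>\<in>P. of_nat (c \<alpha>) * \<alpha> L0.t\<rho>)"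
      using assms(2)[OF g] by blast
    moreover have "0 \<le> (\<Sum>\<alpha>\<in>P. of_nat (c \<alpha>) * \<alpha> L0.t\<rho>)"
      by (intro sum_nonneg mult_nonneg_nonneg of_nat_complex_nonneg less_imp_le) (use L0.t\<rho>_pos \<Delta>p in simp)
    ultimately have "0 \<le> \<beta> 1 L0.t\<rho> - \<gamma> L0.t\<rho>" by (simp only:)
    then show ?thesis by simp
  qed
  have "\<lbrakk>rv \<alpha>, rv (\<beta> 1)\<rbrakk> = 0" if a: "\<alpha> \<in> P" for \<alpha>
  proof (rule rv_bracket_0[OF P_roots[OF a] assms(1)])
    have p: "0 < \<alpha> L0.t\<rho>" using L0.t\<rho>_pos a \<Delta>p by simp
    show "(\<lambda>h. \<alpha> h + \<beta> 1 h) \<notin> roots H"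
      using le[of "\<lambda>h. \<alpha> h + \<beta> 1 h"] p by (auto simp: less_complex_def less_eq_complex_def)
    have "0 < \<beta> 1 L0.t\<rho>" using le[OF P_roots[OF a]] p by simp
    then have "(\<lambda>h. \<alpha> h + \<beta> 1 h) L0.t\<rho> \<noteq> 0" using p by (auto simp: less_complex_def complex_eq_iff)
    then show "(\<lambda>h. \<alpha> h + \<beta> 1 h) \<noteq> (\<lambda>h. 0)" by (auto dest: fun_cong)
  qed
  moreover have "[1..<Suc 1] = [1]" by simp
  then have "DD \<beta> [1..<Suc 1] (sym_inj (rv (\<beta> 1))) = killing (rv (neg (\<beta> 1))) (rv (\<beta> 1)) *\<^sub>C 1"
    by (simp only: DD_Cons DD_Nil dd_sym_inj)
  then have "DD \<beta> [1..<Suc 1] (sym_inj (rv (\<beta> 1))) \<noteq> 0"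
    using killing_rv'[OF assms(1)] sym_alg_one_neq_zero by (simp only: scaleC_one not_False_eq_True)
  ultimately show ?thesis
    using sym_inj_sym_power[of "rv (\<beta> 1)"] bracket_rv[OF assms(1)]
    by (simp add: good_def sym_act_sym_inj sym_inj_scale clinear_0[OF clinear_sym_inj] del: upt_Suc)
qed

text \<open>Translates dominance into positivity of roots on the vector that represents the weight;
  the representing vectors of the summands add up.\<close>

lemma dominant_nonneg:
  assumes d: "dominant H P (\<lambda>h. \<Sum>j=1..i. \<beta> j h)" and \<beta>: "\<And>j. j \<in> {1..i} \<Longrightarrow> \<beta> j \<in> roots H" and a: "\<alpha> \<in> P"
  shows "0 \<le> \<alpha> (\<Sum>j\<in>{1..i}. tt (\<beta> j))"
proof -
  let ?T = "\<Sum>j\<in>{1..i}. tt (\<beta> j)"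
  have ar: "\<alpha> \<in> roots H" by (rule P_roots[OF a])
  have "tt (\<lambda>h. \<Sum>j=1..i. \<beta> j h) = ?T"
    by (rule killing_dual_eq)
      (use \<beta> tt_H subspace_H killing_tt in \<open>auto intro!: cvec.subspace_sum simp: ksum\<close>)
  then have "root_form H (\<lambda>h. \<Sum>j=1..i. \<beta> j h) \<alpha> = killing ?T (tt \<alpha>)" by (simp add: root_form_def)
  also have "\<dots> = \<alpha> ?T"
    using killing_tt[OF ar, of ?T] cvec.subspace_sum[OF subspace_H, of "{1..i}" "\<lambda>j. tt (\<beta> j)"] \<beta> tt_H
    by (simp add: kcommute[of ?T])
  finally have "2 * \<alpha> ?T / \<alpha> (tt \<alpha>) \<in> \<nat>" using d a root_form_eq[OF ar ar] unfolding dominant_def by auto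
  then obtain n where "2 * \<alpha> ?T / \<alpha> (tt \<alpha>) = of_nat n" by (auto simp: Nats_def)
  then have "2 * \<alpha> ?T = of_nat n * \<alpha> (tt \<alpha>)" using root_self_nonzero[OF ar] by (simp add: field_simps)
  moreover have "0 \<le> of_nat n * \<alpha> (tt \<alpha>)"
    by (intro mult_nonneg_nonneg of_nat_complex_nonneg less_imp_le root_self_pos ar)
  ultimately have "0 \<le> 2 * \<alpha> ?T" by simp
  then show ?thesis by (simp add: less_eq_complex_def)
qed

lemma ex_good:
  assumes top: "highest_root P (roots H) (\<beta> 1)"
    and next_root: "\<And>i. 2 \<le> i \<Longrightarrow> i \<le> k \<Longrightarrow> highest_long_root_orthogonal H P (\<beta> ` {1..<i}) (\<beta> i)"
    and dom: "\<And>i. 1 \<le> i \<Longrightarrow> i \<le> k \<Longrightarrow> dominant H P (\<lambda>h. \<Sum>j=1..i. \<beta> j h)"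
    and k: "1 \<le> k"
  shows "\<exists>v. good \<beta> k v"
proof -
  have b1: "\<beta> 1 \<in> roots H" using top by (simp add: highest_root_def)
  have RP: "roots H \<inter> P = P" using P_roots by blast
  have high: "\<exists>c. \<forall>h. \<beta> 1 h - \<gamma> h = (\<Sum>\<alpha>\<in>P. of_nat (c \<alpha> :: nat) * \<alpha> h)" if "\<gamma> \<in> roots H" for \<gamma>
    using top that unfolding highest_root_def RP by blast
  have long: "long_root H (\<beta> i)" if "2 \<le> i" "i \<le> k" for i
    using next_root[OF that] by (simp add: highest_long_root_orthogonal_def)
  have root: "\<beta> i \<in> roots H" if "1 \<le> i" "i \<le> k" for i
  proof (cases "i = 1")
    case False
    then show ?thesis using long[of i] that by (simp add: long_root_def)
  qed (use b1 in simp)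
  have orth': "\<beta> i (tt (\<beta> j)) = 0" if "1 \<le> j" "j < i" "i \<le> k" for i j
  proof -
    have "\<beta> i \<in> orthogonal_roots H (\<beta> ` {1..<i})"
      using next_root[of i] that
      by (auto simp: highest_long_root_orthogonal_def root_component_def highest_root_def)
    then have "root_form H (\<beta> i) (\<beta> j) = 0" using that by (auto simp: orthogonal_roots_def)
    then show ?thesis using root_form_eq[of "\<beta> i" "\<beta> j"] root[of i] root[of j] that by simp
  qed
  have orth: "\<beta> i (tt (\<beta> j)) = 0" if "1 \<le> j" "j \<le> k" "1 \<le> i" "i \<le> k" "i \<noteq> j" for i j
    using orth'[of j i] orth'[of i j] root_tt_commute[of "\<beta> i" "\<beta> j"] root that
    by (cases "j < i") auto
  have nonneg: "0 \<le> \<alpha> (\<Sum>j\<in>{1..i}. tt (\<beta> j))" if "i \<le> k" "1 \<le> i" "\<alpha> \<in> P" for \<alpha> i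
    by (rule dominant_nonneg[OF dom]) (use that root in auto)
  have norm_le: "Re (\<gamma> (tt \<gamma>)) \<le> Re (\<beta> i (tt (\<beta> i)))" if "2 \<le> i" "i \<le> k" "\<gamma> \<in> roots H" for \<gamma> i
    using long[OF that(1,2)] that root_form_eq[of \<gamma> \<gamma>] root_form_eq[of "\<beta> i" "\<beta> i"] root[of i]
    by (auto simp: long_root_def)
  \<comment> \<open>Length of the highest root: \<open>\<beta> 2\<close> is long, and dominance of
    \<open>\<beta> 1 + \<beta> 2\<close> with \<open>\<beta> 2\<close> below
    \<open>\<beta> 1\<close> and orthogonality gives \<open>\<beta> 1\<close> at least its
    length.\<close>
  have long1: "Re (\<gamma> (tt \<gamma>)) \<le> Re (\<beta> 1 (tt (\<beta> 1)))" if k2: "2 \<le> k" and g: "\<gamma> \<in> roots H" for \<gamma>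
  proof -
    let ?T = "\<Sum>j\<in>{1..2}. tt (\<beta> j)"
    have b2: "\<beta> 2 \<in> roots H" using root k2 by simp
    have T: "\<delta> ?T = \<delta> (tt (\<beta> 1)) + \<delta> (tt (\<beta> 2))" if d: "\<delta> \<in> roots H" for \<delta>
    proof -
      have "{1..2} = {1::nat, 2}" by auto
      then have "?T = tt (\<beta> 1) + tt (\<beta> 2)" by simp
      then show ?thesis using root_dual[OF d] tt_H[OF b1] tt_H[OF b2] by (simp add: dual_space_def)
    qed
    obtain c :: "('g \<Rightarrow> complex) \<Rightarrow> nat" where "\<beta> 1 ?T - \<beta> 2 ?T = (\<Sum>\<alpha>\<in>P. of_nat (c \<alpha>) * \<alpha> ?T)"
      using high[OF b2] by blast
    moreover have "0 \<le> (\<Sum>\<alpha>\<in>P. of_nat (c \<alpha>) * \<alpha> ?T)"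
      by (intro sum_nonneg mult_nonneg_nonneg of_nat_complex_nonneg nonneg) (use k2 in auto)
    ultimately have "0 \<le> \<beta> 1 ?T - \<beta> 2 ?T" by simp
    then have "0 \<le> \<beta> 1 (tt (\<beta> 1)) - \<beta> 2 (tt (\<beta> 2))"
      unfolding T[OF b1] T[OF b2] using orth[of 1 2] orth[of 2 1] k2 by simp
    then have "Re (\<beta> 2 (tt (\<beta> 2))) \<le> Re (\<beta> 1 (tt (\<beta> 1)))" by (simp add: less_eq_complex_def)
    then show ?thesis using norm_le[of 2 \<gamma>] k2 g by simp
  qed
  have "\<exists>v. good \<beta> (Suc m) v" if "Suc m \<le> k" for m
    using that
  proof (induction m)
    case 0
    show ?case using good_1[of \<beta>, OF b1 high] by auto
  next
    case (Suc m)
    then obtain v where v: "good \<beta> (Suc m) v" by auto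
    interpret cascade H P \<beta> "Suc m"
    proof unfold_locales
      fix i assume i: "i \<in> {1..Suc (Suc m)}"
      show "\<beta> i \<in> roots H" using root i Suc.prems by simp
      show "\<beta> i (tt (\<beta> i)) = \<beta> 1 (tt (\<beta> 1))"
      proof (cases "i = 1")
        case False
        then have i2: "2 \<le> i" "i \<le> k" using i Suc.prems by auto
        \<comment> \<open>Two long roots bound each other's length, so all \<beta>_i have the same
          one.\<close>
        have "Re (\<beta> i (tt (\<beta> i))) = Re (\<beta> 1 (tt (\<beta> 1)))"
          using norm_le[OF i2 b1] long1[of "\<beta> i"] i2 root[of i] by fastforce
        moreover have "Im (\<beta> i (tt (\<beta> i))) = 0" "Im (\<beta> 1 (tt (\<beta> 1))) = 0"
          using root_self_pos[OF b1] root_self_pos[OF root[of i]] i2 by (auto simp: less_complex_def)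
        ultimately show ?thesis by (simp add: complex_eq_iff)
      qed simp
    next
      show "Re (\<gamma> (tt \<gamma>)) \<le> Re (\<beta> 1 (tt (\<beta> 1)))" if "\<gamma> \<in> roots H" for \<gamma> using long1 that Suc.prems by simp
    next
      show "\<beta> i (tt (\<beta> j)) = 0" if "i \<in> {1..Suc (Suc m)}" "j \<in> {1..Suc (Suc m)}" "i \<noteq> j" for i j
        using orth that Suc.prems by simp
    next
      show "\<exists>c. \<forall>h. \<beta> 1 h - \<gamma> h = (\<Sum>\<alpha>\<in>P. of_nat (c \<alpha> :: nat) * \<alpha> h)" if "\<gamma> \<in> roots H" for \<gamma> by (rule high[OF that])
    next
      show "0 \<le> \<alpha> (\<Sum>i\<in>{1..Suc (Suc m)}. tt (\<beta> i))" "0 \<le> \<alpha> (\<Sum>i\<in>{1..Suc m}. tt (\<beta> i))" if "\<alpha> \<in> P" for \<alpha>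
        using nonneg[of "Suc (Suc m)"] nonneg[of "Suc m"] that Suc.prems by (auto simp del: sum.cl_ivl_Suc)
    qed
    show ?case by (rule good_Suc[OF v]) simp
  qed
  from this[of "k - 1"] show ?thesis using k by simp
qed

end

theorem proposition6p1:
  fixes H :: "'g::complex_lie_algebra set"
    and P :: "('g \<Rightarrow> complex) set"
    and \<beta> :: "nat \<Rightarrow> 'g \<Rightarrow> complex"
    and \<sigma> :: "nat \<Rightarrow> 'g \<Rightarrow> complex"
    and k :: nat
  assumes "simple_lie_algebra TYPE('g)"
    and "cartan_subalgebra H"
    and "positive_system H P"
    and "1 \<le> k"
    and "highest_root P (roots H) (\<beta> 1)"
    and "\<And>i. 2 \<le> i \<Longrightarrow> i \<le> k \<Longrightarrow>
           highest_long_root_orthogonal H P (\<beta> ` {1..<i}) (\<beta> i)"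
    and "\<And>i h. \<sigma> i h = (\<Sum>j = 1..i. \<beta> j h)"
    and "\<And>i. 1 \<le> i \<Longrightarrow> i \<le> k \<Longrightarrow> dominant H P (\<sigma> i)"
  shows "\<exists>W. irreducible_component sym_act (sym_power k) W \<and>
             has_highest_weight H P sym_act W (\<sigma> k)"
proof -
  interpret pos_cartan H P by unfold_locales (fact assms)+
  have \<sigma>: "\<sigma> i = (\<lambda>h. \<Sum>j = 1..i. \<beta> j h)" for i using assms(7) by (simp add: fun_eq_iff)
  have "dominant H P (\<lambda>h. \<Sum>j = 1..i. \<beta> j h)" if "1 \<le> i" "i \<le> k" for i
    using assms(8)[OF that] by (simp only: \<sigma>)
  then obtain v where v: "good \<beta> k v" using ex_good[OF assms(5,6) _ assms(4)] by blast
  show ?thesis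
    unfolding \<sigma>
  proof (rule highest_weight_component)
    show "v \<in> sym_power k" "\<And>h. h \<in> H \<Longrightarrow> sym_act h v = (\<Sum>j = 1..k. \<beta> j h) *\<^sub>C v"
      "\<And>\<alpha>. \<alpha> \<in> P \<Longrightarrow> sym_act (rv \<alpha>) v = 0"
      using v by (auto simp: good_def simp del: upt_Suc)
    \<comment> \<open>A linear contraction with nonzero value forces its argument to be
      nonzero.\<close>
    show "v \<noteq> 0" using v clinear_0[OF clinear_DD] by (auto simp: good_def simp del: upt_Suc)
  qed
qed

end
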